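(* Let $\mathbf{\Gamma}$ be a non self-dual Borel class of rank two (i.e. $\mathbf{\Gamma}\in\{\mathbf{\Sigma}^0_2,\mathbf{\Pi}^0_2\}$). (1) The family $\mathcal{A}^{\mathbf{\Gamma}}\cup\mathcal{B}^{\mathbf{\Gamma}}$ has exactly 76 elements and is both a $\sqsubseteq_c$-antichain basis and a $\leq_c$-antichain basis for the class of non-$\mathbf{\Gamma}$ s-acyclic Borel relations on an analytic space. (2) $\{(\mathbb{D},\mathbb{G}^{\mathbf{\Gamma}}_m),(\mathbb{S},\mathbb{G}^{\mathbf{\Gamma},a}_m)\}$ is both a $\sqsubseteq_c$-antichain basis and a $\leq_c$-antichain basis for the class of non-$\mathbf{\Gamma}$ acyclic Borel graphs on an analytic space.
   Context: A relation on $X$ is a subset of $X^2$. For topological spaces $X,Y$ and $A\subseteq X^2$, $B\subseteq Y^2$: $(X,A)\leq_c(Y,B)$ means there is a continuous $f:X\to Y$ with $A=(f\times f)^{-1}(B)$; $(X,A)\sqsubseteq_c(Y,B)$ means such an $f$ can be chosen injective. An analytic space is a separable metrizable space homeomorphic to an analytic subset of a Polish space. A graph is a symmetric relation disjoint from the diagonal. A relation $R$ on $X$ is non-$\mathbf{\Gamma}$ if it is not a $\mathbf{\Gamma}$ subset of $X^2$. For a relation $A$ on $X$, $s(A)=A\cup A^{-1}$ is its symmetrization. An $A$-path is a finite sequence $(x_i)_{i\leq n}$ of points of $X$ with $(x_i,x_{i+1})\in A$ for $i<n$. $A$ is acyclic if there is no injective $A$-path $(x_i)_{i\leq n}$ with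 $n\geq 2$ and $(x_n,x_0)\in A$; $A$ is s-acyclic if $s(A)$ is acyclic. For a class $\mathcal Q$ of pairs $(X,R)$ and a quasi-order $\leq$, an antichain is a subclass of pairwise $\leq$-incomparable elements; a basis for $\mathcal Q$ is a subclass $B$ of $\mathcal Q$ such that every element of $\mathcal Q$ is $\leq$-above an element of $B$; an antichain basis is a basis which is an antichain. Let $\mathbb{P}_\infty=\{\alpha\in 2^\omega\mid\alpha(n)=1\text{ for infinitely many }n\}$ and $\mathbb{P}_f=2^\omega\setminus\mathbb{P}_\infty$. Put $\mathbb{C}=\mathbb{P}_\infty$ if $\mathbf{\Gamma}=\mathbf{\Sigma}^0_2$ and $\mathbb{C}=\mathbb{P}_f$ if $\mathbf{\Gamma}=\mathbf{\Pi}^0_2$. Let $2=\{0,1\}$, $4=\{0,1,2,3\}$, $\mathbb{D}=2\times 2^\omega$, $N_1=\{\alpha\in 2^\omega\mid\alpha(0)=1\}$, $\mathbb{S}=\{0^\infty\}\cup N_1\subseteq 2^\omega$, $S_0=\mathbb{C}$, $S_1=\emptyset$, $S_2=2^\omega\setminus\mathbb{C}$, $S_3=2^\omega$, $\Delta(E)=\{(x,x)\mid x\in E\}$. Let $P$ be the set of functions $t:2\times 2\to 4$ such that $t(0,0)\neq 0$, $t(1,1)\neq 0$, $t(0,1)=0$, and ($t(1,0)=0\Rightarrow t(0,0)\leq t(1,1)$). For $t\in P$, $\mathbb{R}^{\mathbf{\Gamma}}_t=\{((\varepsilon,x),(\eta,x))\in\mathbb{D}^2\mid x\in S_{t(\varepsilon,\eta)}\}$.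 Put $\mathcal{A}^{\mathbf{\Gamma}}=\{(2^\omega,\Delta(\mathbb{C}))\}\cup\{(\mathbb{D},\mathbb{R}^{\mathbf{\Gamma}}_t)\mid t\in P\}$. Let $A$ be the set of functions $t:2\times 2\to 4$ such that $t(0,0)\in\{0,1\}$, ($t(0,1)=0$ or $t(1,0)=0$), and $t(1,1)\neq 0$. For $t\in A$, let $\mathbb{R}^{\mathbf{\Gamma},a}_t$ be the relation on $\mathbb{S}$ equal to $\{(0^\infty,0^\infty)\mid t(0,0)=1\}\cup\{(0^\infty,1\alpha)\mid\alpha\in S_{t(0,1)}\}\cup\{(1\alpha,0^\infty)\mid\alpha\in S_{t(1,0)}\}\cup\{(1\alpha,1\alpha)\mid\alpha\in S_{t(1,1)}\}$, and put $\mathcal{B}^{\mathbf{\Gamma}}=\{(\mathbb{S},\mathbb{R}^{\mathbf{\Gamma},a}_t)\mid t\in A\}$. Finally $\mathbb{G}^{\mathbf{\Gamma}}_m=\{((\varepsilon,x),(1-\varepsilon,x))\mid\varepsilon\in 2,\ x\in\mathbb{C}\}$ and $\mathbb{G}^{\mathbf{\Gamma},a}_m=s(\{(0^\infty,1\alpha)\mid\alpha\in\mathbb{C}\})$. *)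

theory Defs
  imports "HOL-Analysis.Analysis"
begin

type_synonym 'a space_rel = "'a topology \<times> ('a \<times> 'a) set"

definition relation_on :: "'a topology \<Rightarrow> ('a \<times> 'a) set \<Rightarrow> bool" where
  "relation_on X R \<longleftrightarrow> R \<subseteq> topspace X \<times> topspace X"

definition leq_c :: "'a space_rel \<Rightarrow> 'b space_rel \<Rightarrow> bool" where
  "leq_c = (\<lambda>(X, A) (Y, B).
     \<exists>f. continuous_map X Y f \<and>
         A = {(x, y) \<in> topspace X \<times> topspace X. (f x, f y) \<in> B})"

definition inj_leq_c :: "'a space_rel \<Rightarrow> 'b space_rel \<Rightarrow> bool" where
  "inj_leq_c = (\<lambda>(X, A) (Y, B).
     \<exists>f. continuous_map X Y f \<and> inj_on f (topspace X) \<and>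
         A = {(x, y) \<in> topspace X \<times> topspace X. (f x, f y) \<in> B})"

definition polish_space :: "'a topology \<Rightarrow> bool" where
  "polish_space X \<longleftrightarrow> completely_metrizable_space X \<and> separable_space X"

text \<open>
  HOL cannot quantify over types inside a formula. The auxiliary Polish spaces below therefore
  have their points in the type \<open>nat \<Rightarrow> nat\<close>, with an arbitrary Polish topology on an
  arbitrary subset of it (unrelated to the usual topology of the Baire space). Up to homeomorphism
  these are all the Polish spaces, since a Polish space has at most continuum many points.
\<close>

definition analytic_in :: "'a topology \<Rightarrow> 'a set \<Rightarrow> bool" where
  "analytic_in Y S \<longleftrightarrow>
     (\<exists>(Z :: (nat \<Rightarrow> nat) topology) f.
        polish_space Z \<and> continuous_map Z Y f \<and> f ` topspace Z = S)"

definition analytic_space :: "'a topology \<Rightarrow> bool" where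
  "analytic_space X \<longleftrightarrow>
     separable_space X \<and> metrizable_space X \<and>
     (\<exists>(Y :: (nat \<Rightarrow> nat) topology) S.
        polish_space Y \<and> analytic_in Y S \<and> X homeomorphic_space subtopology Y S)"

definition borel_in :: "'a topology \<Rightarrow> 'a set \<Rightarrow> bool" where
  "borel_in X S \<longleftrightarrow> S \<in> sigma_sets (topspace X) {U. openin X U}"

datatype rank_two_class = Sigma02 | Pi02

text \<open>Only applied to metrizable spaces.\<close>

fun in_class :: "rank_two_class \<Rightarrow> 'a topology \<Rightarrow> 'a set \<Rightarrow> bool" where
  "in_class Sigma02 X S = fsigma_in X S"
| "in_class Pi02 X S = gdelta_in X S"

definition symm :: "('a \<times> 'a) set \<Rightarrow> ('a \<times> 'a) set" where
  "symm A = A \<union> A\<inverse>"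

definition path_in :: "'a topology \<Rightarrow> ('a \<times> 'a) set \<Rightarrow> nat \<Rightarrow> (nat \<Rightarrow> 'a) \<Rightarrow> bool" where
  "path_in X A n x \<longleftrightarrow> (\<forall>i\<le>n. x i \<in> topspace X) \<and> (\<forall>i<n. (x i, x (Suc i)) \<in> A)"

definition acyclic_rel :: "'a topology \<Rightarrow> ('a \<times> 'a) set \<Rightarrow> bool" where
  "acyclic_rel X A \<longleftrightarrow>
     \<not> (\<exists>n x. n \<ge> 2 \<and> path_in X A n x \<and> inj_on x {..n} \<and> (x n, x 0) \<in> A)"

definition s_acyclic_rel :: "'a topology \<Rightarrow> ('a \<times> 'a) set \<Rightarrow> bool" where
  "s_acyclic_rel X A \<longleftrightarrow> acyclic_rel X (symm A)"

definition graph_rel :: "('a \<times> 'a) set \<Rightarrow> bool" where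
  "graph_rel A \<longleftrightarrow> sym A \<and> irrefl A"

definition non_class_borel :: "rank_two_class \<Rightarrow> 'a space_rel set" where
  "non_class_borel \<Gamma> =
     {(X, R). analytic_space X \<and> relation_on X R \<and> borel_in (prod_topology X X) R \<and>
              \<not> in_class \<Gamma> (prod_topology X X) R}"

definition s_acyclic_borel_relations :: "rank_two_class \<Rightarrow> 'a space_rel set" where
  "s_acyclic_borel_relations \<Gamma> = {(X, R) \<in> non_class_borel \<Gamma>. s_acyclic_rel X R}"

definition acyclic_borel_graphs :: "rank_two_class \<Rightarrow> 'a space_rel set" where
  "acyclic_borel_graphs \<Gamma> = {(X, R) \<in> non_class_borel \<Gamma>. graph_rel R \<and> acyclic_rel X R}"

definition antichain :: "('p \<Rightarrow> 'p \<Rightarrow> bool) \<Rightarrow> 'p set \<Rightarrow> bool" where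
  "antichain le B \<longleftrightarrow> (\<forall>p\<in>B. \<forall>q\<in>B. p \<noteq> q \<longrightarrow> \<not> le p q \<and> \<not> le q p)"

text \<open>
  \<open>antichain_basis le le' Q Q' B\<close> is meant for \<open>le\<close> and \<open>le'\<close> two type instances of one
  quasi-order, and \<open>Q\<close> and \<open>Q'\<close> two type instances of one class of pairs: the elements of the
  basis \<open>B\<close> live on a fixed type \<open>'b\<close>, while the pairs to be minorized live on an arbitrary
  type \<open>'a\<close>.
\<close>

definition antichain_basis ::
  "('b space_rel \<Rightarrow> 'b space_rel \<Rightarrow> bool) \<Rightarrow> ('b space_rel \<Rightarrow> 'a space_rel \<Rightarrow> bool) \<Rightarrow>
   'b space_rel set \<Rightarrow> 'a space_rel set \<Rightarrow> 'b space_rel set \<Rightarrow> bool" where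
  "antichain_basis le le' Q Q' B \<longleftrightarrow>
     B \<subseteq> Q \<and> (\<forall>q\<in>Q'. \<exists>p\<in>B. le' p q) \<and> antichain le B"

text \<open>Throughout, \<open>2 = {0, 1}\<close> is rendered by \<open>bool\<close>, with \<open>False\<close> for 0 and \<open>True\<close> for 1.\<close>

type_synonym cantor = "nat \<Rightarrow> bool"

definition cantor_space :: "cantor topology" where
  "cantor_space = product_topology (\<lambda>_. discrete_topology UNIV) UNIV"

definition D_space :: "(bool \<times> cantor) topology" where
  "D_space = prod_topology (discrete_topology UNIV) cantor_space"

definition zeros :: cantor where
  "zeros = (\<lambda>_. False)"

abbreviation one_cons :: "cantor \<Rightarrow> cantor" where
  "one_cons \<alpha> \<equiv> case_nat True \<alpha>"

definition S_space :: "cantor topology" where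
  "S_space = subtopology cantor_space ({zeros} \<union> {\<alpha>. \<alpha> 0})"

definition P_inf :: "cantor set" where
  "P_inf = {\<alpha>. infinite {n. \<alpha> n}}"

definition P_fin :: "cantor set" where
  "P_fin = - P_inf"

fun CC :: "rank_two_class \<Rightarrow> cantor set" where
  "CC Sigma02 = P_inf"
| "CC Pi02 = P_fin"

definition SS :: "rank_two_class \<Rightarrow> nat \<Rightarrow> cantor set" where
  "SS \<Gamma> k = [CC \<Gamma>, {}, - CC \<Gamma>, UNIV] ! k"

type_synonym pattern = "bool \<times> bool \<Rightarrow> nat"

definition P_patterns :: "pattern set" where
  "P_patterns =
     {t. range t \<subseteq> {0, 1, 2, 3} \<and>
         t (False, False) \<noteq> 0 \<and> t (True, True) \<noteq> 0 \<and> t (False, True) = 0 \<and>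
         (t (True, False) = 0 \<longrightarrow> t (False, False) \<le> t (True, True))}"

definition R_rel :: "rank_two_class \<Rightarrow> pattern \<Rightarrow> ((bool \<times> cantor) \<times> (bool \<times> cantor)) set" where
  "R_rel \<Gamma> t = {((\<epsilon>, x), (\<eta>, x)) | \<epsilon> \<eta> x. x \<in> SS \<Gamma> (t (\<epsilon>, \<eta>))}"

definition A_patterns :: "pattern set" where
  "A_patterns =
     {t. range t \<subseteq> {0, 1, 2, 3} \<and>
         t (False, False) \<in> {0, 1} \<and> (t (False, True) = 0 \<or> t (True, False) = 0) \<and>
         t (True, True) \<noteq> 0}"

definition Ra_rel :: "rank_two_class \<Rightarrow> pattern \<Rightarrow> (cantor \<times> cantor) set" where
  "Ra_rel \<Gamma> t =
     (if t (False, False) = 1 then {(zeros, zeros)} else {}) \<union>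
     {(zeros, one_cons \<alpha>) | \<alpha>. \<alpha> \<in> SS \<Gamma> (t (False, True))} \<union>
     {(one_cons \<alpha>, zeros) | \<alpha>. \<alpha> \<in> SS \<Gamma> (t (True, False))} \<union>
     {(one_cons \<alpha>, one_cons \<alpha>) | \<alpha>. \<alpha> \<in> SS \<Gamma> (t (True, True))}"

definition Gm :: "rank_two_class \<Rightarrow> ((bool \<times> cantor) \<times> (bool \<times> cantor)) set" where
  "Gm \<Gamma> = {((\<epsilon>, x), (\<not> \<epsilon>, x)) | \<epsilon> x. x \<in> CC \<Gamma>}"

definition Gma :: "rank_two_class \<Rightarrow> (cantor \<times> cantor) set" where
  "Gma \<Gamma> = symm {(zeros, one_cons \<alpha>) | \<alpha>. \<alpha> \<in> CC \<Gamma>}"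

text \<open>
  The concrete examples live on two types, \<open>cantor\<close> and \<open>bool \<times> cantor\<close>. To collect them in
  one set, they are copied to the sum type along \<open>Inl\<close> and \<open>Inr\<close>; the lemma below
  says that the copy is an isomorphic one.
\<close>

definition copy :: "('a \<Rightarrow> 'b) \<Rightarrow> 'a space_rel \<Rightarrow> 'b space_rel" where
  "copy e = (\<lambda>(X, R). (pullback_topology (range e) (inv e) X, map_prod e e ` R))"

lemma copy_isomorphic:
  assumes "inj e" and "relation_on X R" and "copy e (X, R) = (Y, T)"
  shows "homeomorphic_map X Y e" and "relation_on Y T"
    and "R = {(x, y) \<in> topspace X \<times> topspace X. (e x, e y) \<in> T}"
proof -
  have Y: "Y = pullback_topology (range e) (inv e) X" and T: "T = map_prod e e ` R"
    using assms(3) by (auto simp: copy_def)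
  have i: "inv e (e x) = x" for x
    using assms(1) by simp
  have "homeomorphic_maps X Y e (inv e)"
    unfolding homeomorphic_maps_def
  proof (intro conjI ballI)
    show "continuous_map X Y e"
      unfolding Y by (rule continuous_map_pullback') (auto simp: o_def i)
    show "continuous_map Y X (inv e)"
      unfolding Y using continuous_map_pullback[of X X id] by (simp add: o_def id_def)
  qed (auto simp: i Y topspace_pullback_topology)
  then show "homeomorphic_map X Y e"
    by (rule homeomorphic_maps_imp_map)
  show "relation_on Y T"
    using assms(2) by (auto simp: relation_on_def Y T topspace_pullback_topology i)
  show "R = {(x, y) \<in> topspace X \<times> topspace X. (e x, e y) \<in> T}"
    using assms(1,2) by (auto simp: relation_on_def T inj_eq)
qed

type_synonym point = "cantor + bool \<times> cantor"

definition A_family :: "rank_two_class \<Rightarrow> point space_rel set" where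
  "A_family \<Gamma> =
     {copy Inl (cantor_space, Id_on (CC \<Gamma>))} \<union>
     {copy Inr (D_space, R_rel \<Gamma> t) | t. t \<in> P_patterns}"

definition B_family :: "rank_two_class \<Rightarrow> point space_rel set" where
  "B_family \<Gamma> = {copy Inl (S_space, Ra_rel \<Gamma> t) | t. t \<in> A_patterns}"

definition graph_family :: "rank_two_class \<Rightarrow> point space_rel set" where
  "graph_family \<Gamma> = {copy Inr (D_space, Gm \<Gamma>), copy Inl (S_space, Gma \<Gamma>)}"

end

theory Submission
  imports Defs
begin

text \<open>
  Let \<open>R\<close> be a Borel relation on an analytic space \<open>X\<close> which is not in the class \<open>\<Gamma>\<close>. By the
  Hurewicz dichotomy (\<open>hurewicz\<close>) there is a continuous map from Cantor space to the square of \<open>X\<close>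
  for which the preimage of \<open>R\<close> is \<open>CC \<Gamma>\<close>. Its coordinates are two continuous maps \<open>h False\<close> and
  \<open>h True\<close>, and \<open>x \<in> CC \<Gamma>\<close> iff \<open>(h False x, h True x) \<in> R\<close>. The whole proof consists in composing
  these two maps with self-maps \<open>g\<close> of Cantor space that preserve both \<open>P_inf\<close> and \<open>P_fin\<close>, until
  the traces of \<open>R\<close> on the two images become as simple as in the examples.

  S-acyclicity enters as the absence of squares: the symmetrization of \<open>R\<close>
  cannot contain all four pairs between two distinct points \<open>p, p'\<close> and two further distinct points
  \<open>r, r'\<close>. There are two rounds.

  In the first one (\<open>normal_form\<close>) the countable set \<open>P_fin\<close> is shrunk, in the sense of category
  relative to a crowded subset \<open>D\<close>: each map becomes constant or has nowhere dense fibres, the two maps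
  agree everywhere or nowhere, the relations between \<open>h i x\<close> and \<open>h j x\<close> are independent of
  \<open>x \<in> P_fin\<close>, and the absence of squares makes the sections of the relation nowhere dense, so
  that different eventually zero points are unrelated.

  The second one (\<open>thin_free\<close>) removes the remaining pairs, those with a point of \<open>P_inf\<close>. Here
  category gives no control, since the limits produced by a fusion form a meager set. Instead, a node
  \<open>a \<in> P_fin\<close> carries an ultrafilter \<open>U a\<close> of nodes converging to it, the family \<open>U\<close> being
  idempotent: a set which is large at \<open>a\<close> is large at \<open>U a\<close>-almost every node
  (\<open>finer_idempotent_ultra_family\<close>). A pair of nodes generates a tree of pairs, in which one coordinate
  at a time moves to a node chosen from a large set. For such trees every Borel set \<open>E\<close> is decided:
  almost everywhere, either all fair runs of a suitable tree with large ramification have their limit in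
  \<open>E\<close>, or all of them have their limit outside \<open>E\<close> (\<open>dec_Union\<close>, \<open>dec_borel\<close>). The
  first alternative yields a square when both coordinates move (\<open>inn_two_two\<close>), and also when
  only the second one does but two first nodes share the same second node (\<open>inn_two_sections\<close>). So the second alternative holds on a large set of nodes, and a
  \<open>fusion\<close> produces a copy of Cantor space any two of whose points are the limits of such a run;
  on this copy there is no pair of different related points.

  What remains (\<open>canonical_pair\<close>) is described by a pattern \<open>t\<close>: the relation between \<open>h i x\<close>
  and \<open>h j x\<close> is \<open>x \<in> SS \<Gamma> (t (i, j))\<close>. According to whether the two maps coincide, are both
  injective, or one of them is constant, one finds below \<open>R\<close> the diagonal of \<open>CC \<Gamma>\<close>, a relation
  on \<open>D_space\<close> or a relation on \<open>S_space\<close> (\<open>minorant_exists\<close>).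

  That the examples form an antichain follows from two facts: on a small ball any continuous map into \<open>D_space\<close>
  or \<open>S_space\<close> stays on one sheet (\<open>localize\<close>), and \<open>CC \<Gamma>\<close> is dense and not in \<open>\<Gamma>\<close>
  while \<open>SS \<Gamma> k\<close> is in \<open>\<Gamma>\<close> for \<open>k \<noteq> 0\<close> (\<open>dense_eq\<close>, \<open>pattern_zero\<close>).
  Graphs are the case of symmetric irreflexive relations: these properties pass to any minorant, and only two of
  the examples have them.
\<close>

section \<open>Cantor space\<close>

definition agree :: "nat \<Rightarrow> cantor \<Rightarrow> cantor \<Rightarrow> bool" where
  "agree k x y \<longleftrightarrow> (\<forall>i<k. x i = y i)"

lemma agree_refl [simp]: "agree k x x"
  by (simp add: agree_def)

lemma agree_sym: "agree k x y \<Longrightarrow> agree k y x"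
  by (simp add: agree_def)

lemma agree_trans: "agree k x y \<Longrightarrow> agree k y z \<Longrightarrow> agree k x z"
  by (simp add: agree_def)

lemma agree_mono: "agree k x y \<Longrightarrow> j \<le> k \<Longrightarrow> agree j x y"
  by (simp add: agree_def)

lemma topspace_cantor_space [simp]: "topspace cantor_space = UNIV"
  by (simp add: cantor_space_def)

lemma openin_cantor_space:
  "openin cantor_space U \<longleftrightarrow> (\<forall>x\<in>U. \<exists>k. \<forall>y. agree k x y \<longrightarrow> y \<in> U)"
proof
  assume L: "openin cantor_space U"
  show "\<forall>x\<in>U. \<exists>k. \<forall>y. agree k x y \<longrightarrow> y \<in> U"
  proof
    fix x assume "x \<in> U"
    then obtain V where V: "finite {i. V i \<noteq> (UNIV :: bool set)}" "x \<in> Pi\<^sub>E UNIV V" "Pi\<^sub>E UNIV V \<subseteq> U"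
      using L unfolding cantor_space_def openin_product_topology_alt by auto
    from V(1) obtain k where k: "\<And>i. V i \<noteq> UNIV \<Longrightarrow> i < k"
      unfolding finite_nat_set_iff_bounded by blast
    have "y \<in> U" if "agree k x y" for y
    proof -
      have "y i \<in> V i" for i
      proof (cases "V i = UNIV")
        case False
        then have "x i = y i"
          using that k by (simp add: agree_def)
        moreover have "x i \<in> V i"
          using V(2) by (simp add: PiE_iff)
        ultimately show ?thesis
          by simp
      qed simp
      then show ?thesis
        using V(3) by (auto simp: PiE_iff)
    qed
    then show "\<exists>k. \<forall>y. agree k x y \<longrightarrow> y \<in> U"
      by blast
  qed
next
  assume R: "\<forall>x\<in>U. \<exists>k. \<forall>y. agree k x y \<longrightarrow> y \<in> U"
  show "openin cantor_space U"
    unfolding cantor_space_def openin_product_topology_alt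
  proof
    fix x assume "x \<in> U"
    then obtain k where k: "\<And>y. agree k x y \<Longrightarrow> y \<in> U"
      using R by blast
    define V where "V i = (if i < k then {x i} else UNIV)" for i
    have "{i. V i \<noteq> UNIV} \<subseteq> {..<k}"
      by (auto simp: V_def)
    then have "finite {i. V i \<noteq> UNIV}"
      by (rule finite_subset) simp
    moreover have "x \<in> Pi\<^sub>E UNIV V"
      by (auto simp: V_def)
    moreover have "Pi\<^sub>E UNIV V \<subseteq> U"
    proof
      fix y assume "y \<in> Pi\<^sub>E UNIV V"
      then have "y i \<in> V i" for i
        by (auto simp: PiE_iff)
      then have "agree k x y"
        unfolding agree_def V_def by (metis singletonD)
      then show "y \<in> U"
        by (rule k)
    qed
    ultimately show "\<exists>W. finite {i \<in> UNIV. W i \<noteq> topspace (discrete_topology UNIV)} \<and>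
        (\<forall>i\<in>UNIV. openin (discrete_topology UNIV) (W i)) \<and> x \<in> Pi\<^sub>E UNIV W \<and> Pi\<^sub>E UNIV W \<subseteq> U"
      by auto
  qed
qed

lemma openin_agree: "openin cantor_space {y. agree k x y}"
  unfolding openin_cantor_space
proof
  fix y assume "y \<in> {y. agree k x y}"
  then have "\<forall>z. agree k y z \<longrightarrow> z \<in> {y. agree k x y}"
    using agree_trans by simp
  then show "\<exists>j. \<forall>z. agree j y z \<longrightarrow> z \<in> {y. agree k x y}" ..
qed

lemma continuous_map_cantor_cantor:
  assumes "\<And>k. \<exists>n. \<forall>x y. agree n x y \<longrightarrow> agree k (g x) (g y)"
  shows "continuous_map cantor_space cantor_space g"
  unfolding continuous_map_def
proof (intro conjI allI impI)
  fix V assume V: "openin cantor_space V"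
  show "openin cantor_space {x \<in> topspace cantor_space. g x \<in> V}"
    unfolding openin_cantor_space
  proof
    fix x assume "x \<in> {x \<in> topspace cantor_space. g x \<in> V}"
    then obtain k where k: "\<And>z. agree k (g x) z \<Longrightarrow> z \<in> V"
      using V unfolding openin_cantor_space by blast
    obtain n where "\<And>x y. agree n x y \<Longrightarrow> agree k (g x) (g y)"
      using assms by blast
    then have "\<forall>y. agree n x y \<longrightarrow> y \<in> {x \<in> topspace cantor_space. g x \<in> V}"
      using k by simp
    then show "\<exists>n. \<forall>y. agree n x y \<longrightarrow> y \<in> {x \<in> topspace cantor_space. g x \<in> V}" ..
  qed
qed simp

lemma openin_cantor_square:
  "openin (prod_topology cantor_space cantor_space) U \<longleftrightarrow>
     (\<forall>(x, y)\<in>U. \<exists>k. \<forall>x' y'. agree k x x' \<longrightarrow> agree k y y' \<longrightarrow> (x', y') \<in> U)" (is "?L \<longleftrightarrow> ?R")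
proof
  assume ?L
  show ?R
  proof (clarify)
    fix x y assume "(x, y) \<in> U"
    then have "\<exists>V W. openin cantor_space V \<and> openin cantor_space W \<and> x \<in> V \<and> y \<in> W \<and> V \<times> W \<subseteq> U"
      using \<open>?L\<close> by (simp add: openin_prod_topology_alt)
    then obtain V W where VW: "openin cantor_space V" "openin cantor_space W" "x \<in> V" "y \<in> W" "V \<times> W \<subseteq> U"
      by (elim exE conjE)
    obtain k where k: "\<And>z. agree k x z \<Longrightarrow> z \<in> V"
      using VW(1,3) unfolding openin_cantor_space by blast
    obtain l where l: "\<And>z. agree l y z \<Longrightarrow> z \<in> W"
      using VW(2,4) unfolding openin_cantor_space by blast
    have "(x', y') \<in> U" if "agree (max k l) x x'" "agree (max k l) y y'" for x' y'
    proof -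
      have "x' \<in> V" "y' \<in> W"
        using that by (auto intro!: k l simp: agree_def)
      then show ?thesis
        using VW(5) by auto
    qed
    then have "\<forall>x' y'. agree (max k l) x x' \<longrightarrow> agree (max k l) y y' \<longrightarrow> (x', y') \<in> U"
      by simp
    then show "\<exists>k. \<forall>x' y'. agree k x x' \<longrightarrow> agree k y y' \<longrightarrow> (x', y') \<in> U" ..
  qed
next
  assume ?R
  show ?L
    unfolding openin_prod_topology_alt
  proof (intro allI impI)
    fix x y assume "(x, y) \<in> U"
    then have "\<exists>k. \<forall>x' y'. agree k x x' \<longrightarrow> agree k y y' \<longrightarrow> (x', y') \<in> U"
      using \<open>?R\<close> by auto
    then obtain k where "\<forall>x' y'. agree k x x' \<longrightarrow> agree k y y' \<longrightarrow> (x', y') \<in> U"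
      by (elim exE)
    then have "{x'. agree k x x'} \<times> {y'. agree k y y'} \<subseteq> U"
      by auto
    then show "\<exists>V W. openin cantor_space V \<and> openin cantor_space W \<and> x \<in> V \<and> y \<in> W \<and> V \<times> W \<subseteq> U"
      using openin_agree[of k x] openin_agree[of k y]
      by (intro exI[of _ "{x'. agree k x x'}"] exI[of _ "{y'. agree k y y'}"]) simp
  qed
qed

definition trunc :: "nat \<Rightarrow> cantor \<Rightarrow> cantor" where
  "trunc k x = (\<lambda>i. i < k \<and> x i)"

definition len :: "cantor \<Rightarrow> nat" where
  "len a = (LEAST k. \<forall>i\<ge>k. \<not> a i)"

lemma P_fin_iff: "a \<in> P_fin \<longleftrightarrow> (\<exists>k. \<forall>i\<ge>k. \<not> a i)"
proof -
  have "a \<in> P_fin \<longleftrightarrow> finite {n. a n}"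
    by (simp add: P_fin_def P_inf_def)
  also have "\<dots> \<longleftrightarrow> (\<exists>k. \<forall>i\<ge>k. \<not> a i)"
    unfolding finite_nat_set_iff_bounded by (metis leD linorder_not_less mem_Collect_eq)
  finally show ?thesis .
qed

lemma beyond_len: "a \<in> P_fin \<Longrightarrow> i \<ge> len a \<Longrightarrow> \<not> a i"
  unfolding P_fin_iff len_def using LeastI_ex[of "\<lambda>k. \<forall>i\<ge>k. \<not> a i"] by blast

lemma less_len: "a \<in> P_fin \<Longrightarrow> a i \<Longrightarrow> i < len a"
  using beyond_len linorder_not_less by blast

lemma trunc_P_fin [simp]: "trunc k x \<in> P_fin"
  unfolding P_fin_iff trunc_def by (rule exI[of _ k]) simp

lemma zeros_P_fin [simp]: "zeros \<in> P_fin"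
  by (simp add: P_fin_iff zeros_def)

lemma agree_trunc [simp]: "agree k x (trunc k x)" "agree k (trunc k x) x"
  by (auto simp: agree_def trunc_def)

lemma trunc_len:
  assumes "a \<in> P_fin" "len a \<le> k"
  shows "trunc k a = a"
proof
  fix i
  have "i < k" if "a i"
    using less_len[OF assms(1) that] assms(2) by simp
  then show "trunc k a i = a i"
    by (auto simp: trunc_def)
qed

lemma agree_trunc_eq: "agree k x y \<Longrightarrow> trunc k x = trunc k y"
  by (auto simp: agree_def trunc_def)

lemma countable_P_fin: "countable P_fin"
proof -
  have "P_fin \<subseteq> (\<lambda>A n. n \<in> A) ` {A. finite A}"
  proof
    fix a assume "a \<in> P_fin"
    then have "finite {n. a n}"
      by (simp add: P_fin_def P_inf_def)
    then show "a \<in> (\<lambda>A n. n \<in> A) ` {A. finite A}"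
      by (intro image_eqI[of _ _ "{n. a n}"]) auto
  qed
  then show ?thesis
    using countable_Collect_finite by (rule countable_subset[OF _ countable_image])
qed

lemma one_cons_inj [simp]: "one_cons x = one_cons y \<longleftrightarrow> x = y"
proof
  assume "one_cons x = one_cons y"
  then have "one_cons x (Suc n) = one_cons y (Suc n)" for n
    by simp
  then show "x = y"
    by (simp add: fun_eq_iff)
qed simp

section \<open>Fair runs in trees of filter-large moves\<close>

text \<open>
  A schedule assigns to each time the colour of the move made at that time; \<open>None\<close> is a pause. Pauses
  are needed because two branches of a common tree of nodes advance at different times.
\<close>
definition fair :: "'c set \<Rightarrow> (nat \<Rightarrow> 'c option) \<Rightarrow> bool" where
  "fair C \<kappa> \<longleftrightarrow> (\<forall>c\<in>C. \<forall>m. \<exists>n\<ge>m. \<kappa> n = Some c)"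

lemma fair_shift: "fair C \<kappa> \<Longrightarrow> fair C (\<lambda>n. \<kappa> (n + m))"
  unfolding fair_def
proof (intro ballI allI)
  fix c k assume "\<forall>c\<in>C. \<forall>m. \<exists>n\<ge>m. \<kappa> n = Some c" and "c \<in> C"
  then obtain n where "n \<ge> k + m" "\<kappa> n = Some c"
    by blast
  then show "\<exists>n\<ge>k. \<kappa> (n + m) = Some c"
    by (intro exI[of _ "n - m"]) simp
qed

lemma fairD: "fair C \<kappa> \<Longrightarrow> c \<in> C \<Longrightarrow> \<exists>n\<ge>m. \<kappa> n = Some c"
  unfolding fair_def by blast

text \<open>
  An abstract form of the tree of pairs of nodes. From a position \<open>s\<close> a move of colour \<open>c\<close> goes to a legal
  position; the filter \<open>W c s\<close> says which sets of moves are large. Positions have finitely many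
  predecessors, so finitely many demands per predecessor can be met at once, and the limit of
  a run depends only on its tail.
\<close>
locale game =
  fixes S :: "'s set" and W :: "'c \<Rightarrow> 's \<Rightarrow> 's filter" and le :: "'s \<Rightarrow> 's \<Rightarrow> bool"
    and legal :: "'c \<Rightarrow> 's \<Rightarrow> 's \<Rightarrow> bool" and lim :: "(nat \<Rightarrow> 's) \<Rightarrow> 'o"
  assumes W_proper: "s \<in> S \<Longrightarrow> W c s \<noteq> bot"
    and W_legal: "s \<in> S \<Longrightarrow> eventually (\<lambda>t. t \<in> S \<and> legal c s t) (W c s)"
    and legal_le: "s \<in> S \<Longrightarrow> t \<in> S \<Longrightarrow> legal c s t \<Longrightarrow> le s t \<and> s \<noteq> t"
    and le_refl: "s \<in> S \<Longrightarrow> le s s"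
    and le_trans: "le s t \<Longrightarrow> le t u \<Longrightarrow> le s u"
    and le_antisym: "le s t \<Longrightarrow> le t s \<Longrightarrow> s = t"
    and finite_le: "t \<in> S \<Longrightarrow> finite {s. le s t}"
    and lim_tail: "(\<And>n. r n \<in> S) \<Longrightarrow> (\<And>n. le (r n) (r (Suc n))) \<Longrightarrow> lim (\<lambda>n. r (n + m)) = lim r"
begin

lemma W_exists:
  assumes "eventually P (W c s)" "s \<in> S"
  obtains t where "P t" "t \<in> S" "legal c s t"
proof -
  have "eventually (\<lambda>t. P t \<and> t \<in> S \<and> legal c s t) (W c s)"
    using assms W_legal eventually_conj by blast
  then obtain t where "P t \<and> t \<in> S \<and> legal c s t"
    using eventually_happens'[OF W_proper[OF assms(2)]] by blast
  then show ?thesis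
    using that by blast
qed

definition step :: "('c \<Rightarrow> 's \<Rightarrow> 's set) \<Rightarrow> 'c \<Rightarrow> 's \<Rightarrow> 's \<Rightarrow> bool" where
  "step A c s t \<longleftrightarrow> t \<in> S \<and> legal c s t \<and> t \<in> A c s"

definition tree :: "'c set \<Rightarrow> ('c \<Rightarrow> 's \<Rightarrow> 's set) \<Rightarrow> bool" where
  "tree C A \<longleftrightarrow> (\<forall>c\<in>C. \<forall>s\<in>S. eventually (\<lambda>t. t \<in> A c s) (W c s))"

definition run :: "'c set \<Rightarrow> ('c \<Rightarrow> 's \<Rightarrow> 's set) \<Rightarrow> (nat \<Rightarrow> 'c option) \<Rightarrow> (nat \<Rightarrow> 's) \<Rightarrow> bool" where
  "run C A \<kappa> r \<longleftrightarrow> r 0 \<in> S \<and>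
     (\<forall>n. case \<kappa> n of None \<Rightarrow> r (Suc n) = r n | Some c \<Rightarrow> c \<in> C \<and> step A c (r n) (r (Suc n)))"

lemma runI:
  assumes "r 0 \<in> S" "\<And>n. \<kappa> n = None \<Longrightarrow> r (Suc n) = r n"
    "\<And>n c. \<kappa> n = Some c \<Longrightarrow> c \<in> C \<and> step A c (r n) (r (Suc n))"
  shows "run C A \<kappa> r"
  unfolding run_def using assms by (auto split: option.split)

lemma run_None: "run C A \<kappa> r \<Longrightarrow> \<kappa> n = None \<Longrightarrow> r (Suc n) = r n"
  unfolding run_def by (drule conjunct2, drule spec[of _ n]) simp

lemma run_Some: "run C A \<kappa> r \<Longrightarrow> \<kappa> n = Some c \<Longrightarrow> c \<in> C \<and> step A c (r n) (r (Suc n))"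
  unfolding run_def by (drule conjunct2, drule spec[of _ n]) simp

lemma run_mem: "run C A \<kappa> r \<Longrightarrow> r n \<in> S"
proof (induction n)
  case 0
  then show ?case
    by (simp add: run_def)
next
  case (Suc n)
  then show ?case
    using run_None[of C A \<kappa> r n] run_Some[of C A \<kappa> r n] by (cases "\<kappa> n") (auto simp: step_def)
qed

lemma run_shift:
  assumes "run C A \<kappa> r"
  shows "run C A (\<lambda>n. \<kappa> (n + m)) (\<lambda>n. r (n + m))"
proof (rule runI)
  show "r (0 + m) \<in> S"
    using run_mem[OF assms] .
qed (use run_None[OF assms] run_Some[OF assms] in auto)

lemma run_le_Suc:
  assumes "run C A \<kappa> r"
  shows "le (r n) (r (Suc n))"
proof (cases "\<kappa> n")
  case None
  then show ?thesis
    using run_None[OF assms None] run_mem[OF assms] le_refl by simp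
next
  case (Some c)
  then show ?thesis
    using run_Some[OF assms Some] run_mem[OF assms] legal_le by (auto simp: step_def)
qed

lemma run_le:
  assumes "run C A \<kappa> r" "n \<le> m"
  shows "le (r n) (r m)"
  using assms(2)
proof (induction m rule: dec_induct)
  case base
  then show ?case
    using run_mem[OF assms(1)] le_refl by blast
next
  case (step m)
  then show ?case
    using run_le_Suc[OF assms(1)] le_trans by blast
qed

lemma lim_shift: "run C A \<kappa> r \<Longrightarrow> lim (\<lambda>n. r (n + m)) = lim r"
  by (rule lim_tail) (rule run_mem run_le_Suc; assumption)+

definition rank :: "'s \<Rightarrow> nat" where
  "rank t = card {s. le s t}"

lemma rank_mono: "t \<in> S \<Longrightarrow> le s t \<Longrightarrow> rank s \<le> rank t"
  unfolding rank_def by (rule card_mono) (auto simp: finite_le intro: le_trans)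

lemma rank_step:
  assumes "s \<in> S" "step A c s t"
  shows "rank s < rank t"
proof -
  have t: "t \<in> S" "le s t" "s \<noteq> t"
    using assms legal_le by (auto simp: step_def)
  have "{u. le u s} \<subset> {u. le u t}"
    using t le_trans[of _ s t] le_antisym[of s t] le_refl[of t] by blast
  then show ?thesis
    unfolding rank_def using finite_le[OF t(1)] by (rule psubset_card_mono[rotated])
qed

lemma rank_run:
  assumes r: "run C A \<kappa> r" and f: "fair C \<kappa>" and c: "c \<in> C"
  shows "\<exists>n. rank (r n) \<ge> k"
proof (induction k)
  case (Suc k)
  then obtain n where n: "rank (r n) \<ge> k"
    by blast
  obtain i where i: "i \<ge> n" "\<kappa> i = Some c"
    using fairD[OF f c] by blast
  have "rank (r i) < rank (r (Suc i))"
    using rank_step run_mem[OF r] run_Some[OF r i(2)] by blast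
  moreover have "rank (r n) \<le> rank (r i)"
    by (rule rank_mono[OF run_mem[OF r] run_le[OF r i(1)]])
  ultimately show ?case
    using n by (intro exI[of _ "Suc i"]) simp
qed simp

text \<open>
  The moves that obey all trees \<open>A \<in> G s\<close> attached to predecessors \<open>s\<close> of the current position. A run of
  this tree obeys, from each moment on, the trees attached to the position reached at that moment.
\<close>
definition comb :: "('s \<Rightarrow> ('c \<Rightarrow> 's \<Rightarrow> 's set) set) \<Rightarrow> 'c \<Rightarrow> 's \<Rightarrow> 's set" where
  "comb G c t = {t'. \<forall>s\<in>{s \<in> S. le s t}. \<forall>A\<in>G s. t' \<in> A c t}"

lemma tree_comb:
  assumes "\<And>s. s \<in> S \<Longrightarrow> finite (G s)" "\<And>s A. s \<in> S \<Longrightarrow> A \<in> G s \<Longrightarrow> tree C A"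
  shows "tree C (comb G)"
  unfolding tree_def
proof (intro ballI)
  fix c t assume c: "c \<in> C" and t: "t \<in> S"
  have fin: "finite {s \<in> S. le s t}"
    using finite_le[OF t] by simp
  show "eventually (\<lambda>t'. t' \<in> comb G c t) (W c t)"
    unfolding comb_def mem_Collect_eq
  proof (intro eventually_ball_finite fin ballI)
    fix s A assume "s \<in> {s \<in> S. le s t}" "A \<in> G s"
    then show "eventually (\<lambda>t'. t' \<in> A c t) (W c t)"
      using assms(2) c t unfolding tree_def by blast
  qed (use assms(1) in blast)
qed

lemma run_comb:
  assumes r: "run C (comb G) \<kappa> r" and A: "A \<in> G (r 0)"
  shows "run C A \<kappa> r"
proof (rule runI)
  show "r 0 \<in> S"
    using run_mem[OF r] .
  fix n c assume "\<kappa> n = Some c"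
  from run_Some[OF r this] show "c \<in> C \<and> step A c (r n) (r (Suc n))"
    using run_le[OF r, of 0 n] run_mem[OF r, of 0] A by (auto simp: step_def comb_def)
qed (rule run_None[OF r])

lemma run_mono:
  assumes r: "run C A \<kappa> r" and "\<And>c s. A c s \<subseteq> B c s"
  shows "run C B \<kappa> r"
proof (rule runI)
  show "r 0 \<in> S"
    using run_mem[OF r] .
  fix n c assume "\<kappa> n = Some c"
  from run_Some[OF r this] show "c \<in> C \<and> step B c (r n) (r (Suc n))"
    using assms(2) by (auto simp: step_def)
qed (rule run_None[OF r])

lemma tree_Int: "tree C A \<Longrightarrow> tree C B \<Longrightarrow> tree C (\<lambda>c s. A c s \<inter> B c s)"
  unfolding tree_def by (simp add: eventually_conj)

text \<open>
  A largeness quantifier: the limit of a generic run from \<open>s\<close> with colours in \<open>C\<close>, each used infinitely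
  often, is in \<open>E\<close>.
\<close>
definition inn :: "'c set \<Rightarrow> 'o set \<Rightarrow> 's \<Rightarrow> bool" where
  "inn C E s \<longleftrightarrow> (\<exists>A. tree C A \<and> (\<forall>\<kappa> r. run C A \<kappa> r \<longrightarrow> fair C \<kappa> \<longrightarrow> r 0 = s \<longrightarrow> lim r \<in> E))"

lemma inn_mono: "inn C E s \<Longrightarrow> E \<subseteq> F \<Longrightarrow> inn C F s"
  unfolding inn_def by blast

definition wit :: "'c set \<Rightarrow> 'o set \<Rightarrow> 's \<Rightarrow> ('c \<Rightarrow> 's \<Rightarrow> 's set)" where
  "wit C E s = (SOME A. tree C A \<and> (\<forall>\<kappa> r. run C A \<kappa> r \<longrightarrow> fair C \<kappa> \<longrightarrow> r 0 = s \<longrightarrow> lim r \<in> E))"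

lemma wit:
  assumes "inn C E s"
  shows tree_wit: "tree C (wit C E s)"
    and run_wit: "run C (wit C E s) \<kappa> r \<Longrightarrow> fair C \<kappa> \<Longrightarrow> r 0 = s \<Longrightarrow> lim r \<in> E"
  using someI_ex[OF assms[unfolded inn_def]] unfolding wit_def by blast+

text \<open>
  The engine for producing trees. The run stays in \<open>Y\<close> by moves in \<open>Q\<close> until it possibly reaches a
  position where \<open>inn C E\<close> holds; from then on it follows the tree given there, which is possible since
  \<open>comb\<close> imposes at each position the trees attached to its predecessors. A run that never gets there is
  taken care of by the hypothesis \<open>stay\<close>.
\<close>
lemma inn_escape:
  assumes T: "tree C T" and Y: "s0 \<in> Y"
    and Q: "\<And>s c. s \<in> Y \<Longrightarrow> c \<in> C \<Longrightarrow> eventually (\<lambda>t. Q c s t \<or> inn C E t) (W c s)"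
    and QY: "\<And>c s t. s \<in> Y \<Longrightarrow> Q c s t \<Longrightarrow> t \<in> Y"
    and stay: "\<And>\<kappa> r. run C (\<lambda>c s. {t. Q c s t} \<inter> T c s) \<kappa> r \<Longrightarrow> fair C \<kappa> \<Longrightarrow> r 0 = s0 \<Longrightarrow> lim r \<in> E"
  shows "inn C E s0"
proof -
  define G where "G s = (if inn C E s then {wit C E s} else {})" for s
  define A where "A c s = (comb G c s \<inter> T c s) \<inter> {t. s \<in> Y \<longrightarrow> Q c s t \<or> inn C E t}" for c s
  have "tree C (comb G)"
    by (rule tree_comb) (auto simp: G_def tree_wit split: if_splits)
  moreover have "tree C (\<lambda>c s. {t. s \<in> Y \<longrightarrow> Q c s t \<or> inn C E t})"
    unfolding tree_def
  proof (intro ballI)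
    fix c s assume "c \<in> C" "s \<in> S"
    then show "eventually (\<lambda>t. t \<in> {t. s \<in> Y \<longrightarrow> Q c s t \<or> inn C E t}) (W c s)"
      using Q[of s c] by (cases "s \<in> Y") simp_all
  qed
  ultimately have tA: "tree C A"
    unfolding A_def using T by (intro tree_Int)
  have "lim r \<in> E" if r: "run C A \<kappa> r" and f: "fair C \<kappa>" and r0: "r 0 = s0" for \<kappa> r
  proof (cases "\<exists>n. inn C E (r n)")
    case True
    then obtain n where n: "inn C E (r n)"
      by blast
    have "run C (comb G) (\<lambda>i. \<kappa> (i + n)) (\<lambda>i. r (i + n))"
      using run_shift[OF r] by (rule run_mono) (auto simp: A_def)
    then have "run C (wit C E (r n)) (\<lambda>i. \<kappa> (i + n)) (\<lambda>i. r (i + n))"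
      by (rule run_comb) (simp add: G_def n)
    then have "lim (\<lambda>i. r (i + n)) \<in> E"
      by (rule run_wit[OF n]) (simp_all add: fair_shift[OF f])
    then show ?thesis
      using lim_shift[OF r] by simp
  next
    case False
    have rY: "r n \<in> Y" for n
    proof (induction n)
      case 0
      then show ?case
        by (simp add: r0 Y)
    next
      case (Suc n)
      show ?case
      proof (cases "\<kappa> n")
        case None
        then show ?thesis
          using run_None[OF r None] Suc by simp
      next
        case (Some c)
        then have "Q c (r n) (r (Suc n))"
          using run_Some[OF r Some] Suc False by (auto simp: step_def A_def)
        then show ?thesis
          by (rule QY[OF Suc])
      qed
    qed
    have "run C (\<lambda>c s. {t. Q c s t} \<inter> T c s) \<kappa> r"
    proof (rule runI)
      fix n c assume "\<kappa> n = Some c"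
      from run_Some[OF r this] show "c \<in> C \<and> step (\<lambda>c s. {t. Q c s t} \<inter> T c s) c (r n) (r (Suc n))"
        using rY[of n] False by (auto simp: step_def A_def)
    qed (use run_mem[OF r] run_None[OF r] in auto)
    then show ?thesis
      using stay f r0 by blast
  qed
  then show ?thesis
    unfolding inn_def using tA by blast
qed

lemma tree_UNIV: "tree C (\<lambda>_ _. UNIV)"
  by (simp add: tree_def)

lemma inn_all:
  assumes "C \<noteq> {}" "\<And>c. c \<in> C \<Longrightarrow> eventually (inn C E) (W c s)"
  shows "inn C E s"
proof (rule inn_escape[where Y = "{s}" and Q = "\<lambda>_ _ _. False", OF tree_UNIV])
  fix \<kappa> r assume r: "run C (\<lambda>c s. {t. False} \<inter> UNIV) \<kappa> r" and f: "fair C \<kappa>"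
  obtain c where "c \<in> C"
    using assms(1) by blast
  then obtain n where "\<kappa> n = Some c"
    using fairD[OF f] by blast
  from run_Some[OF r this] show "lim r \<in> E"
    by (simp add: step_def)
qed (use assms in auto)

end

subsection \<open>Ultrafilters decide\<close>

definition is_ultra :: "'a filter \<Rightarrow> bool" where
  "is_ultra F \<longleftrightarrow> F \<noteq> bot \<and> (\<forall>P. eventually P F \<or> eventually (\<lambda>x. \<not> P x) F)"

lemma ultra_disj:
  assumes "is_ultra F" "eventually (\<lambda>x. P x \<or> Q x) F"
  shows "eventually P F \<or> eventually Q F"
proof -
  have "eventually Q F" if "eventually (\<lambda>x. \<not> P x) F"
    using assms(2) that by eventually_elim blast
  then show ?thesis
    using assms(1) unfolding is_ultra_def by blast
qed

lemma ultra_not: "is_ultra F \<Longrightarrow> \<not> eventually P F \<Longrightarrow> eventually (\<lambda>x. \<not> P x) F"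
  unfolding is_ultra_def by blast

locale ultra_game = game +
  assumes W_ultra: "s \<in> S \<Longrightarrow> is_ultra (W c s)"
    and W_idem: "s \<in> S \<Longrightarrow> eventually P (W c s) \<Longrightarrow> eventually (\<lambda>t. eventually P (W c t)) (W c s)"
begin

definition dec :: "'b set \<Rightarrow> 'c set \<Rightarrow> 'a \<Rightarrow> bool" where
  "dec C E s \<longleftrightarrow> inn C E s \<or> inn C (- E) s"

lemma dec_Compl: "dec C (- E) = dec C E"
  by (auto simp: dec_def)

text \<open>
  If after a move of colour \<open>c\<close> a move of colour \<open>d\<close> leads to success, then so does the first move alone. By
  idempotence, the positions from which both \<open>d\<close> succeeds and \<open>c\<close> keeps this true are stable
  under almost every move of colour \<open>c\<close>; staying there, a fair run has to make a move of colour
  \<open>d\<close> sooner or later, and this move succeeds.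
\<close>
lemma inn_other_colour:
  assumes C: "C \<subseteq> {c, d}" and "s0 \<in> S" "c \<in> C" "d \<in> C" "d \<noteq> c"
    and ev: "eventually (\<lambda>s. eventually (inn C E) (W d s)) (W c s0)"
  shows "eventually (inn C E) (W c s0)"
proof -
  let ?P = "\<lambda>s. eventually (inn C E) (W d s)"
  define Y where "Y = {s \<in> S. ?P s \<and> eventually ?P (W c s)}"
  have Yc: "eventually (\<lambda>s. s \<in> Y) (W c s)" if "s \<in> S" "eventually ?P (W c s)" for s
    using W_legal[OF that(1), of c] that(2) W_idem[OF that] unfolding Y_def
    by eventually_elim simp
  have "inn C E s" if "s \<in> Y" for s
  proof (rule inn_escape[where Y = Y and Q = "\<lambda>e _ s'. e = c \<and> s' \<in> Y", OF tree_UNIV that])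
    fix s e assume s: "s \<in> Y" and "e \<in> C"
    then consider "e = c" | "e = d"
      using C by blast
    then show "eventually (\<lambda>s'. e = c \<and> s' \<in> Y \<or> inn C E s') (W e s)"
    proof cases
      case 1
      have "eventually (\<lambda>s. s \<in> Y) (W c s)"
        using s by (intro Yc) (auto simp: Y_def)
      then show ?thesis
        unfolding 1 by (rule eventually_mono) simp
    next
      case 2
      have "eventually (inn C E) (W d s)"
        using s by (simp add: Y_def)
      then show ?thesis
        unfolding 2 by (rule eventually_mono) simp
    qed
  next
    fix \<kappa> r assume r: "run C (\<lambda>e s. {s'. e = c \<and> s' \<in> Y} \<inter> UNIV) \<kappa> r" and f: "fair C \<kappa>"
    obtain n where "\<kappa> n = Some d"
      using fairD[OF f assms(4)] by blast
    from run_Some[OF r this] show "lim r \<in> E"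
      using assms(5) by (simp add: step_def)
  qed auto
  with Yc[OF assms(2) ev] show ?thesis
    by (rule eventually_mono)
qed

text \<open>
  The step that yields all Borel sets. If the union is undecided almost everywhere, then idempotence gives
  positions from which it remains undecided after almost every move, of any colour. Along a run through such
  positions no \<open>E k\<close> can be decided positively, since this would decide the union; so each is
  decided negatively, and the run can obey the corresponding trees for \<open>k\<close> up to the growing rank
  of its position. Its limit is then outside every \<open>E k\<close>, and the union is decided after all. At most
  two colours are involved because \<open>inn_other_colour\<close> eliminates one colour in favour of another.
\<close>
lemma dec_Union:
  fixes E :: "nat \<Rightarrow> 'c set"
  assumes C: "\<And>c d e. c \<in> C \<Longrightarrow> d \<in> C \<Longrightarrow> e \<in> C \<Longrightarrow> c = d \<or> c = e \<or> d = e"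
    and E: "\<And>k s c. s \<in> S \<Longrightarrow> c \<in> C \<Longrightarrow> eventually (dec C (E k)) (W c s)"
    and s0: "s0 \<in> S" and c0: "c0 \<in> C"
  shows "eventually (dec C (\<Union>k. E k)) (W c0 s0)"
proof (rule ccontr)
  assume neg: "\<not> eventually (dec C (\<Union>k. E k)) (W c0 s0)"
  define F where "F = (\<Union>k. E k)"
  define Z where "Z s \<longleftrightarrow> \<not> dec C F s" for s
  have VZ: "eventually Z (W c0 s0)"
    using ultra_not[OF W_ultra[OF s0] neg] by (simp add: Z_def [abs_def] F_def)
  have Zin: "\<not> inn C F s" if "Z s" for s
    using that by (simp add: Z_def dec_def)
  \<comment> \<open>Hereditarily undecided positions.\<close>
  define Z' where "Z' = {s \<in> S. Z s \<and> (\<forall>e\<in>C. eventually Z (W e s))}"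
  have finC: "finite C"
  proof (rule ccontr)
    assume "infinite C"
    then obtain B where "B \<subseteq> C" "card B = 3"
      using infinite_arbitrarily_large by metis
    then obtain x y z where "B = {x, y, z}" "x \<noteq> y" "x \<noteq> z" "y \<noteq> z"
      unfolding card_3_iff by blast
    then show False
      using C[of x y z] \<open>B \<subseteq> C\<close> by blast
  qed
  have step: "eventually (\<lambda>s. s \<in> Z') (W e s)" if s: "s \<in> S" and e: "e \<in> C" and eZ: "eventually Z (W e s)" for e s
  proof -
    have "eventually (\<lambda>t. eventually Z (W d t)) (W e s)" if d: "d \<in> C" for d
    proof (cases "d = e")
      case True
      then show ?thesis
        using W_idem[OF s eZ] by simp
    next
      case False
      then have C2: "C \<subseteq> {e, d}"
        using C[OF _ e d] by blast
      show ?thesis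
      proof (rule ccontr)
        assume "\<not> ?thesis"
        from ultra_not[OF W_ultra[OF s] this] W_legal[OF s, of e]
        have "eventually (\<lambda>t. eventually (inn C F) (W d t) \<or> eventually (inn C (- F)) (W d t)) (W e s)"
        proof eventually_elim
          fix t assume "\<not> eventually Z (W d t)" "t \<in> S \<and> legal e s t"
          then have "eventually (\<lambda>u. \<not> Z u) (W d t)"
            using ultra_not W_ultra by blast
          then have "eventually (\<lambda>u. inn C F u \<or> inn C (- F) u) (W d t)"
            by (rule eventually_mono) (simp add: Z_def dec_def)
          then show "eventually (inn C F) (W d t) \<or> eventually (inn C (- F)) (W d t)"
            using ultra_disj W_ultra \<open>t \<in> S \<and> legal e s t\<close> by blast
        qed
        from ultra_disj[OF W_ultra[OF s] this]
        have "eventually (inn C F) (W e s) \<or> eventually (inn C (- F)) (W e s)"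
          by (elim disj_forward) (rule inn_other_colour[OF C2 s e d False], assumption)+
        then have "eventually (dec C F) (W e s)"
          by (auto simp: dec_def elim: eventually_mono)
        with eZ have "eventually (\<lambda>_. False) (W e s)"
          by eventually_elim (simp add: Z_def)
        then show False
          using W_proper[OF s] by (simp add: trivial_limit_def)
      qed
    qed
    then have "eventually (\<lambda>t. \<forall>d\<in>C. eventually Z (W d t)) (W e s)"
      using finC by (intro eventually_ball_finite) auto
    with W_legal[OF s, of e] eZ show ?thesis
      by eventually_elim (simp add: Z'_def)
  qed
  obtain s where s: "s \<in> Z'"
    using W_exists[OF step[OF s0 c0 VZ] s0] by blast
  \<comment> \<open>The first \<open>rank s\<close> sets only: finitely many trees per position, and all sets in the end,
    since the rank tends to infinity along a fair run.\<close>
  define G where "G s = (\<lambda>k. wit C (- E k) s) ` {k. k \<le> rank s \<and> inn C (- E k) s}" for s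
  define Q where "Q e s t \<longleftrightarrow> t \<in> Z' \<and> (\<forall>k\<in>{..rank s}. inn C (- E k) t)" for e :: 'b and s t
  have TG: "tree C (comb G)"
  proof (rule tree_comb)
    fix s show "finite (G s)"
      unfolding G_def by (rule finite_imageI, rule finite_subset[of _ "{..rank s}"]) auto
  qed (auto simp: G_def tree_wit)
  have "inn C (- F) s"
  proof (rule inn_escape[where Y = Z' and Q = Q, OF TG s])
    fix s e assume s: "s \<in> Z'" and e: "e \<in> C"
    then have sS: "s \<in> S" and eZ: "eventually Z (W e s)"
      by (auto simp: Z'_def)
    have "eventually (\<lambda>t. \<forall>k\<in>{..rank s}. dec C (E k) t) (W e s)"
      using E[OF sS e] by (intro eventually_ball_finite) auto
    with step[OF sS e eZ] show "eventually (\<lambda>t. Q e s t \<or> inn C (- F) t) (W e s)"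
    proof eventually_elim
      fix t assume t: "t \<in> Z'" "\<forall>k\<in>{..rank s}. dec C (E k) t"
      have "inn C (- E k) t" if "k \<le> rank s" for k
      proof (rule ccontr)
        assume "\<not> inn C (- E k) t"
        then have "inn C (E k) t"
          using t that by (auto simp: dec_def)
        then have "inn C F t"
          by (rule inn_mono) (auto simp: F_def)
        then show False
          using t Zin by (auto simp: Z'_def)
      qed
      then show "Q e s t \<or> inn C (- F) t"
        using t by (simp add: Q_def)
    qed
  next
    fix \<kappa> r assume r: "run C (\<lambda>c s. {t. Q c s t} \<inter> comb G c s) \<kappa> r" and f: "fair C \<kappa>"
    have "lim r \<notin> E k" for k
    proof -
      obtain n where n: "rank (r n) \<ge> k"
        using rank_run[OF r f c0] by blast
      obtain m where m: "m \<ge> n" "\<kappa> m = Some c0"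
        using fairD[OF f c0] by blast
      have rk: "k \<le> rank (r i)" if "i \<ge> n" for i
        using rank_mono[OF run_mem[OF r] run_le[OF r that]] n by simp
      have "Q c0 (r m) (r (Suc m))"
        using run_Some[OF r m(2)] by (simp add: step_def)
      then have inn: "inn C (- E k) (r (Suc m))"
        using rk[OF m(1)] by (simp add: Q_def)
      have "run C (comb G) (\<lambda>i. \<kappa> (i + Suc m)) (\<lambda>i. r (i + Suc m))"
        using run_shift[OF r] by (rule run_mono) simp
      moreover have "wit C (- E k) (r (0 + Suc m)) \<in> G (r (0 + Suc m))"
        using inn rk[of "Suc m"] m(1) by (auto simp: G_def)
      ultimately have "run C (wit C (- E k) (r (0 + Suc m))) (\<lambda>i. \<kappa> (i + Suc m)) (\<lambda>i. r (i + Suc m))"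
        by (rule run_comb)
      then have "run C (wit C (- E k) (r (Suc m))) (\<lambda>i. \<kappa> (i + Suc m)) (\<lambda>i. r (i + Suc m))"
        by simp
      then have "lim (\<lambda>i. r (i + Suc m)) \<in> - E k"
        by (rule run_wit[OF inn]) (simp_all only: fair_shift[OF f] add_0)
      then show ?thesis
        using lim_shift[OF r] by (metis Compl_iff)
    qed
    then show "lim r \<in> - F"
      by (simp add: F_def)
  qed (auto simp: Z'_def Q_def)
  with s show False
    by (auto simp: Z'_def Z_def dec_def)
qed

end

section \<open>Idempotent families of ultrafilters\<close>

lemma finer_ultrafilter_exists:
  fixes F :: "'a filter"
  assumes "F \<noteq> bot"
  shows "\<exists>G\<le>F. is_ultra G"
proof -
  define S where "S = {G. G \<le> F \<and> G \<noteq> bot}"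
  have po: "partial_order_on S (relation_of (\<lambda>G H. H \<le> G) S)"
    by (rule partial_order_on_relation_ofI) auto
  have ch: "\<exists>u\<in>S. \<forall>G\<in>K. u \<le> G" if K: "K \<in> Chains (relation_of (\<lambda>G H. H \<le> G) S)" for K
  proof (cases "K = {}")
    case True
    then show ?thesis
      using assms by (auto simp: S_def)
  next
    case False
    have KS: "K \<subseteq> S" and lin: "\<And>G H. G \<in> K \<Longrightarrow> H \<in> K \<Longrightarrow> G \<le> H \<or> H \<le> G"
      using K unfolding Chains_def relation_of_def by auto
    have ev: "eventually P (Inf K) \<longleftrightarrow> (\<exists>G\<in>K. eventually P G)" for P
      using False lin by (intro eventually_Inf_base) (metis inf.absorb1 inf.absorb2 order_refl)+
    have "Inf K \<noteq> bot"
      using ev[of "\<lambda>_. False"] KS unfolding trivial_limit_def S_def by auto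
    moreover have "Inf K \<le> F"
    proof -
      obtain G where "G \<in> K"
        using False by blast
      then show ?thesis
        using KS Inf_lower[of G K] by (auto simp: S_def)
    qed
    ultimately show ?thesis
      by (intro bexI[of _ "Inf K"]) (auto simp: S_def Inf_lower)
  qed
  obtain G where G: "G \<in> S" and min: "\<And>H. H \<in> S \<Longrightarrow> H \<le> G \<Longrightarrow> H = G"
    using predicate_Zorn[OF po ch] by blast
  have "eventually (\<lambda>x. \<not> P x) G" if "\<not> eventually P G" for P
  proof (rule ccontr)
    assume "\<not> eventually (\<lambda>x. \<not> P x) G"
    then have "inf G (principal {x. P x}) \<noteq> bot"
      unfolding trivial_limit_def eventually_inf_principal by simp
    then have "inf G (principal {x. P x}) \<in> S"
      using G by (auto simp: S_def intro: le_infI1)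
    then have "inf G (principal {x. P x}) = G"
      by (rule min) simp
    then show False
      using that eventually_inf_principal[of P G "{x. P x}"] by simp
  qed
  then show ?thesis
    using G unfolding is_ultra_def S_def by blast
qed

definition idem_family :: "('a \<Rightarrow> 'a filter) \<Rightarrow> bool" where
  "idem_family F \<longleftrightarrow> (\<forall>a P. eventually P (F a) \<longrightarrow> eventually (\<lambda>b. eventually P (F b)) (F a))"

text \<open>
  Composition of two families of filters, as for the multiplication of ultrafilters on a semigroup.
\<close>
definition iter :: "('a \<Rightarrow> 'a filter) \<Rightarrow> ('a \<Rightarrow> 'a filter) \<Rightarrow> 'a \<Rightarrow> 'a filter" where
  "iter F U a = Abs_filter (\<lambda>P. eventually (\<lambda>b. eventually P (U b)) (F a))"

lemma eventually_iter:
  "eventually P (iter F U a) \<longleftrightarrow> eventually (\<lambda>b. eventually P (U b)) (F a)"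
  unfolding iter_def
proof (rule eventually_Abs_filter, rule is_filter.intro)
  show "eventually (\<lambda>b. eventually (\<lambda>x. True) (U b)) (F a)"
    by simp
next
  fix P Q assume "eventually (\<lambda>b. eventually P (U b)) (F a)" "eventually (\<lambda>b. eventually Q (U b)) (F a)"
  then show "eventually (\<lambda>b. eventually (\<lambda>x. P x \<and> Q x) (U b)) (F a)"
    by eventually_elim (rule eventually_conj)
next
  fix P Q assume PQ: "\<forall>x. P x \<longrightarrow> Q x" and "eventually (\<lambda>b. eventually P (U b)) (F a)"
  from this(2) show "eventually (\<lambda>b. eventually Q (U b)) (F a)"
    by (rule eventually_mono) (use PQ in \<open>auto elim: eventually_mono\<close>)
qed

text \<open>
  Generated by \<open>F a\<close> and, for the sets \<open>M\<close> of \<open>U a\<close>, the sets of nodes \<open>b\<close> with \<open>M\<close> in \<open>U b\<close>.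
  This is the analogue of the subsemigroup of solutions of \<open>x u = u\<close> in the proof that a compact
  semigroup has an idempotent.
\<close>
definition stab :: "('a \<Rightarrow> 'a filter) \<Rightarrow> ('a \<Rightarrow> 'a filter) \<Rightarrow> 'a \<Rightarrow> 'a filter" where
  "stab F U a = Abs_filter (\<lambda>P. \<exists>Y M. eventually Y (F a) \<and> eventually M (U a) \<and>
      (\<forall>b. Y b \<longrightarrow> eventually M (U b) \<longrightarrow> P b))"

lemma eventually_stab:
  "eventually P (stab F U a) \<longleftrightarrow> (\<exists>Y M. eventually Y (F a) \<and> eventually M (U a) \<and>
      (\<forall>b. Y b \<longrightarrow> eventually M (U b) \<longrightarrow> P b))"
  unfolding stab_def
proof (rule eventually_Abs_filter, rule is_filter.intro)
  show "\<exists>Y M. eventually Y (F a) \<and> eventually M (U a) \<and> (\<forall>b. Y b \<longrightarrow> eventually M (U b) \<longrightarrow> True)"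
    by (intro exI[of _ "\<lambda>_. True"]) simp
next
  fix P Q
  assume "\<exists>Y M. eventually Y (F a) \<and> eventually M (U a) \<and> (\<forall>b. Y b \<longrightarrow> eventually M (U b) \<longrightarrow> P b)"
    and "\<exists>Y M. eventually Y (F a) \<and> eventually M (U a) \<and> (\<forall>b. Y b \<longrightarrow> eventually M (U b) \<longrightarrow> Q b)"
  then obtain Y M Y' M' where *: "eventually Y (F a)" "eventually M (U a)"
      "\<And>b. Y b \<Longrightarrow> eventually M (U b) \<Longrightarrow> P b"
      "eventually Y' (F a)" "eventually M' (U a)" "\<And>b. Y' b \<Longrightarrow> eventually M' (U b) \<Longrightarrow> Q b"
    by auto
  have "eventually M (U b) \<and> eventually M' (U b)" if "eventually (\<lambda>x. M x \<and> M' x) (U b)" for b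
    using that by (simp add: eventually_conj_iff)
  then show "\<exists>Y M. eventually Y (F a) \<and> eventually M (U a) \<and>
      (\<forall>b. Y b \<longrightarrow> eventually M (U b) \<longrightarrow> P b \<and> Q b)"
    using * by (intro exI[of _ "\<lambda>x. Y x \<and> Y' x"] exI[of _ "\<lambda>x. M x \<and> M' x"]) (simp add: eventually_conj_iff)
next
  fix P Q :: "'a \<Rightarrow> bool"
  assume "\<forall>x. P x \<longrightarrow> Q x"
    and "\<exists>Y M. eventually Y (F a) \<and> eventually M (U a) \<and> (\<forall>b. Y b \<longrightarrow> eventually M (U b) \<longrightarrow> P b)"
  then show "\<exists>Y M. eventually Y (F a) \<and> eventually M (U a) \<and> (\<forall>b. Y b \<longrightarrow> eventually M (U b) \<longrightarrow> Q b)"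
    by blast
qed

text \<open>
  The argument of Ellis for idempotents in compact semigroups. Take by Zorn's lemma a minimal
  idempotent family \<open>F\<close> of proper filters below the given one, and any ultrafilters \<open>U a\<close> finer than
  \<open>F a\<close>. Both \<open>iter F U\<close> and \<open>stab F U\<close> are idempotent and below \<open>F\<close>, hence equal to
  \<open>F\<close>. The second equality makes a set \<open>M\<close> of \<open>U a\<close> large for \<open>U b\<close> at \<open>F a\<close>-almost
  every \<open>b\<close>, and the first one then puts \<open>M\<close> into \<open>F a\<close>. So \<open>F = U\<close>.
\<close>
theorem finer_idempotent_ultra_family:
  fixes F0 :: "'a \<Rightarrow> 'a filter"
  assumes ne: "\<And>a. F0 a \<noteq> bot" and idem: "idem_family F0"
  shows "\<exists>U. idem_family U \<and> (\<forall>a. U a \<le> F0 a \<and> is_ultra (U a))"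
proof -
  define S where "S = {F. F \<le> F0 \<and> (\<forall>a. F a \<noteq> bot) \<and> idem_family F}"
  have po: "partial_order_on S (relation_of (\<lambda>G H. H \<le> G) S)"
    by (rule partial_order_on_relation_ofI) auto
  have ch: "\<exists>u\<in>S. \<forall>G\<in>K. u \<le> G" if K: "K \<in> Chains (relation_of (\<lambda>G H. H \<le> G) S)" for K
  proof (cases "K = {}")
    case True
    then show ?thesis
      using assms by (auto simp: S_def)
  next
    case False
    have KS: "K \<subseteq> S" and lin: "\<And>G H. G \<in> K \<Longrightarrow> H \<in> K \<Longrightarrow> G \<le> H \<or> H \<le> G"
      using K unfolding Chains_def relation_of_def by auto
    define u where "u a = (INF F\<in>K. F a)" for a
    have ev: "eventually P (u a) \<longleftrightarrow> (\<exists>F\<in>K. eventually P (F a))" for P a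
      unfolding u_def
    proof (rule eventually_INF_base[OF False])
      fix G H assume "G \<in> K" "H \<in> K"
      then show "\<exists>x\<in>K. x a \<le> inf (G a) (H a)"
        using lin[of G H] by (auto simp: le_fun_def)
    qed
    have lower: "u a \<le> F a" if "F \<in> K" for F a
      unfolding u_def using that by (rule INF_lower)
    have "u a \<noteq> bot" for a
      using ev[of "\<lambda>_. False" a] KS unfolding trivial_limit_def S_def by auto
    moreover have "u \<le> F0"
    proof -
      obtain G where "G \<in> K"
        using False by blast
      then have "u \<le> G" "G \<le> F0"
        using KS lower by (auto simp: S_def le_fun_def)
      then show ?thesis
        by simp
    qed
    moreover have "idem_family u"
      unfolding idem_family_def
    proof (intro allI impI)
      fix a P assume "eventually P (u a)"
      then obtain F where F: "F \<in> K" "eventually P (F a)"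
        using ev by blast
      then have "eventually (\<lambda>b. eventually P (F b)) (F a)"
        using KS by (auto simp: S_def idem_family_def)
      then have "eventually (\<lambda>b. eventually P (u b)) (F a)"
        by (rule eventually_mono) (use F ev in blast)
      then show "eventually (\<lambda>b. eventually P (u b)) (u a)"
        using F ev by blast
    qed
    ultimately show ?thesis
      using lower by (intro bexI[of _ u]) (auto simp: S_def le_fun_def)
  qed
  obtain F where F: "F \<in> S" and min: "\<And>H. H \<in> S \<Longrightarrow> H \<le> F \<Longrightarrow> H = F"
    using predicate_Zorn[OF po ch] by blast
  have Fbot: "F a \<noteq> bot" and Fidem: "eventually P (F a) \<Longrightarrow> eventually (\<lambda>b. eventually P (F b)) (F a)" for a P
    using F by (auto simp: S_def idem_family_def)
  have "\<forall>a. \<exists>G\<le>F a. is_ultra G"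
    using finer_ultrafilter_exists[OF Fbot] by blast
  then obtain U where UF: "\<And>a. U a \<le> F a" and U: "\<And>a. is_ultra (U a)"
    by metis
  have Ubot: "\<not> eventually (\<lambda>_. False) (U a)" for a
    using U[of a] by (simp add: is_ultra_def trivial_limit_def)
  have FU: "eventually P (F a) \<Longrightarrow> eventually P (U a)" for P a
    using UF[of a] by (rule filter_leD)
  have not: "\<not> eventually P (U a) \<longleftrightarrow> eventually (\<lambda>x. \<not> P x) (U a)" for P a
    using U[of a] Ubot[of a] eventually_conj[of P "U a" "\<lambda>x. \<not> P x"] by (auto simp: is_ultra_def)
  have "iter F U \<in> S"
  proof -
    have "iter F U \<le> F"
      unfolding le_fun_def le_filter_def eventually_iter
    proof (intro allI impI)
      fix a P assume "eventually P (F a)"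
      from Fidem[OF this] show "eventually (\<lambda>b. eventually P (U b)) (F a)"
        by (rule eventually_mono) (rule FU)
    qed
    moreover have "iter F U a \<noteq> bot" for a
      using Fbot[of a] Ubot by (simp add: trivial_limit_def eventually_iter)
    moreover have "idem_family (iter F U)"
      unfolding idem_family_def eventually_iter
    proof (intro allI impI)
      fix a P assume "eventually (\<lambda>b. eventually P (U b)) (F a)"
      from Fidem[OF Fidem[OF this]]
      show "eventually (\<lambda>c. eventually (\<lambda>b. eventually (\<lambda>c. eventually P (U c)) (F b)) (U c)) (F a)"
        by (rule eventually_mono) (rule FU)
    qed
    ultimately show ?thesis
      using F by (auto simp: S_def intro: order_trans)
  qed
  moreover have "iter F U \<le> F"
    unfolding le_fun_def le_filter_def eventually_iter
  proof (intro allI impI)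
    fix a P assume "eventually P (F a)"
    from Fidem[OF this] show "eventually (\<lambda>b. eventually P (U b)) (F a)"
      by (rule eventually_mono) (rule FU)
  qed
  ultimately have it: "iter F U = F"
    by (rule min)
  have itF: "eventually P (F a) \<longleftrightarrow> eventually (\<lambda>b. eventually P (U b)) (F a)" for P a
    using eventually_iter[of P F U a] unfolding it .
  have le: "stab F U \<le> F"
    unfolding le_fun_def le_filter_def eventually_stab
  proof (intro allI impI)
    fix a P assume "eventually P (F a)"
    then show "\<exists>Y M. eventually Y (F a) \<and> eventually M (U a) \<and> (\<forall>b. Y b \<longrightarrow> eventually M (U b) \<longrightarrow> P b)"
      by (intro exI[of _ P] exI[of _ "\<lambda>_. True"]) simp
  qed
  moreover have "stab F U \<in> S"
  proof -
    have "stab F U a \<noteq> bot" for a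
    proof
      assume "stab F U a = bot"
      then obtain Y M where YM: "eventually Y (F a)" "eventually M (U a)"
          "\<And>b. Y b \<Longrightarrow> \<not> eventually M (U b)"
        using eventually_stab[of "\<lambda>_. False" F U a] by auto
      have "eventually (\<lambda>b. eventually (\<lambda>x. \<not> M x) (U b)) (F a)"
        using YM(1) by (rule eventually_mono) (use YM(3) not in blast)
      then have "eventually (\<lambda>x. \<not> M x) (U a)"
        using itF FU by blast
      then show False
        using YM(2) not by blast
    qed
    moreover have "idem_family (stab F U)"
      unfolding idem_family_def
    proof (intro allI impI)
      fix a P assume "eventually P (stab F U a)"
      then obtain Y M where YM: "eventually Y (F a)" "eventually M (U a)"
          "\<And>b. Y b \<Longrightarrow> eventually M (U b) \<Longrightarrow> P b"
        unfolding eventually_stab by blast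
      show "eventually (\<lambda>b. eventually P (stab F U b)) (stab F U a)"
        unfolding eventually_stab[of _ F U a]
      proof (intro exI conjI allI impI)
        show "eventually (\<lambda>b. eventually Y (F b)) (F a)" "eventually M (U a)"
          using YM Fidem by blast+
        fix b assume "eventually Y (F b)" "eventually M (U b)"
        then show "eventually P (stab F U b)"
          unfolding eventually_stab using YM(3) by blast
      qed
    qed
    ultimately show ?thesis
      using F le by (auto simp: S_def intro: order_trans)
  qed
  ultimately have st: "stab F U = F"
    by (intro min)
  have UleF: "eventually M (F a)" if "eventually M (U a)" for M a
  proof -
    have "eventually (\<lambda>b. eventually M (U b)) (stab F U a)"
      unfolding eventually_stab using that by (intro exI[of _ "\<lambda>_. True"] exI[of _ M]) simp
    then show ?thesis
      unfolding st using itF by blast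
  qed
  have "U = F"
    using UleF FU by (auto simp: fun_eq_iff filter_eq_iff)
  then show ?thesis
    using F U by (auto simp: S_def le_fun_def)
qed

section \<open>Pairs of finite sequences and their limits\<close>

type_synonym state = "cantor \<times> cantor"

definition sel :: "bool \<Rightarrow> state \<Rightarrow> cantor" where
  "sel c st = (if c then snd st else fst st)"

definition move :: "bool \<Rightarrow> state \<Rightarrow> cantor \<Rightarrow> state" where
  "move c st v = (if c then (fst st, v) else (v, snd st))"

lemma move_simps [simp]:
  "sel c (move c st v) = v" "move c (move c st v) w = move c st w" "sel (\<not> c) (move c st v) = sel (\<not> c) st"
  by (simp_all add: sel_def move_def)

lemma sel_mem: "st \<in> D \<times> D \<Longrightarrow> sel c st \<in> D"
  by (auto simp: sel_def)

lemma move_mem: "st \<in> D \<times> D \<Longrightarrow> v \<in> D \<Longrightarrow> move c st v \<in> D \<times> D"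
  by (auto simp: move_def)

text \<open>
  The order of finite initial segments, where an eventually zero sequence stands for the finite sequence which ends
  with its last 1.
\<close>
definition lep :: "cantor \<Rightarrow> cantor \<Rightarrow> bool" where
  "lep a b \<longleftrightarrow> (\<exists>k. a = trunc k b)"

definition extends :: "cantor \<Rightarrow> cantor \<Rightarrow> bool" where
  "extends a b \<longleftrightarrow> a \<noteq> b \<and> lep a b"

lemma lep_refl: "a \<in> P_fin \<Longrightarrow> lep a a"
  unfolding lep_def by (rule exI[of _ "len a"]) (simp add: trunc_len)

lemma trunc_trunc [simp]: "trunc j (trunc k x) = trunc (min j k) x"
  by (auto simp: trunc_def)

lemma lep_trans: "lep a b \<Longrightarrow> lep b c \<Longrightarrow> lep a c"
  unfolding lep_def by force

lemma lep_imp: "lep a b \<Longrightarrow> a i \<Longrightarrow> b i"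
  by (auto simp: lep_def trunc_def)

lemma lep_antisym: "lep a b \<Longrightarrow> lep b a \<Longrightarrow> a = b"
  by (rule HOL.ext) (blast dest: lep_imp)

lemma finite_lep: "b \<in> P_fin \<Longrightarrow> finite {a. lep a b}"
proof -
  assume b: "b \<in> P_fin"
  have "{a. lep a b} \<subseteq> (\<lambda>k. trunc k b) ` {..len b}"
  proof
    fix a assume "a \<in> {a. lep a b}"
    then obtain k where "a = trunc k b"
      by (auto simp: lep_def)
    also have "\<dots> = trunc k (trunc (len b) b)"
      using b by (simp add: trunc_len)
    finally show "a \<in> (\<lambda>k. trunc k b) ` {..len b}"
      by auto
  qed
  then show ?thesis
    by (rule finite_subset) simp
qed

lemma extends_new:
  assumes "extends a b"
  obtains i where "b i" "\<not> a i"
proof -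
  have "\<exists>i. b i \<and> \<not> a i"
  proof (rule ccontr)
    assume "\<nexists>i. b i \<and> \<not> a i"
    then have "a = b"
      using assms lep_imp unfolding extends_def by (intro HOL.ext) blast
    then show False
      using assms by (simp add: extends_def)
  qed
  then show ?thesis
    using that by blast
qed

definition le_state :: "state \<Rightarrow> state \<Rightarrow> bool" where
  "le_state s t \<longleftrightarrow> lep (fst s) (fst t) \<and> lep (snd s) (snd t)"

lemma finite_le_state: "t \<in> P_fin \<times> P_fin \<Longrightarrow> finite {s. le_state s t}"
proof -
  assume "t \<in> P_fin \<times> P_fin"
  then have "finite ({a. lep a (fst t)} \<times> {a. lep a (snd t)})"
    by (intro finite_cartesian_product finite_lep) auto
  then show ?thesis
    by (rule rev_finite_subset) (auto simp: le_state_def)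
qed

definition legal_move :: "bool \<Rightarrow> state \<Rightarrow> state \<Rightarrow> bool" where
  "legal_move c s t \<longleftrightarrow> extends (sel c s) (sel c t) \<and> sel (\<not> c) t = sel (\<not> c) s"

text \<open>
  Along a run the nodes extend each other, so the pointwise limit is a pointwise disjunction.
\<close>
definition limit_state :: "(nat \<Rightarrow> state) \<Rightarrow> state" where
  "limit_state r = ((\<lambda>i. \<exists>n. fst (r n) i), (\<lambda>i. \<exists>n. snd (r n) i))"

lemma limit_state_tail:
  assumes "\<And>n. r n \<in> P_fin \<times> P_fin" "\<And>n. le_state (r n) (r (Suc n))"
  shows "limit_state (\<lambda>n. r (n + m)) = limit_state r"
proof -
  have le: "le_state (r n) (r (n + k))" for n k
  proof (induction k)
    case 0
    then show ?case
      using assms(1)[of n] by (auto simp: le_state_def intro: lep_refl)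
  next
    case (Suc k)
    then show ?case
      using assms(2)[of "n + k"] by (auto simp: le_state_def intro: lep_trans)
  qed
  have "(\<exists>n. fst (r (n + m)) i) \<longleftrightarrow> (\<exists>n. fst (r n) i)" "(\<exists>n. snd (r (n + m)) i) \<longleftrightarrow> (\<exists>n. snd (r n) i)" for i
    using le lep_imp unfolding le_state_def by blast+
  then show ?thesis
    by (simp add: limit_state_def)
qed

text \<open>
  The positions are pairs of nodes from \<open>D\<close>, and \<open>U a\<close> is a filter of nodes converging to \<open>a\<close>. A move
  of colour \<open>False\<close> replaces the first node, a move of colour \<open>True\<close> the second one. Two
  instances matter: ultrafilters for the dichotomy of Borel sets, and complements of nowhere dense sets for
  arguments of category.
\<close>
locale nodes =
  fixes D :: "cantor set" and U :: "cantor \<Rightarrow> cantor filter"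
  assumes D_fin: "D \<subseteq> P_fin"
    and U_proper: "a \<in> D \<Longrightarrow> U a \<noteq> bot"
    and U_near: "a \<in> D \<Longrightarrow> eventually (\<lambda>b. b \<in> D \<and> b \<noteq> a \<and> agree k a b) (U a)"
begin

lemma U_extends:
  assumes a: "a \<in> D"
  shows "eventually (\<lambda>b. b \<in> D \<and> extends a b \<and> agree k a b) (U a)"
proof -
  have "extends a b \<and> agree k a b" if "b \<noteq> a" "agree (max k (len a)) a b" for b
  proof -
    have "a = trunc (max k (len a)) a"
      using a D_fin by (subst trunc_len) auto
    also have "\<dots> = trunc (max k (len a)) b"
      using that by (intro agree_trunc_eq)
    finally have "lep a b"
      unfolding lep_def by (rule exI)
    then show ?thesis
      using that agree_mono[OF that(2), of k] by (auto simp: extends_def)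
  qed
  with U_near[OF a, of "max k (len a)"] show ?thesis
    by (auto elim: eventually_mono)
qed

definition W :: "bool \<Rightarrow> state \<Rightarrow> state filter" where
  "W c s = filtermap (move c s) (U (sel c s))"

lemma eventually_W: "eventually P (W c s) \<longleftrightarrow> eventually (\<lambda>v. P (move c s v)) (U (sel c s))"
  by (simp add: W_def eventually_filtermap)

lemma W_legal':
  assumes "s \<in> D \<times> D"
  shows "eventually (\<lambda>t. t \<in> D \<times> D \<and> legal_move c s t) (W c s)"
proof -
  have "eventually (\<lambda>b. b \<in> D \<and> extends (sel c s) b \<and> agree 0 (sel c s) b) (U (sel c s))"
    by (rule U_extends[OF sel_mem[OF assms]])
  then show ?thesis
    unfolding eventually_W
  proof (rule eventually_mono)
    fix b assume "b \<in> D \<and> extends (sel c s) b \<and> agree 0 (sel c s) b"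
    then show "move c s b \<in> D \<times> D \<and> legal_move c s (move c s b)"
      using move_mem[OF assms] by (simp add: legal_move_def)
  qed
qed

sublocale game "D \<times> D" W le_state legal_move limit_state
proof
  fix s c assume s: "s \<in> D \<times> D"
  show "W c s \<noteq> bot"
    using U_proper[OF sel_mem[OF s]] by (simp add: W_def filtermap_bot_iff)
  show "eventually (\<lambda>t. t \<in> D \<times> D \<and> legal_move c s t) (W c s)"
    by (rule W_legal'[OF s])
next
  fix s t c assume s: "s \<in> D \<times> D" and t: "t \<in> D \<times> D" and l: "legal_move c s t"
  have refl: "lep (fst s) (fst s)" "lep (snd s) (snd s)"
    using s D_fin by (auto intro!: lep_refl simp: mem_Times_iff subset_iff)
  show "le_state s t \<and> s \<noteq> t"
    using l refl by (cases c) (auto simp: legal_move_def sel_def extends_def le_state_def)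
next
  fix s assume "s \<in> D \<times> D"
  then show "le_state s s"
    using D_fin by (auto simp: le_state_def mem_Times_iff subset_iff intro!: lep_refl)
next
  fix s t u assume "le_state s t" "le_state t u"
  then show "le_state s u"
    unfolding le_state_def using lep_trans by blast
next
  fix s t assume "le_state s t" "le_state t s"
  then show "s = t"
    unfolding le_state_def using lep_antisym by (simp add: prod_eq_iff)
next
  fix t assume "t \<in> D \<times> D"
  then have "t \<in> P_fin \<times> P_fin"
    using D_fin by auto
  then show "finite {s. le_state s t}"
    by (rule finite_le_state)
next
  fix r :: "nat \<Rightarrow> state" and m assume r: "\<And>n. r n \<in> D \<times> D" "\<And>n. le_state (r n) (r (Suc n))"
  have "r n \<in> P_fin \<times> P_fin" for n
    using r(1)[of n] D_fin by auto
  then show "limit_state (\<lambda>n. r (n + m)) = limit_state r"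
    using r(2) by (rule limit_state_tail)
qed

definition agree2 :: "nat \<Rightarrow> state \<Rightarrow> state \<Rightarrow> bool" where
  "agree2 k s t \<longleftrightarrow> agree k (fst s) (fst t) \<and> agree k (snd s) (snd t)"

lemma W_agree2:
  assumes "s \<in> D \<times> D"
  shows "eventually (agree2 k s) (W c s)"
proof -
  have "eventually (\<lambda>b. b \<in> D \<and> extends (sel c s) b \<and> agree k (sel c s) b) (U (sel c s))"
    by (rule U_extends[OF sel_mem[OF assms]])
  then show ?thesis
    unfolding eventually_W by (rule eventually_mono) (cases c; simp add: agree2_def move_def sel_def)
qed

text \<open>
  For a set containing a neighbourhood of the position, no dichotomy is needed: one moves within the neighbourhood.
\<close>
lemma inn_agree2:
  assumes "\<And>z. agree2 k s z \<Longrightarrow> z \<in> E"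
  shows "inn C E s"
proof -
  define A where "A c t = {u. agree2 k t u}" for c :: bool and t
  have "tree C A"
    unfolding tree_def A_def mem_Collect_eq using W_agree2 by blast
  moreover have "limit_state r \<in> E" if r: "run C A \<kappa> r" and r0: "r 0 = s" for \<kappa> r
  proof -
    have "agree2 k s (r n)" for n
    proof (induction n)
      case 0
      then show ?case
        by (simp add: r0 agree2_def)
    next
      case (Suc n)
      show ?case
      proof (cases "\<kappa> n")
        case None
        then show ?thesis
          using run_None[OF r None] Suc by simp
      next
        case (Some c)
        then have "agree2 k (r n) (r (Suc n))"
          using run_Some[OF r Some] by (simp add: step_def A_def)
        with Suc show ?thesis
          unfolding agree2_def using agree_trans by blast
      qed
    qed
    then have "agree2 k s (limit_state r)"
      by (simp add: agree2_def agree_def limit_state_def)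
    then show ?thesis
      by (rule assms)
  qed
  ultimately show ?thesis
    unfolding inn_def by blast
qed

text \<open>
  A single sequence of nodes in which the node \<open>\<nu> m\<close> is a legal successor of its parent \<open>\<nu> (par m)\<close>,
  simultaneously against all earlier nodes in the other coordinate. Only finitely many demands are made at
  each stage, so a large set of choices is left. The agreement up to \<open>len (\<nu> j)\<close> makes the new
  bit of \<open>\<nu> m\<close> lie beyond the supports of all earlier nodes.
\<close>
lemma greedy:
  assumes Dp: "Dp \<subseteq> D" "\<And>a. a \<in> Dp \<Longrightarrow> eventually (\<lambda>b. b \<in> Dp) (U a)"
    and T: "\<And>c s. s \<in> Dp \<times> Dp \<Longrightarrow> eventually (\<lambda>t. t \<in> T c s) (W c s)"
    and root: "\<And>i. i < R \<Longrightarrow> \<nu>0 i \<in> Dp" and par: "\<And>m. R \<le> m \<Longrightarrow> par m < m"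
  obtains \<nu> where "\<And>i. i < R \<Longrightarrow> \<nu> i = \<nu>0 i" "\<And>m. \<nu> m \<in> Dp"
    "\<And>m. R \<le> m \<Longrightarrow> extends (\<nu> (par m)) (\<nu> m)" "\<And>m. R \<le> m \<Longrightarrow> agree m (\<nu> (par m)) (\<nu> m)"
    "\<And>m j. R \<le> m \<Longrightarrow> j < m \<Longrightarrow> agree (len (\<nu> j)) (\<nu> (par m)) (\<nu> m)"
    "\<And>m j. R \<le> m \<Longrightarrow> j < m \<Longrightarrow> (\<nu> m, \<nu> j) \<in> T False (\<nu> (par m), \<nu> j)"
    "\<And>m j. R \<le> m \<Longrightarrow> j < m \<Longrightarrow> (\<nu> j, \<nu> m) \<in> T True (\<nu> j, \<nu> (par m))"
proof -
  define good where "good f m v \<longleftrightarrow> extends (f (par m)) v \<and> agree m (f (par m)) v \<and>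
     (\<forall>j\<in>{..<m}. agree (len (f j)) (f (par m)) v \<and> (v, f j) \<in> T False (f (par m), f j) \<and>
        (f j, v) \<in> T True (f j, f (par m)))" for f m v
  define P where "P f m v \<longleftrightarrow> v \<in> Dp \<and> (m < R \<longrightarrow> v = \<nu>0 m) \<and> (R \<le> m \<longrightarrow> good f m v)" for f m v
  have "\<exists>\<nu>. \<forall>m. P \<nu> m (\<nu> m)"
  proof (rule dependent_wellorder_choice)
    fix f g :: "nat \<Rightarrow> cantor" and m v assume fg: "\<And>y. y < m \<Longrightarrow> f y = g y"
    show "P f m v = P g m v"
    proof (cases "R \<le> m")
      case True
      have "f (par m) = g (par m)"
        using fg par[OF True] by blast
      then show ?thesis
        using fg by (simp add: P_def good_def)
    qed (simp add: P_def)
  next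
    fix f m assume IH: "\<And>y. y < m \<Longrightarrow> P f y (f y)"
    show "\<exists>v. P f m v"
    proof (cases "R \<le> m")
      case False
      then show ?thesis
        using root by (intro exI[of _ "\<nu>0 m"]) (auto simp: P_def)
    next
      case True
      let ?a = "f (par m)"
      have mem: "f j \<in> Dp" if "j < m" for j
        using IH that by (simp add: P_def)
      have a: "?a \<in> Dp"
        using mem par[OF True] .
      then have aD: "?a \<in> D"
        using Dp by blast
      have "eventually (\<lambda>v. agree (len (f j)) ?a v \<and> (v, f j) \<in> T False (?a, f j) \<and> (f j, v) \<in> T True (f j, ?a)) (U ?a)"
        if "j < m" for j
      proof -
        have "eventually (\<lambda>v. (v, f j) \<in> T False (?a, f j)) (U ?a)"
          using T[of "(?a, f j)" False] a mem[OF that] by (simp add: eventually_W move_def sel_def)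
        moreover have "eventually (\<lambda>v. (f j, v) \<in> T True (f j, ?a)) (U ?a)"
          using T[of "(f j, ?a)" True] a mem[OF that] by (simp add: eventually_W move_def sel_def)
        ultimately show ?thesis
          using U_near[OF aD, of "len (f j)"] by eventually_elim simp
      qed
      then have "eventually (\<lambda>v. \<forall>j\<in>{..<m}. agree (len (f j)) ?a v \<and> (v, f j) \<in> T False (?a, f j) \<and> (f j, v) \<in> T True (f j, ?a)) (U ?a)"
        by (intro eventually_ball_finite) auto
      with U_extends[OF aD, of m] Dp(2)[OF a] have "eventually (P f m) (U ?a)"
        by eventually_elim (use True in \<open>simp add: P_def good_def\<close>)
      then show ?thesis
        by (rule eventually_happens'[OF U_proper[OF aD]])
    qed
  qed
  then obtain \<nu> where \<nu>: "\<And>m. P \<nu> m (\<nu> m)"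
    by blast
  have g: "good \<nu> m (\<nu> m)" if "R \<le> m" for m
    using \<nu>[of m] that by (simp add: P_def)
  show ?thesis
    by (rule that[of \<nu>]) (use \<nu> g in \<open>auto simp: P_def good_def\<close>)
qed

end

text \<open>
  A set of indices that is linearly ordered by the parent function, with at most one of the roots \<open>0, ..., R - 1\<close>. It
  need not be infinite.
\<close>
definition branch :: "nat \<Rightarrow> (nat \<Rightarrow> nat) \<Rightarrow> nat set \<Rightarrow> bool" where
  "branch R par B \<longleftrightarrow> (\<forall>i\<in>B. \<forall>j\<in>B. i < R \<longrightarrow> j < R \<longrightarrow> i = j) \<and>
     (\<forall>m\<in>B. R \<le> m \<longrightarrow> par m \<in> B \<and> (\<forall>j\<in>B. j < m \<longrightarrow> j \<le> par m))"

definition pos :: "nat set \<Rightarrow> nat \<Rightarrow> nat" where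
  "pos B m = Max {j \<in> B. j \<le> m}"

lemma pos_mem: "j \<in> B \<Longrightarrow> j \<le> m \<Longrightarrow> pos B m \<in> B \<and> j \<le> pos B m \<and> pos B m \<le> m"
proof -
  assume j: "j \<in> B" "j \<le> m"
  have "finite {j \<in> B. j \<le> m}" "{j \<in> B. j \<le> m} \<noteq> {}"
    using j by auto
  from Max_in[OF this] Max_ge[OF this(1), of j] show ?thesis
    using j unfolding pos_def by simp
qed

lemma pos_eqI: "p \<in> B \<Longrightarrow> p \<le> m \<Longrightarrow> (\<And>j. j \<in> B \<Longrightarrow> j \<le> m \<Longrightarrow> j \<le> p) \<Longrightarrow> pos B m = p"
  unfolding pos_def by (rule Max_eqI) auto

lemma pos_Suc_notin: "Suc m \<notin> B \<Longrightarrow> pos B (Suc m) = pos B m"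
  unfolding pos_def by (rule arg_cong[of _ _ Max]) (auto simp: le_Suc_eq)

lemma pos_Suc_in: "Suc m \<in> B \<Longrightarrow> pos B (Suc m) = Suc m"
  by (rule pos_eqI) auto

text \<open>
  The output of \<open>greedy\<close>. Two branches that are disjoint from some index on trace out a run of \<open>T\<close>: read the
  indices in increasing order, and move the coordinate of the branch to which the index belongs.
\<close>
locale weave = nodes D U for D U +
  fixes Dp T R par \<nu>
  assumes Dp: "Dp \<subseteq> D"
    and par: "R \<le> m \<Longrightarrow> par m < m"
    and \<nu>_mem: "\<nu> m \<in> Dp"
    and \<nu>_extends: "R \<le> m \<Longrightarrow> extends (\<nu> (par m)) (\<nu> m)"
    and \<nu>_agree: "R \<le> m \<Longrightarrow> agree m (\<nu> (par m)) (\<nu> m)"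
    and \<nu>_fresh: "R \<le> m \<Longrightarrow> j < m \<Longrightarrow> agree (len (\<nu> j)) (\<nu> (par m)) (\<nu> m)"
    and \<nu>_left: "R \<le> m \<Longrightarrow> j < m \<Longrightarrow> (\<nu> m, \<nu> j) \<in> T False (\<nu> (par m), \<nu> j)"
    and \<nu>_right: "R \<le> m \<Longrightarrow> j < m \<Longrightarrow> (\<nu> j, \<nu> m) \<in> T True (\<nu> j, \<nu> (par m))"
begin

lemma \<nu>_D: "\<nu> m \<in> D"
  using \<nu>_mem Dp by blast

lemma \<nu>_fin: "\<nu> m \<in> P_fin"
  using \<nu>_D D_fin by blast

definition lub :: "nat set \<Rightarrow> cantor" where
  "lub B = (\<lambda>i. \<exists>m\<in>B. \<nu> m i)"

lemma branch_mono:
  assumes B: "branch R par B" and "m \<in> B" "m' \<in> B" "m \<le> m'"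
  shows "lep (\<nu> m) (\<nu> m')"
  using assms(3,4)
proof (induction m' rule: less_induct)
  case (less m')
  show ?case
  proof (cases "m = m'")
    case True
    then show ?thesis
      using lep_refl \<nu>_fin by simp
  next
    case False
    then have "m < m'"
      using less.prems by simp
    have "R \<le> m'"
    proof (rule ccontr)
      assume "\<not> R \<le> m'"
      then have "m = m'"
        using B assms(2) less.prems \<open>m < m'\<close> unfolding branch_def by auto
      then show False
        using False by simp
    qed
    then have "par m' \<in> B" "m \<le> par m'" "par m' < m'"
      using B less.prems assms(2) \<open>m < m'\<close> par unfolding branch_def by auto
    then have "lep (\<nu> m) (\<nu> (par m'))"
      using less.IH by blast
    then show ?thesis
      using \<nu>_extends[OF \<open>R \<le> m'\<close>] lep_trans unfolding extends_def by blast
  qed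
qed

lemma pos_par:
  assumes "branch R par B" "Suc m \<in> B" "R \<le> Suc m"
  shows "pos B m = par (Suc m)"
  using assms par[OF assms(3)] unfolding branch_def by (intro pos_eqI) auto

text \<open>
  At time \<open>n\<close> each coordinate is the last node of its branch with index at most \<open>M + n\<close>.
\<close>
definition pair_run :: "nat \<Rightarrow> nat set \<Rightarrow> nat set \<Rightarrow> nat \<Rightarrow> state" where
  "pair_run M B B' n = (\<nu> (pos B (M + n)), \<nu> (pos B' (M + n)))"

definition pair_col :: "nat \<Rightarrow> nat set \<Rightarrow> nat set \<Rightarrow> nat \<Rightarrow> bool option" where
  "pair_col M B B' n = (if Suc (M + n) \<in> B then Some False else if Suc (M + n) \<in> B' then Some True else None)"

definition apart :: "nat \<Rightarrow> nat set \<Rightarrow> nat set \<Rightarrow> bool" where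
  "apart M B B' \<longleftrightarrow> branch R par B \<and> branch R par B' \<and> (\<exists>j\<in>B. j \<le> M) \<and> (\<exists>j\<in>B'. j \<le> M) \<and> R \<le> Suc M \<and>
     (\<forall>m>M. \<not> (m \<in> B \<and> m \<in> B'))"

lemma run_pair:
  assumes "apart M B B'"
  shows "run UNIV T (pair_col M B B') (pair_run M B B')"
proof (rule runI)
  show "pair_run M B B' 0 \<in> D \<times> D"
    by (simp add: pair_run_def \<nu>_D)
next
  fix n assume "pair_col M B B' n = None"
  then show "pair_run M B B' (Suc n) = pair_run M B B' n"
    by (simp add: pair_col_def pair_run_def pos_Suc_notin split: if_splits)
next
  fix n c assume c: "pair_col M B B' n = Some c"
  have A: "branch R par B" "branch R par B'" "R \<le> Suc (M + n)" "\<not> (Suc (M + n) \<in> B \<and> Suc (M + n) \<in> B')"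
    using assms by (auto simp: apart_def)
  obtain j j' where j: "j \<in> B" "j \<le> M" "j' \<in> B'" "j' \<le> M"
    using assms by (auto simp: apart_def)
  have p: "pos B (M + n) < Suc (M + n)" "pos B' (M + n) < Suc (M + n)"
    using pos_mem[of j B "M + n"] pos_mem[of j' B' "M + n"] j by auto
  have "step T c (pair_run M B B' n) (pair_run M B B' (Suc n))"
  proof (cases "Suc (M + n) \<in> B")
    case True
    then have c: "\<not> c" "Suc (M + n) \<notin> B'"
      using c A by (auto simp: pair_col_def)
    then show ?thesis
      using pos_par[OF A(1) True A(3)] \<nu>_extends[OF A(3)] \<nu>_left[OF A(3) p(2)] \<nu>_D
      by (simp add: step_def pair_run_def pos_Suc_in[OF True] pos_Suc_notin legal_move_def sel_def)
  next
    case False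
    then have c: "c" "Suc (M + n) \<in> B'"
      using c A by (auto simp: pair_col_def split: if_splits)
    then show ?thesis
      using pos_par[OF A(2) c(2) A(3)] \<nu>_extends[OF A(3)] \<nu>_right[OF A(3) p(1)] \<nu>_D False
      by (simp add: step_def pair_run_def pos_Suc_in pos_Suc_notin legal_move_def sel_def)
  qed
  then show "c \<in> UNIV \<and> step T c (pair_run M B B' n) (pair_run M B B' (Suc n))"
    by simp
qed

lemma lub_pos:
  assumes B: "branch R par B" and j: "j \<in> B" "j \<le> M"
  shows "(\<exists>n. \<nu> (pos B (M + n)) i) \<longleftrightarrow> lub B i"
proof
  assume "\<exists>n. \<nu> (pos B (M + n)) i"
  then obtain n where "\<nu> (pos B (M + n)) i" ..
  moreover have "pos B (M + n) \<in> B"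
    using pos_mem[OF j(1), of "M + n"] j by simp
  ultimately show "lub B i"
    unfolding lub_def by blast
next
  assume "lub B i"
  then obtain m where m: "m \<in> B" "\<nu> m i"
    unfolding lub_def by blast
  have "pos B (M + m) \<in> B" "m \<le> pos B (M + m)"
    using pos_mem[OF m(1), of "M + m"] by simp_all
  then have "\<nu> (pos B (M + m)) i"
    using branch_mono[OF B m(1)] m(2) lep_imp by blast
  then show "\<exists>n. \<nu> (pos B (M + n)) i" ..
qed

lemma limit_pair:
  assumes "apart M B B'"
  shows "limit_state (pair_run M B B') = (lub B, lub B')"
proof -
  obtain j j' where j: "j \<in> B" "j \<le> M" "j' \<in> B'" "j' \<le> M"
    using assms by (auto simp: apart_def)
  have "branch R par B" "branch R par B'"
    using assms by (simp_all add: apart_def)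
  from lub_pos[OF this(1) j(1,2)] lub_pos[OF this(2) j(3,4)] show ?thesis
    by (simp add: limit_state_def pair_run_def)
qed

text \<open>
  The colours that occur infinitely often are those of the infinite branches. So pairs of infinite branches, pairs with
  one finite branch and pairs of finite branches are governed by \<open>inn\<close> for different sets of colours.
\<close>
lemma fair_pair:
  assumes A: "apart M B B'"
  shows "fair {c. if c then infinite B' else infinite B} (pair_col M B B')"
  unfolding fair_def
proof (intro ballI allI)
  fix c m assume c: "c \<in> {c. if c then infinite B' else infinite B}"
  define X where "X = (if c then B' else B)"
  have "infinite X"
    using c by (auto simp: X_def)
  then obtain k where k: "k \<in> X" "Suc (M + m) < k"
    by (meson infinite_nat_iff_unbounded)
  have "pair_col M B B' (k - Suc M) = Some c"
    using k A by (cases c) (auto simp: pair_col_def X_def apart_def)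
  then show "\<exists>n\<ge>m. pair_col M B B' n = Some c"
    using k by (intro exI[of _ "k - Suc M"]) simp
qed

lemma new_bit:
  assumes "R \<le> m"
  obtains f where "\<nu> m f" "m \<le> f" "\<And>j. j < m \<Longrightarrow> \<not> \<nu> j f"
proof -
  obtain f where f: "\<nu> m f" "\<not> \<nu> (par m) f"
    using \<nu>_extends[OF assms] by (rule extends_new)
  have "m \<le> f"
    using \<nu>_agree[OF assms] f by (auto simp: agree_def not_le[symmetric])
  moreover have "\<not> \<nu> j f" if "j < m" for j
  proof
    assume "\<nu> j f"
    then have "f < len (\<nu> j)"
      by (rule less_len[OF \<nu>_fin])
    then show False
      using \<nu>_fresh[OF assms that] f by (auto simp: agree_def)
  qed
  ultimately show ?thesis
    using that f by blast
qed

text \<open>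
  The new bit at the first index \<open>m\<close> of one branch is never taken by the other branch: later
  nodes there extend their parents beyond the support of \<open>\<nu> m\<close>.
\<close>
lemma lub_distinct_aux:
  assumes A: "apart M B B'" and m: "m \<in> B" "M < m" and least: "\<And>j. j \<in> B' \<Longrightarrow> M < j \<Longrightarrow> m < j"
  shows "lub B \<noteq> lub B'"
proof -
  have R: "R \<le> j" if "M < j" for j
    using A that by (simp add: apart_def)
  obtain f where f: "\<nu> m f" "\<And>j. j < m \<Longrightarrow> \<not> \<nu> j f"
    using new_bit[OF R[OF m(2)]] by metis
  have "\<not> \<nu> j f" if "j \<in> B'" for j
    using that
  proof (induction j rule: less_induct)
    case (less j)
    show ?case
    proof (cases "j \<le> M")
      case True
      then show ?thesis
        using f m by simp
    next
      case False
      then have j: "M < j" "m < j"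
        using least less.prems by simp_all
      have "par j \<in> B'" "par j < j"
        using A less.prems R[OF j(1)] par by (auto simp: apart_def branch_def)
      then have "\<not> \<nu> (par j) f"
        using less.IH by blast
      moreover have "f < len (\<nu> m)"
        using f less_len \<nu>_fin by blast
      ultimately show ?thesis
        using \<nu>_fresh[OF R[OF j(1)] j(2)] by (simp add: agree_def)
    qed
  qed
  then have "\<not> lub B' f"
    by (auto simp: lub_def)
  moreover have "lub B f"
    using f m by (auto simp: lub_def)
  ultimately show ?thesis
    by metis
qed

lemma apart_sym: "apart M B B' \<Longrightarrow> apart M B' B"
  by (auto simp: apart_def)

lemma lub_distinct:
  assumes A: "apart M B B'" and ex: "\<exists>m>M. m \<in> B \<union> B'"
  shows "lub B \<noteq> lub B'"
proof -
  define m where "m = (LEAST m. M < m \<and> m \<in> B \<union> B')"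
  have m: "M < m" "m \<in> B \<union> B'"
    using LeastI_ex[of "\<lambda>m. M < m \<and> m \<in> B \<union> B'"] ex unfolding m_def by blast+
  have le: "m \<le> j" if "M < j" "j \<in> B \<union> B'" for j
    unfolding m_def using that by (intro Least_le) blast
  have ne: "\<not> (m \<in> B \<and> m \<in> B')"
    using A m by (simp add: apart_def)
  show ?thesis
  proof (cases "m \<in> B")
    case True
    then show ?thesis
      using lub_distinct_aux[OF A True m(1)] le ne by (metis UnCI le_neq_implies_less)
  next
    case False
    then have "m \<in> B'"
      using m by blast
    then show ?thesis
      using lub_distinct_aux[OF apart_sym[OF A] _ m(1)] le ne by (metis UnCI le_neq_implies_less)
  qed
qed

lemma lub_infinite:
  assumes "infinite B"
  shows "lub B \<in> P_inf"
proof -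
  have "\<exists>f\<ge>k. lub B f" for k
  proof -
    obtain m where m: "m \<in> B" "max R k < m"
      using assms by (meson infinite_nat_iff_unbounded)
    then have "R \<le> m"
      by simp
    then obtain f where "\<nu> m f" "m \<le> f"
      using new_bit by metis
    then show ?thesis
      using m by (intro exI[of _ f]) (auto simp: lub_def)
  qed
  then show ?thesis
    unfolding P_inf_def infinite_nat_iff_unbounded_le by simp
qed

lemma lub_finite:
  assumes B: "branch R par B" "finite B" "B \<noteq> {}"
  shows "lub B = \<nu> (Max B)"
proof
  fix i
  have "\<nu> (Max B) i" if "\<nu> m i" "m \<in> B" for m
    using branch_mono[OF B(1) that(2) Max_in[OF B(2,3)] Max_ge[OF B(2) that(2)]] that lep_imp by blast
  then show "lub B i = \<nu> (Max B) i"
    using Max_in[OF B(2,3)] by (auto simp: lub_def)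
qed

end

section \<open>Fusion along binary codes\<close>

context game begin

lemma run_restrict:
  assumes r: "run C A \<kappa> r" and \<kappa>: "\<And>n c. \<kappa> n = Some c \<Longrightarrow> c \<in> C'" and AB: "\<And>c s. c \<in> C' \<Longrightarrow> A c s \<subseteq> B c s"
  shows "run C' B \<kappa> r"
proof (rule runI)
  show "r 0 \<in> S"
    using run_mem[OF r] .
  fix n c assume c: "\<kappa> n = Some c"
  from run_Some[OF r this] \<kappa>[OF c] show "c \<in> C' \<and> step B c (r n) (r (Suc n))"
    using AB[of c "r n"] by (auto simp: step_def)
qed (rule run_None[OF r])

lemma run_last_move:
  assumes r: "run C A \<kappa> r" and "\<kappa> n0 = Some c0" "n0 < N" and P: "\<And>s t c. s \<in> S \<Longrightarrow> step A c s t \<Longrightarrow> P t"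
  shows "P (r N)"
  using assms(3)
proof (induction N)
  case (Suc N)
  show ?case
  proof (cases "\<kappa> N")
    case None
    then have "n0 < N"
      using Suc.prems assms(2) by (cases "n0 = N") auto
    then show ?thesis
      using Suc.IH run_None[OF r None] by simp
  next
    case (Some c)
    then show ?thesis
      using run_Some[OF r Some] run_mem[OF r] P by blast
  qed
qed simp

end

context weave begin

text \<open>
  The limit of two branches avoids \<open>E\<close> if all moves lead to positions from which \<open>E\<close> is avoided, and obey
  the trees attached to all earlier positions. When a branch is finite, its colour stops at some time
  \<open>N\<close>, and the tree attached to the position at that time only concerns the colours in \<open>C\<close>.
\<close>
lemma lub_avoid:
  assumes A: "apart M B B'" and ex: "\<exists>m>M. m \<in> B \<union> B'"
    and C: "C = {c. if c then infinite B' else infinite B}"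
    and T: "\<And>c s t. t \<in> T c s \<Longrightarrow> inn C (- E) t"
    and G: "\<And>c s. T c s \<subseteq> comb G c s"
      "\<And>s. s \<in> D \<times> D \<Longrightarrow> inn C (- E) s \<Longrightarrow> (\<lambda>c t. if c \<in> C then wit C (- E) s c t else UNIV) \<in> G s"
  shows "(lub B, lub B') \<notin> E"
proof -
  let ?r = "pair_run M B B'" and ?\<kappa> = "pair_col M B B'"
  have r: "run UNIV T ?\<kappa> ?r"
    by (rule run_pair[OF A])
  obtain m where m: "m > M" "m \<in> B \<union> B'"
    using ex by blast
  have bounded: "\<exists>K. \<forall>j\<in>X. j < K" if "finite X" for X :: "nat set"
    using that by (simp add: finite_nat_set_iff_bounded)
  have "finite ((if infinite B then {} else B) \<union> (if infinite B' then {} else B'))"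
    by (cases "infinite B"; cases "infinite B'") simp_all
  from bounded[OF this] obtain K where "\<forall>j\<in>(if infinite B then {} else B) \<union> (if infinite B' then {} else B'). j < K" ..
  then have K: "finite B \<Longrightarrow> j \<in> B \<Longrightarrow> j < K" "finite B' \<Longrightarrow> j \<in> B' \<Longrightarrow> j < K" for j
    by auto
  define N where "N = max m K"
  have "Suc (M + (m - Suc M)) = m"
    using m by simp
  then have "?\<kappa> (m - Suc M) \<noteq> None"
    using m unfolding pair_col_def by auto
  then obtain c0 where c0: "?\<kappa> (m - Suc M) = Some c0"
    by blast
  have inn: "inn C (- E) (?r N)"
  proof (rule run_last_move[OF r c0])
    show "m - Suc M < N"
      using m by (simp add: N_def)
    fix s t c assume "step T c s t"
    then have "t \<in> T c s"
      by (simp add: step_def)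
    then show "inn C (- E) t"
      by (rule T)
  qed
  have col: "c \<in> C" if "?\<kappa> (n + N) = Some c" for n c
  proof -
    have "K \<le> Suc (M + (n + N))"
      by (simp add: N_def)
    then have "Suc (M + (n + N)) \<in> B \<Longrightarrow> infinite B" "Suc (M + (n + N)) \<in> B' \<Longrightarrow> infinite B'"
      using K(1)[of "Suc (M + (n + N))"] K(2)[of "Suc (M + (n + N))"] by linarith+
    then show ?thesis
      using that unfolding C pair_col_def by (auto split: if_splits)
  qed
  have rN: "run UNIV (comb G) (\<lambda>n. ?\<kappa> (n + N)) (\<lambda>n. ?r (n + N))"
    using run_shift[OF r] by (rule run_mono) (rule G(1))
  have memN: "?r N \<in> D \<times> D"
    using run_mem[OF r] .
  have "run UNIV (\<lambda>c t. if c \<in> C then wit C (- E) (?r N) c t else UNIV) (\<lambda>n. ?\<kappa> (n + N)) (\<lambda>n. ?r (n + N))"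
    using rN by (rule run_comb) (use G(2)[OF memN inn] in simp)
  then have "run C (wit C (- E) (?r N)) (\<lambda>n. ?\<kappa> (n + N)) (\<lambda>n. ?r (n + N))"
    by (rule run_restrict) (use col in auto)
  then have "limit_state (\<lambda>n. ?r (n + N)) \<in> - E"
    by (rule run_wit[OF inn]) (use fair_shift[OF fair_pair[OF A], of N] C in simp_all)
  then show ?thesis
    unfolding lim_shift[OF r] limit_pair[OF A] by simp
qed

end

text \<open>
  The number whose binary digits are the first \<open>n\<close> bits of \<open>x\<close>, lowest first. The codes of the initial segments
  of \<open>x\<close> form a branch for the parent function that deletes the leading digit, and this branch is
  finite exactly for \<open>x \<in> P_fin\<close>. It is this feature that lets a fusion preserve \<open>P_fin\<close> and \<open>P_inf\<close>.
\<close>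
definition code :: "cantor \<Rightarrow> nat \<Rightarrow> nat" where
  "code x n = (\<Sum>i<n. of_bool (x i) * 2 ^ i)"

definition unbit :: "nat \<Rightarrow> nat" where
  "unbit m = m - 2 ^ (LEAST k. m < 2 ^ Suc k)"

lemma code_simps [simp]: "code x 0 = 0" "code x (Suc n) = code x n + of_bool (x n) * 2 ^ n"
  by (simp_all add: code_def)

lemma code_less: "code x n < 2 ^ n"
  by (induction n) auto

lemma code_mono: "m \<le> n \<Longrightarrow> code x m \<le> code x n"
  unfolding code_def by (rule sum_mono2) auto

lemma code_agree: "agree n x y \<Longrightarrow> code x n = code y n"
  unfolding code_def agree_def by (rule sum.cong) auto

lemma Least_bit: "p < 2 ^ k \<Longrightarrow> (LEAST j. p + 2 ^ k < (2::nat) ^ Suc j) = k"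
proof (rule Least_equality)
  fix j assume "p + 2 ^ k < (2::nat) ^ Suc j"
  then have "(2::nat) ^ k < 2 ^ Suc j"
    by linarith
  then show "k \<le> j"
    by (subst (asm) power_strict_increasing_iff) simp_all
qed simp

lemma unbit: "p < 2 ^ k \<Longrightarrow> unbit (p + 2 ^ k) = p"
  by (simp only: unbit_def Least_bit add_diff_cancel_right')

lemma unbit_less: "1 \<le> m \<Longrightarrow> unbit m < m"
  by (simp add: unbit_def)

lemma code_top:
  assumes "1 \<le> code x n"
  obtains k where "k < n" "x k" "code x n = code x k + 2 ^ k"
proof -
  have "\<exists>k<n. x k \<and> code x n = code x k + 2 ^ k"
    using assms
  proof (induction n)
    case (Suc n)
    show ?case
    proof (cases "x n")
      case True
      then show ?thesis
        by (intro exI[of _ n]) simp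
    next
      case False
      then show ?thesis
        using Suc by (auto intro: less_SucI)
    qed
  qed simp
  then show ?thesis
    using that by blast
qed

lemma code_eq_imp_agree: "code x n = code y n \<Longrightarrow> agree n x y"
proof (induction n)
  case (Suc n)
  have "x n = y n"
    using Suc.prems code_less[of x n] code_less[of y n] by (cases "x n"; cases "y n") auto
  then have "code x n = code y n"
    using Suc.prems by simp
  then show ?case
    using Suc.IH \<open>x n = y n\<close> by (auto simp: agree_def less_Suc_eq)
qed (simp add: agree_def)

definition codes :: "cantor \<Rightarrow> nat set" where
  "codes x = range (code x)"

lemma branch_codes: "branch 1 unbit (codes x)"
  unfolding branch_def
proof (intro conjI ballI impI)
  fix i j :: nat assume "i < 1" "j < 1"
  then show "i = j"
    by simp
next
  fix m assume "m \<in> codes x" and m1: "1 \<le> m"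
  then obtain n where n: "m = code x n"
    by (auto simp: codes_def)
  then obtain k where k: "x k" "m = code x k + 2 ^ k"
    using m1 code_top[of x n] by metis
  have u: "unbit m = code x k"
    unfolding k(2) by (rule unbit[OF code_less])
  then show "unbit m \<in> codes x"
    by (simp add: codes_def)
  fix j assume "j \<in> codes x" "j < m"
  then obtain n' where n': "j = code x n'"
    by (auto simp: codes_def)
  have "\<not> Suc k \<le> n'"
  proof
    assume "Suc k \<le> n'"
    from code_mono[OF this, of x] show False
      using k n' \<open>j < m\<close> by simp
  qed
  then show "j \<le> unbit m"
    unfolding u n' by (intro code_mono) simp
qed

lemma finite_codes_iff: "finite (codes x) \<longleftrightarrow> x \<in> P_fin"
proof
  assume "x \<in> P_fin"
  have "code x n = code x (min n (len x))" for n
    unfolding code_def using beyond_len[OF \<open>x \<in> P_fin\<close>]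
    by (intro sum.mono_neutral_right) (auto simp: not_less)
  then have "codes x \<subseteq> code x ` {..len x}"
    unfolding codes_def by (metis (no_types, lifting) atMost_iff image_eqI image_subsetI min.cobounded2)
  then show "finite (codes x)"
    by (rule finite_subset) simp
next
  assume fin: "finite (codes x)"
  show "x \<in> P_fin"
  proof (rule ccontr)
    assume "x \<notin> P_fin"
    then have inf: "infinite {n. x n}"
      by (simp add: P_fin_def P_inf_def)
    obtain K where K: "\<And>j. j \<in> codes x \<Longrightarrow> j < K"
      using fin unfolding finite_nat_set_iff_bounded by auto
    obtain n where n: "x n" "n > K"
      using inf unfolding infinite_nat_iff_unbounded by auto
    have "n < 2 ^ n"
      by (rule less_exp)
    also have "\<dots> \<le> code x (Suc n)"
      using n by simp
    also have "\<dots> < K"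
      by (rule K) (unfold codes_def, rule rangeI)
    finally show False
      using n by simp
  qed
qed

lemma branch_progression:
  assumes "r < R" "R \<le> c" "par c = r" "0 < d" "\<And>i. par (c + d * Suc i) = c + d * i"
  shows "branch R par (insert r (range (\<lambda>i. c + d * i)))"
  unfolding branch_def
proof (intro conjI ballI impI)
  fix i j assume "i \<in> insert r (range (\<lambda>i. c + d * i))" "j \<in> insert r (range (\<lambda>i. c + d * i))" "i < R" "j < R"
  then show "i = j"
    using assms(2) by auto
next
  fix m assume "m \<in> insert r (range (\<lambda>i. c + d * i))" "R \<le> m"
  then obtain i where i: "m = c + d * i"
    using assms(1) by auto
  show "par m \<in> insert r (range (\<lambda>i. c + d * i))"
    using i assms(3,5) by (cases i) auto
  fix j assume j: "j \<in> insert r (range (\<lambda>i. c + d * i))" "j < m"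
  show "j \<le> par m"
  proof (cases i)
    case 0
    then show ?thesis
      using i j assms(3) by auto
  next
    case (Suc i')
    then have p: "par m = c + d * i'"
      using i assms(5) by simp
    show ?thesis
    proof (cases "j = r")
      case True
      then show ?thesis
        using p assms(1,2) by simp
    next
      case False
      then obtain l where l: "j = c + d * l"
        using j by blast
      then have "l < i"
        using j(2) i assms(4) by simp
      then show ?thesis
        using p l Suc by simp
    qed
  qed
qed

lemma infinite_progression: "0 < (d::nat) \<Longrightarrow> infinite (insert r (range (\<lambda>i. c + d * i)))"
  using range_inj_infinite[of "\<lambda>i. c + d * i"] by (auto simp: inj_def)

context nodes begin

text \<open>
  Send \<open>x\<close> to the limit of the nodes indexed by the codes of \<open>x\<close>. Codes of different sequences form branches which
  are disjoint from the first difference on, so the pair of their limits is the limit of a run, and it avoids every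
  \<open>E\<close> that is avoided almost everywhere by the runs whose set \<open>C\<close> of recurring colours is the one of this
  pair: \<open>False \<in> C\<close> iff \<open>x \<in> P_inf\<close>, and \<open>True \<in> C\<close> iff \<open>y \<in> P_inf\<close>.
\<close>
theorem fusion:
  assumes Dp: "Dp \<subseteq> D" "Dp \<noteq> {}" "\<And>a. a \<in> Dp \<Longrightarrow> eventually (\<lambda>b. b \<in> Dp) (U a)"
    and H: "finite H"
    and out: "\<And>C E c s. (C, E) \<in> H \<Longrightarrow> s \<in> Dp \<times> Dp \<Longrightarrow> eventually (inn C (- E)) (W c s)"
  obtains g where "\<And>n x y. agree n x y \<Longrightarrow> agree n (g x) (g y)" "inj g"
    "\<And>x. x \<in> P_fin \<Longrightarrow> g x \<in> Dp" "\<And>x. x \<in> P_inf \<Longrightarrow> g x \<in> P_inf"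
    "\<And>C E x y. (C, E) \<in> H \<Longrightarrow> x \<noteq> y \<Longrightarrow> C = {c. if c then y \<in> P_inf else x \<in> P_inf} \<Longrightarrow> (g x, g y) \<notin> E"
proof -
  \<comment> \<open>The tree attached to a position constrains only the moves with colours in \<open>C\<close>; the others
    are free, so that it can be combined with trees for other sets of colours.\<close>
  define G where "G s = (\<lambda>(C, E) c t. if c \<in> C then wit C (- E) s c t else UNIV) ` {(C, E) \<in> H. inn C (- E) s}" for s
  define T where "T c s = {t \<in> Dp \<times> Dp. \<forall>(C, E)\<in>H. inn C (- E) t} \<inter> comb G c s" for c s
  have treeG: "tree UNIV (comb G)"
  proof (rule tree_comb)
    fix s show "finite (G s)"
      unfolding G_def by (rule finite_imageI, rule finite_subset[OF _ H]) auto
    fix A assume "A \<in> G s"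
    then obtain C E where CE: "inn C (- E) s" "A = (\<lambda>c t. if c \<in> C then wit C (- E) s c t else UNIV)"
      by (auto simp: G_def)
    show "tree UNIV A"
      using tree_wit[OF CE(1)] unfolding CE(2) tree_def by auto
  qed
  have evT: "eventually (\<lambda>t. t \<in> T c s) (W c s)" if s: "s \<in> Dp \<times> Dp" for c s
  proof -
    have "eventually (\<lambda>t. t \<in> Dp \<times> Dp) (W c s)"
      unfolding eventually_W using Dp(3)[OF sel_mem[OF s]] by (rule eventually_mono) (rule move_mem[OF s])
    moreover have "eventually (\<lambda>t. \<forall>p\<in>H. inn (fst p) (- snd p) t) (W c s)"
      using H out[OF _ s] by (intro eventually_ball_finite) auto
    moreover have "eventually (\<lambda>t. t \<in> comb G c s) (W c s)"
      using treeG s Dp(1) unfolding tree_def by auto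
    ultimately show ?thesis
      by eventually_elim (auto simp: T_def)
  qed
  obtain root where root: "root \<in> Dp"
    using Dp(2) by blast
  obtain \<nu> where \<nu>: "\<And>i. i < 1 \<Longrightarrow> \<nu> i = root" "\<And>m. \<nu> m \<in> Dp"
    "\<And>m. 1 \<le> m \<Longrightarrow> extends (\<nu> (unbit m)) (\<nu> m)" "\<And>m. 1 \<le> m \<Longrightarrow> agree m (\<nu> (unbit m)) (\<nu> m)"
    "\<And>m j. 1 \<le> m \<Longrightarrow> j < m \<Longrightarrow> agree (len (\<nu> j)) (\<nu> (unbit m)) (\<nu> m)"
    "\<And>m j. 1 \<le> m \<Longrightarrow> j < m \<Longrightarrow> (\<nu> m, \<nu> j) \<in> T False (\<nu> (unbit m), \<nu> j)"
    "\<And>m j. 1 \<le> m \<Longrightarrow> j < m \<Longrightarrow> (\<nu> j, \<nu> m) \<in> T True (\<nu> j, \<nu> (unbit m))"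
    by (rule greedy[OF Dp(1,3) evT, of 1 "\<lambda>_. root" unbit]) (use root unbit_less in auto)
  interpret w: weave D U Dp T 1 unbit \<nu>
    by unfold_locales (use Dp(1) unbit_less \<nu> in auto)
  define g where "g x = w.lub (codes x)" for x
  have apart: "\<exists>M. w.apart M (codes x) (codes y) \<and> (\<exists>m>M. m \<in> codes x \<union> codes y)" if "x \<noteq> y" for x y
  proof -
    have "\<exists>n1. x n1 \<noteq> y n1"
      using that by (auto simp: fun_eq_iff)
    then obtain n1 where "x n1 \<noteq> y n1" ..
    define n where "n = (LEAST n. x n \<noteq> y n)"
    have n: "x n \<noteq> y n"
      unfolding n_def by (rule LeastI, fact)
    \<comment> \<open>The codes beyond \<open>2 ^ n - 1\<close> are those with a digit 1 at a place \<open>\<ge> n\<close>.\<close>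
    define M where "M = (2::nat) ^ n - 1"
    have M: "Suc M = 2 ^ n"
      by (simp add: M_def)
    have zero: "0 \<in> codes z" for z
      unfolding codes_def by (rule range_eqI[of _ _ 0]) simp
    have "False" if m: "m > M" "m \<in> codes x" "m \<in> codes y" for m
    proof -
      obtain i where "m = code x i"
        using m(2) by (auto simp: codes_def)
      moreover obtain j where "m = code y j"
        using m(3) by (auto simp: codes_def)
      ultimately have ij: "m = code x i" "m = code y j"
        by simp_all
      obtain k where k: "x k" "m = code x k + 2 ^ k"
        using code_top[of x i] ij m by (metis One_nat_def Suc_leI gr_implies_not0 neq0_conv)
      obtain l where l: "y l" "m = code y l + 2 ^ l"
        using code_top[of y j] ij m by (metis One_nat_def Suc_leI gr_implies_not0 neq0_conv)
      have kl: "k = l"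
        using Least_bit[OF code_less, of x k] Least_bit[OF code_less, of y l] k l by metis
      then have "code x k = code y k"
        using k l by simp
      then have ag: "agree k x y"
        by (rule code_eq_imp_agree)
      have "(2::nat) ^ n < 2 ^ Suc k"
        using M m(1) k(2) code_less[of x k] by simp
      then have "n \<le> k"
        by (subst (asm) power_strict_increasing_iff) simp_all
      then show False
        using ag n k l kl by (cases "n = k") (auto simp: agree_def)
    qed
    then have "w.apart M (codes x) (codes y)"
      unfolding w.apart_def using branch_codes zero by (auto simp: M_def)
    moreover have "\<exists>m>M. m \<in> codes x \<union> codes y"
    proof (cases "x n")
      case True
      then have "M < code x (Suc n)"
        using M by simp
      then show ?thesis
        unfolding codes_def by blast
    next
      case False
      then have "M < code y (Suc n)"
        using M n by simp
      then show ?thesis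
        unfolding codes_def by blast
    qed
    ultimately show ?thesis
      by blast
  qed
  have inf_iff: "infinite (codes x) \<longleftrightarrow> x \<in> P_inf" for x
    using finite_codes_iff by (simp add: P_fin_def)
  show ?thesis
  proof (rule that[of g])
    fix n x y assume xy: "agree n x y"
    have one: "g y' i" if ag: "agree n x' y'" and "i < n" and gi: "g x' i" for x' y' i
    proof -
      have "\<exists>m'\<in>codes x'. m' < 2 ^ n \<and> \<nu> m' i" if "m \<in> codes x'" "\<nu> m i" for m
        using that
      proof (induction m rule: less_induct)
        case (less m)
        show ?case
        proof (cases "m < 2 ^ n")
          case True
          then show ?thesis
            using less.prems by blast
        next
          case False
          have "n < 2 ^ n"
            by (rule less_exp)
          then have m: "1 \<le> m" "i < m"
            using False \<open>i < n\<close> by linarith+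
          then have "\<nu> (unbit m) i"
            using \<nu>(4)[OF m(1)] less.prems by (simp add: agree_def)
          moreover have "unbit m \<in> codes x'"
            using branch_codes less.prems(1) m(1) unfolding branch_def by blast
          ultimately show ?thesis
            using less.IH[OF unbit_less[OF m(1)]] by blast
        qed
      qed
      then obtain m where m: "m \<in> codes x'" "m < 2 ^ n" "\<nu> m i"
        using gi unfolding g_def w.lub_def by blast
      have "m \<in> codes y'"
      proof (cases "1 \<le> m")
        case False
        then show ?thesis
          unfolding codes_def by (intro range_eqI[of _ _ 0]) simp
      next
        case True
        obtain j where "m = code x' j"
          using m by (auto simp: codes_def)
        then obtain k where k: "x' k" "m = code x' k + 2 ^ k"
          using True code_top[of x' j] by metis
        have "(2::nat) ^ k < 2 ^ n"
          using k m by linarith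
        then have "k < n"
          by (subst (asm) power_strict_increasing_iff) simp_all
        then have "m = code y' (Suc k)"
          using k \<open>agree n x' y'\<close> code_agree[of "Suc k" x' y'] agree_mono[of n x' y' "Suc k"] by simp
        then show ?thesis
          unfolding codes_def by blast
      qed
      then show ?thesis
        using m unfolding g_def w.lub_def by blast
    qed
    show "agree n (g x) (g y)"
      unfolding agree_def using one[OF xy] one[OF agree_sym[OF xy]] by blast
  next
    show "inj g"
    proof (rule injI, rule ccontr)
      fix x y assume eq: "g x = g y" and "x \<noteq> y"
      then show False
        using apart w.lub_distinct unfolding g_def by blast
    qed
  next
    fix x assume "x \<in> P_fin"
    then have "g x = \<nu> (Max (codes x))"
      unfolding g_def using finite_codes_iff[of x] by (intro w.lub_finite branch_codes) (simp_all add: codes_def)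
    then show "g x \<in> Dp"
      using \<nu>(2) by simp
  next
    fix x assume "x \<in> P_inf"
    then show "g x \<in> P_inf"
      unfolding g_def using inf_iff by (intro w.lub_infinite) simp
  next
    fix C E x y assume CE: "(C, E) \<in> H" and "x \<noteq> y" and C: "C = {c. if c then y \<in> P_inf else x \<in> P_inf}"
    obtain M where M: "w.apart M (codes x) (codes y)" "\<exists>m>M. m \<in> codes x \<union> codes y"
      using apart[OF \<open>x \<noteq> y\<close>] by blast
    show "(g x, g y) \<notin> E"
      unfolding g_def
    proof (rule w.lub_avoid[OF M, where G = G])
      show "C = {c. if c then infinite (codes y) else infinite (codes x)}"
        using C inf_iff by simp
      show "inn C (- E) t" if "t \<in> T c s" for c s t
        using that CE by (auto simp: T_def)
      show "T c s \<subseteq> comb G c s" for c s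
        by (auto simp: T_def)
      show "(\<lambda>c t. if c \<in> C then wit C (- E) s c t else UNIV) \<in> G s" if "inn C (- E) s" for s
        unfolding G_def using that CE by (intro image_eqI[of _ _ "(C, E)"]) auto
    qed
  qed
qed

text \<open>
  Weave four branches, two above \<open>a\<close> and two above \<open>b\<close>; each of the first two forms with each of the last two a
  generic run, whose limit is in \<open>E\<close>.
\<close>
lemma inn_two_two:
  assumes inn: "inn UNIV E (a, b)" and ab: "a \<in> D" "b \<in> D"
  obtains x x' y y' where "distinct [x, x', y, y']" "(x, y) \<in> E" "(x, y') \<in> E" "(x', y) \<in> E" "(x', y') \<in> E"
proof -
  define T where "T = wit UNIV E (a, b)"
  \<comment> \<open>Roots 0 and 1; the branches are the residue classes modulo 4, those of 2 and 3 start at root 0,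
    those of 0 and 1 at root 1.\<close>
  define par where "par m = (if m < 4 then 0 else if m < 6 then 1 else m - 4)" for m :: nat
  have tT: "eventually (\<lambda>t. t \<in> T c s) (W c s)" if "s \<in> D \<times> D" for c s
    using tree_wit[OF inn] that unfolding T_def tree_def by blast
  have evD: "eventually (\<lambda>b. b \<in> D) (U a)" if "a \<in> D" for a
    using U_near[OF that] by (rule eventually_mono) blast
  have par: "par m < m" if "2 \<le> m" for m
    using that by (auto simp: par_def)
  obtain \<nu> where \<nu>: "\<And>i. i < 2 \<Longrightarrow> \<nu> i = (if i = 0 then a else b)" "\<And>m. \<nu> m \<in> D"
    "\<And>m. 2 \<le> m \<Longrightarrow> extends (\<nu> (par m)) (\<nu> m)" "\<And>m. 2 \<le> m \<Longrightarrow> agree m (\<nu> (par m)) (\<nu> m)"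
    "\<And>m j. 2 \<le> m \<Longrightarrow> j < m \<Longrightarrow> agree (len (\<nu> j)) (\<nu> (par m)) (\<nu> m)"
    "\<And>m j. 2 \<le> m \<Longrightarrow> j < m \<Longrightarrow> (\<nu> m, \<nu> j) \<in> T False (\<nu> (par m), \<nu> j)"
    "\<And>m j. 2 \<le> m \<Longrightarrow> j < m \<Longrightarrow> (\<nu> j, \<nu> m) \<in> T True (\<nu> j, \<nu> (par m))"
    by (rule greedy[OF order_refl evD tT, of 2 "\<lambda>i. if i = 0 then a else b" par]) (use ab par in auto)
  interpret w: weave D U D T 2 par \<nu>
    by unfold_locales (use par \<nu> in auto)
  define B where "B r c = insert r (range (\<lambda>i. c + 4 * i))" for r c :: nat
  have br: "branch 2 par (B 0 2)" "branch 2 par (B 0 3)" "branch 2 par (B 1 4)" "branch 2 par (B 1 5)"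
    unfolding B_def by (rule branch_progression; simp add: par_def)+
  have inf: "infinite (B r c)" for r c
    unfolding B_def by (rule infinite_progression) simp
  have ap: "w.apart 1 (B r c) (B r' c')"
    if "branch 2 par (B r c)" "branch 2 par (B r' c')" "r \<le> 1" "r' \<le> 1" "c \<noteq> c'" "2 \<le> c" "c \<le> 5" "2 \<le> c'" "c' \<le> 5" for r c r' c'
  proof -
    have "c + 4 * i \<noteq> c' + 4 * i'" for i i'
      using that(5-9) by presburger
    then show ?thesis
      using that unfolding w.apart_def by (auto simp: B_def)
  qed
  have pos: "pos (B r c) 1 = r" if "r \<le> 1" "2 \<le> c" for r c
    by (rule pos_eqI) (use that in \<open>auto simp: B_def\<close>)
  have E: "(w.lub (B 0 c), w.lub (B 1 c')) \<in> E"
    if "branch 2 par (B 0 c)" "branch 2 par (B 1 c')" "c \<noteq> c'" "2 \<le> c" "c \<le> 5" "2 \<le> c'" "c' \<le> 5" for c c'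
  proof -
    have A: "w.apart 1 (B 0 c) (B 1 c')"
      using that by (intro ap) auto
    have "limit_state (w.pair_run 1 (B 0 c) (B 1 c')) \<in> E"
    proof (rule run_wit[OF inn])
      show "run UNIV (wit UNIV E (a, b)) (w.pair_col 1 (B 0 c) (B 1 c')) (w.pair_run 1 (B 0 c) (B 1 c'))"
        using w.run_pair[OF A] by (simp add: T_def)
      have "{d. if d then infinite (B 1 c') else infinite (B 0 c)} = UNIV"
        using inf by auto
      then show "fair UNIV (w.pair_col 1 (B 0 c) (B 1 c'))"
        using w.fair_pair[OF A] by simp
      show "w.pair_run 1 (B 0 c) (B 1 c') 0 = (a, b)"
        using \<nu>(1)[of 0] \<nu>(1)[of 1] that by (simp add: w.pair_run_def pos[unfolded One_nat_def])
    qed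
    then show ?thesis
      using w.limit_pair[OF A] by simp
  qed
  have ne: "w.lub (B r c) \<noteq> w.lub (B r' c')"
    if "branch 2 par (B r c)" "branch 2 par (B r' c')" "r \<le> 1" "r' \<le> 1" "c \<noteq> c'" "2 \<le> c" "c \<le> 5" "2 \<le> c'" "c' \<le> 5" for r c r' c'
  proof (rule w.lub_distinct[OF ap])
    show "\<exists>m>1. m \<in> B r c \<union> B r' c'"
      using that by (intro exI[of _ "c + 4 * 0"]) (simp add: B_def)
  qed (use that in auto)
  show ?thesis
  proof (rule that[of "w.lub (B 0 2)" "w.lub (B 0 3)" "w.lub (B 1 4)" "w.lub (B 1 5)"])
    show "distinct [w.lub (B 0 2), w.lub (B 0 3), w.lub (B 1 4), w.lub (B 1 5)]"
      using ne br by simp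
  qed (use E br in simp_all)
qed

text \<open>
  When only the second coordinate moves, two branches above \<open>b\<close> can obey the trees for \<open>a\<close> and for \<open>a'\<close> at the
  same time.
\<close>
lemma inn_two_sections:
  assumes inn: "inn {True} E (a, b)" "inn {True} F (a', b)" and ab: "a \<in> D" "a' \<in> D" "b \<in> D"
  obtains y y' where "y \<noteq> y'" "y \<in> P_inf" "y' \<in> P_inf" "(a, y) \<in> E" "(a, y') \<in> E" "(a', y) \<in> F" "(a', y') \<in> F"
proof -
  define T where "T c s = (if c then wit {True} E (a, b) c s \<inter> wit {True} F (a', b) c s else UNIV)" for c s
  \<comment> \<open>Roots 0, 1 and 2 for the three given nodes; the odd and the even indices from 3 on start at root 2.\<close>
  define par where "par m = (if m < 5 then 2 else m - 2)" for m :: nat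
  have tT: "eventually (\<lambda>t. t \<in> T c s) (W c s)" if "s \<in> D \<times> D" for c s
  proof (cases c)
    case True
    have "eventually (\<lambda>t. t \<in> wit {True} E (a, b) True s) (W True s)" "eventually (\<lambda>t. t \<in> wit {True} F (a', b) True s) (W True s)"
      using tree_wit[OF inn(1)] tree_wit[OF inn(2)] that unfolding tree_def by blast+
    then show ?thesis
      using True by (simp add: T_def eventually_conj)
  qed (simp add: T_def)
  have evD: "eventually (\<lambda>b. b \<in> D) (U a)" if "a \<in> D" for a
    using U_near[OF that] by (rule eventually_mono) blast
  have par: "par m < m" if "3 \<le> m" for m
    using that by (auto simp: par_def)
  define \<nu>0 where "\<nu>0 i = (if i = 0 then a else if i = 1 then a' else b)" for i :: nat
  obtain \<nu> where \<nu>: "\<And>i. i < 3 \<Longrightarrow> \<nu> i = \<nu>0 i" "\<And>m. \<nu> m \<in> D"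
    "\<And>m. 3 \<le> m \<Longrightarrow> extends (\<nu> (par m)) (\<nu> m)" "\<And>m. 3 \<le> m \<Longrightarrow> agree m (\<nu> (par m)) (\<nu> m)"
    "\<And>m j. 3 \<le> m \<Longrightarrow> j < m \<Longrightarrow> agree (len (\<nu> j)) (\<nu> (par m)) (\<nu> m)"
    "\<And>m j. 3 \<le> m \<Longrightarrow> j < m \<Longrightarrow> (\<nu> m, \<nu> j) \<in> T False (\<nu> (par m), \<nu> j)"
    "\<And>m j. 3 \<le> m \<Longrightarrow> j < m \<Longrightarrow> (\<nu> j, \<nu> m) \<in> T True (\<nu> j, \<nu> (par m))"
    by (rule greedy[OF order_refl evD tT, of 3 \<nu>0 par]) (use ab par in \<open>auto simp: \<nu>0_def\<close>)
  interpret w: weave D U D T 3 par \<nu>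
    by unfold_locales (use par \<nu> in auto)
  define B where "B k = insert 2 (range (\<lambda>i. (3 + k) + 2 * i))" for k :: nat
  have br: "branch 3 par (B 0)" "branch 3 par (B 1)"
    unfolding B_def by (rule branch_progression; simp add: par_def)+
  have br1: "branch 3 par {0}" "branch 3 par {1}"
    unfolding branch_def by auto
  have inf: "infinite (B k)" for k
    unfolding B_def by (rule infinite_progression) simp
  have pos: "pos (B k) 2 = 2" "pos {0} 2 = 0" "pos {1} 2 = 1" for k
    by (rule pos_eqI; auto simp: B_def)+
  have E: "(\<nu> r, w.lub (B k)) \<in> E'"
    if inn': "inn {True} E' (\<nu> r, b)" and T': "\<And>s. T True s \<subseteq> wit {True} E' (\<nu> r, b) True s"
      and r: "r < 2" and k: "branch 3 par (B k)" "k < 2" for E' r k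
  proof -
    have br': "branch 3 par {r}"
      using br1 r by (auto simp: less_Suc_eq numeral_2_eq_2)
    have A: "w.apart 2 {r} (B k)"
      unfolding w.apart_def using k br' r by (auto simp: B_def)
    have posr: "pos {r} 2 = r"
      by (rule pos_eqI) (use r in auto)
    have "limit_state (w.pair_run 2 {r} (B k)) \<in> E'"
    proof (rule run_wit[OF inn'])
      show "run {True} (wit {True} E' (\<nu> r, b)) (w.pair_col 2 {r} (B k)) (w.pair_run 2 {r} (B k))"
        using w.run_pair[OF A]
      proof (rule run_restrict)
        fix n c assume "w.pair_col 2 {r} (B k) n = Some c"
        then show "c \<in> {True}"
          using r by (auto simp: w.pair_col_def split: if_splits)
      next
        fix c s assume "c \<in> {True}"
        then show "T c s \<subseteq> wit {True} E' (\<nu> r, b) c s"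
          using T' by simp
      qed
      have "{c. if c then infinite (B k) else infinite {r}} = {True}"
        using inf by auto
      then show "fair {True} (w.pair_col 2 {r} (B k))"
        using w.fair_pair[OF A] by simp
      show "w.pair_run 2 {r} (B k) 0 = (\<nu> r, b)"
        using \<nu>(1)[of 2] by (simp add: w.pair_run_def pos posr \<nu>0_def)
    qed
    moreover have "w.lub {r} = \<nu> r"
      using w.lub_finite[OF br'] by simp
    ultimately show ?thesis
      using w.limit_pair[OF A] by simp
  qed
  have "w.lub (B 0) \<noteq> w.lub (B 1)"
  proof (rule w.lub_distinct)
    show "w.apart 2 (B 0) (B 1)"
    proof -
      have "3 + 2 * i \<noteq> Suc 3 + 2 * i'" for i i' :: nat
        by presburger
      then show ?thesis
        unfolding w.apart_def using br by (auto simp: B_def)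
    qed
    show "\<exists>m>2. m \<in> B 0 \<union> B 1"
      by (intro exI[of _ 3]) (simp add: B_def)
  qed
  moreover have \<nu>01: "\<nu> 0 = a" "\<nu> 1 = a'"
    using \<nu>(1)[of 0] \<nu>(1)[of 1] by (simp_all add: \<nu>0_def)
  moreover have "(a, w.lub (B k)) \<in> E" if "branch 3 par (B k)" "k < 2" for k
    using E[of E 0 k] inn(1) that \<nu>01 by (auto simp: T_def)
  moreover have "(a', w.lub (B k)) \<in> F" if "branch 3 par (B k)" "k < 2" for k
    using E[of F 1 k] inn(2) that \<nu>01 by (auto simp: T_def)
  ultimately show ?thesis
    using that[of "w.lub (B 0)" "w.lub (B 1)"] br w.lub_infinite[OF inf] by simp
qed

end

section \<open>Borel sets and second countability\<close>

lemma borel_in_continuous_preimage: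
  assumes "continuous_map X Y f" "borel_in Y B"
  shows "borel_in X {x \<in> topspace X. f x \<in> B}"
  using assms(2) unfolding borel_in_def
proof (induction rule: sigma_sets.induct)
  case (Basic V)
  then show ?case
    using openin_continuous_map_preimage[OF assms(1)] by (intro sigma_sets.Basic) simp
next
  case Empty
  then show ?case
    by (simp add: sigma_sets.Empty)
next
  case (Compl B)
  have "{x \<in> topspace X. f x \<in> topspace Y - B} = topspace X - {x \<in> topspace X. f x \<in> B}"
    using continuous_map_funspace[OF assms(1)] by auto
  then show ?case
    using sigma_sets.Compl[OF Compl.IH] by simp
next
  case (Union B)
  have "{x \<in> topspace X. f x \<in> \<Union> (range B)} = (\<Union>i. {x \<in> topspace X. f x \<in> B i})"
    by auto
  then show ?case
    using sigma_sets.Union[of "\<lambda>i. {x \<in> topspace X. f x \<in> B i}", OF Union.IH] by simp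
qed

lemma second_countable_prod:
  assumes "second_countable X" "second_countable Y"
  shows "second_countable (prod_topology X Y)"
proof -
  obtain A where A: "countable A" "\<And>V. V \<in> A \<Longrightarrow> openin X V"
    "\<And>U x. openin X U \<Longrightarrow> x \<in> U \<Longrightarrow> \<exists>V\<in>A. x \<in> V \<and> V \<subseteq> U"
    using assms(1) unfolding second_countable_def by auto
  obtain B where B: "countable B" "\<And>V. V \<in> B \<Longrightarrow> openin Y V"
    "\<And>U x. openin Y U \<Longrightarrow> x \<in> U \<Longrightarrow> \<exists>V\<in>B. x \<in> V \<and> V \<subseteq> U"
    using assms(2) unfolding second_countable_def by auto
  define C where "C = (\<lambda>(V, W). V \<times> W) ` (A \<times> B)"
  have "countable C"
    unfolding C_def using A(1) B(1) by simp
  moreover have "\<forall>V\<in>C. openin (prod_topology X Y) V"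
    unfolding C_def using A(2) B(2) by (auto simp: openin_prod_Times_iff)
  moreover have "\<exists>V\<in>C. z \<in> V \<and> V \<subseteq> U" if U: "openin (prod_topology X Y) U" "z \<in> U" for U z
  proof -
    have "\<exists>V W. openin X V \<and> openin Y W \<and> fst z \<in> V \<and> snd z \<in> W \<and> V \<times> W \<subseteq> U"
      using U by (simp add: openin_prod_topology_alt)
    then obtain V W where VW: "openin X V" "openin Y W" "fst z \<in> V" "snd z \<in> W" "V \<times> W \<subseteq> U"
      by (elim exE conjE)
    obtain V' where "V' \<in> A" "fst z \<in> V'" "V' \<subseteq> V"
      using A(3)[OF VW(1,3)] by blast
    moreover obtain W' where "W' \<in> B" "snd z \<in> W'" "W' \<subseteq> W"
      using B(3)[OF VW(2,4)] by blast
    ultimately show ?thesis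
      unfolding C_def using VW(5) by (intro bexI[of _ "V' \<times> W'"]) (auto simp: mem_Times_iff)
  qed
  ultimately show ?thesis
    unfolding second_countable_def by (intro exI[of _ C]) auto
qed

lemma second_countable_sequences:
  "second_countable (product_topology (\<lambda>_. discrete_topology (UNIV :: 'b::countable set)) (UNIV :: nat set))" (is "second_countable ?X")
proof -
  define cyl where "cyl l = Pi\<^sub>E UNIV (\<lambda>i. if i < length l then {l ! i} else UNIV)" for l :: "'b list"
  have "openin ?X (cyl l)" for l
  proof -
    have "{i. (if i < length l then {l ! i} else UNIV) \<noteq> UNIV} \<subseteq> {..<length l}"
      by auto
    then have "finite {i. (if i < length l then {l ! i} else UNIV) \<noteq> UNIV}"
      by (rule finite_subset) simp
    then show ?thesis
      unfolding cyl_def by (intro product_topology_basis) auto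
  qed
  moreover have "\<exists>V\<in>range cyl. x \<in> V \<and> V \<subseteq> U" if U: "openin ?X U" "x \<in> U" for U x
  proof -
    have "\<exists>V. finite {i. V i \<noteq> (UNIV :: 'b set)} \<and> x \<in> Pi\<^sub>E UNIV V \<and> Pi\<^sub>E UNIV V \<subseteq> U"
      using U unfolding openin_product_topology_alt by auto
    then obtain V where V: "finite {i. V i \<noteq> (UNIV :: 'b set)}" "x \<in> Pi\<^sub>E UNIV V" "Pi\<^sub>E UNIV V \<subseteq> U"
      by (elim exE conjE)
    from V(1) obtain k where k: "\<And>i. V i \<noteq> UNIV \<Longrightarrow> i < k"
      unfolding finite_nat_set_iff_bounded by auto
    have "x \<in> cyl (map x [0..<k])"
      by (auto simp: cyl_def)
    moreover have "cyl (map x [0..<k]) \<subseteq> U"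
    proof
      fix y assume y: "y \<in> cyl (map x [0..<k])"
      have "y i \<in> V i" for i
      proof (cases "i < k")
        case True
        then have "y i = x i"
          using y by (auto simp: cyl_def PiE_iff split: if_splits dest!: spec[of _ i])
        moreover have "x i \<in> V i"
          using V(2) by (simp add: PiE_iff)
        ultimately show ?thesis
          by simp
      next
        case False
        then have "V i = UNIV"
          using k by blast
        then show ?thesis
          by simp
      qed
      then show "y \<in> U"
        using V(3) by (auto simp: PiE_iff)
    qed
    ultimately show ?thesis
      by blast
  qed
  ultimately show ?thesis
    unfolding second_countable_def by (intro exI[of _ "range cyl"]) auto
qed

lemma (in Metric_space) separable_imp_second_countable:
  assumes "separable_space mtopology"
  shows "second_countable mtopology"
proof -
  obtain C where C: "countable C" "C \<subseteq> M" "mtopology closure_of C = M"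
    using assms unfolding separable_space_def by auto
  define B where "B = (\<lambda>(c, n). mball c (inverse (Suc n))) ` (C \<times> (UNIV :: nat set))"
  have "countable B"
    unfolding B_def using C(1) by simp
  moreover have "\<forall>V\<in>B. openin mtopology V"
    unfolding B_def by auto
  moreover have "\<exists>V\<in>B. x \<in> V \<and> V \<subseteq> U" if U: "openin mtopology U" "x \<in> U" for U x
  proof -
    obtain r where r: "r > 0" "mball x r \<subseteq> U" and x: "x \<in> M"
      using U unfolding openin_mtopology by blast
    obtain n where n: "inverse (real (Suc n)) < r / 2"
      using reals_Archimedean[of "r / 2"] r by auto
    have "x \<in> mtopology closure_of C"
      using C x by simp
    then obtain c where c: "c \<in> C" "c \<in> mball x (inverse (real (Suc n)))"
      unfolding metric_closure_of by (auto dest!: spec[of _ "inverse (real (Suc n))"])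
    have "x \<in> mball c (inverse (real (Suc n)))"
      using c by (simp add: commute)
    moreover have "mball c (inverse (real (Suc n))) \<subseteq> U"
    proof
      fix y assume y: "y \<in> mball c (inverse (real (Suc n)))"
      have "d x y \<le> d x c + d c y"
        using c y by (intro triangle) auto
      also have "\<dots> < r"
        using c y n by simp
      finally have "y \<in> mball x r"
        using x y by simp
      then show "y \<in> U"
        using r by blast
    qed
    ultimately show ?thesis
      unfolding B_def using c by (intro bexI[of _ "mball c (inverse (real (Suc n)))"]) auto
  qed
  ultimately show ?thesis
    unfolding second_countable_def by (intro exI[of _ B]) auto
qed

lemma metrizable_separable_imp_second_countable:
  "metrizable_space X \<Longrightarrow> separable_space X \<Longrightarrow> second_countable X"
  unfolding metrizable_space_def using Metric_space.separable_imp_second_countable by blast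

section \<open>Borel sets as continuous images of Polish spaces\<close>

definition baire :: "(nat \<Rightarrow> nat) topology" where
  "baire = product_topology (\<lambda>_. discrete_topology UNIV) UNIV"

lemma topspace_baire [simp]: "topspace baire = UNIV"
  by (simp add: baire_def)

text \<open>
  Analytic sets, with a closed set instead of a Borel set in the product with Baire space. This form is convenient for
  countable operations in an arbitrary space \<open>X\<close>.
\<close>
definition souslin :: "'a topology \<Rightarrow> 'a set \<Rightarrow> bool" where
  "souslin X A \<longleftrightarrow> (\<exists>K. closedin (prod_topology baire X) K \<and> A = snd ` K)"

lemma souslin_closed: "closedin X F \<Longrightarrow> souslin X F"
  unfolding souslin_def
  by (rule exI[of _ "UNIV \<times> F"]) (auto simp: closedin_prod_Times_iff closedin_topspace[of baire, simplified] image_iff)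

lemma souslin_Union:
  assumes "\<And>n :: nat. souslin X (A n)"
  shows "souslin X (\<Union>n. A n)"
proof -
  let ?Q = "prod_topology baire X"
  obtain K where K: "\<And>n. closedin ?Q (K n)" "\<And>n. A n = snd ` K n"
    using assms unfolding souslin_def by metis
  define f where "f p = ((\<lambda>i. fst p (Suc i)), snd p)" for p :: "(nat \<Rightarrow> nat) \<times> 'a"
  have cf: "continuous_map ?Q ?Q f"
    unfolding f_def continuous_map_pairwise o_def fst_conv snd_conv
    unfolding baire_def continuous_map_componentwise_UNIV
    by (intro conjI allI continuous_map_snd continuous_map_compose[OF continuous_map_fst continuous_map_product_projection, unfolded o_def]) simp
  define L where "L = (\<Inter>n. {p \<in> topspace ?Q. fst p 0 \<in> - {n}} \<union> {p \<in> topspace ?Q. f p \<in> K n})"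
  have c0: "continuous_map ?Q (discrete_topology UNIV) (\<lambda>p. fst p 0)"
    unfolding baire_def
    by (intro continuous_map_compose[OF continuous_map_fst continuous_map_product_projection, unfolded o_def]) simp
  have "closedin ?Q L"
    unfolding L_def
    by (intro closedin_INT closedin_Un closedin_continuous_map_preimage[OF c0] closedin_continuous_map_preimage[OF cf] K) auto
  moreover have "(\<Union>n. A n) = snd ` L"
  proof (intro equalityI subsetI)
    fix y assume "y \<in> (\<Union>n. A n)"
    then obtain n z where z: "(z, y) \<in> K n"
      using K(2) by force
    have "y \<in> topspace X"
      using closedin_subset[OF K(1)] z by auto
    moreover have "f (case_nat n z, y) = (z, y)"
      by (simp add: f_def)
    ultimately have "(case_nat n z, y) \<in> L"
      using z by (auto simp: L_def)
    then show "y \<in> snd ` L"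
      by (metis imageI snd_conv)
  next
    fix y assume "y \<in> snd ` L"
    then obtain z where "(z, y) \<in> L"
      by force
    then have "f (z, y) \<in> K (z 0)"
      by (auto simp: L_def)
    then have "y \<in> A (z 0)"
      unfolding K(2) f_def by (intro image_eqI[of _ _ "f (z, y)"]) (simp_all add: f_def)
    then show "y \<in> (\<Union>n. A n)"
      by blast
  qed
  ultimately show ?thesis
    unfolding souslin_def by blast
qed

text \<open>
  A witness for the intersection codes one witness for each of the sets, and the conditions on them are all closed.
\<close>
lemma souslin_Inter:
  assumes "\<And>n :: nat. souslin X (A n)"
  shows "souslin X (\<Inter>n. A n)"
proof -
  let ?Q = "prod_topology baire X"
  obtain K where K: "\<And>n. closedin ?Q (K n)" "\<And>n. A n = snd ` K n"
    using assms unfolding souslin_def by metis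
  define f where "f n p = ((\<lambda>i. fst p (prod_encode (n, i))), snd p)" for n and p :: "(nat \<Rightarrow> nat) \<times> 'a"
  have cf: "continuous_map ?Q ?Q (f n)" for n
    unfolding f_def continuous_map_pairwise o_def fst_conv snd_conv
    unfolding baire_def continuous_map_componentwise_UNIV
    by (intro conjI allI continuous_map_snd continuous_map_compose[OF continuous_map_fst continuous_map_product_projection, unfolded o_def]) simp
  define L where "L = (\<Inter>n. {p \<in> topspace ?Q. f n p \<in> K n})"
  have "closedin ?Q L"
    unfolding L_def by (intro closedin_INT closedin_continuous_map_preimage[OF cf] K) auto
  moreover have "(\<Inter>n. A n) = snd ` L"
  proof (intro equalityI subsetI)
    fix y assume y: "y \<in> (\<Inter>n. A n)"
    then have "\<forall>n. \<exists>z. (z, y) \<in> K n"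
      using K(2) by force
    then obtain z where z: "\<And>n. (z n, y) \<in> K n"
      by metis
    have "y \<in> topspace X"
      using closedin_subset[OF K(1)] z[of 0] by auto
    moreover have "f n ((\<lambda>m. case prod_decode m of (k, i) \<Rightarrow> z k i), y) = (z n, y)" for n
      by (simp add: f_def)
    ultimately have "((\<lambda>m. case prod_decode m of (k, i) \<Rightarrow> z k i), y) \<in> L"
      using z by (auto simp: L_def)
    then show "y \<in> snd ` L"
      by (metis imageI snd_conv)
  next
    fix y assume "y \<in> snd ` L"
    then obtain z where z: "(z, y) \<in> L"
      by force
    have "y \<in> A n" for n
    proof -
      have "f n (z, y) \<in> K n"
        using z by (auto simp: L_def)
      then show ?thesis
        unfolding K(2) by (intro image_eqI[of _ _ "f n (z, y)"]) (simp_all add: f_def)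
    qed
    then show "y \<in> (\<Inter>n. A n)"
      by blast
  qed
  ultimately show ?thesis
    unfolding souslin_def by blast
qed

lemma borel_in_subset:
  assumes "borel_in X B"
  shows "B \<subseteq> topspace X"
  using sigma_sets_into_sp[OF _ assms[unfolded borel_in_def]] openin_subset by blast

lemma borel_imp_souslin:
  assumes X: "metrizable_space X" and A: "borel_in X A"
  shows "souslin X A"
proof -
  have "souslin X A \<and> souslin X (topspace X - A)"
    using A unfolding borel_in_def
  proof (induction rule: sigma_sets.induct)
    case (Basic V)
    then have "openin X V"
      by simp
    then have "fsigma_in X V"
      by (rule open_imp_fsigma_in[OF X])
    then obtain C where C: "\<And>n :: nat. closedin X (C n)" "\<Union> (range C) = V"
      unfolding fsigma_in_ascending by blast
    have "souslin X (\<Union>n. C n)"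
      by (intro souslin_Union souslin_closed C)
    then show ?case
      using C(2) \<open>openin X V\<close> by (simp add: souslin_closed closedin_diff)
  next
    case Empty
    then show ?case
      by (simp add: souslin_closed)
  next
    case (Compl B)
    have "B \<subseteq> topspace X"
      using borel_in_subset Compl.hyps unfolding borel_in_def by blast
    then show ?case
      using Compl.IH by (simp add: Diff_Diff_Int Int_absorb1)
  next
    case (Union B)
    have "topspace X - \<Union> (range B) = (\<Inter>n. topspace X - B n)"
      by auto
    then show ?case
      using Union.IH souslin_Union[of X B] souslin_Inter[of X "\<lambda>n. topspace X - B n"] by simp
  qed
  then show ?thesis ..
qed

lemma polish_second_countable: "polish_space X \<Longrightarrow> second_countable X"
  unfolding polish_space_def
  using metrizable_separable_imp_second_countable completely_metrizable_imp_metrizable_space by blast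

lemma polish_baire: "polish_space baire"
  unfolding polish_space_def baire_def
  using second_countable_imp_separable_space[OF second_countable_sequences]
  by (simp add: completely_metrizable_space_product_topology completely_metrizable_space_discrete_topology)

lemma polish_prod:
  assumes "polish_space X" "polish_space Y"
  shows "polish_space (prod_topology X Y)"
  unfolding polish_space_def
proof
  show "completely_metrizable_space (prod_topology X Y)"
    using assms by (simp add: completely_metrizable_space_prod_topology polish_space_def)
  show "separable_space (prod_topology X Y)"
    using assms by (intro second_countable_imp_separable_space second_countable_prod polish_second_countable)
qed

lemma polish_closed:
  assumes "polish_space X" "closedin X K"
  shows "polish_space (subtopology X K)"
  unfolding polish_space_def
proof
  show "completely_metrizable_space (subtopology X K)"
    using assms completely_metrizable_space_closedin by (auto simp: polish_space_def)
  show "separable_space (subtopology X K)"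
    using assms by (intro second_countable_imp_separable_space second_countable_subtopology polish_second_countable)
qed

lemma analytic_space_continuous_image:
  assumes "analytic_space X"
  obtains Z :: "(nat \<Rightarrow> nat) topology" and \<phi> where "polish_space Z" "continuous_map Z X \<phi>" "\<phi> ` topspace Z = topspace X"
proof -
  obtain Y :: "(nat \<Rightarrow> nat) topology" and S where Y: "analytic_in Y S" "X homeomorphic_space subtopology Y S"
    using assms unfolding analytic_space_def by blast
  obtain Z :: "(nat \<Rightarrow> nat) topology" and f where Z: "polish_space Z" "continuous_map Z Y f" "f ` topspace Z = S"
    using Y(1) unfolding analytic_in_def by blast
  obtain a b where ab: "homeomorphic_maps X (subtopology Y S) a b"
    using Y(2) unfolding homeomorphic_space_def by blast
  have S: "S \<subseteq> topspace Y"
    using Z(2,3) continuous_map_image_subset_topspace by blast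
  have fS: "continuous_map Z (subtopology Y S) f"
    using Z by (auto simp: continuous_map_in_subtopology)
  have b: "continuous_map (subtopology Y S) X b" and "b ` S = topspace X"
  proof -
    show "continuous_map (subtopology Y S) X b"
      using ab by (simp add: homeomorphic_maps_def)
    have "homeomorphic_map (subtopology Y S) X b"
      using ab homeomorphic_maps_sym homeomorphic_maps_imp_map by blast
    then have "b ` topspace (subtopology Y S) = topspace X"
      by (rule homeomorphic_imp_surjective_map)
    then show "b ` S = topspace X"
      using S by (simp add: topspace_subtopology Int_absorb1)
  qed
  show ?thesis
  proof (rule that[OF Z(1)])
    show "continuous_map Z X (b \<circ> f)"
      by (rule continuous_map_compose[OF fS b])
    show "(b \<circ> f) ` topspace Z = topspace X"
      unfolding image_comp[symmetric] Z(3) by fact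
  qed
qed

text \<open>
  The square of \<open>X\<close> is a continuous image of a Polish space, hence a Borel set in it is a continuous image of a closed
  subset of the product with Baire space.
\<close>
lemma borel_square_continuous_image:
  fixes X :: "'a topology"
  assumes X: "analytic_space X" and A: "borel_in (prod_topology X X) A"
  obtains M :: "((nat \<Rightarrow> nat) \<times> (nat \<Rightarrow> nat) \<times> (nat \<Rightarrow> nat)) topology" and p
    where "polish_space M" "continuous_map M (prod_topology X X) p" "p ` topspace M = A"
proof -
  obtain Z :: "(nat \<Rightarrow> nat) topology" and \<phi> where Z: "polish_space Z" "continuous_map Z X \<phi>" "\<phi> ` topspace Z = topspace X"
    by (rule analytic_space_continuous_image[OF X])
  let ?Q = "prod_topology Z Z"
  define \<psi> where "\<psi> q = (\<phi> (fst q), \<phi> (snd q))" for q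
  have \<psi>: "continuous_map ?Q (prod_topology X X) \<psi>"
    unfolding \<psi>_def
    by (intro continuous_map_pairedI continuous_map_compose[OF continuous_map_fst Z(2), unfolded o_def]
        continuous_map_compose[OF continuous_map_snd Z(2), unfolded o_def])
  have Q: "polish_space ?Q"
    by (rule polish_prod[OF Z(1,1)])
  have sub: "A \<subseteq> topspace X \<times> topspace X"
    using borel_in_subset[OF A] by simp
  have "borel_in ?Q {q \<in> topspace ?Q. \<psi> q \<in> A}"
    by (rule borel_in_continuous_preimage[OF \<psi> A])
  then have "souslin ?Q {q \<in> topspace ?Q. \<psi> q \<in> A}"
    using Q unfolding polish_space_def by (intro borel_imp_souslin completely_metrizable_imp_metrizable_space) auto
  then obtain K where K: "closedin (prod_topology baire ?Q) K" "{q \<in> topspace ?Q. \<psi> q \<in> A} = snd ` K"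
    unfolding souslin_def by blast
  let ?M = "subtopology (prod_topology baire ?Q) K"
  have tM: "topspace ?M = K"
    using closedin_subset[OF K(1)] by (simp add: topspace_subtopology Int_absorb1)
  show ?thesis
  proof (rule that)
    show "polish_space ?M"
      by (intro polish_closed polish_prod polish_baire Z K)
    show "continuous_map ?M (prod_topology X X) (\<psi> \<circ> snd)"
      by (rule continuous_map_compose[OF continuous_map_from_subtopology[OF continuous_map_snd] \<psi>])
    show "(\<psi> \<circ> snd) ` topspace ?M = A"
    proof -
      have "(\<psi> \<circ> snd) ` topspace ?M = \<psi> ` {q \<in> topspace ?Q. \<psi> q \<in> A}"
        unfolding tM K(2) by (simp add: image_comp)
      also have "\<dots> = A"
      proof (intro equalityI subsetI)
        fix z assume z: "z \<in> A"
        then have "fst z \<in> \<phi> ` topspace Z" "snd z \<in> \<phi> ` topspace Z"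
          using sub Z(3) by auto
        then obtain u v where "u \<in> topspace Z" "v \<in> topspace Z" "fst z = \<phi> u" "snd z = \<phi> v"
          by blast
        moreover from this have "z = (\<phi> u, \<phi> v)"
          by (simp add: prod_eq_iff)
        ultimately show "z \<in> \<psi> ` {q \<in> topspace ?Q. \<psi> q \<in> A}"
          using z by (intro image_eqI[of _ _ "(u, v)"]) (auto simp: \<psi>_def)
      qed auto
      finally show ?thesis .
    qed
  qed
qed

section \<open>The Hurewicz dichotomy\<close>

text \<open>
  Delete from \<open>M\<close> all basic open sets whose image can be covered by an \<open>F\<^sub>\<sigma>\<close> subset of \<open>A\<close>. Since \<open>A\<close> is not
  \<open>F\<^sub>\<sigma>\<close>, the remaining set \<open>K\<close> is nonempty, and for every open set \<open>V\<close> meeting \<open>K\<close> the image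
  of \<open>V \<inter> K\<close> has a limit point outside \<open>A\<close>. A node is a ball of \<open>M\<close> around a point of \<open>K\<close>
  together with such a limit point \<open>b\<close>; a small ball inside it is mapped near \<open>b\<close>, and contains points of
  \<open>K\<close>, so that nodes have arbitrarily close successors. Along the branch of codes of \<open>x\<close>, the points \<open>b\<close> stay outside
  \<open>A\<close> if the branch stops, and converge to the image of the point shared by all balls, a member of \<open>A\<close>, if it does not.
\<close>
theorem hurewicz_metric:
  fixes A :: "'x set" and p :: "'m \<Rightarrow> 'x"
  assumes M: "Metric_space M dM" and compl: "Metric_space.mcomplete M dM"
    and sc: "second_countable (Metric_space.mtopology M dM)"
    and X: "Metric_space X dX"
    and p: "continuous_map (Metric_space.mtopology M dM) (Metric_space.mtopology X dX) p" "p ` M = A"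
    and A: "\<not> fsigma_in (Metric_space.mtopology X dX) A"
  obtains h where "continuous_map cantor_space (Metric_space.mtopology X dX) h" "\<And>x. h x \<in> A \<longleftrightarrow> x \<in> P_inf"
proof -
  interpret M: Metric_space M dM by fact
  interpret X: Metric_space X dX by fact
  have AX: "A \<subseteq> X"
    using continuous_map_image_subset_topspace[OF p(1)] p(2) by simp
  obtain B where B: "countable B" "\<And>V. V \<in> B \<Longrightarrow> openin M.mtopology V"
    "\<And>U x. openin M.mtopology U \<Longrightarrow> x \<in> U \<Longrightarrow> \<exists>V\<in>B. x \<in> V \<and> V \<subseteq> U"
    using sc unfolding second_countable_def by auto
  define sep where "sep V \<longleftrightarrow> (\<exists>F. fsigma_in X.mtopology F \<and> p ` V \<subseteq> F \<and> F \<subseteq> A)" for V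
  define W where "W = \<Union> {V \<in> B. sep V}"
  define K where "K = M - W"
  have sepW: "sep W"
  proof -
    define F where "F V = (SOME F. fsigma_in X.mtopology F \<and> p ` V \<subseteq> F \<and> F \<subseteq> A)" for V
    have F: "fsigma_in X.mtopology (F V) \<and> p ` V \<subseteq> F V \<and> F V \<subseteq> A" if V: "V \<in> {V \<in> B. sep V}" for V
    proof -
      have "\<exists>F. fsigma_in X.mtopology F \<and> p ` V \<subseteq> F \<and> F \<subseteq> A"
        using V by (simp add: sep_def)
      from someI_ex[OF this] show ?thesis
        unfolding F_def .
    qed
    have "fsigma_in X.mtopology (\<Union> (F ` {V \<in> B. sep V}))"
      using B(1) F by (intro fsigma_in_Union) auto
    moreover have "p ` W \<subseteq> \<Union> (F ` {V \<in> B. sep V})" "\<Union> (F ` {V \<in> B. sep V}) \<subseteq> A"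
      using F unfolding W_def by blast+
    ultimately show ?thesis
      unfolding sep_def by blast
  qed
  have meets: "\<exists>b. b \<in> X - A \<and> b \<in> X.mtopology closure_of (p ` (V \<inter> K))"
    if V: "openin M.mtopology V" and ne: "V \<inter> K \<noteq> {}" for V
  proof (rule ccontr)
    assume no: "\<not> ?thesis"
    let ?F = "X.mtopology closure_of (p ` (V \<inter> K))"
    have VM: "V \<subseteq> M"
      using openin_subset[OF V] by simp
    have "?F \<subseteq> X"
      using closure_of_subset_topspace[of X.mtopology] by simp
    then have FA: "?F \<subseteq> A"
      using no by blast
    obtain G where G: "fsigma_in X.mtopology G" "p ` W \<subseteq> G" "G \<subseteq> A"
      using sepW unfolding sep_def by blast
    have "p ` (V \<inter> K) \<subseteq> topspace X.mtopology"
      using p(2) AX VM by auto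
    then have "p ` (V \<inter> K) \<subseteq> ?F"
      by (rule closure_of_subset)
    then have "p ` V \<subseteq> ?F \<union> G"
      using G(2) VM unfolding K_def by blast
    moreover have "fsigma_in X.mtopology (?F \<union> G)"
      by (intro fsigma_in_Un closed_imp_fsigma_in closedin_closure_of G(1))
    ultimately have sepV: "sep V"
      unfolding sep_def using FA G(3) by blast
    obtain x where x: "x \<in> V" "x \<in> K"
      using ne by blast
    obtain V' where V': "V' \<in> B" "x \<in> V'" "V' \<subseteq> V"
      using B(3)[OF V x(1)] by blast
    have "sep V'"
      using sepV V'(3) unfolding sep_def by blast
    then have "x \<in> W"
      unfolding W_def using V' by blast
    then show False
      using x(2) by (simp add: K_def)
  qed
  define node where "node \<nu> \<longleftrightarrow> (case \<nu> of (c, \<rho>, b) \<Rightarrow> c \<in> K \<and> 0 < \<rho> \<and> b \<in> X - A \<and>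
      b \<in> X.mtopology closure_of (p ` (M.mball c \<rho> \<inter> K)))" for \<nu> :: "'m \<times> real \<times> 'x"
  define child where "child \<epsilon> \<nu> \<nu>' \<longleftrightarrow> (case (\<nu>, \<nu>') of ((c, \<rho>, b), (c', \<rho>', b')) \<Rightarrow>
      \<rho>' \<le> \<epsilon> \<and> M.mcball c' \<rho>' \<subseteq> M.mball c \<rho> \<and> p ` M.mball c' \<rho>' \<subseteq> X.mball b \<epsilon> \<and> dX b b' \<le> \<epsilon>)"
    for \<epsilon> :: real and \<nu> \<nu>' :: "'m \<times> real \<times> 'x"
  have mk: "\<exists>b. node (c, \<rho>, b)" if "c \<in> K" "0 < \<rho>" for c \<rho>
  proof -
    have "c \<in> M.mball c \<rho> \<inter> K"
      using that by (simp add: K_def)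
    then obtain b where "b \<in> X - A" "b \<in> X.mtopology closure_of (p ` (M.mball c \<rho> \<inter> K))"
      using meets[OF M.openin_mball, of c \<rho>] by blast
    then show ?thesis
      unfolding node_def using that by auto
  qed
  have "K \<noteq> {}"
  proof
    assume "K = {}"
    then have "M \<subseteq> W"
      by (simp add: K_def)
    then have "sep M"
      using sepW unfolding sep_def by blast
    then obtain F where "fsigma_in X.mtopology F" "A \<subseteq> F" "F \<subseteq> A"
      unfolding sep_def p(2) by blast
    then have "fsigma_in X.mtopology A"
      by (metis subset_antisym)
    then show False
      using A by blast
  qed
  then obtain root where root: "node root"
    using mk[of _ 1] by fastforce
  have ch: "\<exists>\<nu>'. node \<nu>' \<and> child \<epsilon> \<nu> \<nu>'" if \<nu>: "node \<nu>" and \<epsilon>: "0 < \<epsilon>" for \<nu> \<epsilon>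
  proof -
    obtain c \<rho> b where eq: "\<nu> = (c, \<rho>, b)"
      by (cases \<nu>) auto
    have n: "c \<in> K" "0 < \<rho>" "b \<in> X" "b \<in> X.mtopology closure_of (p ` (M.mball c \<rho> \<inter> K))"
      using \<nu> by (auto simp: node_def eq)
    have "\<exists>y\<in>p ` (M.mball c \<rho> \<inter> K). y \<in> X.mball b \<epsilon>"
      using n(4) \<epsilon> unfolding X.metric_closure_of by blast
    then obtain c' where c': "c' \<in> M.mball c \<rho>" "c' \<in> K" "p c' \<in> X.mball b \<epsilon>"
      by blast
    have op: "openin M.mtopology (M.mball c \<rho> \<inter> {x \<in> topspace M.mtopology. p x \<in> X.mball b \<epsilon>})"
      by (intro openin_Int M.openin_mball openin_continuous_map_preimage[OF p(1)] X.openin_mball)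
    have "c' \<in> M.mball c \<rho> \<inter> {x \<in> topspace M.mtopology. p x \<in> X.mball b \<epsilon>}"
      using c' by (simp add: K_def)
    with op obtain r where r: "r > 0" "M.mcball c' r \<subseteq> M.mball c \<rho> \<inter> {x \<in> topspace M.mtopology. p x \<in> X.mball b \<epsilon>}"
      unfolding M.openin_mtopology_mcball by blast
    define \<rho>' where "\<rho>' = min r \<epsilon>"
    have \<rho>': "0 < \<rho>'" "\<rho>' \<le> \<epsilon>" "M.mcball c' \<rho>' \<subseteq> M.mcball c' r"
      using r \<epsilon> by (auto simp: \<rho>'_def)
    obtain b' where b': "node (c', \<rho>', b')"
      using mk[OF c'(2) \<rho>'(1)] by blast
    have im: "p ` M.mball c' \<rho>' \<subseteq> X.mball b \<epsilon>"
      using r(2) \<rho>'(3) M.mball_subset_mcball[of c' \<rho>'] by blast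
    have "dX b b' \<le> \<epsilon>"
    proof -
      have "p ` (M.mball c' \<rho>' \<inter> K) \<subseteq> X.mcball b \<epsilon>"
        using im X.mball_subset_mcball[of b \<epsilon>] by blast
      then have "X.mtopology closure_of (p ` (M.mball c' \<rho>' \<inter> K)) \<subseteq> X.mcball b \<epsilon>"
        by (rule closure_of_minimal) simp
      then show ?thesis
        using b' by (auto simp: node_def)
    qed
    then have "child \<epsilon> \<nu> (c', \<rho>', b')"
      unfolding child_def eq using \<rho>' r(2) im by auto
    then show ?thesis
      using b' by blast
  qed
  define P where "P f m v \<longleftrightarrow> node v \<and> (1 \<le> m \<longrightarrow> child ((1/2) ^ m) (f (unbit m)) v)" for f and m :: nat and v
  have "\<exists>\<nu>. \<forall>m. P \<nu> m (\<nu> m)"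
  proof (rule dependent_wellorder_choice)
    fix f g :: "nat \<Rightarrow> 'm \<times> real \<times> 'x" and m v assume fg: "\<And>y. y < m \<Longrightarrow> f y = g y"
    show "P f m v = P g m v"
      using fg unbit_less by (auto simp: P_def)
  next
    fix f m assume IH: "\<And>y. y < m \<Longrightarrow> P f y (f y)"
    show "\<exists>v. P f m v"
    proof (cases "1 \<le> m")
      case False
      then show ?thesis
        using root by (intro exI[of _ root]) (simp add: P_def)
    next
      case True
      then have "node (f (unbit m))"
        using IH unbit_less by (simp add: P_def)
      then show ?thesis
        using ch[of "f (unbit m)" "(1/2) ^ m"] by (auto simp: P_def)
    qed
  qed
  then obtain \<nu> where \<nu>: "\<And>m. P \<nu> m (\<nu> m)"
    by blast
  define c where "c m = fst (\<nu> m)" for m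
  define \<rho> where "\<rho> m = fst (snd (\<nu> m))" for m
  define b where "b m = snd (snd (\<nu> m))" for m
  have \<nu>eq: "\<nu> m = (c m, \<rho> m, b m)" for m
    by (simp add: c_def \<rho>_def b_def)
  have nd: "c m \<in> M" "0 < \<rho> m" "b m \<in> X" "b m \<notin> A" for m
    using \<nu>[of m] by (auto simp: P_def node_def \<nu>eq K_def)
  have cd: "\<rho> m \<le> (1/2) ^ m" "M.mcball (c m) (\<rho> m) \<subseteq> M.mball (c (unbit m)) (\<rho> (unbit m))"
      "p ` M.mball (c m) (\<rho> m) \<subseteq> X.mball (b (unbit m)) ((1/2) ^ m)" "dX (b (unbit m)) (b m) \<le> (1/2) ^ m" if "1 \<le> m" for m
    using \<nu>[of m] that by (auto simp: P_def child_def \<nu>eq)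
  have br: "unbit m \<in> codes x" "\<And>j. j \<in> codes x \<Longrightarrow> j < m \<Longrightarrow> j \<le> unbit m" if "m \<in> codes x" "1 \<le> m" for m x
    using branch_codes[of x] that unfolding branch_def by blast+
  have dist: "dX (b j) (b m) \<le> (if m = j then 0 else 2 * (1/2) ^ N - (1/2) ^ m)"
    if "j \<in> codes x" "m \<in> codes x" "j \<le> m" "\<And>i. i \<in> codes x \<Longrightarrow> j < i \<Longrightarrow> N \<le> i" for j m N x
    using that(2,3)
  proof (induction m rule: less_induct)
    case (less m)
    show ?case
    proof (cases "m = j")
      case True
      then show ?thesis
        using nd by simp
    next
      case False
      then have m: "1 \<le> m" "j < m"
        using less.prems by linarith+
      have u: "unbit m \<in> codes x" "j \<le> unbit m" "unbit m < m"
        using br[OF less.prems(1) m(1)] that(1) m unbit_less by blast+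
      have N: "N \<le> m"
        using that(4)[OF less.prems(1) m(2)] .
      have tri: "dX (b j) (b m) \<le> dX (b j) (b (unbit m)) + (1/2) ^ m"
        using X.triangle[of "b j" "b (unbit m)" "b m"] nd cd(4)[OF m(1)] by fastforce
      have half: "(1/2::real) ^ i \<ge> 2 * (1/2) ^ m" if "i < m" for i
      proof -
        have "(1/2::real) ^ (m - 1) \<le> (1/2) ^ i"
          using that by (intro power_decreasing) auto
        moreover have "(1/2::real) ^ m = (1/2) ^ (m - 1) / 2"
          using m by (cases m) auto
        ultimately show ?thesis
          by linarith
      qed
      have "dX (b j) (b m) \<le> 2 * (1/2) ^ N - (1/2) ^ m"
      proof (cases "unbit m = j")
        case True
        have "(1/2::real) ^ m \<le> (1/2) ^ N"
          using N by (intro power_decreasing) auto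
        moreover have "dX (b j) (b (unbit m)) \<le> 0"
          using less.IH[OF u(3,1,2)] True by simp
        ultimately show ?thesis
          using tri by linarith
      next
        case F: False
        have "dX (b j) (b (unbit m)) \<le> 2 * (1/2) ^ N - (1/2) ^ unbit m"
          using less.IH[OF u(3,1,2)] F by simp
        then show ?thesis
          using tri half[OF u(3)] by linarith
      qed
      then show ?thesis
        using False by simp
    qed
  qed
  have limex: "\<exists>l\<in>M. \<forall>m\<in>codes x. l \<in> M.mball (c m) (\<rho> m)" if x: "x \<in> P_inf" for x
  proof -
    have inf: "infinite (codes x)"
      using x by (simp add: finite_codes_iff P_fin_def)
    define e where "e = enumerate (codes x)"
    have e_in: "e n \<in> codes x" for n
      unfolding e_def by (rule enumerate_in_set[OF inf])
    have e_mono: "e i < e j \<longleftrightarrow> i < j" for i j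
      unfolding e_def by (rule enumerate_mono_iff[OF inf])
    have e_ex: "\<exists>n. e n = m" if "m \<in> codes x" for m
      unfolding e_def by (rule enumerate_Ex[OF inf that])
    have e_Suc: "1 \<le> e (Suc n)" "unbit (e (Suc n)) = e n" for n
    proof -
      have "e n < e (Suc n)"
        by (simp add: e_mono)
      then show one: "1 \<le> e (Suc n)"
        by simp
      obtain k where k: "e k = unbit (e (Suc n))"
        using e_ex[OF br(1)[OF e_in one]] by blast
      have "e n \<le> e k"
        unfolding k using br(2)[OF e_in one e_in \<open>e n < e (Suc n)\<close>] .
      moreover have "e k < e (Suc n)"
        unfolding k by (rule unbit_less[OF one])
      ultimately have "k = n"
        using e_mono[of k "Suc n"] e_mono[of k n] by auto
      then show "unbit (e (Suc n)) = e n"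
        using k by simp
    qed
    define C where "C n = M.mcball (c (e (Suc n))) (\<rho> (e (Suc n)))" for n
    have sub: "C n \<subseteq> M.mball (c (e n)) (\<rho> (e n))" for n
      unfolding C_def using cd(2)[OF e_Suc(1)[of n]] e_Suc(2)[of n] by simp
    have "decseq C"
    proof (rule decseq_SucI)
      fix n
      show "C (Suc n) \<subseteq> C n"
        using sub[of "Suc n"] M.mball_subset_mcball unfolding C_def by blast
    qed
    moreover have "C n \<noteq> {}" for n
      unfolding C_def using nd[of "e (Suc n)"] by (auto simp: M.mcball_def intro!: exI[of _ "c (e (Suc n))"])
    moreover have "\<exists>n a. C n \<subseteq> M.mcball a \<epsilon>" if eps: "\<epsilon> > 0" for \<epsilon> :: real
    proof -
      have "\<exists>n. (1/2) ^ n < \<epsilon>"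
        using real_arch_pow_inv[OF eps, of "1/2"] by simp
      then obtain n where n: "(1/2) ^ n < \<epsilon>" ..
      have ge: "k \<le> e k" for k
      proof (induction k)
        case (Suc k)
        then show ?case
          using e_mono[of k "Suc k"] by simp
      qed simp
      have "\<rho> (e (Suc n)) \<le> (1/2) ^ e (Suc n)"
        by (rule cd(1)[OF e_Suc(1)])
      also have "\<dots> \<le> (1/2) ^ n"
        using ge[of "Suc n"] by (intro power_decreasing) auto
      finally have "C n \<subseteq> M.mcball (c (e (Suc n))) \<epsilon>"
        unfolding C_def using n by (intro M.mcball_subset_concentric) simp
      then show ?thesis
        by blast
    qed
    moreover have "closedin M.mtopology (C n)" for n
      by (simp add: C_def)
    ultimately have "(\<forall>n. closedin M.mtopology (C n)) \<and> (\<forall>n. C n \<noteq> {}) \<and> decseq C \<and> (\<forall>\<epsilon>>0. \<exists>n a. C n \<subseteq> M.mcball a \<epsilon>)"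
      by blast
    then have "\<Inter> (range C) \<noteq> {}"
      by (rule compl[unfolded M.mcomplete_nest, THEN spec, THEN mp])
    then obtain l where "l \<in> \<Inter> (range C)"
      by (meson all_not_in_conv)
    then have l: "l \<in> C n" for n
      by simp
    have "l \<in> M.mball (c m) (\<rho> m)" if m: "m \<in> codes x" for m
    proof -
      obtain n where "e n = m"
        using e_ex[OF m] by blast
      then show ?thesis
        using l[of n] sub[of n] by auto
    qed
    moreover have "l \<in> M"
      using l[of 0] by (simp add: C_def)
    ultimately show ?thesis
      by blast
  qed
  define l where "l x = (SOME l. l \<in> M \<and> (\<forall>m\<in>codes x. l \<in> M.mball (c m) (\<rho> m)))" for x
  have l: "l x \<in> M" "\<And>m. m \<in> codes x \<Longrightarrow> l x \<in> M.mball (c m) (\<rho> m)" if "x \<in> P_inf" for x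
    using someI_ex[of "\<lambda>l. l \<in> M \<and> (\<forall>m\<in>codes x. l \<in> M.mball (c m) (\<rho> m))"] limex[OF that] unfolding l_def by blast+
  define h where "h x = (if x \<in> P_inf then p (l x) else b (Max (codes x)))" for x
  have hX: "h x \<in> X" for x
    using l[of x] nd p(2) AX by (auto simp: h_def)
  have close: "dX (b j) (h x) \<le> 2 * (1/2) ^ N"
    if j: "j \<in> codes x" and N: "\<And>i. i \<in> codes x \<Longrightarrow> j < i \<Longrightarrow> N \<le> i" for j x N
  proof (cases "x \<in> P_inf")
    case False
    then have fin: "finite (codes x)" "codes x \<noteq> {}"
      using j by (auto simp: finite_codes_iff P_fin_def)
    have "dX (b j) (b (Max (codes x))) \<le> (if Max (codes x) = j then 0 else 2 * (1/2) ^ N - (1/2) ^ Max (codes x))"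
      by (rule dist[OF j Max_in[OF fin] Max_ge[OF fin(1) j] N])
    also have "\<dots> \<le> 2 * (1/2) ^ N"
      by simp
    finally show ?thesis
      using False by (simp add: h_def)
  next
    case True
    have inf: "infinite (codes x)"
      using True by (simp add: finite_codes_iff P_fin_def)
    define m where "m = (LEAST m. m \<in> codes x \<and> j < m)"
    have m: "m \<in> codes x" "j < m"
      using LeastI_ex[of "\<lambda>m. m \<in> codes x \<and> j < m"] inf unfolding m_def infinite_nat_iff_unbounded by blast+
    then have m1: "1 \<le> m"
      by simp
    have "unbit m = j"
    proof (rule antisym)
      show "j \<le> unbit m"
        by (rule br(2)[OF m(1) m1 j m(2)])
      show "unbit m \<le> j"
      proof (rule ccontr)
        assume "\<not> unbit m \<le> j"
        then have "m \<le> unbit m"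
          unfolding m_def using br(1)[OF m(1) m1] by (intro Least_le) (simp add: m_def)
        then show False
          using unbit_less[OF m1] by simp
      qed
    qed
    then have "p (l x) \<in> X.mball (b j) ((1/2) ^ m)"
      using cd(3)[OF m1] l(2)[OF True m(1)] by blast
    then have "dX (b j) (p (l x)) \<le> (1/2) ^ m"
      by simp
    also have "\<dots> \<le> (1/2) ^ N"
      using N[OF m] by (intro power_decreasing) auto
    also have "\<dots> \<le> 2 * (1/2) ^ N"
      by simp
    finally show ?thesis
      using True by (simp add: h_def)
  qed
  have later: "2 ^ n \<le> i" if i: "i \<in> codes x" "code x n < i" for i x n
  proof -
    obtain k where k: "i = code x k"
      using i by (auto simp: codes_def)
    have "1 \<le> code x k"
      using i k by simp
    then obtain t where t: "x t" "code x k = code x t + 2 ^ t"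
      by (rule code_top)
    have "n \<le> t"
    proof (rule ccontr)
      assume "\<not> n \<le> t"
      then have "code x (Suc t) \<le> code x n"
        by (intro code_mono) simp
      then show False
        using t k i by simp
    qed
    then have "(2::nat) ^ n \<le> 2 ^ t"
      by (intro power_increasing) auto
    then show ?thesis
      using t k by linarith
  qed
  have hclose: "dX (h x) (h y) \<le> 4 * (1/2) ^ n" if xy: "agree n x y" for x y n
  proof -
    have "dX (b (code z n)) (h z) \<le> 2 * (1/2) ^ n" for z
    proof (rule close)
      show "code z n \<in> codes z"
        by (simp add: codes_def)
      fix i assume "i \<in> codes z" "code z n < i"
      then have "2 ^ n \<le> i"
        by (rule later)
      then show "n \<le> i"
        using less_exp[of n] by linarith
    qed
    from this[of x] this[of y] show ?thesis
      using X.triangle[of "h x" "b (code x n)" "h y"] hX nd code_agree[OF xy] X.commute[of "b (code x n)" "h x"] by fastforce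
  qed
  have "continuous_map cantor_space X.mtopology h"
    unfolding continuous_map_def
  proof (intro conjI allI impI)
    show "h \<in> topspace cantor_space \<rightarrow> topspace X.mtopology"
      using hX by simp
    fix V assume V: "openin X.mtopology V"
    show "openin cantor_space {x \<in> topspace cantor_space. h x \<in> V}"
      unfolding openin_cantor_space
    proof
      fix x assume "x \<in> {x \<in> topspace cantor_space. h x \<in> V}"
      then obtain r where r: "r > 0" "X.mball (h x) r \<subseteq> V"
        using V unfolding X.openin_mtopology by blast
      have "\<exists>n. (1/2) ^ n < r / 4"
        using real_arch_pow_inv[of "r / 4" "1/2"] r by simp
      then obtain n where n: "(1/2) ^ n < r / 4" ..
      have "h y \<in> V" if "agree n x y" for y
      proof -
        have "h y \<in> X.mball (h x) r"
          using hclose[OF that] n hX by simp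
        then show ?thesis
          using r by blast
      qed
      then have "\<forall>y. agree n x y \<longrightarrow> y \<in> {x \<in> topspace cantor_space. h x \<in> V}"
        by simp
      then show "\<exists>n. \<forall>y. agree n x y \<longrightarrow> y \<in> {x \<in> topspace cantor_space. h x \<in> V}" ..
    qed
  qed
  moreover have "h x \<in> A \<longleftrightarrow> x \<in> P_inf" for x
    using l[of x] nd p(2) by (auto simp: h_def)
  ultimately show ?thesis
    by (rule that)
qed

theorem hurewicz:
  fixes X :: "'a topology"
  assumes X: "analytic_space X" and A: "borel_in (prod_topology X X) A" "\<not> fsigma_in (prod_topology X X) A"
  obtains h where "continuous_map cantor_space (prod_topology X X) h" "\<And>x. h x \<in> A \<longleftrightarrow> x \<in> P_inf"
proof -
  obtain M :: "((nat \<Rightarrow> nat) \<times> (nat \<Rightarrow> nat) \<times> (nat \<Rightarrow> nat)) topology" and p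
    where M: "polish_space M" "continuous_map M (prod_topology X X) p" "p ` topspace M = A"
    by (rule borel_square_continuous_image[OF X A(1)])
  obtain S d where d: "Metric_space S d" "Metric_space.mcomplete S d" "M = Metric_space.mtopology S d"
    using M(1) unfolding polish_space_def completely_metrizable_space_def by blast
  have "metrizable_space (prod_topology X X)"
    using X by (simp add: metrizable_space_prod_topology analytic_space_def)
  then obtain S' d' where d': "Metric_space S' d'" "prod_topology X X = Metric_space.mtopology S' d'"
    unfolding metrizable_space_def by blast
  have S: "topspace M = S"
    unfolding d(3) using d(1) by (simp add: Metric_space.topspace_mtopology)
  obtain h where "continuous_map cantor_space (Metric_space.mtopology S' d') h" "\<And>x. h x \<in> A \<longleftrightarrow> x \<in> P_inf"
    by (rule hurewicz_metric[OF d(1,2) _ d'(1), of p A])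
      (use M A polish_second_countable[OF M(1)] S in \<open>simp_all add: d(3)[symmetric] d'(2)[symmetric]\<close>)
  then show ?thesis
    using that d'(2) by metis
qed

section \<open>Thinning out a Borel relation without squares\<close>

context game begin

text \<open>
  Success is inherited by almost all later positions, since the tree given at \<open>s\<close> can be followed from there.
\<close>
lemma inn_persist:
  assumes inn: "inn C E s" and s: "s \<in> S" and c: "c \<in> C"
  shows "eventually (inn C E) (W c s)"
proof -
  let ?A = "wit C E s"
  have "eventually (\<lambda>t. t \<in> ?A c s) (W c s)"
    using tree_wit[OF inn] s c unfolding tree_def by blast
  with W_legal[OF s, of c] show ?thesis
  proof eventually_elim
    fix t assume t: "t \<in> S \<and> legal c s t" "t \<in> ?A c s"
    have "lim r \<in> E" if r: "run C ?A \<kappa> r" and f: "fair C \<kappa>" and r0: "r 0 = t" for \<kappa> r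
    proof -
      define r' where "r' n = (case n of 0 \<Rightarrow> s | Suc m \<Rightarrow> r m)" for n
      define \<kappa>' where "\<kappa>' n = (case n of 0 \<Rightarrow> Some c | Suc m \<Rightarrow> \<kappa> m)" for n
      have r': "run C ?A \<kappa>' r'"
      proof (rule runI)
        fix n assume "\<kappa>' n = None"
        then show "r' (Suc n) = r' n"
          using run_None[OF r] by (cases n) (auto simp: \<kappa>'_def r'_def)
      next
        fix n e assume e: "\<kappa>' n = Some e"
        show "e \<in> C \<and> step ?A e (r' n) (r' (Suc n))"
        proof (cases n)
          case 0
          then show ?thesis
            using e t c r0 by (simp add: \<kappa>'_def r'_def step_def)
        next
          case (Suc m)
          then show ?thesis
            using e run_Some[OF r, of m e] by (simp add: \<kappa>'_def r'_def)
        qed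
      qed (simp add: r'_def s)
      have "fair C \<kappa>'"
        unfolding fair_def
      proof (intro ballI allI)
        fix d m assume "d \<in> C"
        then obtain n where "n \<ge> m" "\<kappa> n = Some d"
          using fairD[OF f] by blast
        then show "\<exists>n\<ge>m. \<kappa>' n = Some d"
          by (intro exI[of _ "Suc n"]) (simp add: \<kappa>'_def)
      qed
      then have "lim r' \<in> E"
        by (rule run_wit[OF inn r']) (simp add: r'_def)
      moreover have "(\<lambda>n. r' (n + 1)) = r"
        by (simp add: r'_def)
      ultimately show ?thesis
        using lim_shift[OF r', of 1] by simp
    qed
    then show "inn C E t"
      unfolding inn_def using tree_wit[OF inn] by blast
  qed
qed

end

context nodes begin

lemma eventually_neq:
  assumes "a \<in> D"
  shows "eventually (\<lambda>b. b \<noteq> f) (U a)"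
proof (cases "f = a")
  case True
  show ?thesis
    using U_near[OF assms, of 0] unfolding True by (rule eventually_mono) simp
next
  case False
  then obtain i where "f i \<noteq> a i"
    by (auto simp: fun_eq_iff)
  then have *: "b \<noteq> f" if "agree (Suc i) a b" for b
    using that by (auto simp: agree_def)
  show ?thesis
    by (rule eventually_mono[OF U_near[OF assms, of "Suc i"]]) (simp add: *)
qed

lemma inn_empty:
  assumes "s \<in> E"
  shows "inn {} E s"
  unfolding inn_def
proof (intro exI[of _ "\<lambda>_ _. UNIV"] conjI tree_UNIV allI impI)
  fix \<kappa> r assume r: "run {} (\<lambda>_ _. UNIV) \<kappa> r" and r0: "r 0 = s"
  have N: "\<kappa> n = None" for n
    using run_Some[OF r, of n] by (cases "\<kappa> n") auto
  have "r n = s" for n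
    by (induction n) (simp_all add: r0 run_None[OF r N])
  then show "limit_state r \<in> E"
    using assms by (simp add: limit_state_def)
qed

lemma inn_swap:
  assumes inn: "inn C E (a, b)"
  shows "inn {c. (\<not> c) \<in> C} (prod.swap ` E) (b, a)"
  unfolding inn_def
proof (intro exI conjI allI impI)
  let ?A = "wit C E (a, b)"
  let ?B = "\<lambda>c s. {t. prod.swap t \<in> ?A (\<not> c) (prod.swap s)}"
  show "tree {c. (\<not> c) \<in> C} ?B"
    unfolding tree_def
  proof (intro ballI)
    fix c s assume c: "c \<in> {c. (\<not> c) \<in> C}" and s: "s \<in> D \<times> D"
    then have "(\<not> c) \<in> C" "prod.swap s \<in> D \<times> D"
      by auto
    then have "eventually (\<lambda>t. t \<in> ?A (\<not> c) (prod.swap s)) (W (\<not> c) (prod.swap s))"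
      by (rule bspec[OF bspec[OF tree_wit[OF inn, unfolded tree_def]]])
    moreover have "sel (\<not> c) (prod.swap s) = sel c s" "\<And>v. move (\<not> c) (prod.swap s) v = prod.swap (move c s v)"
      by (simp_all add: sel_def move_def)
    ultimately show "eventually (\<lambda>t. t \<in> ?B c s) (W c s)"
      by (simp add: eventually_W)
  qed
  fix \<kappa> r assume r: "run {c. (\<not> c) \<in> C} ?B \<kappa> r" and f: "fair {c. (\<not> c) \<in> C} \<kappa>" and r0: "r 0 = (b, a)"
  have "run C ?A (\<lambda>n. map_option Not (\<kappa> n)) (\<lambda>n. prod.swap (r n))"
  proof (rule runI)
    show "prod.swap (r 0) \<in> D \<times> D"
      using run_mem[OF r, of 0] by auto
    show "prod.swap (r (Suc n)) = prod.swap (r n)" if "map_option Not (\<kappa> n) = None" for n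
      using run_None[OF r] that by simp
    fix n c assume "map_option Not (\<kappa> n) = Some c"
    then obtain d where d: "\<kappa> n = Some d" "c = (\<not> d)"
      by auto
    have "d \<in> {c. (\<not> c) \<in> C} \<and> step ?B d (r n) (r (Suc n))"
      by (rule run_Some[OF r d(1)])
    then show "c \<in> C \<and> step ?A c (prod.swap (r n)) (prod.swap (r (Suc n)))"
      unfolding d(2) step_def by (cases d) (auto simp: legal_move_def sel_def)
  qed
  moreover have "fair C (\<lambda>n. map_option Not (\<kappa> n))"
    unfolding fair_def
  proof (intro ballI allI)
    fix c m assume "c \<in> C"
    then have "(\<not> c) \<in> {c. (\<not> c) \<in> C}"
      by simp
    then obtain n where "n \<ge> m" "\<kappa> n = Some (\<not> c)"
      using fairD[OF f] by blast
    then show "\<exists>n\<ge>m. map_option Not (\<kappa> n) = Some c"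
      by (intro exI[of _ n]) simp
  qed
  ultimately have "limit_state (\<lambda>n. prod.swap (r n)) \<in> E"
    by (rule run_wit[OF inn]) (simp add: r0)
  then have "prod.swap (limit_state (\<lambda>n. prod.swap (r n))) \<in> prod.swap ` E"
    by (rule imageI)
  then show "limit_state r \<in> prod.swap ` E"
    by (simp add: limit_state_def)
qed

text \<open>
  If only the second coordinate moves and the condition concerns only this coordinate, then the first node does not matter.
\<close>
lemma inn_right_only:
  assumes inn: "inn {True} {p. snd p \<in> B} (a, b)" and a: "a \<in> D" "a' \<in> D"
  shows "inn {True} {p. snd p \<in> B} (a', b)"
  unfolding inn_def
proof (intro exI conjI allI impI)
  let ?A = "wit {True} {p. snd p \<in> B} (a, b)"
  let ?B = "\<lambda>c s. {t. (a, snd t) \<in> ?A c (a, snd s)}"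
  show "tree {True} ?B"
    unfolding tree_def
  proof (intro ballI)
    fix c s assume c: "c \<in> {True}" and s: "s \<in> D \<times> D"
    then have "(a, snd s) \<in> D \<times> D"
      using a by auto
    then have "eventually (\<lambda>t. t \<in> ?A True (a, snd s)) (W True (a, snd s))"
      by (intro bspec[OF bspec[OF tree_wit[OF inn, unfolded tree_def]]]) simp_all
    then show "eventually (\<lambda>t. t \<in> ?B c s) (W c s)"
      using c by (simp add: eventually_W sel_def move_def)
  qed
  fix \<kappa> r assume r: "run {True} ?B \<kappa> r" and f: "fair {True} \<kappa>" and r0: "r 0 = (a', b)"
  have "run {True} ?A \<kappa> (\<lambda>n. (a, snd (r n)))"
  proof (rule runI)
    show "(a, snd (r 0)) \<in> D \<times> D"
      using run_mem[OF r, of 0] a by auto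
    show "(a, snd (r (Suc n))) = (a, snd (r n))" if "\<kappa> n = None" for n
      using run_None[OF r that] by simp
    fix n c assume "\<kappa> n = Some c"
    from run_Some[OF r this] show "c \<in> {True} \<and> step ?A c (a, snd (r n)) (a, snd (r (Suc n)))"
      using a by (auto simp: legal_move_def sel_def step_def mem_Times_iff)
  qed
  from run_wit[OF inn this f] have "limit_state (\<lambda>n. (a, snd (r n))) \<in> {p. snd p \<in> B}"
    by (simp add: r0)
  then show "limit_state r \<in> {p. snd p \<in> B}"
    by (simp add: limit_state_def)
qed

end

locale ultra_nodes = nodes +
  assumes U_ultra: "a \<in> D \<Longrightarrow> is_ultra (U a)"
    and U_idem: "a \<in> D \<Longrightarrow> eventually P (U a) \<Longrightarrow> eventually (\<lambda>b. eventually P (U b)) (U a)"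
begin

sublocale ultra_game "D \<times> D" W le_state legal_move limit_state
proof
  fix s c assume s: "s \<in> D \<times> D"
  show "is_ultra (W c s)"
    using U_ultra[OF sel_mem[OF s, of c]]
    unfolding is_ultra_def eventually_W by (simp add: W_def filtermap_bot_iff)
  fix P assume "eventually P (W c s)"
  then have "eventually (\<lambda>v. P (move c s v)) (U (sel c s))"
    by (simp add: eventually_W)
  from U_idem[OF sel_mem[OF s] this] show "eventually (\<lambda>t. eventually P (W c t)) (W c s)"
    by (simp add: eventually_W)
qed

text \<open>
  Cylinders are decided at every position; complements are trivial and countable unions are \<open>dec_Union\<close>.
\<close>
theorem dec_borel:
  assumes E: "borel_in (prod_topology cantor_space cantor_space) E"
    and "s \<in> D \<times> D" "c \<in> C"
  shows "eventually (dec C E) (W c s)"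
proof -
  have C: "c = d \<or> c = e \<or> d = e" for c d e :: bool
    by (cases c; cases d; cases e) simp_all
  have "\<forall>s\<in>D \<times> D. \<forall>c\<in>C. eventually (dec C E) (W c s)"
    using E unfolding borel_in_def
  proof (induction rule: sigma_sets.induct)
    case (Basic V)
    define cyl where "cyl p = {z. agree2 (fst p) (snd p) z}" for p
    define I where "I = {p \<in> UNIV \<times> (P_fin \<times> P_fin). cyl p \<subseteq> V}"
    have "countable I"
      unfolding I_def by (intro countable_subset[OF _ countable_SIGMA[OF countableI_type countable_SIGMA[OF countable_P_fin countable_P_fin]]]) auto
    define e where "e k = (if k \<in> to_nat_on I ` I then cyl (from_nat_into I k) else {})" for k
    have V: "V = (\<Union>k. e k)"
    proof -
      have "V = (\<Union>p\<in>I. cyl p)"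
      proof (intro equalityI subsetI)
        fix z assume z: "z \<in> V"
        have "openin (prod_topology cantor_space cantor_space) V"
          using Basic by simp
        then have "\<exists>k. \<forall>x' y'. agree k (fst z) x' \<longrightarrow> agree k (snd z) y' \<longrightarrow> (x', y') \<in> V"
          unfolding openin_cantor_square using z by (auto simp: case_prod_unfold)
        then obtain k where k: "\<And>x' y'. agree k (fst z) x' \<Longrightarrow> agree k (snd z) y' \<Longrightarrow> (x', y') \<in> V"
          by blast
        have "cyl (k, trunc k (fst z), trunc k (snd z)) \<subseteq> V"
        proof
          fix w assume "w \<in> cyl (k, trunc k (fst z), trunc k (snd z))"
          then have "agree k (fst z) (fst w)" "agree k (snd z) (snd w)"
            by (auto simp: cyl_def agree2_def agree_def trunc_def)
          from k[OF this] show "w \<in> V"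
            by simp
        qed
        then have "(k, trunc k (fst z), trunc k (snd z)) \<in> I"
          by (simp add: I_def)
        moreover have "z \<in> cyl (k, trunc k (fst z), trunc k (snd z))"
          by (simp add: cyl_def agree2_def)
        ultimately show "z \<in> (\<Union>p\<in>I. cyl p)"
          by blast
      next
        fix z assume "z \<in> (\<Union>p\<in>I. cyl p)"
        then show "z \<in> V"
          unfolding I_def by blast
      qed
      also have "\<dots> = (\<Union>k. e k)"
      proof (intro equalityI subsetI)
        fix z assume "z \<in> (\<Union>p\<in>I. cyl p)"
        then obtain p where p: "p \<in> I" "z \<in> cyl p"
          by blast
        then have "z \<in> e (to_nat_on I p)"
          using \<open>countable I\<close> by (simp add: e_def)
        then show "z \<in> (\<Union>k. e k)"
          by blast
      next
        fix z assume "z \<in> (\<Union>k. e k)"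
        then obtain k where "z \<in> e k"
          by blast
        then obtain p where "p \<in> I" "z \<in> cyl p"
          using \<open>countable I\<close> by (auto simp: e_def split: if_splits)
        then show "z \<in> (\<Union>p\<in>I. cyl p)"
          by blast
      qed
      finally show ?thesis .
    qed
    have cl: "agree2 j p z \<longleftrightarrow> agree2 j p s" if "agree2 j s z" for j p s z
      using that agree_trans agree_sym unfolding agree2_def by blast
    have "dec C (e k) s" for k s
    proof (cases "s \<in> e k")
      case True
      have "z \<in> e k" if "agree2 (fst (from_nat_into I k)) s z" for z
        using cl[OF that] True unfolding e_def cyl_def by (simp split: if_splits)
      then show ?thesis
        unfolding dec_def using inn_agree2 by blast
    next
      case False
      have "z \<in> - e k" if "agree2 (fst (from_nat_into I k)) s z" for z
        using cl[OF that] False unfolding e_def cyl_def by (simp split: if_splits)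
      then show ?thesis
        unfolding dec_def using inn_agree2 by blast
    qed
    then have "eventually (dec C (e k)) (W c s)" for k c s
      by (intro always_eventually) simp
    then show ?case
      unfolding V by (intro ballI dec_Union C)
  next
    case Empty
    have "dec C {} s" for s
      unfolding dec_def using inn_agree2[of 0 s "- {}"] by simp
    then show ?case
      by simp
  next
    case (Compl E)
    then show ?case
      by (simp add: dec_Compl flip: Compl_eq_Diff_UNIV)
  next
    case (Union E)
    then show ?case
      by (intro ballI dec_Union C) blast+
  qed
  then show ?thesis
    using assms by blast
qed

lemma dec_section:
  assumes "borel_in (prod_topology cantor_space cantor_space) E" "s \<in> D \<times> D"
  shows "inn {c} E s \<or> inn {c} (- E) s"
proof -
  have "eventually (\<lambda>t. inn {c} E t \<or> inn {c} (- E) t) (W c s)"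
    using dec_borel[OF assms, of c "{c}"] unfolding dec_def by simp
  moreover have "inn {c} F s" if "eventually (inn {c} F) (W c s)" for F
    using that by (intro inn_all) simp_all
  ultimately show ?thesis
    using ultra_disj[OF W_ultra[OF assms(2)]] by blast
qed

end

definition near :: "cantor \<Rightarrow> cantor filter" where
  "near a = (INF k. principal {b \<in> P_fin. b \<noteq> a \<and> agree k a b})"

lemma eventually_near:
  "eventually P (near a) \<longleftrightarrow> (\<exists>k. \<forall>b\<in>P_fin. b \<noteq> a \<longrightarrow> agree k a b \<longrightarrow> P b)"
proof -
  have "eventually P (near a) \<longleftrightarrow> (\<exists>k\<in>UNIV. eventually P (principal {b \<in> P_fin. b \<noteq> a \<and> agree k a b}))"
    unfolding near_def
  proof (rule eventually_INF_base)
    fix j k :: nat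
    have "{b \<in> P_fin. b \<noteq> a \<and> agree (max j k) a b} \<subseteq> {b \<in> P_fin. b \<noteq> a \<and> agree j a b} \<inter> {b \<in> P_fin. b \<noteq> a \<and> agree k a b}"
      by (auto simp: agree_def)
    then show "\<exists>x\<in>UNIV. principal {b \<in> P_fin. b \<noteq> a \<and> agree x a b}
        \<le> inf (principal {b \<in> P_fin. b \<noteq> a \<and> agree j a b}) (principal {b \<in> P_fin. b \<noteq> a \<and> agree k a b})"
      by (intro bexI[of _ "max j k"]) simp_all
  qed simp
  then show ?thesis
    by (simp add: eventually_principal Ball_def imp_conjL)
qed

lemma near_proper: "a \<in> P_fin \<Longrightarrow> near a \<noteq> bot"
proof
  assume a: "a \<in> P_fin" and "near a = bot"
  then have "eventually (\<lambda>_. False) (near a)"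
    by simp
  then obtain k where k: "\<And>b. b \<in> P_fin \<Longrightarrow> b \<noteq> a \<Longrightarrow> agree k a b \<Longrightarrow> False"
    unfolding eventually_near by blast
  define m where "m = max k (len a)"
  let ?b = "a(m := True)"
  have "?b \<in> P_fin"
    unfolding P_fin_iff by (rule exI[of _ "Suc m"]) (use beyond_len[OF a] in \<open>simp add: m_def\<close>)
  moreover have "?b \<noteq> a"
    using beyond_len[OF a, of m] by (auto simp: fun_eq_iff m_def)
  moreover have "agree k a ?b"
    by (simp add: agree_def m_def)
  ultimately show False
    by (rule k)
qed

lemma ultra_nodes_exist: "\<exists>U. ultra_nodes P_fin U"
proof -
  define F0 where "F0 a = (if a \<in> P_fin then near a else principal {a})" for a
  have "idem_family F0"
    unfolding idem_family_def
  proof (intro allI impI)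
    fix a P assume P: "eventually P (F0 a)"
    show "eventually (\<lambda>b. eventually P (F0 b)) (F0 a)"
    proof (cases "a \<in> P_fin")
      case False
      then show ?thesis
        using P by (simp add: F0_def eventually_principal)
    next
      case True
      then obtain k where k: "\<And>b. b \<in> P_fin \<Longrightarrow> b \<noteq> a \<Longrightarrow> agree k a b \<Longrightarrow> P b"
        using P unfolding F0_def by (auto simp: eventually_near)
      have "eventually P (near b)" if b: "b \<in> P_fin" "b \<noteq> a" "agree k a b" for b
      proof -
        obtain i where i: "b i \<noteq> a i"
          using b(2) by (auto simp: fun_eq_iff)
        have "P c" if "c \<in> P_fin" "agree (max k (Suc i)) b c" for c
        proof (rule k[OF that(1)])
          show "c \<noteq> a"
            using that(2) i by (auto simp: agree_def)
          show "agree k a c"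
            using agree_trans[OF b(3)] agree_mono[OF that(2), of k] by simp
        qed
        then show ?thesis
          unfolding eventually_near by blast
      qed
      then have "eventually (\<lambda>b. b \<in> P_fin \<and> eventually P (near b)) (near a)"
        unfolding eventually_near[of _ a] by blast
      then have "eventually (\<lambda>b. eventually P (F0 b)) (near a)"
        by (rule eventually_mono) (simp add: F0_def)
      then show ?thesis
        using True by (simp add: F0_def)
    qed
  qed
  moreover have "F0 a \<noteq> bot" for a
    using near_proper by (simp add: F0_def principal_eq_bot_iff)
  ultimately obtain U where U: "idem_family U" "\<And>a. U a \<le> F0 a" "\<And>a. is_ultra (U a)"
    using finer_idempotent_ultra_family[of F0] by blast
  have "ultra_nodes P_fin U"
  proof
    fix a k assume a: "a \<in> P_fin"
    have "eventually (\<lambda>b. b \<in> P_fin \<and> b \<noteq> a \<and> agree k a b) (near a)"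
      unfolding eventually_near by blast
    then show "eventually (\<lambda>b. b \<in> P_fin \<and> b \<noteq> a \<and> agree k a b) (U a)"
      using filter_leD[OF U(2)[of a]] a by (simp add: F0_def)
  next
    fix a P assume "eventually P (U a)"
    then show "eventually (\<lambda>b. eventually P (U b)) (U a)"
      using U(1) by (simp add: idem_family_def)
  qed (use U(3) in \<open>auto simp: is_ultra_def\<close>)
  then show ?thesis
    by (intro exI[of _ U])
qed

text \<open>
  The dichotomy is applied for each set \<open>C\<close> of moving colours. For both colours, \<open>inn_two_two\<close> excludes the positive
  case. For the second colour alone, \<open>inn_two_sections\<close> allows for a node \<open>b\<close> and each \<open>k\<close> at most one
  node \<open>a\<close> with almost all limits above \<open>b\<close> related to \<open>a\<close>; there is a set of nodes \<open>b\<close>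
  with the same exceptional nodes \<open>a\<close>, closed under almost all moves, and these exceptions are deleted. For the first
  colour alone one uses the converse relations. For no colour the relations are empty on \<open>P_fin\<close> by
  hypothesis. Then \<open>fusion\<close> applies. The sets \<open>B l\<close> only concern one limit; they are
  decided at a fixed node, and made constant by the same fusion.
\<close>
theorem thin_free:
  fixes \<rho> :: "'k::finite \<Rightarrow> (cantor \<times> cantor) set" and B :: "'l::finite \<Rightarrow> cantor set"
  assumes borel: "\<And>k. borel_in (prod_topology cantor_space cantor_space) (\<rho> k)"
    and borelB: "\<And>l. borel_in cantor_space (B l)"
    and conv: "\<And>k. \<exists>k'. \<rho> k' = prod.swap ` \<rho> k"
    and K22: "\<And>k x x' y y'. distinct [x, x', y, y'] \<Longrightarrow> (x, y) \<in> \<rho> k \<Longrightarrow> (x, y') \<in> \<rho> k \<Longrightarrow> (x', y) \<in> \<rho> k \<Longrightarrow>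
        (x', y') \<in> \<rho> k \<Longrightarrow> False"
    and QQ: "\<And>k x y. x \<in> P_fin \<Longrightarrow> y \<in> P_fin \<Longrightarrow> x \<noteq> y \<Longrightarrow> (x, y) \<notin> \<rho> k"
  obtains g where "\<And>n x y. agree n x y \<Longrightarrow> agree n (g x) (g y)" "inj g"
    "\<And>x. x \<in> P_fin \<Longrightarrow> g x \<in> P_fin" "\<And>x. x \<in> P_inf \<Longrightarrow> g x \<in> P_inf"
    "\<And>k x y. x \<noteq> y \<Longrightarrow> (g x, g y) \<notin> \<rho> k"
    "\<And>l. (\<forall>x\<in>P_inf. g x \<in> B l) \<or> (\<forall>x\<in>P_inf. g x \<notin> B l)"
proof -
  obtain U where "ultra_nodes P_fin U"
    using ultra_nodes_exist by blast
  then interpret ultra_nodes P_fin U .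
  have both: "eventually (inn UNIV (- \<rho> k)) (W c s)" if s: "s \<in> P_fin \<times> P_fin" for k c s
  proof -
    have "\<not> inn UNIV (\<rho> k) t" if t: "t \<in> P_fin \<times> P_fin" for t
    proof
      assume "inn UNIV (\<rho> k) t"
      then have "inn UNIV (\<rho> k) (fst t, snd t)"
        by simp
      then obtain x x' y y' where "distinct [x, x', y, y']" "(x, y) \<in> \<rho> k" "(x, y') \<in> \<rho> k" "(x', y) \<in> \<rho> k" "(x', y') \<in> \<rho> k"
        by (rule inn_two_two) (use t in auto)
      then show False
        by (rule K22)
    qed
    then have "eventually (\<lambda>t. t \<in> P_fin \<times> P_fin \<longrightarrow> inn UNIV (- \<rho> k) t) (W c s)"
      using dec_borel[OF borel s, of c UNIV k] unfolding dec_def by (auto elim: eventually_mono)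
    with W_legal[OF s, of c] show ?thesis
      by eventually_elim simp
  qed
  define Bd where "Bd b = {(k, a). a \<in> P_fin \<and> inn {True} (\<rho> k) (a, b)}" for b
  have uniq: "a = a'" if "(k, a) \<in> Bd b" "(k, a') \<in> Bd b" and b: "b \<in> P_fin" for k a a' b
  proof (rule ccontr)
    assume ne: "a \<noteq> a'"
    have *: "inn {True} (\<rho> k) (a, b)" "inn {True} (\<rho> k) (a', b)" "a \<in> P_fin" "a' \<in> P_fin"
      using that by (auto simp: Bd_def)
    obtain y y' where y: "y \<noteq> y'" "y \<in> P_inf" "y' \<in> P_inf" "(a, y) \<in> \<rho> k" "(a, y') \<in> \<rho> k" "(a', y) \<in> \<rho> k" "(a', y') \<in> \<rho> k"
      by (rule inn_two_sections[OF * b])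
    then have "distinct [a, a', y, y']"
      using ne *(3,4) by (auto simp: P_fin_def)
    then show False
      by (rule K22) (use y in auto)
  qed
  have inj_fst: "inj_on fst (Bd b)" if "b \<in> P_fin" for b
    by (rule inj_onI) (use uniq[OF _ _ that] in auto)
  have finBd: "finite (Bd b)" if "b \<in> P_fin" for b
    by (rule inj_on_finite[OF inj_fst[OF that], of UNIV]) simp_all
  have cardBd: "card (Bd b) \<le> card (UNIV :: 'k set)" if "b \<in> P_fin" for b
    by (rule card_inj_on_le[OF inj_fst[OF that]]) simp_all
  \<comment> \<open>With the largest number of exceptions: exceptions persist under almost all moves, so by
    maximality almost all moves from such a node lead to a node with exactly the same exceptions.\<close>
  obtain b0 where b0: "b0 \<in> P_fin" "\<And>b. b \<in> P_fin \<Longrightarrow> card (Bd b) \<le> card (Bd b0)"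
  proof -
    have "\<exists>b. b \<in> P_fin \<and> (\<forall>b'. b' \<in> P_fin \<longrightarrow> card (Bd b') \<le> card (Bd b))"
      by (rule ex_has_greatest_nat[of _ zeros _ "Suc (card (UNIV :: 'k set))"])
        (use cardBd in \<open>auto simp: less_Suc_eq_le\<close>)
    then show ?thesis
      using that by blast
  qed
  define D1 where "D1 = {b \<in> P_fin. Bd b = Bd b0 \<and> b \<notin> snd ` Bd b0}"
  have pers: "eventually (\<lambda>b'. b' \<in> D1) (U b)" if b: "b \<in> P_fin" "Bd b = Bd b0" for b
  proof -
    have "eventually (\<lambda>b'. \<forall>p\<in>Bd b0. p \<in> Bd b') (U b)"
    proof (intro eventually_ball_finite finBd[OF b0(1)] ballI)
      fix p assume "p \<in> Bd b0"
      then have p: "snd p \<in> P_fin" "inn {True} (\<rho> (fst p)) (snd p, b)"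
        using b(2) by (auto simp: Bd_def)
      then have "eventually (inn {True} (\<rho> (fst p))) (W True (snd p, b))"
        using b by (intro inn_persist) auto
      then show "eventually (\<lambda>b'. p \<in> Bd b') (U b)"
        using p by (simp add: Bd_def case_prod_unfold eventually_W sel_def move_def)
    qed
    moreover have "eventually (\<lambda>b'. \<forall>f\<in>snd ` Bd b0. b' \<noteq> f) (U b)"
      using finBd[OF b0(1)] eventually_neq[OF b(1)] by (intro eventually_ball_finite) auto
    moreover have "eventually (\<lambda>b'. b' \<in> P_fin \<and> b' \<noteq> b \<and> agree 0 b b') (U b)"
      by (rule U_near[OF b(1)])
    ultimately show ?thesis
    proof eventually_elim
      fix b' assume b': "\<forall>p\<in>Bd b0. p \<in> Bd b'" "\<forall>f\<in>snd ` Bd b0. b' \<noteq> f" "b' \<in> P_fin \<and> b' \<noteq> b \<and> agree 0 b b'"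
      then have "Bd b0 = Bd b'"
        using b0(2) finBd by (intro card_seteq) auto
      then show "b' \<in> D1"
        using b' by (auto simp: D1_def)
    qed
  qed
  have D1: "D1 \<subseteq> P_fin" "\<And>b. b \<in> D1 \<Longrightarrow> eventually (\<lambda>b'. b' \<in> D1) (U b)"
    using pers by (auto simp: D1_def)
  obtain b1 where b1: "b1 \<in> D1"
    using eventually_happens'[OF U_proper[OF b0(1)] pers[OF b0(1) refl]] by blast
  have right: "inn {True} (- \<rho> k) s" if s: "s \<in> D1 \<times> D1" for k s
  proof -
    obtain a b where ab: "s = (a, b)" "a \<in> D1" "b \<in> D1"
      using s by blast
    then have fin: "a \<in> P_fin" "b \<in> P_fin"
      using D1 by auto
    have "(k, a) \<notin> Bd b"
    proof
      assume "(k, a) \<in> Bd b"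
      then have "(k, a) \<in> Bd b0"
        using ab by (simp add: D1_def)
      then have "snd (k, a) \<in> snd ` Bd b0"
        by (rule imageI)
      then show False
        using ab by (simp add: D1_def)
    qed
    then have "\<not> inn {True} (\<rho> k) s"
      using fin ab by (simp add: Bd_def)
    then show ?thesis
      using dec_section[OF borel, of s True k] fin ab by auto
  qed
  have left: "inn {False} (- \<rho> k) s" if s: "s \<in> D1 \<times> D1" for k s
  proof -
    obtain a b where ab: "s = (a, b)" "(b, a) \<in> D1 \<times> D1"
      using s by blast
    obtain k' where k': "\<rho> k' = prod.swap ` \<rho> k"
      using conv by blast
    have "inn {c. (\<not> c) \<in> {True}} (prod.swap ` (- \<rho> k')) (a, b)"
      by (rule inn_swap[OF right[OF ab(2)]])
    moreover have sw: "(u, v) \<in> prod.swap ` Y \<longleftrightarrow> (v, u) \<in> Y" for u v and Y :: "(cantor \<times> cantor) set"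
      by force
    have "prod.swap ` (- \<rho> k') = - \<rho> k"
      unfolding k' by (rule set_eqI) (simp add: sw split_paired_all)
    moreover have "{c. (\<not> c) \<in> {True}} = {False}"
      by auto
    ultimately show ?thesis
      using ab by simp
  qed
  have none: "eventually (inn {} (- \<rho> k)) (W c s)" if s: "s \<in> D1 \<times> D1" for k c s
  proof -
    have sP: "s \<in> P_fin \<times> P_fin"
      using s D1 by auto
    have "eventually (\<lambda>v. v \<noteq> sel (\<not> c) s) (U (sel c s))"
      by (rule eventually_neq[OF sel_mem[OF sP]])
    with U_near[OF sel_mem[OF sP], of c 0] show ?thesis
      unfolding eventually_W
    proof eventually_elim
      fix v assume v: "v \<in> P_fin \<and> v \<noteq> sel c s \<and> agree 0 (sel c s) v" "v \<noteq> sel (\<not> c) s"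
      then have "move c s v \<notin> \<rho> k"
        using QQ[of v "snd s" k] QQ[of "fst s" v k] sP by (cases c) (auto simp: move_def sel_def)
      then show "inn {} (- \<rho> k) (move c s v)"
        by (intro inn_empty) simp
    qed
  qed
  define E where "E l = {p :: state. snd p \<in> B l}" for l
  have borelE: "borel_in (prod_topology cantor_space cantor_space) (E l)" for l
    using borel_in_continuous_preimage[OF continuous_map_snd borelB[of l], of cantor_space]
    by (simp add: E_def)
  \<comment> \<open>\<open>F l\<close> is the alternative to be avoided.\<close>
  define F where "F l = (if inn {True} (E l) (b1, b1) then - E l else E l)" for l
  have F: "inn {True} (- F l) (b1, b1)" for l
    using dec_section[OF borelE, of "(b1, b1)" True l] b1 D1(1) by (auto simp: F_def)
  have Fany: "inn {True} (- F l) (a', b)" if "inn {True} (- F l) (a, b)" "a \<in> P_fin" "a' \<in> P_fin" for l a a' b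
  proof -
    define B' where "B' = (if inn {True} (E l) (b1, b1) then B l else - B l)"
    have eq: "- F l = {p. snd p \<in> B'}"
      by (auto simp: F_def E_def B'_def)
    show ?thesis
      using that unfolding eq by (rule inn_right_only)
  qed
  define D2 where "D2 = {b \<in> D1. \<forall>l. inn {True} (- F l) (b1, b)}"
  have D2: "D2 \<subseteq> P_fin" "D2 \<noteq> {}"
    using D1 b1 F by (auto simp: D2_def)
  have D2pers: "eventually (\<lambda>b'. b' \<in> D2) (U b)" if b: "b \<in> D2" for b
  proof -
    have bP: "(b1, b) \<in> P_fin \<times> P_fin"
      using b b1 D1 by (auto simp: D2_def)
    have "eventually (\<lambda>b'. inn {True} (- F l) (b1, b')) (U b)" for l
    proof -
      have "eventually (inn {True} (- F l)) (W True (b1, b))"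
        using b by (intro inn_persist[OF _ bP]) (auto simp: D2_def)
      then show ?thesis
        by (simp add: eventually_W sel_def move_def)
    qed
    then have "eventually (\<lambda>b'. \<forall>l. inn {True} (- F l) (b1, b')) (U b)"
      by (rule eventually_all_finite)
    moreover have "eventually (\<lambda>b'. b' \<in> D1) (U b)"
      using b D1(2) by (simp add: D2_def)
    ultimately show ?thesis
      by eventually_elim (simp add: D2_def)
  qed
  have ev2: "eventually (\<lambda>t. t \<in> D2 \<times> D2) (W c s)" if s: "s \<in> D2 \<times> D2" for c s
    unfolding eventually_W using D2pers[OF sel_mem[OF s]] by (rule eventually_mono) (rule move_mem[OF s])
  have sets: "C = {} \<or> C = {True} \<or> C = {False} \<or> C = UNIV" for C :: "bool set"
  proof -
    have "C \<in> Pow {False, True}"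
      by auto
    then show ?thesis
      unfolding UNIV_bool by (simp add: Pow_insert insert_commute) blast
  qed
  define H where "H = (\<lambda>(C, k). (C, \<rho> k)) ` UNIV \<union> (\<lambda>l. ({True}, F l)) ` UNIV"
  have "finite H"
    by (simp add: H_def)
  have out: "eventually (inn C (- E')) (W c s)" if H: "(C, E') \<in> H" and s: "s \<in> D2 \<times> D2" for C E' c s
  proof -
    have sD: "s \<in> D1 \<times> D1" "s \<in> P_fin \<times> P_fin"
      using s D2 by (auto simp: D2_def)
    consider k where "E' = \<rho> k" | l where "C = {True}" "E' = F l"
      using H by (auto simp: H_def)
    then show ?thesis
    proof cases
      case 1
      have "eventually (inn {True} (- \<rho> k)) (W c s)" "eventually (inn {False} (- \<rho> k)) (W c s)"
        using ev2[OF s, of c] by (rule eventually_mono; use left right in \<open>auto simp: D2_def\<close>)+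
      then show ?thesis
        unfolding 1 using sets[of C] none[OF sD(1)] both[OF sD(2)] by blast
    next
      case 2
      show ?thesis
        using ev2[OF s, of c]
      proof (rule eventually_mono)
        fix t assume "t \<in> D2 \<times> D2"
        then have t: "fst t \<in> P_fin" "inn {True} (- F l) (b1, snd t)"
          using D2 by (auto simp: D2_def)
        have "inn {True} (- F l) (fst t, snd t)"
          by (rule Fany[OF t(2) _ t(1)]) (use b1 D1 in auto)
        then show "inn C (- E') t"
          using 2 by simp
      qed
    qed
  qed
  obtain g where g: "\<And>n x y. agree n x y \<Longrightarrow> agree n (g x) (g y)" "inj g"
    "\<And>x. x \<in> P_fin \<Longrightarrow> g x \<in> D2" "\<And>x. x \<in> P_inf \<Longrightarrow> g x \<in> P_inf"
    "\<And>C E x y. (C, E) \<in> H \<Longrightarrow> x \<noteq> y \<Longrightarrow> C = {c. if c then y \<in> P_inf else x \<in> P_inf} \<Longrightarrow> (g x, g y) \<notin> E"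
    by (rule fusion[OF D2 D2pers \<open>finite H\<close> out]) blast+
  show ?thesis
  proof (rule that[of g])
    fix k x y assume ne: "x \<noteq> (y :: cantor)"
    have "({c. if c then y \<in> P_inf else x \<in> P_inf}, \<rho> k) \<in> H"
      unfolding H_def by (intro UnI1 image_eqI[of _ _ "({c. if c then y \<in> P_inf else x \<in> P_inf}, k)"]) simp_all
    from g(5)[OF this ne refl] show "(g x, g y) \<notin> \<rho> k" .
  next
    fix l
    \<comment> \<open>A fixed point of \<open>P_fin\<close> as first coordinate turns a statement about one
      limit into one about pairs in which only the second coordinate moves.\<close>
    have "(g zeros, g y) \<notin> F l" if "y \<in> P_inf" for y
    proof (rule g(5))
      show "({True}, F l) \<in> H"
        by (simp add: H_def)
      have z: "zeros \<notin> P_inf"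
        using zeros_P_fin by (simp add: P_fin_def)
      then show "zeros \<noteq> y"
        using that by auto
      show "{True} = {c. if c then y \<in> P_inf else zeros \<in> P_inf}"
        using that z by auto
    qed
    then have F': "(g zeros, g y) \<notin> F l" if "y \<in> P_inf" for y
      using that .
    show "(\<forall>x\<in>P_inf. g x \<in> B l) \<or> (\<forall>x\<in>P_inf. g x \<notin> B l)"
    proof (cases "inn {True} (E l) (b1, b1)")
      case True
      then have "F l = - E l"
        by (simp add: F_def)
      then show ?thesis
        using F' by (simp add: E_def)
    next
      case False
      then have "F l = E l"
        by (simp add: F_def)
      then show ?thesis
        using F' by (simp add: E_def)
    qed
  next
    fix x assume "x \<in> P_fin"
    then show "g x \<in> P_fin"
      using g(3)[of x] D2(1) by blast
  next
    show "agree n (g x) (g y)" if "agree n x y" for n x y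
      using that by (rule g(1))
    show "inj g"
      by (rule g(2))
    show "g x \<in> P_inf" if "x \<in> P_inf" for x
      using that by (rule g(4))
  qed
qed

section \<open>Normal form on the eventually zero sequences\<close>

definition crowded :: "cantor set \<Rightarrow> bool" where
  "crowded D \<longleftrightarrow> D \<subseteq> P_fin \<and> D \<noteq> {} \<and> (\<forall>q\<in>D. \<forall>k. \<exists>z\<in>D. z \<noteq> q \<and> agree k q z)"

definition nwd :: "cantor set \<Rightarrow> cantor set \<Rightarrow> bool" where
  "nwd D M \<longleftrightarrow> (\<forall>q\<in>D. \<forall>k. \<exists>z\<in>D. agree k q z \<and> (\<exists>j. \<forall>w\<in>D. agree j z w \<longrightarrow> w \<notin> M))"

text \<open>
  \<open>D'\<close> is a dense subset of a nonempty relatively open subset of \<open>D\<close>; then nowhere dense subsets of \<open>D\<close> remain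
  nowhere dense in \<open>D'\<close>.
\<close>
definition refines :: "cantor set \<Rightarrow> cantor set \<Rightarrow> bool" where
  "refines D' D \<longleftrightarrow> crowded D' \<and> D' \<subseteq> D \<and>
     (\<exists>q\<in>D. \<exists>k. (\<forall>z\<in>D'. agree k q z) \<and> (\<forall>z\<in>D. agree k q z \<longrightarrow> (\<forall>j. \<exists>w\<in>D'. agree j z w)))"

lemma nwdD:
  assumes "nwd D M" "q \<in> D"
  obtains z j where "z \<in> D" "agree k q z" "\<And>w. w \<in> D \<Longrightarrow> agree j z w \<Longrightarrow> w \<notin> M"
  using assms unfolding nwd_def by blast

lemma nwd_mono: "nwd D M \<Longrightarrow> N \<inter> D \<subseteq> M \<Longrightarrow> nwd D N"
  unfolding nwd_def by (meson IntI subsetD)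

lemma agree_max: "agree (max j k) x y \<longleftrightarrow> agree j x y \<and> agree k x y"
  unfolding agree_def less_max_iff_disj by blast

lemma nwd_Un:
  assumes "nwd D M" "nwd D N"
  shows "nwd D (M \<union> N)"
  unfolding nwd_def
proof (intro ballI allI)
  fix q k assume "q \<in> D"
  then obtain z j where z: "z \<in> D" "agree k q z" "\<And>w. w \<in> D \<Longrightarrow> agree j z w \<Longrightarrow> w \<notin> M"
    using nwdD[OF assms(1), of q k] by metis
  obtain z' j' where z': "z' \<in> D" "agree (max k j) z z'" "\<And>w. w \<in> D \<Longrightarrow> agree j' z' w \<Longrightarrow> w \<notin> N"
    using nwdD[OF assms(2) z(1), of "max k j"] by metis
  show "\<exists>z\<in>D. agree k q z \<and> (\<exists>j. \<forall>w\<in>D. agree j z w \<longrightarrow> w \<notin> M \<union> N)"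
  proof (intro bexI[of _ z'] conjI exI[of _ "max j j'"] ballI impI)
    show "agree k q z'"
      using agree_trans[OF z(2)] z'(2) by (simp add: agree_max)
    fix w assume w: "w \<in> D" "agree (max j j') z' w"
    then have "agree j z w"
      using z'(2) agree_trans by (auto simp: agree_max)
    then show "w \<notin> M \<union> N"
      using z(3) z'(3) w by (simp add: agree_max)
  qed fact
qed

lemma nwd_single:
  assumes "crowded D"
  shows "nwd D {a}"
  unfolding nwd_def
proof (intro ballI allI)
  fix q k assume "q \<in> D"
  have "\<exists>z\<in>D. z \<noteq> a \<and> agree k q z"
  proof (cases "q = a")
    case True
    then show ?thesis
      using assms \<open>q \<in> D\<close> unfolding crowded_def by blast
  next
    case False
    then show ?thesis
      using \<open>q \<in> D\<close> by (intro bexI[of _ q]) auto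
  qed
  then obtain z where z: "z \<in> D" "z \<noteq> a" "agree k q z"
    by blast
  obtain i where "z i \<noteq> a i"
    using z(2) by (auto simp: fun_eq_iff)
  then have "w \<notin> {a}" if "agree (Suc i) z w" for w
    using that by (auto simp: agree_def)
  then show "\<exists>z\<in>D. agree k q z \<and> (\<exists>j. \<forall>w\<in>D. agree j z w \<longrightarrow> w \<notin> {a})"
    using z by blast
qed

lemma not_nwd_ball: "a \<in> D \<Longrightarrow> \<not> nwd D {z. agree k a z}"
proof
  assume a: "a \<in> D" and "nwd D {z. agree k a z}"
  then obtain z j where "z \<in> D" "agree k a z" "\<And>w. w \<in> D \<Longrightarrow> agree j z w \<Longrightarrow> w \<notin> {z. agree k a z}"
    using nwdD[OF _ a, of "{z. agree k a z}" k] by metis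
  then show False
    using agree_refl by blast
qed

lemma nwd_refine:
  assumes "refines D' D" "nwd D M"
  shows "nwd D' M"
proof -
  obtain q0 k0 where D': "D' \<subseteq> D" "\<And>z. z \<in> D' \<Longrightarrow> agree k0 q0 z"
    "\<And>z j. z \<in> D \<Longrightarrow> agree k0 q0 z \<Longrightarrow> \<exists>w\<in>D'. agree j z w"
    using assms(1) unfolding refines_def by blast
  show ?thesis
    unfolding nwd_def
  proof (intro ballI allI)
    fix q k assume q: "q \<in> D'"
    then obtain z j where z: "z \<in> D" "agree (max k k0) q z" "\<And>w. w \<in> D \<Longrightarrow> agree j z w \<Longrightarrow> w \<notin> M"
      using nwdD[OF assms(2), of q "max k k0"] D'(1) by (metis subsetD)
    have "agree k0 q0 z"
      using D'(2)[OF q] z(2) agree_trans by (auto simp: agree_max)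
    then obtain w where w: "w \<in> D'" "agree (max j k) z w"
      using D'(3)[OF z(1)] by blast
    show "\<exists>z\<in>D'. agree k q z \<and> (\<exists>j. \<forall>w\<in>D'. agree j z w \<longrightarrow> w \<notin> M)"
    proof (intro bexI[of _ w] conjI exI[of _ j] ballI impI)
      show "agree k q w"
        using z(2) w(2) agree_trans by (auto simp: agree_max)
      fix u assume u: "u \<in> D'" "agree j w u"
      then have "agree j z u"
        using w(2) agree_trans by (auto simp: agree_max)
      then show "u \<notin> M"
        using z(3) u(1) D'(1) by blast
    qed fact
  qed
qed

text \<open>
  A set which is not nowhere dense is dense in some ball, and stays so when a nowhere dense set is removed.
\<close>
lemma refine_inside:
  assumes D: "crowded D" and M: "\<not> nwd D M" and N: "nwd D N"
  obtains D' where "refines D' D" "D' \<subseteq> M" "D' \<inter> N = {}"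
proof -
  obtain q k where q: "q \<in> D" "\<And>z j. z \<in> D \<Longrightarrow> agree k q z \<Longrightarrow> \<exists>w\<in>D. agree j z w \<and> w \<in> M"
    using M unfolding nwd_def by blast
  define D' where "D' = {z \<in> D. agree k q z \<and> z \<in> M \<and> z \<notin> N}"
  have dense: "\<exists>w\<in>D'. agree j z w" if z: "z \<in> D" "agree k q z" for z j
  proof -
    obtain u i where u: "u \<in> D" "agree (max j k) z u" "\<And>w. w \<in> D \<Longrightarrow> agree i u w \<Longrightarrow> w \<notin> N"
      using nwdD[OF N z(1), of "max j k"] by metis
    have "agree k q u"
      using z(2) u(2) agree_trans by (auto simp: agree_max)
    then obtain w where w: "w \<in> D" "agree (max i (max j k)) u w" "w \<in> M"
      using q(2)[OF u(1), of "max i (max j k)"] by blast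
    have uw: "agree i u w" "agree j u w" "agree k u w" and zu: "agree j z u"
      using w(2) u(2) by (simp_all add: agree_max)
    have "agree k q w" "agree j z w"
      by (rule agree_trans[OF \<open>agree k q u\<close> uw(3)], rule agree_trans[OF zu uw(2)])
    then have "w \<in> D'"
      using w(1,3) u(3)[OF w(1) uw(1)] by (simp add: D'_def)
    then show ?thesis
      using \<open>agree j z w\<close> by blast
  qed
  have "crowded D'"
    unfolding crowded_def
  proof (intro conjI ballI allI)
    show "D' \<subseteq> P_fin"
      using D by (auto simp: D'_def crowded_def)
    show "D' \<noteq> {}"
      using dense[OF q(1) agree_refl] by blast
    fix z j assume z: "z \<in> D'"
    then have zD: "z \<in> D" "agree k q z"
      by (auto simp: D'_def)
    obtain u where u: "u \<in> D" "u \<noteq> z" "agree (max j k) z u"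
      using D zD(1) unfolding crowded_def by blast
    obtain i where i: "u i \<noteq> z i"
      using u(2) by (auto simp: fun_eq_iff)
    have "agree k q u"
      using zD(2) u(3) agree_trans by (auto simp: agree_max)
    then obtain w where w: "w \<in> D'" "agree (max (Suc i) j) u w"
      using dense[OF u(1)] by blast
    have "w \<noteq> z"
      using w(2) i by (auto simp: agree_def)
    moreover have "agree j z w"
      using u(3) w(2) agree_trans by (auto simp: agree_max)
    ultimately show "\<exists>w\<in>D'. w \<noteq> z \<and> agree j z w"
      using w(1) by blast
  qed
  moreover have "\<forall>z\<in>D'. agree k q z"
    by (simp add: D'_def)
  moreover have "D' \<subseteq> D"
    by (auto simp: D'_def)
  ultimately have "refines D' D"
    unfolding refines_def using q(1) dense by blast
  then show ?thesis
    by (rule that) (auto simp: D'_def)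
qed

lemma crowded_not_nwd: "crowded D \<Longrightarrow> D \<subseteq> M \<Longrightarrow> \<not> nwd D M"
proof
  assume "crowded D" "D \<subseteq> M" "nwd D M"
  then obtain q where q: "q \<in> D"
    unfolding crowded_def by blast
  obtain z j where "z \<in> D" "\<And>w. w \<in> D \<Longrightarrow> agree j z w \<Longrightarrow> w \<notin> M"
    using nwdD[OF \<open>nwd D M\<close> q, of 0] by metis
  then show False
    using \<open>D \<subseteq> M\<close> agree_refl by blast
qed

lemma nwd_empty: "nwd D {}"
  unfolding nwd_def using agree_refl by blast

lemma refine_ball: "crowded D \<Longrightarrow> q \<in> D \<Longrightarrow> \<exists>D'. refines D' D \<and> (\<forall>z\<in>D'. agree k q z)"
  using refine_inside[OF _ not_nwd_ball nwd_empty, of D q k] by (metis mem_Collect_eq subsetD)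

lemma refines_crowded: "refines D' D \<Longrightarrow> crowded D'"
  by (simp add: refines_def)

lemma refines_subset: "refines D' D \<Longrightarrow> D' \<subseteq> D"
  by (simp add: refines_def)

lemma refines_some: "crowded D \<Longrightarrow> \<exists>D'. refines D' D"
  using refine_ball by (metis all_not_in_conv crowded_def)

lemma refine_finitely_many:
  assumes "finite S" "crowded D" "Q D"
    and Q: "\<And>D D'. Q D \<Longrightarrow> refines D' D \<Longrightarrow> Q D'"
    and her: "\<And>p D D'. p \<in> S \<Longrightarrow> crowded D \<Longrightarrow> Q D \<Longrightarrow> p D \<Longrightarrow> refines D' D \<Longrightarrow> p D'"
    and ref: "\<And>p D. p \<in> S \<Longrightarrow> crowded D \<Longrightarrow> Q D \<Longrightarrow> \<exists>D'. refines D' D \<and> p D'"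
  shows "\<exists>D'. crowded D' \<and> Q D' \<and> (\<forall>p\<in>S. p D')"
  using assms(1) her ref
proof (induction S rule: finite_induct)
  case empty
  then show ?case
    using assms(2,3) by blast
next
  case (insert p S)
  have "\<exists>D'. crowded D' \<and> Q D' \<and> (\<forall>p\<in>S. p D')"
  proof (rule insert.IH)
    show "p' D'" if "p' \<in> S" "crowded D" "Q D" "p' D" "refines D' D" for p' D D'
      using insert.prems(1)[of p' D D'] that by simp
    show "\<exists>D'. refines D' D \<and> p' D'" if "p' \<in> S" "crowded D" "Q D" for p' D
      using insert.prems(2)[of p' D] that by simp
  qed
  then obtain D1 where D1: "crowded D1" "Q D1" "\<And>p. p \<in> S \<Longrightarrow> p D1"
    by blast
  obtain D2 where D2: "refines D2 D1" "p D2"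
    using insert.prems(2)[of p D1] D1 by auto
  have "p' D2" if "p' \<in> S" for p'
    using insert.prems(1)[of p' D1 D2] D1(1,2) D1(3)[OF that] that D2(1) by simp
  then show ?case
    using D2 Q[OF D1(2) D2(1)] refines_crowded[OF D2(1)] by blast
qed

text \<open>
  Generated by the balls around \<open>a\<close> and the complements of nowhere dense sets.
\<close>
definition nwd_filter :: "cantor set \<Rightarrow> cantor \<Rightarrow> cantor filter" where
  "nwd_filter D a = Abs_filter (\<lambda>P. \<exists>k. nwd D {z. agree k a z \<and> \<not> P z})"

lemma eventually_nwd_filter:
  "eventually P (nwd_filter D a) \<longleftrightarrow> (\<exists>k. nwd D {z. agree k a z \<and> \<not> P z})"
  unfolding nwd_filter_def
proof (rule eventually_Abs_filter, rule is_filter.intro)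
  show "\<exists>k. nwd D {z. agree k a z \<and> \<not> True}"
    using nwd_empty by simp
next
  fix P Q assume "\<exists>k. nwd D {z. agree k a z \<and> \<not> P z}" "\<exists>k. nwd D {z. agree k a z \<and> \<not> Q z}"
  then obtain j k where "nwd D {z. agree j a z \<and> \<not> P z}" "nwd D {z. agree k a z \<and> \<not> Q z}"
    by blast
  from nwd_Un[OF this] have "nwd D {z. agree (max j k) a z \<and> \<not> (P z \<and> Q z)}"
    by (rule nwd_mono) (auto simp: agree_max)
  then show "\<exists>k. nwd D {z. agree k a z \<and> \<not> (P z \<and> Q z)}"
    by blast
next
  fix P Q :: "cantor \<Rightarrow> bool" assume PQ: "\<forall>x. P x \<longrightarrow> Q x" and "\<exists>k. nwd D {z. agree k a z \<and> \<not> P z}"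
  then obtain k where "nwd D {z. agree k a z \<and> \<not> P z}"
    by blast
  then have "nwd D {z. agree k a z \<and> \<not> Q z}"
    by (rule nwd_mono) (use PQ in auto)
  then show "\<exists>k. nwd D {z. agree k a z \<and> \<not> Q z}"
    by blast
qed

lemma eventually_nwd_filterI: "nwd D {z. \<not> P z} \<Longrightarrow> eventually P (nwd_filter D a)"
  unfolding eventually_nwd_filter by (rule exI[of _ 0], erule nwd_mono) auto

lemma nodes_nwd:
  assumes "crowded D"
  shows "nodes D (nwd_filter D)"
proof
  show "D \<subseteq> P_fin"
    using assms by (simp add: crowded_def)
  fix a assume a: "a \<in> D"
  show "nwd_filter D a \<noteq> bot"
    unfolding trivial_limit_def eventually_nwd_filter using not_nwd_ball[OF a] by simp
  fix k
  have "nwd D {z. agree k a z \<and> \<not> (z \<in> D \<and> z \<noteq> a \<and> agree k a z)}"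
    using nwd_single[OF assms, of a] by (rule nwd_mono) auto
  then show "eventually (\<lambda>b. b \<in> D \<and> b \<noteq> a \<and> agree k a b) (nwd_filter D a)"
    unfolding eventually_nwd_filter by blast
qed

lemma crowded_P_fin: "crowded P_fin"
  unfolding crowded_def
proof (intro conjI ballI allI)
  show "P_fin \<noteq> {}"
    using zeros_P_fin by blast
  fix a k assume a: "a \<in> P_fin"
  define m where "m = max k (len a)"
  have "a(m := True) \<in> P_fin"
    unfolding P_fin_iff by (rule exI[of _ "Suc m"]) (use beyond_len[OF a] in \<open>simp add: m_def\<close>)
  moreover have "a(m := True) \<noteq> a"
    using beyond_len[OF a, of m] by (auto simp: fun_eq_iff m_def)
  moreover have "agree k a (a(m := True))"
    by (simp add: agree_def m_def)
  ultimately show "\<exists>z\<in>P_fin. z \<noteq> a \<and> agree k a z"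
    by blast
qed simp

text \<open>
  Refine \<open>P_fin\<close> to a crowded set \<open>D\<close> with good properties and fuse along nodes of \<open>D\<close>. If a fibre of \<open>h i\<close> is not nowhere
  dense, \<open>D\<close> can be refined to lie in it, and \<open>h i\<close> becomes constant; otherwise the fibres are nowhere dense. If in the latter
  situation a section of \<open>G\<close> at \<open>h i q\<close> is not nowhere dense, refine \<open>D\<close> to lie in this section: a second
  such section inside it would give a square, so all sections are nowhere dense now. The fibres and the sections are then
  avoided by almost all moves. Injectivity is an open condition by continuity and thus passes to limits, whereas \<open>G\<close> is
  controlled between the nodes only.
\<close>
theorem normal_form:
  fixes h :: "bool \<Rightarrow> cantor \<Rightarrow> 'a" and G :: "('a \<times> 'a) set" and B :: "'l::finite \<Rightarrow> cantor set"
  assumes sep: "\<And>i j x y. h i x \<noteq> h j y \<Longrightarrow> \<exists>k. \<forall>x' y'. agree k x x' \<longrightarrow> agree k y y' \<longrightarrow> h i x' \<noteq> h j y'"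
    and G: "sym G"
    and K22: "\<And>p p' r r'. distinct [p, p', r, r'] \<Longrightarrow> (p, r) \<in> G \<Longrightarrow> (p, r') \<in> G \<Longrightarrow> (p', r) \<in> G \<Longrightarrow> (p', r') \<in> G \<Longrightarrow> False"
  obtains g I where "\<And>n x y. agree n x y \<Longrightarrow> agree n (g x) (g y)"
    "\<And>x. x \<in> P_fin \<Longrightarrow> g x \<in> P_fin" "\<And>x. x \<in> P_inf \<Longrightarrow> g x \<in> P_inf"
    "\<And>i. i \<notin> I \<Longrightarrow> \<exists>v. \<forall>x. h i (g x) = v"
    "\<And>i j x y. i \<in> I \<Longrightarrow> j \<in> I \<Longrightarrow> x \<noteq> y \<Longrightarrow> h i (g x) \<noteq> h j (g y)"
    "(\<forall>x. h False (g x) = h True (g x)) \<or> (\<forall>x. h False (g x) \<noteq> h True (g x))"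
    "\<And>i j x y. i \<in> I \<Longrightarrow> j \<in> I \<Longrightarrow> x \<in> P_fin \<Longrightarrow> y \<in> P_fin \<Longrightarrow> x \<noteq> y \<Longrightarrow> (h i (g x), h j (g y)) \<notin> G"
    "\<And>l. (\<forall>x\<in>P_fin. g x \<in> B l) \<or> (\<forall>x\<in>P_fin. g x \<notin> B l)"
proof -
  \<comment> \<open>Each of the following properties passes to refinements and can be achieved by a refinement. In
    \<open>p2\<close> the maps disagree on a ball of Cantor space and not only on \<open>D\<close>, in order to pass to limits.\<close>
  define thin where "thin i D \<longleftrightarrow> (\<forall>w. nwd D {q. h i q = w})" for i D
  define p1 where "p1 i D \<longleftrightarrow> (\<exists>v. \<forall>q\<in>D. h i q = v) \<or> thin i D" for i D
  define p2 where "p2 D \<longleftrightarrow> (\<forall>q\<in>D. h False q = h True q) \<or>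
     (\<exists>q k. (\<forall>z\<in>D. agree k q z) \<and> (\<forall>x. agree k q x \<longrightarrow> h False x \<noteq> h True x))" for D
  define p3 where "p3 i j D \<longleftrightarrow> \<not> thin i D \<or> \<not> thin j D \<or> (\<forall>q\<in>D. nwd D {z. (h i q, h j z) \<in> G})" for i j D
  define p4 where "p4 l D \<longleftrightarrow> (\<forall>q\<in>D. q \<in> B l) \<or> (\<forall>q\<in>D. q \<notin> B l)" for l D
  have thin_her: "thin i D'" if "thin i D" "refines D' D" for i D D'
    unfolding thin_def
  proof
    fix w show "nwd D' {q. h i q = w}"
      using that(1) by (intro nwd_refine[OF that(2)]) (simp add: thin_def)
  qed
  have p1_her: "p1 i D'" if "p1 i D" "refines D' D" for i D D'
    using that(1) unfolding p1_def
  proof (elim disjE exE)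
    fix v assume v: "\<forall>q\<in>D. h i q = v"
    show "(\<exists>v. \<forall>q\<in>D'. h i q = v) \<or> thin i D'"
      by (intro disjI1 exI[of _ v] ballI bspec[OF v] subsetD[OF refines_subset[OF that(2)]])
  qed (rule disjI2[OF thin_her[OF _ that(2)]])
  have p2_her: "p2 D'" if "p2 D" "refines D' D" for D D'
    using that(1) unfolding p2_def
  proof (elim disjE exE conjE)
    assume e: "\<forall>q\<in>D. h False q = h True q"
    show "(\<forall>q\<in>D'. h False q = h True q) \<or>
      (\<exists>q k. (\<forall>z\<in>D'. agree k q z) \<and> (\<forall>x. agree k q x \<longrightarrow> h False x \<noteq> h True x))"
      by (intro disjI1 ballI bspec[OF e] subsetD[OF refines_subset[OF that(2)]])
  next
    fix q k assume e: "\<forall>z\<in>D. agree k q z" "\<forall>x. agree k q x \<longrightarrow> h False x \<noteq> h True x"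
    have "\<forall>z\<in>D'. agree k q z"
      by (intro ballI bspec[OF e(1)] subsetD[OF refines_subset[OF that(2)]])
    then show "(\<forall>q\<in>D'. h False q = h True q) \<or>
      (\<exists>q k. (\<forall>z\<in>D'. agree k q z) \<and> (\<forall>x. agree k q x \<longrightarrow> h False x \<noteq> h True x))"
      by (intro disjI2 exI[of _ q] exI[of _ k] conjI e(2))
  qed
  have p4_her: "p4 l D'" if "p4 l D" "refines D' D" for l D D'
    using that(1) unfolding p4_def
  proof (elim disjE)
    assume e: "\<forall>q\<in>D. q \<in> B l"
    show "(\<forall>q\<in>D'. q \<in> B l) \<or> (\<forall>q\<in>D'. q \<notin> B l)"
      by (intro disjI1 ballI bspec[OF e] subsetD[OF refines_subset[OF that(2)]])
  next
    assume e: "\<forall>q\<in>D. q \<notin> B l"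
    show "(\<forall>q\<in>D'. q \<in> B l) \<or> (\<forall>q\<in>D'. q \<notin> B l)"
      by (intro disjI2 ballI bspec[OF e] subsetD[OF refines_subset[OF that(2)]])
  qed
  have thin_iff: "thin i D' \<longleftrightarrow> thin i D" if "p1 i D" "crowded D" "refines D' D" for i D D'
  proof
    assume t: "thin i D'"
    show "thin i D"
    proof (rule ccontr)
      assume "\<not> thin i D"
      then have "\<exists>v. \<forall>q\<in>D. h i q = v"
        using that(1) by (simp add: p1_def)
      then obtain v where v: "\<forall>q\<in>D. h i q = v" ..
      have "D' \<subseteq> {q. h i q = v}"
        by (intro subsetI CollectI bspec[OF v] subsetD[OF refines_subset[OF that(3)]])
      then have "\<not> nwd D' {q. h i q = v}"
        by (rule crowded_not_nwd[OF refines_crowded[OF that(3)]])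
      then show False
        using t by (simp add: thin_def)
    qed
  qed (rule thin_her[OF _ that(3)])
  have p1_ref: "\<exists>D'. refines D' D \<and> p1 i D'" if D: "crowded D" for i D
  proof (cases "thin i D")
    case True
    obtain D' where D': "refines D' D"
      using refines_some[OF D] ..
    have "p1 i D'"
      unfolding p1_def by (rule disjI2[OF thin_her[OF True D']])
    then show ?thesis
      using D' by (intro exI conjI)
  next
    case False
    then obtain w where "\<not> nwd D {q. h i q = w}"
      unfolding thin_def by blast
    then obtain D' where D': "refines D' D" "D' \<subseteq> {q. h i q = w}"
      using refine_inside[OF D _ nwd_empty] by metis
    have "\<forall>q\<in>D'. h i q = w"
      using D'(2) by auto
    then have "p1 i D'"
      unfolding p1_def by (intro disjI1 exI)
    then show ?thesis
      using D'(1) by (intro exI conjI)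
  qed
  have p2_ref: "\<exists>D'. refines D' D \<and> p2 D'" if D: "crowded D" for D
  proof (cases "\<forall>q\<in>D. h False q = h True q")
    case True
    obtain D' where D': "refines D' D"
      using refines_some[OF D] ..
    have "p2 D'"
      unfolding p2_def by (intro disjI1 ballI bspec[OF True] subsetD[OF refines_subset[OF D']])
    then show ?thesis
      using D' by (intro exI conjI)
  next
    case False
    then obtain q where q: "q \<in> D" "h False q \<noteq> h True q"
      by blast
    obtain k where k: "\<forall>x' y'. agree k q x' \<longrightarrow> agree k q y' \<longrightarrow> h False x' \<noteq> h True y'"
      using sep[OF q(2)] ..
    have k': "\<forall>x. agree k q x \<longrightarrow> h False x \<noteq> h True x"
      using k by simp
    obtain D' where D': "refines D' D" "\<forall>z\<in>D'. agree k q z"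
      using refine_ball[OF D q(1), of k] by (elim exE conjE)
    have "p2 D'"
      unfolding p2_def by (intro disjI2 exI[of _ q] exI[of _ k] conjI D'(2) k')
    then show ?thesis
      using D'(1) by (intro exI conjI)
  qed
  have p4_ref: "\<exists>D'. refines D' D \<and> p4 l D'" if D: "crowded D" for l D
  proof (cases "nwd D (B l)")
    case True
    have "\<not> nwd D (- B l)"
      using nwd_Un[OF True, of "- B l"] crowded_not_nwd[OF D, of "B l \<union> - B l"] by auto
    then obtain D' where D': "refines D' D" "D' \<subseteq> - B l"
      using refine_inside[OF D _ nwd_empty] by metis
    have "p4 l D'"
      unfolding p4_def by (rule disjI2) (use D'(2) in auto)
    then show ?thesis
      using D'(1) by (intro exI conjI)
  next
    case False
    then obtain D' where D': "refines D' D" "D' \<subseteq> B l"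
      using refine_inside[OF D _ nwd_empty] by metis
    have "p4 l D'"
      unfolding p4_def by (rule disjI1) (use D'(2) in auto)
    then show ?thesis
      using D'(1) by (intro exI conjI)
  qed
  define Q where "Q D \<longleftrightarrow> p1 False D \<and> p1 True D \<and> p2 D \<and> (\<forall>l. p4 l D)" for D
  have Q_her: "Q D'" if "Q D" "refines D' D" for D D'
    using that(1) p1_her[OF _ that(2)] p2_her[OF _ that(2)] p4_her[OF _ that(2)] by (simp add: Q_def)
  have "\<exists>D. crowded D \<and> True \<and> (\<forall>p\<in>{p1 False, p1 True, p2} \<union> range p4. p D)"
  proof (rule refine_finitely_many[where Q = "\<lambda>_. True", OF _ crowded_P_fin])
    fix p D D' assume "p \<in> {p1 False, p1 True, p2} \<union> range p4" "p D" "refines D' D"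
    then show "p D'"
      using p1_her p2_her p4_her by auto
  next
    fix p D assume "p \<in> {p1 False, p1 True, p2} \<union> range p4" "crowded D"
    then show "\<exists>D'. refines D' D \<and> p D'"
      using p1_ref p2_ref p4_ref by auto
  qed simp_all
  then obtain D0 where "crowded D0" "\<forall>p\<in>{p1 False, p1 True, p2} \<union> range p4. p D0"
    by (elim exE conjE)
  then have D0: "crowded D0" "Q D0"
    by (simp_all add: Q_def)
  have Qp1: "p1 i D" if "Q D" for i D
    using that unfolding Q_def by (cases i) simp_all
  have p3_her: "p3 i j D'" if D: "crowded D" "Q D" and r: "refines D' D" and p: "p3 i j D" for i j D D'
  proof (cases "thin i D \<and> thin j D")
    case True
    then have "\<forall>q\<in>D. nwd D {z. (h i q, h j z) \<in> G}"
      using p by (simp add: p3_def)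
    then have "\<forall>q\<in>D'. nwd D' {z. (h i q, h j z) \<in> G}"
      using refines_subset[OF r] nwd_refine[OF r] by (simp add: subset_eq)
    then show ?thesis
      by (simp add: p3_def)
  next
    case False
    then show ?thesis
      unfolding p3_def thin_iff[OF Qp1[OF D(2)] D(1) r] by auto
  qed
  have "\<exists>D. crowded D \<and> Q D \<and> (\<forall>p\<in>(\<lambda>(i, j). p3 i j) ` UNIV. p D)"
  proof (rule refine_finitely_many[where Q = Q and D = D0])
    show "crowded D0" "Q D0"
      by (rule D0)+
    show "Q D'" if "Q D" "refines D' D" for D D'
      using that by (rule Q_her)
  next
    fix p D D' assume p: "p \<in> (\<lambda>(i, j). p3 i j) ` UNIV" "p D" and r: "refines D' D" and D: "crowded D" "Q D"
    from p(1) obtain i j where ij: "p = p3 i j"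
      by auto
    show "p D'"
      using p(2) p3_her[OF D r] by (simp add: ij)
  next
    fix p D assume p: "p \<in> (\<lambda>(i, j). p3 i j) ` UNIV" and D: "crowded D" "Q D"
    then obtain i j where ij: "p = p3 i j"
      by auto
    obtain D1 where D1: "refines D1 D"
      using refines_some[OF D(1)] ..
    show "\<exists>D'. refines D' D \<and> p D'"
    proof (cases "p3 i j D")
      case True
      then have "p3 i j D1"
        by (rule p3_her[OF D D1])
      then show ?thesis
        unfolding ij using D1 by (intro exI conjI)
    next
      case False
      have p3D: "thin i D" "thin j D" "\<not> (\<forall>q\<in>D. nwd D {z. (h i q, h j z) \<in> G})"
        using False by (simp_all add: p3_def)
      then obtain q0 where th: "thin i D" "thin j D" and q0: "q0 \<in> D" "\<not> nwd D {z. (h i q0, h j z) \<in> G}"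
        using p3D by metis
      have "nwd D ({z. h i z = h i q0} \<union> {z. h j z = h i q0})"
        using th by (intro nwd_Un) (simp_all add: thin_def)
      then obtain D' where D': "refines D' D" "D' \<subseteq> {z. (h i q0, h j z) \<in> G}"
          "D' \<inter> ({z. h i z = h i q0} \<union> {z. h j z = h i q0}) = {}"
        using refine_inside[OF D(1) q0(2)] by metis
      have *: "nwd D' {z. (h i q, h j z) \<in> G}" if q: "q \<in> D'" for q
      proof (rule ccontr)
        assume n: "\<not> nwd D' {z. (h i q, h j z) \<in> G}"
        have "nwd D' {z. h j z = h i q}"
          using thin_her[OF th(2) D'(1)] by (simp add: thin_def)
        then obtain D'' where D'': "refines D'' D'" "D'' \<subseteq> {z. (h i q, h j z) \<in> G}" "D'' \<inter> {z. h j z = h i q} = {}"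
          using refine_inside[OF refines_crowded[OF D'(1)] n] by metis
        obtain z1 where z1: "z1 \<in> D''"
          using refines_crowded[OF D''(1)] unfolding crowded_def by blast
        have "nwd D'' {z. h j z = h j z1}"
          using thin_her[OF thin_her[OF th(2) D'(1)] D''(1)] by (simp add: thin_def)
        then have "\<not> D'' \<subseteq> {z. h j z = h j z1}"
          using crowded_not_nwd[OF refines_crowded[OF D''(1)]] by metis
        then have "\<exists>z2\<in>D''. h j z2 \<noteq> h j z1"
          by auto
        then obtain z2 where z2: "z2 \<in> D''" "h j z2 \<noteq> h j z1" ..
        have zD': "z1 \<in> D'" "z2 \<in> D'"
          by (rule subsetD[OF refines_subset[OF D''(1)]], fact)+
        have e: "(h i q0, h j z1) \<in> G" "(h i q0, h j z2) \<in> G" "(h i q, h j z1) \<in> G" "(h i q, h j z2) \<in> G"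
          using subsetD[OF D'(2) zD'(1)] subsetD[OF D'(2) zD'(2)] subsetD[OF D''(2) z1] subsetD[OF D''(2) z2(1)]
          by simp_all
        have d1: "h i z \<noteq> h i q0 \<and> h j z \<noteq> h i q0" if "z \<in> D'" for z
          using that equalityD1[OF D'(3)] by auto
        have d2: "h j z \<noteq> h i q" if "z \<in> D''" for z
          using that equalityD1[OF D''(3)] by auto
        have "h i q \<noteq> h i q0" "h j z1 \<noteq> h i q0" "h j z2 \<noteq> h i q0" "h j z1 \<noteq> h i q" "h j z2 \<noteq> h i q"
          using d1[OF q] d1[OF zD'(1)] d1[OF zD'(2)] d2[OF z1] d2[OF z2(1)] by simp_all
        then have "distinct [h i q0, h i q, h j z1, h j z2]"
          using z2(2) by (simp add: eq_commute)
        then show False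
          using e by (rule K22)
      qed
      have "p3 i j D'"
        unfolding p3_def by (intro disjI2 ballI *)
      then show ?thesis
        unfolding ij using D'(1) by (intro exI conjI)
    qed
  qed simp_all
  then obtain D where D: "crowded D" "Q D" and Dp3: "\<And>i j. p3 i j D"
    by auto
  have Dfin: "D \<subseteq> P_fin" and Dne: "D \<noteq> {}"
    using D(1) by (auto simp: crowded_def)
  interpret nodes D "nwd_filter D"
    by (rule nodes_nwd[OF D(1)])
  define I where "I = {i. thin i D}"
  define Eq where "Eq i j = {p. h i (fst p) = h j (snd p)}" for i j
  define \<rho> where "\<rho> i j = {p. (h i (fst p), h j (snd p)) \<in> G}" for i j
  define H where "H = (\<lambda>(C :: bool set, i, j). (C, Eq i j)) ` (UNIV \<times> I \<times> I) \<union> (\<lambda>(i, j). ({}, \<rho> i j)) ` (I \<times> I)"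
  have "finite H"
    by (simp add: H_def)
  have avoidEq: "eventually (inn C (- Eq i j)) (W c s)" if ij: "i \<in> I" "j \<in> I" and s: "s \<in> D \<times> D" for C i j c s
  proof -
    have "eventually (\<lambda>v. move c s v \<notin> Eq i j) (nwd_filter D (sel c s))"
    proof (rule eventually_nwd_filterI)
      show "nwd D {v. \<not> move c s v \<notin> Eq i j}"
      proof (cases c)
        case True
        have "nwd D {v. h j v = h i (fst s)}"
          using ij by (simp add: I_def thin_def)
        then show ?thesis
          by (rule nwd_mono) (auto simp: True move_def Eq_def)
      next
        case False
        have "nwd D {v. h i v = h j (snd s)}"
          using ij by (simp add: I_def thin_def)
        then show ?thesis
          by (rule nwd_mono) (auto simp: False move_def Eq_def)
      qed
    qed
    then show ?thesis
      unfolding eventually_W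
    proof (rule eventually_mono)
      fix v assume "move c s v \<notin> Eq i j"
      then have "h i (fst (move c s v)) \<noteq> h j (snd (move c s v))"
        by (simp add: Eq_def)
      from sep[OF this] obtain k where
        k: "\<And>x' y'. agree k (fst (move c s v)) x' \<Longrightarrow> agree k (snd (move c s v)) y' \<Longrightarrow> h i x' \<noteq> h j y'"
        by blast
      show "inn C (- Eq i j) (move c s v)"
        by (rule inn_agree2[of k]) (use k in \<open>auto simp: Eq_def agree2_def\<close>)
    qed
  qed
  have avoid\<rho>: "eventually (inn {} (- \<rho> i j)) (W c s)" if ij: "i \<in> I" "j \<in> I" and s: "s \<in> D \<times> D" for i j c s
  proof -
    have n3: "nwd D {z. (h i' q, h j' z) \<in> G}" if "q \<in> D" "i' \<in> I" "j' \<in> I" for q i' j'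
      using Dp3[of i' j'] that by (simp add: p3_def I_def)
    have fs: "fst s \<in> D" "snd s \<in> D"
      using s by auto
    have "eventually (\<lambda>v. move c s v \<notin> \<rho> i j) (nwd_filter D (sel c s))"
    proof (rule eventually_nwd_filterI)
      show "nwd D {v. \<not> move c s v \<notin> \<rho> i j}"
      proof (cases c)
        case True
        show ?thesis
          using n3[OF fs(1) ij] by (rule nwd_mono) (auto simp: True move_def \<rho>_def)
      next
        case False
        show ?thesis
          using n3[OF fs(2) ij(2,1)] by (rule nwd_mono) (auto simp: False move_def \<rho>_def dest: symD[OF G])
      qed
    qed
    then show ?thesis
      unfolding eventually_W by (rule eventually_mono) (simp add: inn_empty)
  qed
  have pers: "eventually (\<lambda>b. b \<in> D) (nwd_filter D a)" if "a \<in> D" for a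
    using U_near[OF that, of 0] by (rule eventually_mono) simp
  have out: "eventually (inn C (- E)) (W c s)" if "(C, E) \<in> H" "s \<in> D \<times> D" for C E c s
    using that avoidEq avoid\<rho> by (auto simp: H_def)
  obtain g where g: "\<And>n x y. agree n x y \<Longrightarrow> agree n (g x) (g y)" "inj g"
    "\<And>x. x \<in> P_fin \<Longrightarrow> g x \<in> D" "\<And>x. x \<in> P_inf \<Longrightarrow> g x \<in> P_inf"
    "\<And>C E x y. (C, E) \<in> H \<Longrightarrow> x \<noteq> y \<Longrightarrow> C = {c. if c then y \<in> P_inf else x \<in> P_inf} \<Longrightarrow> (g x, g y) \<notin> E"
    by (rule fusion[OF order_refl Dne pers \<open>finite H\<close> out]) blast+
  have approx: "\<exists>q\<in>D. agree k (g x) q" for x k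
    using g(1)[OF agree_trunc(1), of k x] g(3)[OF trunc_P_fin, of k x] by blast
  show ?thesis
  proof (rule that[of g I])
    show "agree n (g x) (g y)" if "agree n x y" for n x y
      using that by (rule g(1))
    show "g x \<in> P_fin" if "x \<in> P_fin" for x
      using g(3)[OF that] Dfin by blast
    show "g x \<in> P_inf" if "x \<in> P_inf" for x
      using that by (rule g(4))
    show "\<exists>v. \<forall>x. h i (g x) = v" if i: "i \<notin> I" for i
    proof -
      obtain v where v: "\<And>q. q \<in> D \<Longrightarrow> h i q = v"
        using Qp1[OF D(2), of i] i by (auto simp: p1_def I_def)
      obtain q0 where q0: "q0 \<in> D"
        using Dne by blast
      have "h i (g x) = v" for x
      proof (rule ccontr)
        assume "h i (g x) \<noteq> v"
        then have "h i (g x) \<noteq> h i q0"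
          using v[OF q0] by simp
        from sep[OF this] obtain k where "\<And>z. agree k (g x) z \<Longrightarrow> h i z \<noteq> h i q0"
          using agree_refl by blast
        then show False
          using approx[of k x] v q0 by metis
      qed
      then show ?thesis
        by blast
    qed
    show "h i (g x) \<noteq> h j (g y)" if "i \<in> I" "j \<in> I" "x \<noteq> y" for i j x y
    proof -
      have "({c. if c then y \<in> P_inf else x \<in> P_inf}, Eq i j) \<in> H"
        unfolding H_def using that
        by (intro UnI1 image_eqI[of _ _ "({c. if c then y \<in> P_inf else x \<in> P_inf}, i, j)"]) simp_all
      from g(5)[OF this that(3) refl] show ?thesis
        by (simp add: Eq_def)
    qed
    show "(\<forall>x. h False (g x) = h True (g x)) \<or> (\<forall>x. h False (g x) \<noteq> h True (g x))"
    proof -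
      have "p2 D"
        using D(2) by (simp add: Q_def)
      then consider "\<forall>q\<in>D. h False q = h True q"
        | q k where "\<forall>z\<in>D. agree k q z" "\<forall>x. agree k q x \<longrightarrow> h False x \<noteq> h True x"
        unfolding p2_def by blast
      then show ?thesis
      proof cases
        case 1
        have "h False (g x) = h True (g x)" for x
        proof (rule ccontr)
          assume "h False (g x) \<noteq> h True (g x)"
          from sep[OF this] obtain k where "\<And>z. agree k (g x) z \<Longrightarrow> h False z \<noteq> h True z"
            by blast
          then show False
            using approx[of k x] 1 by blast
        qed
        then show ?thesis
          by blast
      next
        case 2
        have "agree k q (g x)" for x
        proof -
          obtain z where z: "z \<in> D" "agree k (g x) z"
            using approx by blast
          then show ?thesis
            using 2(1) agree_trans[OF _ agree_sym[OF z(2)]] by blast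
        qed
        then show ?thesis
          using 2(2) by blast
      qed
    qed
    show "(h i (g x), h j (g y)) \<notin> G" if "i \<in> I" "j \<in> I" "x \<in> P_fin" "y \<in> P_fin" "x \<noteq> y" for i j x y
    proof -
      have "({}, \<rho> i j) \<in> H"
        unfolding H_def using that by (intro UnI2 image_eqI[of _ _ "(i, j)"]) simp_all
      moreover have "{} = {c. if c then y \<in> P_inf else x \<in> P_inf}"
        using that by (auto simp: P_fin_def)
      ultimately have "(g x, g y) \<notin> \<rho> i j"
        using that(5) by (intro g(5))
      then show ?thesis
        by (simp add: \<rho>_def)
    qed
    show "(\<forall>x\<in>P_fin. g x \<in> B l) \<or> (\<forall>x\<in>P_fin. g x \<notin> B l)" for l
      using D(2) g(3) unfolding Q_def p4_def by blast
  qed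
qed

section \<open>The sets of the patterns and the class\<close>

lemma fsigma_in_preimage:
  assumes f: "continuous_map X Y f" and S: "fsigma_in Y S"
  shows "fsigma_in X {x \<in> topspace X. f x \<in> S}"
proof -
  obtain C where C: "\<And>n :: nat. closedin Y (C n)" "\<And>n. C n \<subseteq> C (Suc n)" "\<Union> (range C) = S"
    using S unfolding fsigma_in_ascending by blast
  have "fsigma_in X (\<Union>n. {x \<in> topspace X. f x \<in> C n})"
    by (intro fsigma_in_Union) (auto intro!: closed_imp_fsigma_in closedin_continuous_map_preimage[OF f] C)
  moreover have "(\<Union>n. {x \<in> topspace X. f x \<in> C n}) = {x \<in> topspace X. f x \<in> S}"
    using C(3) by auto
  ultimately show ?thesis
    by simp
qed

text \<open>
  The classes are closed under continuous preimages; this is what makes a reduction of \<open>CC \<Gamma>\<close> a proof that a set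
  is not in \<open>\<Gamma>\<close>.
\<close>
lemma in_class_preimage:
  assumes f: "continuous_map X Y f" and S: "in_class \<Gamma> Y S"
  shows "in_class \<Gamma> X {x \<in> topspace X. f x \<in> S}"
proof (cases \<Gamma>)
  case Sigma02
  then show ?thesis
    using fsigma_in_preimage[OF f] S by simp
next
  case Pi02
  then have "fsigma_in Y (topspace Y - S)"
    using S by (simp add: gdelta_in_fsigma_in)
  from fsigma_in_preimage[OF f this] have "fsigma_in X {x \<in> topspace X. f x \<in> topspace Y - S}" .
  moreover have "{x \<in> topspace X. f x \<in> topspace Y - S} = topspace X - {x \<in> topspace X. f x \<in> S}"
    using continuous_map_funspace[OF f] by auto
  ultimately show ?thesis
    using Pi02 by (simp add: gdelta_in_fsigma_in)
qed

lemma closedin_point: "closedin cantor_space {q}"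
  unfolding closedin_def topspace_cantor_space openin_cantor_space
proof (intro conjI ballI)
  fix x assume "x \<in> UNIV - {q}"
  then obtain i where "x i \<noteq> q i"
    by (auto simp: fun_eq_iff)
  then have "\<forall>y. agree (Suc i) x y \<longrightarrow> y \<in> UNIV - {q}"
    by (auto simp: agree_def)
  then show "\<exists>k. \<forall>y. agree k x y \<longrightarrow> y \<in> UNIV - {q}" ..
qed simp

lemma fsigma_P_fin: "fsigma_in cantor_space P_fin"
proof -
  have "fsigma_in cantor_space (\<Union> ((\<lambda>q. {q}) ` P_fin))"
    using countable_P_fin by (intro fsigma_in_Union) (auto intro: closed_imp_fsigma_in closedin_point)
  then show ?thesis
    by simp
qed

lemma polish_cantor_space: "polish_space cantor_space"
  unfolding polish_space_def cantor_space_def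
  using second_countable_imp_separable_space[OF second_countable_sequences]
  by (simp add: completely_metrizable_space_product_topology completely_metrizable_space_discrete_topology)

text \<open>
  Otherwise Cantor space would be a countable union of closed sets with empty interior: points, and closed subsets of
  \<open>P_inf\<close>, whose complement contains the dense set \<open>P_fin\<close>.
\<close>
lemma not_fsigma_P_inf: "\<not> fsigma_in cantor_space P_inf"
proof
  assume "fsigma_in cantor_space P_inf"
  then obtain C where C: "\<And>n :: nat. closedin cantor_space (C n)" "\<Union> (range C) = P_inf"
    unfolding fsigma_in_ascending by blast
  let ?G = "range C \<union> (\<lambda>q. {q}) ` P_fin"
  have "cantor_space interior_of \<Union> ?G = {}"
  proof (rule Baire_category_alt)
    show "completely_metrizable_space cantor_space \<or>
        locally_compact_space cantor_space \<and> regular_space cantor_space"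
      using polish_cantor_space by (simp add: polish_space_def)
    show "countable ?G"
      using countable_P_fin by simp
    fix T assume T: "T \<in> ?G"
    have "\<exists>y. agree k x y \<and> y \<notin> T" for x k
    proof (cases "T \<in> range C")
      case True
      then have "T \<subseteq> P_inf"
        using C(2) by blast
      then have "trunc k x \<notin> T"
        using trunc_P_fin by (auto simp: P_fin_def)
      then show ?thesis
        using agree_trunc by blast
    next
      case False
      then obtain q where q: "T = {q}"
        using T by blast
      have "agree k x (x(k := \<not> q k))" "x(k := \<not> q k) \<noteq> q"
        by (auto simp: agree_def fun_eq_iff)
      then show ?thesis
        unfolding q by blast
    qed
    moreover have "\<exists>k. \<forall>y. agree k x y \<longrightarrow> y \<in> T" if "x \<in> cantor_space interior_of T" for x
    proof -
      have "openin cantor_space (cantor_space interior_of T)"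
        by simp
      then have "\<exists>k. \<forall>y. agree k x y \<longrightarrow> y \<in> cantor_space interior_of T"
        unfolding openin_cantor_space using that by (rule bspec)
      then obtain k where k: "\<forall>y. agree k x y \<longrightarrow> y \<in> cantor_space interior_of T" ..
      have "\<forall>y. agree k x y \<longrightarrow> y \<in> T"
        by (intro allI impI, rule subsetD[OF interior_of_subset], rule k[rule_format])
      then show ?thesis ..
    qed
    ultimately have "cantor_space interior_of T = {}"
      by (meson equals0I)
    then show "closedin cantor_space T \<and> cantor_space interior_of T = {}"
      using T C(1) closedin_point by auto
  qed
  moreover have "\<Union> ?G = topspace cantor_space"
    using C(2) by (auto simp: P_fin_def)
  ultimately have "cantor_space interior_of topspace cantor_space = {}"
    by metis
  then show False
    unfolding interior_of_topspace by simp
qed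

lemma CC_not_in_class: "\<not> in_class \<Gamma> cantor_space (CC \<Gamma>)"
proof (cases \<Gamma>)
  case Pi02
  then show ?thesis
    using not_fsigma_P_inf by (simp add: gdelta_in_fsigma_in P_fin_def flip: Compl_eq_Diff_UNIV)
qed (use not_fsigma_P_inf in simp)

lemma Compl_CC_in_class: "in_class \<Gamma> cantor_space (- CC \<Gamma>)"
proof (cases \<Gamma>)
  case Pi02
  then show ?thesis
    using fsigma_P_fin by (simp add: gdelta_in_fsigma_in flip: Compl_eq_Diff_UNIV)
qed (use fsigma_P_fin in \<open>simp add: P_fin_def\<close>)

lemma in_class_UNIV: "in_class \<Gamma> cantor_space UNIV" and in_class_empty: "in_class \<Gamma> X {}"
  using fsigma_in_topspace[of cantor_space] gdelta_in_topspace[of cantor_space] by (cases \<Gamma>; simp)+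

lemma SS_simps [simp]: "SS \<Gamma> 0 = CC \<Gamma>" "SS \<Gamma> (Suc 0) = {}" "SS \<Gamma> 1 = {}" "SS \<Gamma> 2 = - CC \<Gamma>" "SS \<Gamma> 3 = UNIV"
  by (simp_all add: SS_def numeral_2_eq_2 numeral_3_eq_3)

lemma SS_in_class: "k \<in> {1, 2, 3} \<Longrightarrow> in_class \<Gamma> cantor_space (SS \<Gamma> k)"
  using Compl_CC_in_class in_class_UNIV in_class_empty by auto

lemma no_reduction:
  assumes f: "continuous_map cantor_space Y f" and "in_class \<Gamma> Y S" "\<And>x. f x \<in> S \<longleftrightarrow> x \<in> CC \<Gamma>"
  shows False
proof -
  have "{x \<in> topspace cantor_space. f x \<in> S} = CC \<Gamma>"
    using assms(3) by auto
  then show False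
    using in_class_preimage[OF f assms(2)] CC_not_in_class by metis
qed

lemma borel_P_inf: "borel_in cantor_space P_inf"
proof -
  have "{q} \<in> sigma_sets UNIV {U. openin cantor_space U}" for q
  proof -
    have "openin cantor_space (UNIV - {q})"
      using closedin_point[of q] unfolding closedin_def by simp
    then have "UNIV - (UNIV - {q}) \<in> sigma_sets UNIV {U. openin cantor_space U}"
      by (intro sigma_sets.Compl sigma_sets.Basic) simp
    then show ?thesis
      by (simp add: double_diff)
  qed
  then have "\<Union> ((\<lambda>q. {q}) ` P_fin) \<in> sigma_sets UNIV {U. openin cantor_space U}"
    using countable_P_fin by (intro sigma_sets_UNION) auto
  then have "UNIV - P_fin \<in> sigma_sets UNIV {U. openin cantor_space U}"
    by (intro sigma_sets.Compl) simp
  then show ?thesis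
    by (simp add: borel_in_def P_fin_def double_diff flip: Compl_eq_Diff_UNIV)
qed

section \<open>Borel predicates\<close>

text \<open>
  Borel sets as predicates, so that membership in the examples can be shown Borel by following its logical form.
\<close>
definition borelp :: "'a topology \<Rightarrow> ('a \<Rightarrow> bool) \<Rightarrow> bool" where
  "borelp X P \<longleftrightarrow> borel_in X {x \<in> topspace X. P x}"

lemma borelp_not: "borelp X P \<Longrightarrow> borelp X (\<lambda>x. \<not> P x)"
proof -
  assume "borelp X P"
  then have "topspace X - {x \<in> topspace X. P x} \<in> sigma_sets (topspace X) {U. openin X U}"
    unfolding borelp_def borel_in_def by (rule sigma_sets.Compl)
  moreover have "topspace X - {x \<in> topspace X. P x} = {x \<in> topspace X. \<not> P x}"
    by auto
  ultimately show ?thesis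
    by (simp add: borelp_def borel_in_def)
qed

lemma borelp_disj: "borelp X P \<Longrightarrow> borelp X Q \<Longrightarrow> borelp X (\<lambda>x. P x \<or> Q x)"
proof -
  assume "borelp X P" "borelp X Q"
  then have "{x \<in> topspace X. P x} \<union> {x \<in> topspace X. Q x} \<in> sigma_sets (topspace X) {U. openin X U}"
    unfolding borelp_def borel_in_def by (rule sigma_sets_Un)
  moreover have "{x \<in> topspace X. P x} \<union> {x \<in> topspace X. Q x} = {x \<in> topspace X. P x \<or> Q x}"
    by auto
  ultimately show ?thesis
    by (simp add: borelp_def borel_in_def)
qed

lemma borelp_conj: "borelp X P \<Longrightarrow> borelp X Q \<Longrightarrow> borelp X (\<lambda>x. P x \<and> Q x)"
  using borelp_not[OF borelp_disj[OF borelp_not borelp_not], of X P Q] by simp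

lemma borelp_const: "borelp X (\<lambda>x. b)"
proof -
  have "borelp X (\<lambda>x. False)"
    by (simp add: borelp_def borel_in_def sigma_sets.Empty)
  then show ?thesis
    using borelp_not[of X "\<lambda>x. False"] by (cases b) simp_all
qed

lemma borelp_comp: "continuous_map X Y f \<Longrightarrow> borelp Y P \<Longrightarrow> borelp X (\<lambda>x. P (f x))"
proof -
  assume f: "continuous_map X Y f" and "borelp Y P"
  then have "borel_in X {x \<in> topspace X. f x \<in> {y \<in> topspace Y. P y}}"
    unfolding borelp_def using borel_in_continuous_preimage[OF f] by blast
  moreover have "{x \<in> topspace X. f x \<in> {y \<in> topspace Y. P y}} = {x \<in> topspace X. P (f x)}"
    using continuous_map_funspace[OF f] by auto
  ultimately show ?thesis
    by (simp add: borelp_def)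
qed

lemma borelp_open: "openin X U \<Longrightarrow> borelp X (\<lambda>x. x \<in> U)"
proof -
  assume "openin X U"
  moreover from this have "{x \<in> topspace X. x \<in> U} = U"
    using openin_subset by blast
  ultimately show ?thesis
    by (simp add: borelp_def borel_in_def sigma_sets.Basic)
qed

lemma borelp_eq:
  assumes "Hausdorff_space Y" "continuous_map X Y f" "continuous_map X Y g"
  shows "borelp X (\<lambda>x. f x = g x)"
proof -
  have "closedin X {x \<in> topspace X. f x = g x}"
    by (rule closedin_continuous_maps_eq[OF assms])
  then have "openin X (topspace X - {x \<in> topspace X. f x = g x})"
    by (simp add: closedin_def)
  from borelp_not[OF borelp_open[OF this]] show ?thesis
    by (simp add: borelp_def conj_commute cong: conj_cong)
qed

lemma borelp_SS: "k \<in> {0, 1, 2, 3} \<Longrightarrow> borelp cantor_space (\<lambda>x. x \<in> SS \<Gamma> k)"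
proof -
  assume k: "k \<in> {0, 1, 2, 3}"
  have inf: "borelp cantor_space (\<lambda>x. x \<in> P_inf)"
    using borel_P_inf by (simp add: borelp_def)
  have CC: "borelp cantor_space (\<lambda>x. x \<in> CC \<Gamma>)"
    using inf borelp_not[OF inf] by (cases \<Gamma>) (simp_all add: P_fin_def)
  show ?thesis
    using k CC borelp_not[OF CC] borelp_const by auto
qed

section \<open>The examples are acyclic Borel relations outside the class\<close>

lemma analytic_space_of_polish:
  fixes X :: "'p topology" and j :: "'p \<Rightarrow> nat \<Rightarrow> nat"
  assumes X: "polish_space X" and j: "inj j"
  shows "analytic_space X"
proof -
  obtain Y T where YT: "copy j (X, {}) = (Y, T)"
    by (cases "copy j (X, {})")
  have "homeomorphic_map X Y j"
    by (rule copy_isomorphic(1)[OF j _ YT]) (simp add: relation_on_def)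
  then have XY: "X homeomorphic_space Y"
    by (rule homeomorphic_map_imp_homeomorphic_space)
  then have Y: "polish_space Y"
    using X homeomorphic_completely_metrizable_space homeomorphic_separable_space by (auto simp: polish_space_def)
  have "analytic_in Y (topspace Y)"
    unfolding analytic_in_def using Y by (intro exI[of _ Y] exI[of _ id]) auto
  moreover have "X homeomorphic_space subtopology Y (topspace Y)"
    using XY by (simp add: subtopology_topspace)
  ultimately have "\<exists>(Z :: (nat \<Rightarrow> nat) topology) S. polish_space Z \<and> analytic_in Z S \<and> X homeomorphic_space subtopology Z S"
    using Y by (intro exI conjI)
  then show ?thesis
    unfolding analytic_space_def using X completely_metrizable_imp_metrizable_space[of X] by (simp add: polish_space_def)
qed

text \<open>
  Analytic spaces are defined through auxiliary Polish spaces with points in \<open>nat \<Rightarrow> nat\<close>; the examples are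
  moved there along this injection.
\<close>
definition encode_point :: "point \<Rightarrow> nat \<Rightarrow> nat" where
  "encode_point p = (case p of Inl x \<Rightarrow> case_nat 0 (\<lambda>n. of_bool (x n)) | Inr q \<Rightarrow> case_nat (1 + of_bool (fst q)) (\<lambda>n. of_bool (snd q n)))"

lemma case_nat_eq_iff: "case_nat a f = case_nat b g \<longleftrightarrow> a = b \<and> f = g"
proof
  assume eq: "case_nat a f = case_nat b g"
  have "case_nat a f 0 = case_nat b g 0" "\<And>n. case_nat a f (Suc n) = case_nat b g (Suc n)"
    unfolding eq by simp_all
  then show "a = b \<and> f = g"
    by (simp add: fun_eq_iff)
qed simp

lemma of_bool_fun_eq_iff: "(\<lambda>n. of_bool (f n) :: nat) = (\<lambda>n. of_bool (g n)) \<longleftrightarrow> f = g"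
  by (simp add: fun_eq_iff of_bool_eq_iff)

lemma inj_encode_point: "inj encode_point"
proof (rule injI)
  fix p q assume "encode_point p = encode_point q"
  then show "p = q"
    by (cases p; cases q) (simp_all add: encode_point_def case_nat_eq_iff of_bool_fun_eq_iff prod_eq_iff of_bool_eq_iff)
qed

lemma copy_member:
  fixes e :: "'b \<Rightarrow> point"
  assumes e: "inj e" and X: "polish_space X" and R: "relation_on X R" "borel_in (prod_topology X X) R"
    and nc: "\<not> in_class \<Gamma> (prod_topology X X) R" and ac: "s_acyclic_rel X R"
  shows "copy e (X, R) \<in> s_acyclic_borel_relations \<Gamma>"
proof -
  obtain Y T where YT: "copy e (X, R) = (Y, T)"
    by (cases "copy e (X, R)")
  note iso = copy_isomorphic[OF e R(1) YT]
  have Ye: "topspace Y = e ` topspace X"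
    using homeomorphic_imp_surjective_map[OF iso(1)] by simp
  have Te: "T = map_prod e e ` R" and Yd: "Y = pullback_topology (range e) (inv e) X"
    using YT by (auto simp: copy_def)
  have i: "inv e (e x) = x" for x
    using e by simp
  have XY: "X homeomorphic_space Y"
    using iso(1) by (rule homeomorphic_map_imp_homeomorphic_space)
  then have "polish_space Y"
    using X homeomorphic_completely_metrizable_space homeomorphic_separable_space by (auto simp: polish_space_def)
  then have an: "analytic_space Y"
    using inj_encode_point by (rule analytic_space_of_polish)
  have ce: "continuous_map X Y e"
    using iso(1) by (rule homeomorphic_imp_continuous_map)
  have ci: "continuous_map Y X (inv e)"
    unfolding Yd using continuous_map_pullback[of X X id] by (simp add: o_def id_def)
  have cei: "continuous_map (prod_topology Y Y) (prod_topology X X) (\<lambda>p. (inv e (fst p), inv e (snd p)))"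
    by (intro continuous_map_pairedI continuous_map_compose[OF continuous_map_fst ci, unfolded o_def]
        continuous_map_compose[OF continuous_map_snd ci, unfolded o_def])
  have cee: "continuous_map (prod_topology X X) (prod_topology Y Y) (\<lambda>p. (e (fst p), e (snd p)))"
    by (intro continuous_map_pairedI continuous_map_compose[OF continuous_map_fst ce, unfolded o_def]
        continuous_map_compose[OF continuous_map_snd ce, unfolded o_def])
  have Tpre: "T = {p \<in> topspace (prod_topology Y Y). (inv e (fst p), inv e (snd p)) \<in> R}"
    unfolding Te using R(1) by (auto simp: Ye i relation_on_def image_iff)
  have "borel_in (prod_topology Y Y) T"
    unfolding Tpre by (rule borel_in_continuous_preimage[OF cei R(2)])
  moreover have "\<not> in_class \<Gamma> (prod_topology Y Y) T"
  proof
    assume "in_class \<Gamma> (prod_topology Y Y) T"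
    from in_class_preimage[OF cee this]
    have "in_class \<Gamma> (prod_topology X X) {p \<in> topspace (prod_topology X X). (e (fst p), e (snd p)) \<in> T}" .
    moreover have "{p \<in> topspace (prod_topology X X). (e (fst p), e (snd p)) \<in> T} = R"
      using iso(3) R(1) by (auto simp: relation_on_def)
    ultimately show False
      using nc by simp
  qed
  moreover have "s_acyclic_rel Y T"
    unfolding s_acyclic_rel_def acyclic_rel_def
  proof
    assume "\<exists>n x. 2 \<le> n \<and> path_in Y (symm T) n x \<and> inj_on x {..n} \<and> (x n, x 0) \<in> symm T"
    then obtain n x where x: "2 \<le> n" "path_in Y (symm T) n x" "inj_on x {..n}" "(x n, x 0) \<in> symm T"
      by blast
    have symT: "(inv e a, inv e b) \<in> symm R" if "(a, b) \<in> symm T" for a b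
      using that by (auto simp: symm_def Te i)
    have top: "x k \<in> e ` topspace X" if "k \<le> n" for k
      using x(2) that by (simp add: path_in_def Ye)
    have "path_in X (symm R) n (inv e \<circ> x)"
      unfolding path_in_def
    proof (intro conjI allI impI)
      fix k assume "k \<le> n"
      then show "(inv e \<circ> x) k \<in> topspace X"
        using top[of k] by (auto simp: i)
    next
      fix k assume "k < n"
      then show "((inv e \<circ> x) k, (inv e \<circ> x) (Suc k)) \<in> symm R"
        using x(2) symT by (simp add: path_in_def)
    qed
    moreover have "inj_on (inv e \<circ> x) {..n}"
    proof (rule comp_inj_on[OF x(3)])
      show "inj_on (inv e) (x ` {..n})"
        by (rule inj_on_subset[OF inj_on_inv_into[of "range e"]]) (use top in auto)
    qed
    moreover have "((inv e \<circ> x) n, (inv e \<circ> x) 0) \<in> symm R"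
      using symT[OF x(4)] by simp
    ultimately show False
      using ac x(1) unfolding s_acyclic_rel_def acyclic_rel_def by blast
  qed
  ultimately show ?thesis
    using an iso(2) unfolding YT s_acyclic_borel_relations_def non_class_borel_def by simp
qed

text \<open>
  Two adjacent vertices of a cycle of length at least 3 both lie in the middle of a path of three different points, and would both be
  equal to \<open>z\<close>. For the relations on \<open>D_space\<close> there is no such path at all, for those on \<open>S_space\<close> the only middle point
  is \<open>zeros\<close>.
\<close>
lemma acyclic_of_centre:
  assumes "\<And>a b c. (a, b) \<in> symm R \<Longrightarrow> a \<noteq> b \<Longrightarrow> (b, c) \<in> symm R \<Longrightarrow> b \<noteq> c \<Longrightarrow> a \<noteq> c \<Longrightarrow> b = z"
  shows "s_acyclic_rel X R"
  unfolding s_acyclic_rel_def acyclic_rel_def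
proof
  assume "\<exists>n x. 2 \<le> n \<and> path_in X (symm R) n x \<and> inj_on x {..n} \<and> (x n, x 0) \<in> symm R"
  then obtain n x where x: "2 \<le> n" "path_in X (symm R) n x" "inj_on x {..n}" "(x n, x 0) \<in> symm R"
    by blast
  have e: "(x 0, x 1) \<in> symm R" "(x 1, x 2) \<in> symm R"
    using x(1,2) unfolding path_in_def by (auto simp: numeral_2_eq_2)
  have ne: "x i \<noteq> x j" if "i \<le> n" "j \<le> n" "i \<noteq> j" for i j
    using x(3) that by (auto simp: inj_on_def)
  have "x 1 = z"
    by (rule assms[OF e(1) _ e(2)]) (use ne x(1) in auto)
  moreover have "x 0 = z"
    by (rule assms[OF x(4) _ e(1)]) (use ne x(1) in auto)
  ultimately show False
    using ne[of 0 1] x(1) by simp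
qed

lemma topspace_D_space [simp]: "topspace D_space = UNIV"
  by (simp add: D_space_def)

lemma topspace_S_space: "topspace S_space = {zeros} \<union> {\<alpha>. \<alpha> 0}"
  by (simp add: S_space_def)

lemma one_cons_in_S [simp]: "one_cons x \<in> topspace S_space" and zeros_in_S [simp]: "zeros \<in> topspace S_space"
  by (simp_all add: topspace_S_space)

lemma zeros_one_cons [simp]: "zeros \<noteq> one_cons x" "one_cons x \<noteq> zeros"
proof -
  have "zeros 0 \<noteq> one_cons x 0"
    by (simp add: zeros_def)
  then show "zeros \<noteq> one_cons x" "one_cons x \<noteq> zeros"
    by metis+
qed

lemma S_space_cases:
  assumes "s \<in> topspace S_space"
  obtains "s = zeros" | x where "s = one_cons x"
proof (cases "s 0")
  case True
  have "s = one_cons (\<lambda>n. s (Suc n))"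
    using True by (auto simp: fun_eq_iff split: nat.split)
  then show ?thesis
    using that by blast
next
  case False
  then show ?thesis
    using assms that by (auto simp: topspace_S_space)
qed

lemma Ra_rel_cases:
  "(zeros, zeros) \<in> Ra_rel \<Gamma> t \<longleftrightarrow> t (False, False) = 1"
  "(zeros, one_cons x) \<in> Ra_rel \<Gamma> t \<longleftrightarrow> x \<in> SS \<Gamma> (t (False, True))"
  "(one_cons x, zeros) \<in> Ra_rel \<Gamma> t \<longleftrightarrow> x \<in> SS \<Gamma> (t (True, False))"
  "(one_cons x, one_cons y) \<in> Ra_rel \<Gamma> t \<longleftrightarrow> x = y \<and> x \<in> SS \<Gamma> (t (True, True))"
  by (auto simp: Ra_rel_def)

lemma R_rel_iff: "((i, x), (j, y)) \<in> R_rel \<Gamma> t \<longleftrightarrow> x = y \<and> x \<in> SS \<Gamma> (t (i, j))"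
  by (auto simp: R_rel_def)

lemma Ra_rel_subset: "Ra_rel \<Gamma> t \<subseteq> topspace S_space \<times> topspace S_space"
  by (auto simp: Ra_rel_def)

lemma continuous_one_cons: "continuous_map cantor_space S_space one_cons"
  unfolding S_space_def continuous_map_in_subtopology
proof
  show "continuous_map cantor_space cantor_space one_cons"
  proof (rule continuous_map_cantor_cantor)
    fix k show "\<exists>n. \<forall>x y. agree n x y \<longrightarrow> agree k (one_cons x) (one_cons y)"
      by (intro exI[of _ k]) (auto simp: agree_def split: nat.split)
  qed
qed auto

lemma continuous_tail: "continuous_map S_space cantor_space (\<lambda>s n. s (Suc n))"
  unfolding S_space_def
proof (intro continuous_map_from_subtopology continuous_map_cantor_cantor)
  fix k show "\<exists>n. \<forall>x y. agree n x y \<longrightarrow> agree k (\<lambda>n. x (Suc n)) (\<lambda>n. y (Suc n))"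
    by (intro exI[of _ "Suc k"]) (auto simp: agree_def)
qed

lemma Hausdorff_cantor_space: "Hausdorff_space cantor_space"
  using polish_cantor_space completely_metrizable_imp_metrizable_space metrizable_imp_Hausdorff_space
  by (auto simp: polish_space_def)

lemma borelp_first_bit: "borelp S_space (\<lambda>s. s 0)"
proof -
  have "openin cantor_space {s. s 0}"
    unfolding openin_cantor_space by (intro ballI exI[of _ 1]) (simp add: agree_def)
  from borelp_open[OF this] have "borelp cantor_space (\<lambda>s. s 0)"
    by simp
  moreover have "continuous_map S_space cantor_space (\<lambda>s. s)"
    unfolding S_space_def by (intro continuous_map_from_subtopology) (simp add: id_def[symmetric])
  ultimately show ?thesis
    using borelp_comp[of S_space cantor_space "\<lambda>s. s" "\<lambda>s. s 0"] by simp
qed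

lemma polish_D_space: "polish_space D_space"
  unfolding D_space_def
proof (rule polish_prod[OF _ polish_cantor_space])
  show "polish_space (discrete_topology (UNIV :: bool set))"
    by (simp add: polish_space_def completely_metrizable_space_discrete_topology separable_space_discrete_topology)
qed

lemma polish_S_space: "polish_space S_space"
  unfolding S_space_def
proof (rule polish_closed[OF polish_cantor_space])
  have "closedin cantor_space {\<alpha>. \<alpha> 0}"
    unfolding closedin_def openin_cantor_space topspace_cantor_space
    by (intro conjI ballI exI[of _ 1]) (auto simp: agree_def)
  then show "closedin cantor_space ({zeros} \<union> {\<alpha>. \<alpha> 0})"
    using closedin_point by (rule closedin_Un[rotated])
qed

lemma diagonal_member: "(copy Inl (cantor_space, Id_on (CC \<Gamma>)) :: point space_rel) \<in> s_acyclic_borel_relations \<Gamma>"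
proof (rule copy_member)
  let ?CC = "prod_topology cantor_space cantor_space"
  have "borelp ?CC (\<lambda>p. fst p = snd p \<and> fst p \<in> SS \<Gamma> 0)"
    by (intro borelp_conj borelp_eq[OF Hausdorff_cantor_space continuous_map_fst continuous_map_snd]
        borelp_comp[OF continuous_map_fst borelp_SS]) simp
  moreover have "{p \<in> topspace ?CC. fst p = snd p \<and> fst p \<in> SS \<Gamma> 0} = Id_on (CC \<Gamma>)"
    by (auto simp: Id_on_def)
  ultimately show "borel_in ?CC (Id_on (CC \<Gamma>))"
    unfolding borelp_def by simp
  show "\<not> in_class \<Gamma> ?CC (Id_on (CC \<Gamma>))"
  proof
    assume c: "in_class \<Gamma> ?CC (Id_on (CC \<Gamma>))"
    have "continuous_map cantor_space ?CC (\<lambda>x. (x, x))"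
      by (intro continuous_map_pairedI continuous_map_id[unfolded id_def])
    from no_reduction[OF this c] show False
      by auto
  qed
  show "s_acyclic_rel cantor_space (Id_on (CC \<Gamma>))"
    by (rule acyclic_of_centre) (auto simp: symm_def Id_on_def)
qed (auto simp: relation_on_def polish_cantor_space)

lemma R_rel_member:
  assumes t: "t \<in> P_patterns"
  shows "(copy Inr (D_space, R_rel \<Gamma> t) :: point space_rel) \<in> s_acyclic_borel_relations \<Gamma>"
proof (rule copy_member)
  let ?DD = "prod_topology D_space D_space"
  have rng: "t p \<in> {0, 1, 2, 3}" for p
    using t unfolding P_patterns_def by blast
  have c1: "continuous_map ?DD cantor_space (\<lambda>p. snd (fst p))" "continuous_map ?DD cantor_space (\<lambda>p. snd (snd p))"
    unfolding D_space_def
    by (intro continuous_map_compose[OF continuous_map_fst continuous_map_snd, unfolded o_def]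
        continuous_map_compose[OF continuous_map_snd continuous_map_snd, unfolded o_def])+
  have c2: "continuous_map ?DD (discrete_topology UNIV) (\<lambda>p. fst (fst p))" "continuous_map ?DD (discrete_topology UNIV) (\<lambda>p. fst (snd p))"
    unfolding D_space_def
    by (intro continuous_map_compose[OF continuous_map_fst continuous_map_fst, unfolded o_def]
        continuous_map_compose[OF continuous_map_snd continuous_map_fst, unfolded o_def])+
  have b: "borelp (discrete_topology (UNIV :: bool set)) (\<lambda>i. i)"
    using borelp_open[of "discrete_topology (UNIV :: bool set)" "{True}"] by simp
  note bb = borelp_comp[OF c2(1) b] borelp_comp[OF c2(2) b]
  note ss = borelp_comp[OF c1(1) borelp_SS[OF rng]]
  have "borelp ?DD (\<lambda>p. snd (fst p) = snd (snd p) \<and>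
     ((fst (fst p) \<and> fst (snd p) \<and> snd (fst p) \<in> SS \<Gamma> (t (True, True))) \<or>
      (fst (fst p) \<and> \<not> fst (snd p) \<and> snd (fst p) \<in> SS \<Gamma> (t (True, False))) \<or>
      (\<not> fst (fst p) \<and> fst (snd p) \<and> snd (fst p) \<in> SS \<Gamma> (t (False, True))) \<or>
      (\<not> fst (fst p) \<and> \<not> fst (snd p) \<and> snd (fst p) \<in> SS \<Gamma> (t (False, False)))))" (is "borelp _ ?P")
    by (intro borelp_conj borelp_disj borelp_not bb ss borelp_eq[OF Hausdorff_cantor_space c1])
  moreover have "((i, x), (j, y)) \<in> R_rel \<Gamma> t \<longleftrightarrow> ?P ((i, x), (j, y))" for i j x y
    unfolding R_rel_iff by (cases i; cases j) auto
  then have "p \<in> R_rel \<Gamma> t \<longleftrightarrow> ?P p" for p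
    by (metis prod.collapse)
  then have "R_rel \<Gamma> t = {p \<in> topspace ?DD. ?P p}"
    by (intro set_eqI) (simp add: mem_Times_iff)
  ultimately show "borel_in ?DD (R_rel \<Gamma> t)"
    by (simp only: borelp_def)
  show "\<not> in_class \<Gamma> ?DD (R_rel \<Gamma> t)"
  proof
    assume c: "in_class \<Gamma> ?DD (R_rel \<Gamma> t)"
    have "continuous_map cantor_space ?DD (\<lambda>x. ((False, x), (True, x)))"
      unfolding D_space_def by (intro continuous_map_pairedI continuous_map_id[unfolded id_def]) simp_all
    from no_reduction[OF this c] show False
      using t by (auto simp: R_rel_iff P_patterns_def)
  qed
  show "s_acyclic_rel D_space (R_rel \<Gamma> t)"
    by (rule acyclic_of_centre) (auto simp: symm_def R_rel_def)
qed (auto simp: relation_on_def polish_D_space)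

lemma Ra_rel_member:
  assumes t: "t \<in> A_patterns"
  shows "(copy Inl (S_space, Ra_rel \<Gamma> t) :: point space_rel) \<in> s_acyclic_borel_relations \<Gamma>"
proof (rule copy_member)
  let ?SS = "prod_topology S_space S_space"
  have rng: "t p \<in> {0, 1, 2, 3}" for p
    using t unfolding A_patterns_def by blast
  have t1: "continuous_map ?SS cantor_space (\<lambda>p n. fst p (Suc n))" "continuous_map ?SS cantor_space (\<lambda>p n. snd p (Suc n))"
    by (intro continuous_map_compose[OF continuous_map_fst continuous_tail, unfolded o_def]
        continuous_map_compose[OF continuous_map_snd continuous_tail, unfolded o_def])+
  note bits = borelp_comp[OF continuous_map_fst borelp_first_bit] borelp_comp[OF continuous_map_snd borelp_first_bit]
  note ss = borelp_comp[OF t1(1) borelp_SS[OF rng]] borelp_comp[OF t1(2) borelp_SS[OF rng]]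
  have "borelp ?SS (\<lambda>p.
      (fst p 0 \<and> snd p 0 \<and> (\<lambda>n. fst p (Suc n)) = (\<lambda>n. snd p (Suc n)) \<and> (\<lambda>n. fst p (Suc n)) \<in> SS \<Gamma> (t (True, True))) \<or>
      (fst p 0 \<and> \<not> snd p 0 \<and> (\<lambda>n. fst p (Suc n)) \<in> SS \<Gamma> (t (True, False))) \<or>
      (\<not> fst p 0 \<and> snd p 0 \<and> (\<lambda>n. snd p (Suc n)) \<in> SS \<Gamma> (t (False, True))) \<or>
      (\<not> fst p 0 \<and> \<not> snd p 0 \<and> t (False, False) = 1))" (is "borelp _ ?P")
    by (intro borelp_conj borelp_disj borelp_not bits ss borelp_const borelp_eq[OF Hausdorff_cantor_space t1])
  moreover have iff: "(a, b) \<in> Ra_rel \<Gamma> t \<longleftrightarrow> ?P (a, b)" if "a \<in> topspace S_space" "b \<in> topspace S_space" for a b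
  proof -
    have z: "\<not> zeros 0" "(\<lambda>n. one_cons x (Suc n)) = x" for x
      by (simp_all add: zeros_def)
    from that show ?thesis
      by (elim S_space_cases) (simp_all only: Ra_rel_cases fst_conv snd_conv z nat.case simp_thms)
  qed
  have "Ra_rel \<Gamma> t = {p \<in> topspace ?SS. ?P p}"
  proof (intro set_eqI iffI CollectI conjI)
    fix p assume p: "p \<in> Ra_rel \<Gamma> t"
    then have m: "fst p \<in> topspace S_space" "snd p \<in> topspace S_space"
      using subsetD[OF Ra_rel_subset p] by (simp_all add: mem_Times_iff)
    then show "p \<in> topspace ?SS"
      by (simp add: mem_Times_iff)
    show "?P p"
      using iff[OF m] p by simp
  next
    fix p assume p: "p \<in> {p \<in> topspace ?SS. ?P p}"
    then have m: "fst p \<in> topspace S_space" "snd p \<in> topspace S_space"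
      by (simp_all add: mem_Times_iff)
    show "p \<in> Ra_rel \<Gamma> t"
      using iff[OF m] p by simp
  qed
  ultimately show "borel_in ?SS (Ra_rel \<Gamma> t)"
    by (simp only: borelp_def)
  show "\<not> in_class \<Gamma> ?SS (Ra_rel \<Gamma> t)"
  proof
    assume c: "in_class \<Gamma> ?SS (Ra_rel \<Gamma> t)"
    have c0: "continuous_map cantor_space S_space (\<lambda>x. zeros)"
      by simp
    show False
    proof (cases "t (False, True) = 0")
      case True
      show False
        by (rule no_reduction[OF continuous_map_pairedI[OF c0 continuous_one_cons] c]) (simp add: Ra_rel_cases True)
    next
      case False
      then have "t (True, False) = 0"
        using t by (simp add: A_patterns_def)
      show False
        by (rule no_reduction[OF continuous_map_pairedI[OF continuous_one_cons c0] c])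
          (simp add: Ra_rel_cases \<open>t (True, False) = 0\<close>)
    qed
  qed
  show "s_acyclic_rel S_space (Ra_rel \<Gamma> t)"
    by (rule acyclic_of_centre[of _ zeros]) (auto simp: symm_def Ra_rel_def split: if_splits)
qed (use Ra_rel_subset in \<open>auto simp: relation_on_def polish_S_space\<close>)

section \<open>Every relation has a minorant among the examples\<close>

lemma copy_topspace: "inj e \<Longrightarrow> topspace (pullback_topology (range e) (inv e) Y) = e ` topspace Y"
  by (auto simp: topspace_pullback_topology image_iff)

lemma inj_leq_copy:
  assumes e: "inj e" and f: "continuous_map Y X f" "inj_on f (topspace Y)"
    and S: "S = {(x, y) \<in> topspace Y \<times> topspace Y. (f x, f y) \<in> R}"
  shows "inj_leq_c (copy e (Y, S)) (X, R)"
proof -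
  let ?Y = "pullback_topology (range e) (inv e) Y"
  have i: "inv e (e x) = x" for x
    using e by simp
  have "continuous_map ?Y Y (inv e)"
    using continuous_map_pullback[of Y Y id] by (simp add: o_def id_def)
  then have "continuous_map ?Y X (f \<circ> inv e)"
    using f(1) by (rule continuous_map_compose)
  moreover have "inj_on (f \<circ> inv e) (topspace ?Y)"
    using f(2) unfolding copy_topspace[OF e] by (auto simp: inj_on_def i)
  moreover have "map_prod e e ` S = {(x, y) \<in> topspace ?Y \<times> topspace ?Y. ((f \<circ> inv e) x, (f \<circ> inv e) y) \<in> R}"
    unfolding copy_topspace[OF e] S by (auto simp: i image_iff)
  ultimately show ?thesis
    unfolding inj_leq_c_def copy_def by auto
qed

lemma CC_nontrivial: "\<exists>x. x \<in> CC \<Gamma>" "\<exists>x. x \<notin> CC \<Gamma>"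
proof -
  have "zeros \<in> P_fin" "(\<lambda>_. True) \<in> P_inf"
    by (simp_all add: P_inf_def)
  then show "\<exists>x. x \<in> CC \<Gamma>" "\<exists>x. x \<notin> CC \<Gamma>"
    by (cases \<Gamma>; auto simp: P_fin_def)+
qed

lemma SS_inj: "k \<in> {0, 1, 2, 3} \<Longrightarrow> l \<in> {0, 1, 2, 3} \<Longrightarrow> SS \<Gamma> k = SS \<Gamma> l \<Longrightarrow> k = l"
  using CC_nontrivial[of \<Gamma>] by auto

text \<open>
  A square would be a cycle of length 4.
\<close>
lemma symm_acyclic_no_square:
  assumes R: "relation_on X R" and A: "s_acyclic_rel X R" and d: "distinct [p, p', r, r']"
    and e: "(p, r) \<in> symm R" "(p, r') \<in> symm R" "(p', r) \<in> symm R" "(p', r') \<in> symm R"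
  shows False
proof -
  have sy: "(a, b) \<in> symm R \<Longrightarrow> (b, a) \<in> symm R" for a b
    by (auto simp: symm_def)
  have top: "(a, b) \<in> symm R \<Longrightarrow> a \<in> topspace X \<and> b \<in> topspace X" for a b
    using R by (auto simp: symm_def relation_on_def)
  define x where "x i = [p, r, p', r'] ! i" for i
  have x: "x 0 = p" "x (Suc 0) = r" "x (Suc (Suc 0)) = p'" "x (Suc (Suc (Suc 0))) = r'"
    by (simp_all add: x_def)
  have "path_in X (symm R) 3 x"
    unfolding path_in_def using e top sy
    by (auto simp: x le_Suc_eq less_Suc_eq numeral_3_eq_3)
  moreover have "inj_on x {..3}"
    using d by (auto simp: inj_on_def x le_Suc_eq numeral_3_eq_3 atMost_Suc)
  moreover have "(x 3, x 0) \<in> symm R"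
    using e sy by (simp add: x numeral_3_eq_3)
  ultimately have "\<exists>n x. n \<ge> 2 \<and> path_in X (symm R) n x \<and> inj_on x {..n} \<and> (x n, x 0) \<in> symm R"
    by (intro exI[of _ 3] exI[of _ x]) simp
  then show False
    using A unfolding s_acyclic_rel_def acyclic_rel_def by (rule notE[rotated])
qed

lemma Hausdorff_space_separates:
  "Hausdorff_space X \<Longrightarrow> a \<in> topspace X \<Longrightarrow> b \<in> topspace X \<Longrightarrow> a \<noteq> b \<Longrightarrow>
    \<exists>U V. openin X U \<and> openin X V \<and> a \<in> U \<and> b \<in> V \<and> disjnt U V"
  unfolding Hausdorff_space_def by blast

lemma continuous_map_near:
  assumes f: "continuous_map cantor_space X f" and V: "openin X V" and x: "f x \<in> V"
  shows "\<exists>k. \<forall>z. agree k x z \<longrightarrow> f z \<in> V"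
proof -
  have "openin cantor_space {z \<in> topspace cantor_space. f z \<in> V}"
    by (rule openin_continuous_map_preimage[OF f V])
  then show ?thesis
    using x unfolding openin_cantor_space by simp
qed

text \<open>
  The Hurewicz dichotomy, for \<open>R\<close> or its complement depending on \<open>\<Gamma>\<close>, followed by the two rounds of thinning. Here \<open>I\<close> is
  the set of indices of the injective maps, the other maps being constant. The pattern exists because the relation between
  \<open>h i x\<close> and \<open>h j x\<close> is constant on \<open>P_fin\<close> by the first round and on \<open>P_inf\<close> by the second one.
\<close>
lemma canonical_pair:
  assumes "(X, R) \<in> s_acyclic_borel_relations \<Gamma>"
  obtains h I t where "\<And>i. continuous_map cantor_space X (h i)"
    "\<And>i. i \<notin> I \<Longrightarrow> \<exists>v. \<forall>x. h i x = v"
    "\<And>i j x y. i \<in> I \<Longrightarrow> j \<in> I \<Longrightarrow> x \<noteq> y \<Longrightarrow> h i x \<noteq> h j y"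
    "(\<forall>x. h False x = h True x) \<or> (\<forall>x. h False x \<noteq> h True x)"
    "\<And>i j x y. i \<in> I \<Longrightarrow> j \<in> I \<Longrightarrow> x \<noteq> y \<Longrightarrow> (h i x, h j y) \<notin> R"
    "\<And>i j. t (i, j) \<in> {0, 1, 2, 3}" "\<And>i j x. (h i x, h j x) \<in> R \<longleftrightarrow> x \<in> SS \<Gamma> (t (i, j))" "t (False, True) = 0"
proof -
  let ?XX = "prod_topology X X" and ?CC = "prod_topology cantor_space cantor_space"
  have X: "analytic_space X" and R: "relation_on X R" "borel_in ?XX R" "\<not> in_class \<Gamma> ?XX R" "s_acyclic_rel X R"
    using assms by (auto simp: s_acyclic_borel_relations_def non_class_borel_def)
  have RX: "R \<subseteq> topspace ?XX"
    using R(1) by (simp add: relation_on_def)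
  obtain hh where hh: "continuous_map cantor_space ?XX hh" "\<And>x. hh x \<in> R \<longleftrightarrow> x \<in> CC \<Gamma>"
  proof (cases \<Gamma>)
    case Sigma02
    then obtain h where "continuous_map cantor_space ?XX h" "\<And>x. h x \<in> R \<longleftrightarrow> x \<in> P_inf"
      using hurewicz[OF X R(2)] R(3) by auto
    then show ?thesis
      using that Sigma02 by simp
  next
    case Pi02
    have "borel_in ?XX (topspace ?XX - R)"
      using R(2) unfolding borel_in_def by (rule sigma_sets.Compl)
    moreover have "\<not> fsigma_in ?XX (topspace ?XX - R)"
      using R(3) RX Pi02 gdelta_in_fsigma_in[of ?XX R] by auto
    ultimately obtain h where h: "continuous_map cantor_space ?XX h" "\<And>x. h x \<in> topspace ?XX - R \<longleftrightarrow> x \<in> P_inf"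
      using hurewicz[OF X] by metis
    have "h x \<in> topspace ?XX" for x
      using continuous_map_funspace[OF h(1)] by auto
    then have "h x \<in> R \<longleftrightarrow> x \<in> CC \<Gamma>" for x
      using h(2)[of x] Pi02 by (auto simp: P_fin_def)
    then show ?thesis
      using that h(1) by blast
  qed
  define h0 where "h0 i x = (if i then snd (hh x) else fst (hh x))" for i x
  have c0: "continuous_map cantor_space X (h0 i)" for i
    using hh(1) unfolding h0_def continuous_map_pairwise o_def by (cases i) simp_all
  have haus: "Hausdorff_space X"
    using X metrizable_imp_Hausdorff_space[of X] by (simp add: analytic_space_def)
  have sep: "\<exists>k. \<forall>x' y'. agree k x x' \<longrightarrow> agree k y y' \<longrightarrow> h0 i x' \<noteq> h0 j y'" if ne: "h0 i x \<noteq> h0 j y" for i j x y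
  proof -
    have "h0 i x \<in> topspace X" "h0 j y \<in> topspace X"
      using continuous_map_funspace[OF c0] by auto
    then obtain V W where VW: "openin X V" "openin X W" "h0 i x \<in> V" "h0 j y \<in> W" "disjnt V W"
      using Hausdorff_space_separates[OF haus _ _ ne] by metis
    obtain k where k: "\<forall>z. agree k x z \<longrightarrow> h0 i z \<in> V"
      using continuous_map_near[OF c0 VW(1,3)] ..
    obtain l where l: "\<forall>z. agree l y z \<longrightarrow> h0 j z \<in> W"
      using continuous_map_near[OF c0 VW(2,4)] ..
    have "h0 i x' \<noteq> h0 j y'" if "agree (max k l) x x'" "agree (max k l) y y'" for x' y'
      using k[rule_format, of x'] l[rule_format, of y'] that VW(5) by (auto simp: agree_max disjnt_iff)
    then show ?thesis
      by (intro exI[of _ "max k l"] allI impI)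
  qed
  have symG: "sym (symm R)"
    by (auto simp: sym_def symm_def)
  have K22: "False" if "distinct [p, p', r, r']" "(p, r) \<in> symm R" "(p, r') \<in> symm R" "(p', r) \<in> symm R" "(p', r') \<in> symm R" for p p' r r'
    using symm_acyclic_no_square[OF R(1,4) that] .
  obtain g1 I where g1: "\<And>n x y. agree n x y \<Longrightarrow> agree n (g1 x) (g1 y)"
    "\<And>x. x \<in> P_fin \<Longrightarrow> g1 x \<in> P_fin" "\<And>x. x \<in> P_inf \<Longrightarrow> g1 x \<in> P_inf"
    "\<And>i. i \<notin> I \<Longrightarrow> \<exists>v. \<forall>x. h0 i (g1 x) = v"
    "\<And>i j x y. i \<in> I \<Longrightarrow> j \<in> I \<Longrightarrow> x \<noteq> y \<Longrightarrow> h0 i (g1 x) \<noteq> h0 j (g1 y)"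
    "(\<forall>x. h0 False (g1 x) = h0 True (g1 x)) \<or> (\<forall>x. h0 False (g1 x) \<noteq> h0 True (g1 x))"
    "\<And>i j x y. i \<in> I \<Longrightarrow> j \<in> I \<Longrightarrow> x \<in> P_fin \<Longrightarrow> y \<in> P_fin \<Longrightarrow> x \<noteq> y \<Longrightarrow> (h0 i (g1 x), h0 j (g1 y)) \<notin> symm R"
    "\<And>l. (\<forall>x\<in>P_fin. g1 x \<in> {x. (h0 (fst l) x, h0 (snd l) x) \<in> R}) \<or>
       (\<forall>x\<in>P_fin. g1 x \<notin> {x. (h0 (fst l) x, h0 (snd l) x) \<in> R})"
    by (rule normal_form[where h = h0 and G = "symm R" and B = "\<lambda>l. {x. (h0 (fst l) x, h0 (snd l) x) \<in> R}",
          OF sep symG K22]) blast+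
  define h1 where "h1 i x = h0 i (g1 x)" for i x
  have cg: "continuous_map cantor_space cantor_space g" if "\<And>n x y. agree n x y \<Longrightarrow> agree n (g x) (g y)" for g
    using that by (intro continuous_map_cantor_cantor) blast
  have cg1: "continuous_map cantor_space cantor_space g1"
    by (rule cg) (rule g1(1))
  have c1: "continuous_map cantor_space X (h1 i)" for i
    using continuous_map_compose[OF cg1 c0[of i]] by (simp add: h1_def [abs_def] o_def)
  have borel_symm: "borel_in ?XX (symm R)"
  proof -
    have sw: "continuous_map ?XX ?XX (\<lambda>p. (snd p, fst p))"
      by (intro continuous_map_pairedI continuous_map_snd continuous_map_fst)
    have "borel_in ?XX {p \<in> topspace ?XX. (snd p, fst p) \<in> R}"
      by (rule borel_in_continuous_preimage[OF sw R(2)])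
    moreover have "symm R = R \<union> {p \<in> topspace ?XX. (snd p, fst p) \<in> R}"
      using RX by (auto simp: symm_def)
    ultimately show ?thesis
      using R(2) unfolding borel_in_def by (simp add: sigma_sets_Un)
  qed
  \<comment> \<open>Pulling squares back needs injective maps, so pairs with a constant map are left out.\<close>
  define \<rho> where "\<rho> k = (if fst k \<in> I \<and> snd k \<in> I then {p. (h1 (fst k) (fst p), h1 (snd k) (snd p)) \<in> symm R} else {})"
    for k :: "bool \<times> bool"
  define B where "B l = {x. (h1 (fst l) x, h1 (snd l) x) \<in> R}" for l :: "bool \<times> bool"
  have top1: "h1 i x \<in> topspace X" for i x
    using continuous_map_funspace[OF c1] by auto
  have borel\<rho>: "borel_in ?CC (\<rho> k)" for k
  proof -
    have cc: "continuous_map ?CC ?XX (\<lambda>p. (h1 (fst k) (fst p), h1 (snd k) (snd p)))"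
      by (intro continuous_map_pairedI continuous_map_compose[OF continuous_map_fst c1, unfolded o_def]
          continuous_map_compose[OF continuous_map_snd c1, unfolded o_def])
    have "borel_in ?CC {p. (h1 (fst k) (fst p), h1 (snd k) (snd p)) \<in> symm R}"
      using borel_in_continuous_preimage[OF cc borel_symm] by simp
    moreover have "borel_in ?CC {}"
      by (simp add: borel_in_def sigma_sets.Empty)
    ultimately show ?thesis
      by (simp add: \<rho>_def)
  qed
  have borelB: "borel_in cantor_space (B l)" for l
  proof -
    have cc: "continuous_map cantor_space ?XX (\<lambda>x. (h1 (fst l) x, h1 (snd l) x))"
      by (intro continuous_map_pairedI c1)
    show ?thesis
      using borel_in_continuous_preimage[OF cc R(2)] by (simp add: B_def)
  qed
  have conv: "\<exists>k'. \<rho> k' = prod.swap ` \<rho> k" for k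
  proof (intro exI set_eqI iffI)
    fix p assume "p \<in> \<rho> (prod.swap k)"
    then have "prod.swap p \<in> \<rho> k"
      using symD[OF symG] by (auto simp: \<rho>_def split: if_splits)
    then show "p \<in> prod.swap ` \<rho> k"
      by (intro image_eqI[of _ _ "prod.swap p"]) simp_all
  next
    fix p assume "p \<in> prod.swap ` \<rho> k"
    then show "p \<in> \<rho> (prod.swap k)"
      using symD[OF symG] by (auto simp: \<rho>_def split: if_splits)
  qed
  have K22': False if d: "distinct [x, x', y, y']" and e: "(x, y) \<in> \<rho> k" "(x, y') \<in> \<rho> k" "(x', y) \<in> \<rho> k" "(x', y') \<in> \<rho> k" for k x x' y y'
  proof -
    have I: "fst k \<in> I" "snd k \<in> I"
      using e(1) by (auto simp: \<rho>_def split: if_splits)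
    have e': "(h1 (fst k) x, h1 (snd k) y) \<in> symm R" "(h1 (fst k) x, h1 (snd k) y') \<in> symm R"
      "(h1 (fst k) x', h1 (snd k) y) \<in> symm R" "(h1 (fst k) x', h1 (snd k) y') \<in> symm R"
      using e I by (simp_all add: \<rho>_def)
    have ne: "h1 i a \<noteq> h1 j b" if "i \<in> I" "j \<in> I" "a \<noteq> b" for i j a b
      using g1(5)[OF that] by (simp add: h1_def)
    have "distinct [h1 (fst k) x, h1 (fst k) x', h1 (snd k) y, h1 (snd k) y']"
      using d ne I by simp
    then show False
      using e' by (rule K22)
  qed
  have QQ: "(x, y) \<notin> \<rho> k" if "x \<in> P_fin" "y \<in> P_fin" "x \<noteq> y" for k x y
    using g1(7)[of "fst k" "snd k" x y] that by (simp add: \<rho>_def h1_def)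
  obtain g2 where g2: "\<And>n x y. agree n x y \<Longrightarrow> agree n (g2 x) (g2 y)" "inj g2"
    "\<And>x. x \<in> P_fin \<Longrightarrow> g2 x \<in> P_fin" "\<And>x. x \<in> P_inf \<Longrightarrow> g2 x \<in> P_inf"
    "\<And>k x y. x \<noteq> y \<Longrightarrow> (g2 x, g2 y) \<notin> \<rho> k"
    "\<And>l. (\<forall>x\<in>P_inf. g2 x \<in> B l) \<or> (\<forall>x\<in>P_inf. g2 x \<notin> B l)"
    by (rule thin_free[where \<rho> = \<rho> and B = B, OF borel\<rho> borelB conv K22' QQ]) blast+
  define h where "h i x = h1 i (g2 x)" for i x
  have cg2: "continuous_map cantor_space cantor_space g2"
    by (rule cg) (rule g2(1))
  have c: "continuous_map cantor_space X (h i)" for i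
    using continuous_map_compose[OF cg2 c1[of i]] by (simp add: h_def [abs_def] o_def)
  have Bfin: "(\<forall>x\<in>P_fin. x \<in> B l) \<or> (\<forall>x\<in>P_fin. x \<notin> B l)" for l
    using g1(8)[of l] by (simp add: B_def h1_def)
  have "\<exists>k\<in>{0, 1, 2, 3}. \<forall>x. (h i x, h j x) \<in> R \<longleftrightarrow> x \<in> SS \<Gamma> k" for i j
  proof -
    have eq: "(h i x, h j x) \<in> R \<longleftrightarrow> g2 x \<in> B (i, j)" for x
      by (simp add: h_def B_def)
    obtain u where u: "\<And>x. x \<in> P_inf \<Longrightarrow> g2 x \<in> B (i, j) \<longleftrightarrow> u"
      using g2(6)[of "(i, j)"] by blast
    obtain v where v: "\<And>x. x \<in> P_fin \<Longrightarrow> g2 x \<in> B (i, j) \<longleftrightarrow> v"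
      using Bfin[of "(i, j)"] g2(3) by blast
    define a where "a = (case \<Gamma> of Sigma02 \<Rightarrow> u | Pi02 \<Rightarrow> v)"
    define b where "b = (case \<Gamma> of Sigma02 \<Rightarrow> v | Pi02 \<Rightarrow> u)"
    have ab: "g2 x \<in> B (i, j) \<longleftrightarrow> (if x \<in> CC \<Gamma> then a else b)" for x
      using u[of x] v[of x] by (cases \<Gamma>) (auto simp: a_def b_def P_fin_def)
    show ?thesis
      unfolding eq ab
      by (intro bexI[of _ "if a then (if b then 3 else 0) else (if b then 2 else 1)"]) auto
  qed
  then have "\<forall>l. \<exists>k\<in>{0, 1, 2, 3}. \<forall>x. (h (fst l) x, h (snd l) x) \<in> R \<longleftrightarrow> x \<in> SS \<Gamma> k"
    by blast
  then obtain t where t: "\<And>l. t l \<in> {0, 1, 2, 3}" "\<And>l x. (h (fst l) x, h (snd l) x) \<in> R \<longleftrightarrow> x \<in> SS \<Gamma> (t l)"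
    by metis
  have gC: "g1 x \<in> CC \<Gamma> \<longleftrightarrow> x \<in> CC \<Gamma>" "g2 x \<in> CC \<Gamma> \<longleftrightarrow> x \<in> CC \<Gamma>" for x
    using g1(2,3)[of x] g2(3,4)[of x] by (cases \<Gamma>; auto simp: P_fin_def)+
  have FT: "(h False x, h True x) \<in> R \<longleftrightarrow> x \<in> CC \<Gamma>" for x
    using hh(2)[of "g1 (g2 x)"] gC by (simp add: h_def h1_def h0_def)
  show ?thesis
  proof (rule that[of h I t])
    show "continuous_map cantor_space X (h i)" for i
      by (rule c)
    show "\<exists>v. \<forall>x. h i x = v" if "i \<notin> I" for i
      using g1(4)[OF that] by (auto simp: h_def h1_def)
    show "h i x \<noteq> h j y" if "i \<in> I" "j \<in> I" "x \<noteq> y" for i j x y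
      using g1(5)[OF that(1,2), of "g2 x" "g2 y"] that(3) g2(2) by (simp add: h_def h1_def inj_eq)
    show "(\<forall>x. h False x = h True x) \<or> (\<forall>x. h False x \<noteq> h True x)"
      using g1(6) by (auto simp: h_def h1_def)
    show "(h i x, h j y) \<notin> R" if "i \<in> I" "j \<in> I" "x \<noteq> y" for i j x y
      using g2(5)[OF that(3), of "(i, j)"] that(1,2) by (auto simp: \<rho>_def h_def symm_def)
    show "t (i, j) \<in> {0, 1, 2, 3}" for i j
      by (rule t(1))
    show "(h i x, h j x) \<in> R \<longleftrightarrow> x \<in> SS \<Gamma> (t (i, j))" for i j x
      using t(2)[of "(i, j)"] by simp
    then have "SS \<Gamma> (t (False, True)) = SS \<Gamma> 0"
      using FT by auto
    then show "t (False, True) = 0"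
      using SS_inj[OF t(1)] by simp
  qed
qed

lemma reduce_diagonal:
  assumes R: "relation_on X R" and f: "continuous_map cantor_space X f" "inj f"
    and d: "\<And>x. (f x, f x) \<in> R \<longleftrightarrow> x \<in> CC \<Gamma>" "\<And>x y. x \<noteq> y \<Longrightarrow> (f x, f y) \<notin> R"
  shows "inj_leq_c (copy Inl (cantor_space, Id_on (CC \<Gamma>))) (X, R)"
proof (rule inj_leq_copy[OF _ f(1)])
  show "Id_on (CC \<Gamma>) = {(x, y) \<in> topspace cantor_space \<times> topspace cantor_space. (f x, f y) \<in> R}"
  proof (intro set_eqI iffI)
    fix p assume "p \<in> {(x, y) \<in> topspace cantor_space \<times> topspace cantor_space. (f x, f y) \<in> R}"
    then obtain x y where p: "p = (x, y)" "(f x, f y) \<in> R"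
      by blast
    then have "x = y"
      using d(2) by blast
    then show "p \<in> Id_on (CC \<Gamma>)"
      using p d(1) by auto
  qed (use d(1) in auto)
qed (use f in \<open>auto simp: inj_def\<close>)

lemma continuous_map_D_space:
  assumes "\<And>i. continuous_map cantor_space X (h i)"
  shows "continuous_map D_space X (\<lambda>p. h (fst p) (snd p))"
  unfolding continuous_map_def
proof (intro conjI allI impI)
  show "(\<lambda>p. h (fst p) (snd p)) \<in> topspace D_space \<rightarrow> topspace X"
    using continuous_map_funspace[OF assms] by auto
  fix V assume V: "openin X V"
  show "openin D_space {p \<in> topspace D_space. h (fst p) (snd p) \<in> V}"
    unfolding D_space_def openin_prod_topology_alt
  proof (intro allI impI)
    fix i x assume "(i, x) \<in> {p \<in> topspace (prod_topology (discrete_topology UNIV) cantor_space). h (fst p) (snd p) \<in> V}"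
    moreover have "openin cantor_space {x \<in> topspace cantor_space. h i x \<in> V}"
      by (rule openin_continuous_map_preimage[OF assms V])
    ultimately show "\<exists>U W. openin (discrete_topology UNIV) U \<and> openin cantor_space W \<and> i \<in> U \<and> x \<in> W \<and>
        U \<times> W \<subseteq> {p \<in> topspace (prod_topology (discrete_topology UNIV) cantor_space). h (fst p) (snd p) \<in> V}"
      by (intro exI[of _ "{i}"] exI[of _ "{x \<in> topspace cantor_space. h i x \<in> V}"]) auto
  qed
qed

lemma continuous_map_S_space:
  assumes f: "continuous_map cantor_space X f" and v: "v \<in> topspace X"
  shows "continuous_map S_space X (\<lambda>s. if s 0 then f (\<lambda>n. s (Suc n)) else v)"
  unfolding S_space_def
proof (rule continuous_map_from_subtopology)
  show "continuous_map cantor_space X (\<lambda>s. if s 0 then f (\<lambda>n. s (Suc n)) else v)"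
    unfolding continuous_map_def
  proof (intro conjI allI impI)
    show "(\<lambda>s. if s 0 then f (\<lambda>n. s (Suc n)) else v) \<in> topspace cantor_space \<rightarrow> topspace X"
      using continuous_map_funspace[OF f] v by auto
    fix V assume V: "openin X V"
    show "openin cantor_space {s \<in> topspace cantor_space. (if s 0 then f (\<lambda>n. s (Suc n)) else v) \<in> V}"
      unfolding openin_cantor_space
    proof
      fix s assume s: "s \<in> {s \<in> topspace cantor_space. (if s 0 then f (\<lambda>n. s (Suc n)) else v) \<in> V}"
      show "\<exists>k. \<forall>y. agree k s y \<longrightarrow> y \<in> {s \<in> topspace cantor_space. (if s 0 then f (\<lambda>n. s (Suc n)) else v) \<in> V}"
      proof (cases "s 0")
        case True
        have "openin cantor_space {x \<in> topspace cantor_space. f x \<in> V}"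
          by (rule openin_continuous_map_preimage[OF f V])
        then obtain k where k: "\<And>y. agree k (\<lambda>n. s (Suc n)) y \<Longrightarrow> f y \<in> V"
          using s True unfolding openin_cantor_space by auto
        have kk: "f (\<lambda>n. y (Suc n)) \<in> V \<and> y 0" if "agree (Suc k) s y" for y
          using that True by (auto intro!: k simp: agree_def)
        then show ?thesis
          by (intro exI[of _ "Suc k"] allI impI) (simp add: kk)
      next
        case False
        then show ?thesis
          using s by (intro exI[of _ 1]) (simp add: agree_def)
      qed
    qed
  qed
qed

text \<open>
  If an injective map has \<open>t (i, i) = 0\<close>, it reduces the diagonal of \<open>CC \<Gamma>\<close>; this includes the case of equal maps, where all
  entries of the pattern are equal. Otherwise two injective maps define an injection of \<open>D_space\<close>, and exchanging them achieves the
  inequality required in \<open>P_patterns\<close>. If only one map is injective, the constant value of the other one becomes the image of \<open>zeros\<close>.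
  The maps cannot both be constant, since \<open>CC \<Gamma>\<close> is neither empty nor everything.
\<close>
theorem minorant_exists:
  assumes XR: "(X, R) \<in> s_acyclic_borel_relations \<Gamma>"
  shows "\<exists>p\<in>A_family \<Gamma> \<union> B_family \<Gamma>. inj_leq_c p (X, R)"
proof -
  have R: "relation_on X R"
    using XR by (simp add: s_acyclic_borel_relations_def non_class_borel_def)
  obtain h I t where c: "\<And>i. continuous_map cantor_space X (h i)"
    and const: "\<And>i. i \<notin> I \<Longrightarrow> \<exists>v. \<forall>x. h i x = v"
    and ne: "\<And>i j x y. i \<in> I \<Longrightarrow> j \<in> I \<Longrightarrow> x \<noteq> y \<Longrightarrow> h i x \<noteq> h j y"
    and eq: "(\<forall>x. h False x = h True x) \<or> (\<forall>x. h False x \<noteq> h True x)"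
    and free: "\<And>i j x y. i \<in> I \<Longrightarrow> j \<in> I \<Longrightarrow> x \<noteq> y \<Longrightarrow> (h i x, h j y) \<notin> R"
    and t: "\<And>i j. t (i, j) \<in> {0, 1, 2, 3}" "\<And>i j x. (h i x, h j x) \<in> R \<longleftrightarrow> x \<in> SS \<Gamma> (t (i, j))" "t (False, True) = 0"
    by (rule canonical_pair[OF XR]) blast
  have topX: "h i x \<in> topspace X" for i x
    using continuous_map_funspace[OF c] by auto
  have diag: ?thesis if i: "i \<in> I" and ti: "t (i, i) = 0" for i
  proof -
    have "inj_leq_c (copy Inl (cantor_space, Id_on (CC \<Gamma>)) :: point space_rel) (X, R)"
    proof (rule reduce_diagonal[OF R c[of i]])
      show "inj (h i)"
        using ne[OF i i] by (auto simp: inj_def)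
    qed (use t(2)[of i _ i] ti free[OF i i] in auto)
    then show ?thesis
      by (auto simp: A_family_def)
  qed
  have notconst: "\<not> (\<exists>v w. (\<forall>x. h False x = v) \<and> (\<forall>x. h True x = w))"
  proof
    assume "\<exists>v w. (\<forall>x. h False x = v) \<and> (\<forall>x. h True x = w)"
    then obtain v w where "\<And>x. h False x = v" "\<And>x. h True x = w"
      by blast
    then have "x \<in> CC \<Gamma> \<longleftrightarrow> (v, w) \<in> R" for x
      using t(2)[of False x True] t(3) by simp
    then show False
      using CC_nontrivial[of \<Gamma>] by blast
  qed
  show ?thesis
  proof (cases "\<forall>x. h False x = h True x")
    case True
    then have "False \<in> I"
      using const[of False] notconst by auto
    moreover have "SS \<Gamma> (t (False, False)) = SS \<Gamma> 0"
      using t(2)[of False _ False] t(2)[of False _ True] True t(3) by auto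
    then have "t (False, False) = 0"
      using SS_inj[OF t(1)] by simp
    ultimately show ?thesis
      by (rule diag)
  next
    case False
    then have never: "h False x \<noteq> h True x" for x
      using eq by blast
    have never': "h i x \<noteq> h (\<not> i) x" for i x
      using never[of x] by (cases i) auto
    have "I = UNIV \<or> (\<exists>i. i \<in> I \<and> (\<not> i) \<notin> I) \<or> I = {}"
    proof (rule disjCI)
      assume "\<not> ((\<exists>i. i \<in> I \<and> (\<not> i) \<notin> I) \<or> I = {})"
      then have mixed: "\<not> (\<exists>i. i \<in> I \<and> (\<not> i) \<notin> I)" and nonempty: "I \<noteq> {}"
        by (rule contrapos_nn, simp)+
      have flip: "i \<in> I \<longrightarrow> (\<not> i) \<in> I" for i
      proof (intro impI, rule ccontr)
        assume "i \<in> I" "(\<not> i) \<notin> I"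
        then have "\<exists>i. i \<in> I \<and> (\<not> i) \<notin> I"
          by (intro exI conjI)
        then show False
          using mixed by (rule notE[rotated])
      qed
      obtain i where "i \<in> I"
        using nonempty by auto
      then have "j \<in> I" for j
        using flip[of i] by (cases i; cases j) simp_all
      then show "I = UNIV"
        by auto
    qed
    then show ?thesis
    proof (elim disjE exE conjE)
      assume 1: "I = UNIV"
      show ?thesis
      proof (cases "t (False, False) = 0 \<or> t (True, True) = 0")
        case True
        then show ?thesis
          using diag 1 by blast
      next
        case nz: False
        have main: ?thesis if s: "\<And>i j. s (i, j) = t (\<sigma> i, \<sigma> j)" "s \<in> P_patterns" and \<sigma>: "inj \<sigma>" for s and \<sigma> :: "bool \<Rightarrow> bool"
        proof -
          let ?f = "\<lambda>p. h (\<sigma> (fst p)) (snd p)"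
          have "inj_leq_c (copy Inr (D_space, R_rel \<Gamma> s) :: point space_rel) (X, R)"
          proof (rule inj_leq_copy)
            show "continuous_map D_space X ?f"
              by (rule continuous_map_D_space[of X "\<lambda>i. h (\<sigma> i)"]) (rule c)
            show "inj_on ?f (topspace D_space)"
            proof (rule inj_onI)
              fix p q :: "bool \<times> cantor" assume pq: "?f p = ?f q"
              then have "snd p = snd q"
                using ne[of "\<sigma> (fst p)" "\<sigma> (fst q)" "snd p" "snd q"] 1 by blast
              moreover have "\<sigma> (fst p) = \<sigma> (fst q)"
                using pq calculation never[of "snd q"] never[of "snd q", symmetric] by (cases "\<sigma> (fst p)"; cases "\<sigma> (fst q)") auto
              ultimately show "p = q"
                using \<sigma> by (simp add: prod_eq_iff inj_eq)
            qed
            show "R_rel \<Gamma> s = {(x, y) \<in> topspace D_space \<times> topspace D_space. (?f x, ?f y) \<in> R}"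
            proof -
              have "((i, x), (j, y)) \<in> R_rel \<Gamma> s \<longleftrightarrow> (h (\<sigma> i) x, h (\<sigma> j) y) \<in> R" for i j x y
                unfolding R_rel_iff s(1) using t(2) free[of "\<sigma> i" "\<sigma> j" x y] 1 by (cases "x = y") auto
              then show ?thesis
                by (auto simp: split_paired_all)
            qed
          qed simp
          then show ?thesis
            using s(2) by (auto simp: A_family_def)
        qed
        have rng: "range (\<lambda>p. t (\<sigma> (fst p), \<sigma> (snd p))) \<subseteq> {0, 1, 2, 3}" for \<sigma>
          by (intro image_subsetI) (rule t(1))
        show ?thesis
        proof (cases "t (True, False) = 0 \<longrightarrow> t (False, False) \<le> t (True, True)")
          case True
          show ?thesis
            by (rule main[of "\<lambda>p. t (id (fst p), id (snd p))" id]) (use True nz t(3) rng[of id] in \<open>auto simp: P_patterns_def\<close>)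
        next
          case False
          show ?thesis
            by (rule main[of "\<lambda>p. t (Not (fst p), Not (snd p))" Not])
              (use False nz t(3) rng[of Not] in \<open>auto simp: P_patterns_def inj_def\<close>)
        qed
      qed
    next
      fix i assume 2: "i \<in> I" "(\<not> i) \<notin> I"
      obtain v where v: "\<And>x. h (\<not> i) x = v"
        using const[OF 2(2)] by blast
      show ?thesis
      proof (cases "t (i, i) = 0")
        case True
        then show ?thesis
          using diag 2 by blast
      next
        case False
        define s where "s p = (if p = (False, False) then (if (v, v) \<in> R then 1 else 0)
            else if p = (False, True) then t (\<not> i, i) else if p = (True, False) then t (i, \<not> i) else t (i, i))" for p
        have "s \<in> A_patterns"
          unfolding A_patterns_def
        proof (intro CollectI conjI)
          show "range s \<subseteq> {0, 1, 2, 3}"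
            using t(1)[of "\<not> i" i] t(1)[of i "\<not> i"] t(1)[of i i] by (intro image_subsetI) (simp add: s_def)
          show "s (False, True) = 0 \<or> s (True, False) = 0"
            using t(3) by (cases i) (auto simp: s_def)
        qed (use False in \<open>auto simp: s_def\<close>)
        let ?f = "\<lambda>x :: cantor. if x 0 then h i (\<lambda>n. x (Suc n)) else v"
        have fz: "?f zeros = v" and fo: "?f (one_cons x) = h i x" for x
          by (simp_all add: zeros_def)
        have vne: "v \<noteq> h i x" for x
          using never'[of i x] v[of x] by simp
        have hinj: "h i x = h i y \<longleftrightarrow> x = y" for x y
          using ne[OF 2(1) 2(1)] by blast
        have "inj_leq_c (copy Inl (S_space, Ra_rel \<Gamma> s) :: point space_rel) (X, R)"
        proof (rule inj_leq_copy)
          show "continuous_map S_space X ?f"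
            using topX[of "\<not> i"] v by (intro continuous_map_S_space c) metis
          show "inj_on ?f (topspace S_space)"
          proof (rule inj_onI)
            fix p q assume p: "p \<in> topspace S_space" and q: "q \<in> topspace S_space" and e: "?f p = ?f q"
            show "p = q"
              using p
            proof (cases rule: S_space_cases)
              case 1
              note p = this
              show ?thesis
                using q
              proof (cases rule: S_space_cases)
                case 1
                then show ?thesis
                  using p by simp
              next
                case (2 y)
                show ?thesis
                  using e vne[of y] unfolding p 2 fz fo by (rule notE[rotated])
              qed
            next
              case (2 x)
              note p = this
              show ?thesis
                using q
              proof (cases rule: S_space_cases)
                case 1
                show ?thesis
                  using e[symmetric] vne[of x] unfolding p 1 fz fo by (rule notE[rotated])
              next
                case (2 y)
                have "x = y"
                  using e unfolding p 2 fo hinj .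
                then show ?thesis
                  using p 2 by simp
              qed
            qed
          qed
          show "Ra_rel \<Gamma> s = {(x, y) \<in> topspace S_space \<times> topspace S_space. (?f x, ?f y) \<in> R}"
          proof -
            have sub: "Ra_rel \<Gamma> s \<subseteq> topspace S_space \<times> topspace S_space"
              by (auto simp: Ra_rel_def)
            have "(p, q) \<in> Ra_rel \<Gamma> s \<longleftrightarrow> (?f p, ?f q) \<in> R" if "p \<in> topspace S_space" "q \<in> topspace S_space" for p q
            proof -
              have z1: "(v, h i y) \<in> R \<longleftrightarrow> y \<in> SS \<Gamma> (t (\<not> i, i))" "(h i y, v) \<in> R \<longleftrightarrow> y \<in> SS \<Gamma> (t (i, \<not> i))" for y
                using t(2)[of "\<not> i" y i] t(2)[of i y "\<not> i"] v by simp_all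
              have z2: "(h i x, h i y) \<in> R \<longleftrightarrow> x = y \<and> x \<in> SS \<Gamma> (t (i, i))" for x y
                using t(2)[of i x i] free[OF 2(1) 2(1), of x y] by (cases "x = y") auto
              show ?thesis
                using that
                by (elim S_space_cases) (simp_all only: fz fo Ra_rel_cases z1 z2, simp_all add: s_def)
            qed
            then show ?thesis
              using sub by blast
          qed
        qed simp
        then show ?thesis
          using \<open>s \<in> A_patterns\<close> by (auto simp: B_family_def)
      qed
    next
      assume 3: "I = {}"
      then show ?thesis
        using const[of False] const[of True] notconst by auto
    qed
  qed
qed

section \<open>Reductions between the examples\<close>

text \<open>
  The witness of \<open>leq_c\<close>, before the examples are copied to a common type.
\<close>
definition reduces :: "'a topology \<Rightarrow> ('a \<times> 'a) set \<Rightarrow> 'b topology \<Rightarrow> ('b \<times> 'b) set \<Rightarrow> ('a \<Rightarrow> 'b) \<Rightarrow> bool" where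
  "reduces X A Y B f \<longleftrightarrow> continuous_map X Y f \<and> (\<forall>x\<in>topspace X. \<forall>y\<in>topspace X. (x, y) \<in> A \<longleftrightarrow> (f x, f y) \<in> B)"

lemma reduces_converse: "reduces X A Y B f \<Longrightarrow> reduces X (A\<inverse>) Y (B\<inverse>) f"
  by (simp add: reduces_def)

lemma leq_c_copyD:
  assumes e: "inj e" and e': "inj e'" and A: "relation_on X A"
    and le: "leq_c (copy e (X, A)) (copy e' (Y, B))"
  shows "\<exists>f. reduces X A Y B f"
proof -
  let ?X = "pullback_topology (range e) (inv e) X" and ?Y = "pullback_topology (range e') (inv e') Y"
  obtain f where f: "continuous_map ?X ?Y f"
    "map_prod e e ` A = {(x, y) \<in> topspace ?X \<times> topspace ?X. (f x, f y) \<in> map_prod e' e' ` B}"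
    using le unfolding leq_c_def copy_def by auto
  have i: "inv e (e x) = x" "inv e' (e' y) = y" for x y
    using e e' by simp_all
  have ce: "continuous_map X ?X e"
    by (rule continuous_map_pullback') (auto simp: o_def i continuous_map_id[unfolded id_def])
  have ci: "continuous_map ?Y Y (inv e')"
    using continuous_map_pullback[of Y Y id] by (simp add: o_def id_def)
  have c: "continuous_map X Y (\<lambda>x. inv e' (f (e x)))"
    using continuous_map_compose[OF continuous_map_compose[OF ce f(1)] ci] by (simp add: o_def)
  have "(x, y) \<in> A \<longleftrightarrow> (inv e' (f (e x)), inv e' (f (e y))) \<in> B" if xy: "x \<in> topspace X" "y \<in> topspace X" for x y
  proof -
    have ex: "e x \<in> topspace ?X" "e y \<in> topspace ?X"
      using xy unfolding copy_topspace[OF e] by blast+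
    then have "f (e x) \<in> topspace ?Y" "f (e y) \<in> topspace ?Y"
      using continuous_map_funspace[OF f(1)] by auto
    then obtain u v where uv: "f (e x) = e' u" "f (e y) = e' v"
      unfolding copy_topspace[OF e'] by blast
    have "(x, y) \<in> A \<longleftrightarrow> (e x, e y) \<in> map_prod e e ` A"
      using e by (auto simp: inj_eq)
    also have "\<dots> \<longleftrightarrow> (f (e x), f (e y)) \<in> map_prod e' e' ` B"
      unfolding f(2) using ex by simp
    also have "\<dots> \<longleftrightarrow> (u, v) \<in> B"
      unfolding uv using e' by (auto simp: inj_eq)
    finally show ?thesis
      by (simp add: uv i)
  qed
  then show ?thesis
    unfolding reduces_def using c by blast
qed

section \<open>Making clopen choices constant\<close>

definition shift :: "cantor \<Rightarrow> nat \<Rightarrow> cantor \<Rightarrow> cantor" where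
  "shift a k x = (\<lambda>i. if i < k then a i else x (i - k))"

lemma shift_P_inf: "shift a k x \<in> P_inf \<longleftrightarrow> x \<in> P_inf"
proof -
  have "{n. shift a k x n} = {n. n < k \<and> a n} \<union> (\<lambda>n. n + k) ` {n. x n}"
  proof (intro set_eqI iffI)
    fix n assume n: "n \<in> {n. shift a k x n}"
    show "n \<in> {n. n < k \<and> a n} \<union> (\<lambda>n. n + k) ` {n. x n}"
    proof (cases "n < k")
      case True
      then show ?thesis
        using n by (simp add: shift_def)
    next
      case False
      then show ?thesis
        using n by (intro UnI2 image_eqI[of _ _ "n - k"]) (simp_all add: shift_def)
    qed
  qed (auto simp: shift_def)
  moreover have "finite ((\<lambda>n. n + k) ` {n. x n}) \<longleftrightarrow> finite {n. x n}"
    by (rule finite_image_iff) (simp add: inj_on_def)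
  ultimately show ?thesis
    by (simp add: P_inf_def)
qed

lemma shift_SS: "k' \<in> {0, 1, 2, 3} \<Longrightarrow> shift a k x \<in> SS \<Gamma> k' \<longleftrightarrow> x \<in> SS \<Gamma> k'"
  using shift_P_inf[of a k x] by (cases \<Gamma>) (auto simp: P_fin_def)

lemma inj_shift: "inj (shift a k)"
proof (rule injI)
  fix x y assume "shift a k x = shift a k y"
  then have "shift a k x (n + k) = shift a k y (n + k)" for n
    by simp
  then show "x = y"
    by (simp add: shift_def fun_eq_iff)
qed

lemma continuous_shift: "continuous_map cantor_space cantor_space (shift a k)"
proof (rule continuous_map_cantor_cantor)
  fix j show "\<exists>n. \<forall>x y. agree n x y \<longrightarrow> agree j (shift a k x) (shift a k y)"
    by (intro exI[of _ j]) (auto simp: agree_def shift_def)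
qed

text \<open>
  Near \<open>zeros\<close> two given clopen sets are constant, and adding a fixed initial segment maps Cantor space into this
  neighbourhood without changing membership in the sets \<open>SS \<Gamma> k\<close>. For a reduction into \<open>D_space\<close> or \<open>S_space\<close> one
  may thus assume that the sheet of the image is constant.
\<close>
lemma localize:
  fixes \<epsilon> \<delta> :: "cantor \<Rightarrow> bool"
  assumes "openin cantor_space {x. \<epsilon> x}" "openin cantor_space {x. \<not> \<epsilon> x}"
    and "openin cantor_space {x. \<delta> x}" "openin cantor_space {x. \<not> \<delta> x}"
  obtains \<phi> c d where "continuous_map cantor_space cantor_space \<phi>" "inj \<phi>"
    "\<And>x \<Gamma> k. k \<in> {0, 1, 2, 3} \<Longrightarrow> \<phi> x \<in> SS \<Gamma> k \<longleftrightarrow> x \<in> SS \<Gamma> k" "\<And>x. \<epsilon> (\<phi> x) = c" "\<And>x. \<delta> (\<phi> x) = d"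
proof -
  have loc: "\<exists>k. \<forall>y. agree k zeros y \<longrightarrow> \<eta> y = \<eta> zeros"
    if "openin cantor_space {x. \<eta> x}" "openin cantor_space {x. \<not> \<eta> x}" for \<eta> :: "cantor \<Rightarrow> bool"
  proof (cases "\<eta> zeros")
    case True
    then show ?thesis
      using that(1) unfolding openin_cantor_space by auto
  next
    case False
    then show ?thesis
      using that(2) unfolding openin_cantor_space by auto
  qed
  obtain k where k: "\<And>y. agree k zeros y \<Longrightarrow> \<epsilon> y = \<epsilon> zeros"
    using loc[OF assms(1,2)] by blast
  obtain l where l: "\<And>y. agree l zeros y \<Longrightarrow> \<delta> y = \<delta> zeros"
    using loc[OF assms(3,4)] by blast
  have ag: "agree j zeros (shift zeros (max k l) x)" if "j \<le> max k l" for j x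
    using that by (simp add: agree_def shift_def)
  show ?thesis
  proof (rule that[OF continuous_shift inj_shift shift_SS])
    show "\<epsilon> (shift zeros (max k l) x) = \<epsilon> zeros" "\<delta> (shift zeros (max k l) x) = \<delta> zeros" for x
      using k[OF ag] l[OF ag] by simp_all
  qed
qed

lemma dense_CC: "\<exists>y\<in>CC \<Gamma>. agree k x y"
proof -
  have "agree k x (\<lambda>i. i < k \<longrightarrow> x i)" "(\<lambda>i. i < k \<longrightarrow> x i) \<in> P_inf"
  proof -
    have "{k..} \<subseteq> {i. i < k \<longrightarrow> x i}"
      by auto
    then show "(\<lambda>i. i < k \<longrightarrow> x i) \<in> P_inf"
      unfolding P_inf_def using infinite_Ici infinite_super by blast
  qed (simp add: agree_def)
  then show ?thesis
    by (cases \<Gamma>) (auto intro: agree_trunc(1) trunc_P_fin)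
qed

lemma dense_eq:
  assumes "continuous_map cantor_space cantor_space u" "continuous_map cantor_space cantor_space v"
    and "\<And>x. x \<in> CC \<Gamma> \<Longrightarrow> u x = v x"
  shows "u = v"
proof
  fix x
  have "closedin cantor_space {x \<in> topspace cantor_space. u x = v x}"
    by (rule closedin_continuous_maps_eq[OF Hausdorff_cantor_space assms(1,2)])
  then have op: "openin cantor_space {x. u x \<noteq> v x}"
    by (simp add: closedin_def set_diff_eq)
  show "u x = v x"
  proof (rule ccontr)
    assume "u x \<noteq> v x"
    then obtain k where "\<And>y. agree k x y \<Longrightarrow> u y \<noteq> v y"
      using op unfolding openin_cantor_space by blast
    then show False
      using dense_CC[of \<Gamma> k x] assms(3) by blast
  qed
qed

lemma two_in_CC: "\<exists>x\<in>CC \<Gamma>. \<exists>y\<in>CC \<Gamma>. x \<noteq> y"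
proof -
  obtain x where x: "x \<in> CC \<Gamma>"
    using CC_nontrivial by blast
  obtain y where "y \<in> CC \<Gamma>" "agree 1 (\<lambda>_. \<not> x 0) y"
    using dense_CC by blast
  then have "y 0 \<noteq> x 0"
    by (simp add: agree_def)
  then show ?thesis
    using x \<open>y \<in> CC \<Gamma>\<close> by metis
qed

text \<open>
  Among the sets \<open>SS \<Gamma> k\<close>, only \<open>CC \<Gamma>\<close> is outside \<open>\<Gamma>\<close>.
\<close>
lemma pattern_zero:
  assumes "continuous_map cantor_space cantor_space u" "k \<in> {0, 1, 2, 3}" "\<And>x. x \<in> CC \<Gamma> \<longleftrightarrow> u x \<in> SS \<Gamma> k"
  shows "k = 0"
proof (rule ccontr)
  assume "k \<noteq> 0"
  then have "in_class \<Gamma> cantor_space (SS \<Gamma> k)"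
    using assms(2) by (intro SS_in_class) auto
  from no_reduction[OF assms(1) this] show False
    using assms(3) by blast
qed

lemma SS_transfer:
  assumes "\<And>x. u x \<in> CC \<Gamma> \<longleftrightarrow> x \<in> CC \<Gamma>" "k \<in> {0, 1, 2, 3}"
  shows "u x \<in> SS \<Gamma> k \<longleftrightarrow> x \<in> SS \<Gamma> k"
  using assms by auto

lemma CC_not_const: "\<not> (\<forall>x. x \<in> CC \<Gamma> \<longleftrightarrow> b)"
  using CC_nontrivial[of \<Gamma>] by blast

lemma continuous_map_into_D_space:
  assumes f: "continuous_map cantor_space D_space f"
  shows "continuous_map cantor_space cantor_space (\<lambda>x. snd (f x))"
    "openin cantor_space {x. fst (f x)}" "openin cantor_space {x. \<not> fst (f x)}"
proof -
  have c: "continuous_map cantor_space (discrete_topology UNIV) (\<lambda>x. fst (f x))"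
    "continuous_map cantor_space cantor_space (\<lambda>x. snd (f x))"
    using f unfolding D_space_def continuous_map_pairwise o_def by simp_all
  show "continuous_map cantor_space cantor_space (\<lambda>x. snd (f x))"
    by (rule c(2))
  show "openin cantor_space {x. fst (f x)}" "openin cantor_space {x. \<not> fst (f x)}"
    using openin_continuous_map_preimage[OF c(1), of "{True}"] openin_continuous_map_preimage[OF c(1), of "{False}"] by simp_all
qed

lemma continuous_map_into_S_space:
  assumes f: "continuous_map cantor_space S_space f"
  shows "continuous_map cantor_space cantor_space (\<lambda>x n. f x (Suc n))"
    "openin cantor_space {x. f x 0}" "openin cantor_space {x. \<not> f x 0}"
    "\<not> f x 0 \<Longrightarrow> f x = zeros" "f x 0 \<Longrightarrow> f x = one_cons (\<lambda>n. f x (Suc n))"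
proof -
  show "continuous_map cantor_space cantor_space (\<lambda>x n. f x (Suc n))"
    using continuous_map_compose[OF f continuous_tail] by (simp add: o_def)
  have cf: "continuous_map cantor_space cantor_space f"
    using f unfolding S_space_def continuous_map_in_subtopology by blast
  have o: "openin cantor_space {s. s 0}" "openin cantor_space {s. \<not> s 0}"
    unfolding openin_cantor_space by (intro ballI exI[of _ 1]; simp add: agree_def)+
  show "openin cantor_space {x. f x 0}" "openin cantor_space {x. \<not> f x 0}"
    using openin_continuous_map_preimage[OF cf o(1)] openin_continuous_map_preimage[OF cf o(2)] by simp_all
  have m: "f x \<in> topspace S_space"
    using continuous_map_funspace[OF f] by auto
  show "f x = zeros" if "\<not> f x 0"
    using m that by (auto simp: topspace_S_space)
  show "f x = one_cons (\<lambda>n. f x (Suc n))" if "f x 0"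
    using m that by (rule_tac S_space_cases[OF m]) (auto simp: zeros_def)
qed

lemma open_True: "openin cantor_space {x. True}" "openin cantor_space {x. \<not> True}"
  using openin_topspace[of cantor_space] by simp_all

section \<open>Incomparability of the examples\<close>

lemma diagonal_not_R:
  assumes t: "t \<in> P_patterns" and f: "reduces cantor_space (Id_on (CC \<Gamma>)) D_space (R_rel \<Gamma> t) f"
  shows False
proof -
  have cf: "continuous_map cantor_space D_space f" and red: "x \<in> CC \<Gamma> \<longleftrightarrow> (f x, f x) \<in> R_rel \<Gamma> t" for x
    using f by (auto simp: reduces_def Id_on_iff)
  obtain \<phi> c d where \<phi>: "continuous_map cantor_space cantor_space \<phi>" "inj \<phi>"
    "\<And>x \<Gamma> k. k \<in> {0, 1, 2, 3} \<Longrightarrow> \<phi> x \<in> SS \<Gamma> k \<longleftrightarrow> x \<in> SS \<Gamma> k" "\<And>x. fst (f (\<phi> x)) = c" "\<And>x. True = d"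
    by (rule localize[OF continuous_map_into_D_space(2,3)[OF cf] open_True]) blast
  have cu: "continuous_map cantor_space cantor_space (\<lambda>x. snd (f (\<phi> x)))"
    using continuous_map_compose[OF \<phi>(1) continuous_map_into_D_space(1)[OF cf]] by (simp add: o_def)
  have "x \<in> CC \<Gamma> \<longleftrightarrow> snd (f (\<phi> x)) \<in> SS \<Gamma> (t (c, c))" for x
  proof -
    obtain y where "f (\<phi> x) = (c, y)"
      using \<phi>(4)[of x] by (cases "f (\<phi> x)") simp
    then show ?thesis
      using red[of "\<phi> x"] \<phi>(3)[of 0 x \<Gamma>] by (simp add: R_rel_iff)
  qed
  moreover have "t (c, c) \<in> {0, 1, 2, 3}"
    using t unfolding P_patterns_def by blast
  ultimately have "t (c, c) = 0"
    using pattern_zero[OF cu] by blast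
  then show False
    using t by (cases c) (simp_all add: P_patterns_def)
qed

lemma diagonal_not_Ra:
  assumes t: "t \<in> A_patterns" and f: "reduces cantor_space (Id_on (CC \<Gamma>)) S_space (Ra_rel \<Gamma> t) f"
  shows False
proof -
  have cf: "continuous_map cantor_space S_space f" and red: "x \<in> CC \<Gamma> \<longleftrightarrow> (f x, f x) \<in> Ra_rel \<Gamma> t" for x
    using f by (auto simp: reduces_def Id_on_iff)
  obtain \<phi> c d where \<phi>: "continuous_map cantor_space cantor_space \<phi>" "inj \<phi>"
    "\<And>x \<Gamma> k. k \<in> {0, 1, 2, 3} \<Longrightarrow> \<phi> x \<in> SS \<Gamma> k \<longleftrightarrow> x \<in> SS \<Gamma> k" "\<And>x. f (\<phi> x) 0 = c" "\<And>x. True = d"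
    by (rule localize[OF continuous_map_into_S_space(2,3)[OF cf] open_True]) blast
  have red': "x \<in> CC \<Gamma> \<longleftrightarrow> (f (\<phi> x), f (\<phi> x)) \<in> Ra_rel \<Gamma> t" for x
    using \<phi>(3)[of 0 x \<Gamma>] red by simp
  have cu: "continuous_map cantor_space cantor_space (\<lambda>x n. f (\<phi> x) (Suc n))"
    using continuous_map_compose[OF \<phi>(1) continuous_map_into_S_space(1)[OF cf]] by (simp add: o_def)
  show False
  proof (cases c)
    case True
    have "f (\<phi> x) = one_cons (\<lambda>n. f (\<phi> x) (Suc n))" for x
      using continuous_map_into_S_space(5)[OF cf] \<phi>(4) True by blast
    then have "x \<in> CC \<Gamma> \<longleftrightarrow> (\<lambda>n. f (\<phi> x) (Suc n)) \<in> SS \<Gamma> (t (True, True))" for x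
      using red'[of x] Ra_rel_cases(4) by metis
    moreover have "t (True, True) \<in> {0, 1, 2, 3}"
      using t unfolding A_patterns_def by blast
    ultimately have "t (True, True) = 0"
      using pattern_zero[OF cu] by blast
    then show False
      using t by (simp add: A_patterns_def)
  next
    case False
    then have "f (\<phi> x) = zeros" for x
      using continuous_map_into_S_space(4)[OF cf] \<phi>(4) by blast
    then have "x \<in> CC \<Gamma> \<longleftrightarrow> (zeros, zeros) \<in> Ra_rel \<Gamma> t" for x
      using red' by metis
    then show False
      using CC_not_const by blast
  qed
qed

lemma continuous_D_sections:
  assumes "continuous_map D_space Y f"
  shows "continuous_map cantor_space Y (\<lambda>x. f (i, x))"
proof -
  have "continuous_map cantor_space D_space (\<lambda>x. (i, x))"
    unfolding D_space_def by (intro continuous_map_pairedI continuous_map_id[unfolded id_def]) simp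
  from continuous_map_compose[OF this assms] show ?thesis
    by (simp add: o_def)
qed

text \<open>
  The two points over \<open>x \<in> CC \<Gamma>\<close> are related, so they have the same image; by density this holds over all \<open>x\<close>, and \<open>t\<close> would be
  constantly 0.
\<close>
lemma R_not_diagonal:
  assumes t: "t \<in> P_patterns" and f: "reduces D_space (R_rel \<Gamma> t) cantor_space (Id_on (CC \<Gamma>)) f"
  shows False
proof -
  have cf: "continuous_map D_space cantor_space f"
    and red: "x \<in> SS \<Gamma> (t (i, j)) \<longleftrightarrow> f (i, x) = f (j, x) \<and> f (i, x) \<in> CC \<Gamma>" for i j x
    using f R_rel_iff[of i x j x \<Gamma> t] by (auto simp: reduces_def Id_on_iff)
  have t01: "t (False, True) = 0"
    using t by (simp add: P_patterns_def)
  have t00: "t (False, False) \<in> {0, 1, 2, 3}"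
    using t unfolding P_patterns_def by blast
  have red01: "x \<in> CC \<Gamma> \<longleftrightarrow> f (False, x) = f (True, x) \<and> f (False, x) \<in> CC \<Gamma>" for x
    using red[of x False True] t01 by simp
  have "(\<lambda>x. f (False, x)) = (\<lambda>x. f (True, x))"
  proof (rule dense_eq[OF continuous_D_sections[OF cf] continuous_D_sections[OF cf]])
    fix x assume "x \<in> CC \<Gamma>"
    then show "f (False, x) = f (True, x)"
      using red01[of x] by simp
  qed
  then have eq: "f (False, x) = f (True, x)" for x
    by (rule fun_cong)
  have "SS \<Gamma> (t (False, False)) = SS \<Gamma> 0"
  proof (rule set_eqI)
    fix x show "x \<in> SS \<Gamma> (t (False, False)) \<longleftrightarrow> x \<in> SS \<Gamma> 0"
      using red01[of x] red[of x False False] eq[of x] by simp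
  qed
  then have "t (False, False) = 0"
    using SS_inj[OF t00] by simp
  then show False
    using t by (simp add: P_patterns_def)
qed

lemma Ra_converse: "(Ra_rel \<Gamma> t)\<inverse> = Ra_rel \<Gamma> (t \<circ> prod.swap)"
  by (auto simp: Ra_rel_def)

lemma Ra_swap_pattern: "t \<in> A_patterns \<Longrightarrow> t \<circ> prod.swap \<in> A_patterns"
  unfolding A_patterns_def by (auto simp: image_subset_iff)

lemma R_converse: "(R_rel \<Gamma> t)\<inverse> = R_rel \<Gamma> (t \<circ> prod.swap)"
  by (auto simp: R_rel_def)

lemma Ra_not_diagonal:
  assumes t: "t \<in> A_patterns" and f: "reduces S_space (Ra_rel \<Gamma> t) cantor_space (Id_on (CC \<Gamma>)) f"
  shows False
proof -
  have main: False if t01: "t (False, True) = 0" and f: "reduces S_space (Ra_rel \<Gamma> t) cantor_space (Id_on (CC \<Gamma>)) f" for t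
  proof -
    have cf: "continuous_map S_space cantor_space f"
      and red: "x \<in> CC \<Gamma> \<longleftrightarrow> f zeros = f (one_cons x) \<and> f zeros \<in> CC \<Gamma>" for x
      using f Ra_rel_cases(2)[of x \<Gamma> t] t01 by (auto simp: reduces_def Id_on_iff)
    have "(\<lambda>x. f (one_cons x)) = (\<lambda>x. f zeros)"
    proof (rule dense_eq)
      show "continuous_map cantor_space cantor_space (\<lambda>x. f (one_cons x))"
        using continuous_map_compose[OF continuous_one_cons cf] by (simp add: o_def)
      show "f (one_cons x) = f zeros" if "x \<in> CC \<Gamma>" for x
        using red[of x] that by simp
    qed simp
    then have eq: "f (one_cons x) = f zeros" for x
      by (rule fun_cong)
    have "x \<in> CC \<Gamma> \<longleftrightarrow> f zeros \<in> CC \<Gamma>" for x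
      using red[of x] eq[of x] by simp
    then show False
      using CC_not_const by metis
  qed
  show False
  proof (cases "t (False, True) = 0")
    case True
    then show ?thesis
      using main f by blast
  next
    case False
    then have "(t \<circ> prod.swap) (False, True) = 0"
      using t by (simp add: A_patterns_def)
    moreover have "reduces S_space (Ra_rel \<Gamma> (t \<circ> prod.swap)) cantor_space (Id_on (CC \<Gamma>)) f"
      using reduces_converse[OF f] by (simp add: Ra_converse)
    ultimately show ?thesis
      by (rule main)
  qed
qed

text \<open>
  Over a small ball the sheets are sent to sheets, and as in \<open>R_not_diagonal\<close> to the same point of Cantor space by density. So \<open>t\<close> is
  \<open>t'\<close> up to a map of the two indices, which sends \<open>(False, True)\<close> to an entry 0 of \<open>t'\<close>; as the diagonal entries of \<open>t'\<close> are not 0, it is injective. If it is the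
  exchange, both patterns have two entries 0, and the inequality between the diagonal entries in \<open>P_patterns\<close> forces equality.
\<close>
lemma R_R_eq:
  assumes t: "t \<in> P_patterns" and t': "t' \<in> P_patterns" and f: "reduces D_space (R_rel \<Gamma> t) D_space (R_rel \<Gamma> t') f"
  shows "t = t'"
proof -
  have rng: "t p \<in> {0, 1, 2, 3}" "t' p \<in> {0, 1, 2, 3}" for p
    using t t' unfolding P_patterns_def by blast+
  have cf: "continuous_map D_space D_space f"
    and red: "x \<in> SS \<Gamma> (t (i, j)) \<longleftrightarrow> (f (i, x), f (j, x)) \<in> R_rel \<Gamma> t'" for i j x
    using f R_rel_iff[of i x j x \<Gamma> t] by (auto simp: reduces_def)
  note cs = continuous_D_sections[OF cf]
  obtain \<phi> c d where \<phi>: "continuous_map cantor_space cantor_space \<phi>" "inj \<phi>"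
    "\<And>x \<Gamma> k. k \<in> {0, 1, 2, 3} \<Longrightarrow> \<phi> x \<in> SS \<Gamma> k \<longleftrightarrow> x \<in> SS \<Gamma> k"
    "\<And>x. fst (f (False, \<phi> x)) = c" "\<And>x. fst (f (True, \<phi> x)) = d"
    by (rule localize[OF continuous_map_into_D_space(2,3)[OF cs[of False]] continuous_map_into_D_space(2,3)[OF cs[of True]]]) blast
  define u where "u i x = snd (f (i, \<phi> x))" for i x
  define \<sigma> where "\<sigma> i = (if i then d else c)" for i
  have fe: "f (i, \<phi> x) = (\<sigma> i, u i x)" for i x
    using \<phi>(4,5)[of x] by (cases i) (auto simp: u_def \<sigma>_def prod_eq_iff)
  have cu: "continuous_map cantor_space cantor_space (u i)" for i
    using continuous_map_compose[OF \<phi>(1) continuous_map_into_D_space(1)[OF cs[of i]]] by (simp add: o_def u_def [abs_def])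
  have red': "x \<in> SS \<Gamma> (t (i, j)) \<longleftrightarrow> u i x = u j x \<and> u i x \<in> SS \<Gamma> (t' (\<sigma> i, \<sigma> j))" for i j x
    using red[of "\<phi> x" i j] \<phi>(3)[OF rng(1), of x \<Gamma>] by (simp add: fe R_rel_iff)
  have t01: "t (False, True) = 0"
    using t by (simp add: P_patterns_def)
  have uu: "u False = u True"
  proof (rule dense_eq[OF cu cu])
    fix x assume "x \<in> CC \<Gamma>"
    then show "u False x = u True x"
      using red'[of x False True] t01 by simp
  qed
  then have uj: "u i = u False" for i
    by (cases i) simp_all
  have CCu: "x \<in> CC \<Gamma> \<longleftrightarrow> u False x \<in> SS \<Gamma> (t' (c, d))" for x
    using red'[of x False True] t01 uj[of True] by (simp add: \<sigma>_def)
  have cd: "t' (c, d) = 0"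
    by (rule pattern_zero[OF cu rng(2) CCu])
  have CCu': "u False x \<in> CC \<Gamma> \<longleftrightarrow> x \<in> CC \<Gamma>" for x
    using CCu[of x] cd by simp
  have tt: "t (i, j) = t' (\<sigma> i, \<sigma> j)" for i j
  proof (rule SS_inj[OF rng])
    have tr: "u False x \<in> SS \<Gamma> (t' (\<sigma> i, \<sigma> j)) \<longleftrightarrow> x \<in> SS \<Gamma> (t' (\<sigma> i, \<sigma> j))" for x
      by (rule SS_transfer[OF CCu' rng(2)])
    show "SS \<Gamma> (t (i, j)) = SS \<Gamma> (t' (\<sigma> i, \<sigma> j))"
    proof (rule set_eqI)
      fix x show "x \<in> SS \<Gamma> (t (i, j)) \<longleftrightarrow> x \<in> SS \<Gamma> (t' (\<sigma> i, \<sigma> j))"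
        using red'[of x i j] tr[of x] unfolding uj[of i] uj[of j] by simp
    qed
  qed
  have "c \<noteq> d"
    using cd t' by (cases c; cases d) (auto simp: P_patterns_def)
  have all: "t = t'" if "\<And>i j. t (i, j) = t' (i, j)"
    using that by (auto simp: fun_eq_iff)
  show ?thesis
  proof (cases c)
    case False
    then have "\<sigma> i = i" for i
      using \<open>c \<noteq> d\<close> by (simp add: \<sigma>_def)
    then show ?thesis
      using tt by (intro all) simp
  next
    case True
    then have s: "\<sigma> i = (\<not> i)" for i
      using \<open>c \<noteq> d\<close> by (simp add: \<sigma>_def)
    have e: "t (False, False) = t' (True, True)" "t (True, True) = t' (False, False)" "t (True, False) = t' (False, True)"
      "t (False, True) = t' (True, False)"
      using tt s by simp_all
    have "t (False, False) = t' (False, False)" "t (True, True) = t' (True, True)"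
      using t t' e by (auto simp: P_patterns_def)
    moreover have "t (True, False) = 0" "t' (True, False) = 0" "t' (False, True) = 0"
      using t t' e by (auto simp: P_patterns_def)
    ultimately have "t (i, j) = t' (i, j)" for i j
      using t01 by (cases i; cases j) simp_all
    then show ?thesis
      by (rule all)
  qed
qed

text \<open>
  The pairs over \<open>x \<in> CC \<Gamma>\<close> form a matching, whereas all pairs of the target which are not on the diagonal share the point \<open>zeros\<close>.
  And if they were sent to the diagonal, it would reduce \<open>CC \<Gamma>\<close> to \<open>SS \<Gamma> (t' (True, True))\<close>.
\<close>
lemma R_not_Ra:
  assumes t: "t \<in> P_patterns" and t': "t' \<in> A_patterns" and f: "reduces D_space (R_rel \<Gamma> t) S_space (Ra_rel \<Gamma> t') f"
  shows False
proof -
  have rng: "t p \<in> {0, 1, 2, 3}" "t' p \<in> {0, 1, 2, 3}" for p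
    using t t' unfolding P_patterns_def A_patterns_def by blast+
  have t01: "t (False, True) = 0"
    using t by (simp add: P_patterns_def)
  have cf: "continuous_map D_space S_space f"
    and red: "x = y \<and> x \<in> CC \<Gamma> \<longleftrightarrow> (f (False, x), f (True, y)) \<in> Ra_rel \<Gamma> t'" for x y
    using f R_rel_iff[of False x True y \<Gamma> t] t01 by (auto simp: reduces_def)
  note cs = continuous_D_sections[OF cf]
  obtain \<phi> c d where \<phi>: "continuous_map cantor_space cantor_space \<phi>" "inj \<phi>"
    "\<And>x \<Gamma> k. k \<in> {0, 1, 2, 3} \<Longrightarrow> \<phi> x \<in> SS \<Gamma> k \<longleftrightarrow> x \<in> SS \<Gamma> k"
    "\<And>x. f (False, \<phi> x) 0 = c" "\<And>x. f (True, \<phi> x) 0 = d"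
    by (rule localize[OF continuous_map_into_S_space(2,3)[OF cs[of False]] continuous_map_into_S_space(2,3)[OF cs[of True]]]) blast
  define u where "u i x = (\<lambda>n. f (i, \<phi> x) (Suc n))" for i x
  have cu: "continuous_map cantor_space cantor_space (u i)" for i
    using continuous_map_compose[OF \<phi>(1) continuous_map_into_S_space(1)[OF cs[of i]]] by (simp add: o_def u_def [abs_def])
  have fF: "f (False, \<phi> x) = (if c then one_cons (u False x) else zeros)" for x
    using continuous_map_into_S_space(4,5)[OF cs[of False], of "\<phi> x"] \<phi>(4)[of x] by (auto simp: u_def)
  have fT: "f (True, \<phi> x) = (if d then one_cons (u True x) else zeros)" for x
    using continuous_map_into_S_space(4,5)[OF cs[of True], of "\<phi> x"] \<phi>(5)[of x] by (auto simp: u_def)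
  have red': "x = y \<and> x \<in> CC \<Gamma> \<longleftrightarrow> (f (False, \<phi> x), f (True, \<phi> y)) \<in> Ra_rel \<Gamma> t'" for x y
    using red[of "\<phi> x" "\<phi> y"] \<phi>(3)[of 0 x \<Gamma>] \<phi>(2) by (simp add: inj_eq)
  obtain a b where ab: "a \<in> CC \<Gamma>" "b \<in> CC \<Gamma>" "a \<noteq> b"
    using two_in_CC by blast
  consider "c" "d" | "c" "\<not> d" | "\<not> c" "d" | "\<not> c" "\<not> d"
    by blast
  then show False
  proof cases
    case 1
    then have r: "x \<in> CC \<Gamma> \<longleftrightarrow> u False x = u True x \<and> u False x \<in> SS \<Gamma> (t' (True, True))" for x
      using red'[of x x] by (simp add: fF fT Ra_rel_cases)
    have "u False = u True"
    proof (rule dense_eq[OF cu cu])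
      fix x assume "x \<in> CC \<Gamma>"
      then show "u False x = u True x"
        using r[of x] by simp
    qed
    then have "t' (True, True) = 0"
      using r by (intro pattern_zero[OF cu[of False] rng(2)]) simp
    then show False
      using t' by (simp add: A_patterns_def)
  next
    case 2
    then have r: "x = y \<and> x \<in> CC \<Gamma> \<longleftrightarrow> u False x \<in> SS \<Gamma> (t' (True, False))" for x y
      using red'[of x y] by (simp add: fF fT Ra_rel_cases)
    then show False
      using ab r[of a b] r[of a a] by blast
  next
    case 3
    then have r: "x = y \<and> x \<in> CC \<Gamma> \<longleftrightarrow> u True y \<in> SS \<Gamma> (t' (False, True))" for x y
      using red'[of x y] by (simp add: fF fT Ra_rel_cases)
    then show False
      using ab r[of a b] r[of b b] by blast
  next
    case 4
    then have r: "x = y \<and> x \<in> CC \<Gamma> \<longleftrightarrow> t' (False, False) = 1" for x y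
      using red'[of x y] by (simp add: fF fT Ra_rel_cases)
    show False
      using ab r[of a b] r[of a a] by simp
  qed
qed

text \<open>
  The point \<open>zeros\<close> is related to many points, but on each sheet of the target a point is related to one point only; by density the
  reduction would be constant near a point.
\<close>
lemma Ra_not_R:
  assumes t: "t \<in> A_patterns" and f: "reduces S_space (Ra_rel \<Gamma> t) D_space (R_rel \<Gamma> t') f"
  shows False
proof -
  have main: False if t01: "t (False, True) = 0" and f: "reduces S_space (Ra_rel \<Gamma> t) D_space (R_rel \<Gamma> t') f" for t t'
  proof -
    have cf: "continuous_map S_space D_space f"
      and red: "x \<in> CC \<Gamma> \<longleftrightarrow> (f zeros, f (one_cons x)) \<in> R_rel \<Gamma> t'" for x
      using f Ra_rel_cases(2)[of x \<Gamma> t] t01 by (auto simp: reduces_def)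
    have c1: "continuous_map cantor_space D_space (\<lambda>x. f (one_cons x))"
      using continuous_map_compose[OF continuous_one_cons cf] by (simp add: o_def)
    obtain \<phi> c d where \<phi>: "continuous_map cantor_space cantor_space \<phi>" "inj \<phi>"
      "\<And>x \<Gamma> k. k \<in> {0, 1, 2, 3} \<Longrightarrow> \<phi> x \<in> SS \<Gamma> k \<longleftrightarrow> x \<in> SS \<Gamma> k"
      "\<And>x. fst (f (one_cons (\<phi> x))) = c" "\<And>x. True = d"
      by (rule localize[OF continuous_map_into_D_space(2,3)[OF c1] open_True]) blast
    obtain i w where iw: "f zeros = (i, w)"
      by (cases "f zeros")
    define u where "u x = snd (f (one_cons (\<phi> x)))" for x
    have fe: "f (one_cons (\<phi> x)) = (c, u x)" for x
      using \<phi>(4)[of x] by (simp add: u_def prod_eq_iff)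
    have cu: "continuous_map cantor_space cantor_space u"
      using continuous_map_compose[OF \<phi>(1) continuous_map_into_D_space(1)[OF c1]] by (simp add: o_def u_def [abs_def])
    have r: "x \<in> CC \<Gamma> \<longleftrightarrow> w = u x \<and> w \<in> SS \<Gamma> (t' (i, c))" for x
      using red[of "\<phi> x"] \<phi>(3)[of 0 x \<Gamma>] by (simp add: fe iw R_rel_iff)
    have "u = (\<lambda>x. w)"
    proof (rule dense_eq[OF cu])
      fix x assume "x \<in> CC \<Gamma>"
      then show "u x = w"
        using r[of x] by simp
    qed simp
    then have "x \<in> CC \<Gamma> \<longleftrightarrow> w \<in> SS \<Gamma> (t' (i, c))" for x
      using r by simp
    then show False
      using CC_not_const by blast
  qed
  show False
  proof (cases "t (False, True) = 0")
    case True
    then show ?thesis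
      using main f by blast
  next
    case False
    then have "(t \<circ> prod.swap) (False, True) = 0"
      using t by (simp add: A_patterns_def)
    moreover have "reduces S_space (Ra_rel \<Gamma> (t \<circ> prod.swap)) D_space (R_rel \<Gamma> (t' \<circ> prod.swap)) f"
      using reduces_converse[OF f] by (simp add: Ra_converse R_converse)
    ultimately show ?thesis
      by (rule main)
  qed
qed

text \<open>
  The image of a ball cannot be the single point \<open>zeros\<close>, and \<open>zeros\<close> has to be sent to itself, since the other points are
  related to at most one point besides it; then the entries of the patterns can be compared. One of the two entries off the diagonal
  of a pattern is 0, and passing to converse relations allows one to assume that it is the first one.
\<close>
lemma Ra_Ra_eq:
  assumes t: "t \<in> A_patterns" and t': "t' \<in> A_patterns" and f: "reduces S_space (Ra_rel \<Gamma> t) S_space (Ra_rel \<Gamma> t') f"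
  shows "t = t'"
proof -
  have main: "t = t'" if t: "t \<in> A_patterns" and t': "t' \<in> A_patterns" and t01: "t (False, True) = 0"
    and f: "reduces S_space (Ra_rel \<Gamma> t) S_space (Ra_rel \<Gamma> t') f" for t t'
  proof -
    have rng: "t p \<in> {0, 1, 2, 3}" "t' p \<in> {0, 1, 2, 3}" for p
      using t t' unfolding A_patterns_def by blast+
    have cf: "continuous_map S_space S_space f"
      and red: "p \<in> topspace S_space \<Longrightarrow> q \<in> topspace S_space \<Longrightarrow> (p, q) \<in> Ra_rel \<Gamma> t \<longleftrightarrow> (f p, f q) \<in> Ra_rel \<Gamma> t'" for p q
      using f by (auto simp: reduces_def)
    have c1: "continuous_map cantor_space S_space (\<lambda>x. f (one_cons x))"
      using continuous_map_compose[OF continuous_one_cons cf] by (simp add: o_def)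
    obtain \<phi> c d where \<phi>: "continuous_map cantor_space cantor_space \<phi>" "inj \<phi>"
      "\<And>x \<Gamma> k. k \<in> {0, 1, 2, 3} \<Longrightarrow> \<phi> x \<in> SS \<Gamma> k \<longleftrightarrow> x \<in> SS \<Gamma> k"
      "\<And>x. f (one_cons (\<phi> x)) 0 = c" "\<And>x. True = d"
      by (rule localize[OF continuous_map_into_S_space(2,3)[OF c1] open_True]) blast
    define u where "u x = (\<lambda>n. f (one_cons (\<phi> x)) (Suc n))" for x
    have cu: "continuous_map cantor_space cantor_space u"
      using continuous_map_compose[OF \<phi>(1) continuous_map_into_S_space(1)[OF c1]] by (simp add: o_def u_def [abs_def])
    have r: "x \<in> CC \<Gamma> \<longleftrightarrow> (f zeros, f (one_cons (\<phi> x))) \<in> Ra_rel \<Gamma> t'" for x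
      using red[of zeros "one_cons (\<phi> x)"] \<phi>(3)[of 0 x \<Gamma>] t01 by (simp add: Ra_rel_cases)
    have c
    proof (rule ccontr)
      assume "\<not> c"
      then have "f (one_cons (\<phi> x)) = zeros" for x
        using continuous_map_into_S_space(4)[OF c1] \<phi>(4) by blast
      then show False
        using r CC_not_const[of \<Gamma> "(f zeros, zeros) \<in> Ra_rel \<Gamma> t'"] by simp
    qed
    then have fe: "f (one_cons (\<phi> x)) = one_cons (u x)" for x
      using continuous_map_into_S_space(5)[OF c1, of "\<phi> x"] \<phi>(4)[of x] unfolding u_def by blast
    have fz: "f zeros = zeros"
    proof (rule ccontr)
      assume "f zeros \<noteq> zeros"
      moreover have "f zeros \<in> topspace S_space"
        using continuous_map_funspace[OF cf] by auto
      ultimately obtain w where w: "f zeros = one_cons w"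
        by (metis S_space_cases)
      have r': "x \<in> CC \<Gamma> \<longleftrightarrow> w = u x \<and> w \<in> SS \<Gamma> (t' (True, True))" for x
        using r[of x] by (simp add: fe w Ra_rel_cases)
      have "u = (\<lambda>x. w)"
      proof (rule dense_eq[OF cu])
        fix x assume "x \<in> CC \<Gamma>"
        then show "u x = w"
          using r'[of x] by simp
      qed simp
      then have "x \<in> CC \<Gamma> \<longleftrightarrow> w \<in> SS \<Gamma> (t' (True, True))" for x
        using r' by simp
      then show False
        using CC_not_const by blast
    qed
    have CCu: "x \<in> CC \<Gamma> \<longleftrightarrow> u x \<in> SS \<Gamma> (t' (False, True))" for x
      using r[of x] by (simp add: fe fz Ra_rel_cases)
    have t'01: "t' (False, True) = 0"
      by (rule pattern_zero[OF cu rng(2) CCu])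
    have CCu': "u x \<in> CC \<Gamma> \<longleftrightarrow> x \<in> CC \<Gamma>" for x
      using CCu[of x] t'01 by simp
    have tr: "u x \<in> SS \<Gamma> (t' p) \<longleftrightarrow> x \<in> SS \<Gamma> (t' p)" for x p
      by (rule SS_transfer[OF CCu' rng(2)])
    have "t (False, False) = 1 \<longleftrightarrow> t' (False, False) = 1"
      using red[of zeros zeros] by (simp add: fz Ra_rel_cases)
    then have "t (False, False) = t' (False, False)"
      using t t' by (auto simp: A_patterns_def)
    moreover have "t (True, False) = t' (True, False)"
    proof (rule SS_inj[OF rng])
      show "SS \<Gamma> (t (True, False)) = SS \<Gamma> (t' (True, False))"
      proof (rule set_eqI)
        fix x show "x \<in> SS \<Gamma> (t (True, False)) \<longleftrightarrow> x \<in> SS \<Gamma> (t' (True, False))"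
          using red[of "one_cons (\<phi> x)" zeros] \<phi>(3)[OF rng(1), of x \<Gamma>] tr
          by (simp add: fe fz Ra_rel_cases)
      qed
    qed
    moreover have "t (True, True) = t' (True, True)"
    proof (rule SS_inj[OF rng])
      show "SS \<Gamma> (t (True, True)) = SS \<Gamma> (t' (True, True))"
      proof (rule set_eqI)
        fix x show "x \<in> SS \<Gamma> (t (True, True)) \<longleftrightarrow> x \<in> SS \<Gamma> (t' (True, True))"
          using red[of "one_cons (\<phi> x)" "one_cons (\<phi> x)"] \<phi>(3)[OF rng(1), of x \<Gamma>] tr
          by (simp add: fe Ra_rel_cases)
      qed
    qed
    ultimately have "t (i, j) = t' (i, j)" for i j
      using t01 t'01 by (cases i; cases j) simp_all
    then show ?thesis
      by (auto simp: fun_eq_iff)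
  qed
  show ?thesis
  proof (cases "t (False, True) = 0")
    case True
    then show ?thesis
      using main t t' f by blast
  next
    case False
    then have "(t \<circ> prod.swap) (False, True) = 0"
      using t by (simp add: A_patterns_def)
    moreover have "reduces S_space (Ra_rel \<Gamma> (t \<circ> prod.swap)) S_space (Ra_rel \<Gamma> (t' \<circ> prod.swap)) f"
      using reduces_converse[OF f] by (simp add: Ra_converse)
    ultimately have "t \<circ> prod.swap = t' \<circ> prod.swap"
      by (rule main[OF Ra_swap_pattern[OF t] Ra_swap_pattern[OF t']])
    then have "t (prod.swap p) = t' (prod.swap p)" for p
      by (metis comp_apply)
    then show ?thesis
      by (metis ext swap_swap)
  qed
qed

section \<open>Counting and comparing the examples\<close>

lemma inj_leq_c_imp_leq_c: "inj_leq_c p q \<Longrightarrow> leq_c p q"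
  by (auto simp: inj_leq_c_def leq_c_def)

lemma leq_c_refl:
  assumes "relation_on X R"
  shows "leq_c (X, R) (X, R)"
proof -
  have "R = {(x, y) \<in> topspace X \<times> topspace X. (id x, id y) \<in> R}"
    using assms by (auto simp: relation_on_def)
  then show ?thesis
    unfolding leq_c_def prod.case by (intro exI[of _ id] conjI continuous_map_id)
qed

lemma relation_on_examples:
  "relation_on cantor_space (Id_on (CC \<Gamma>))" "relation_on D_space (R_rel \<Gamma> t)" "relation_on S_space (Ra_rel \<Gamma> t)"
  using Ra_rel_subset by (auto simp: relation_on_def)

lemma family_cases:
  assumes "p \<in> A_family \<Gamma> \<union> B_family \<Gamma>"
  obtains "p = copy Inl (cantor_space, Id_on (CC \<Gamma>))"
    | t where "t \<in> P_patterns" "p = copy Inr (D_space, R_rel \<Gamma> t)"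
    | t where "t \<in> A_patterns" "p = copy Inl (S_space, Ra_rel \<Gamma> t)"
  using assms by (auto simp: A_family_def B_family_def)

lemma leq_c_examples:
  "leq_c (copy Inr (D_space, R_rel \<Gamma> t) :: point space_rel) (copy Inr (D_space, R_rel \<Gamma> t') :: point space_rel) \<Longrightarrow> t \<in> P_patterns \<Longrightarrow> t' \<in> P_patterns \<Longrightarrow> t = t'"
  "leq_c (copy Inl (S_space, Ra_rel \<Gamma> t) :: point space_rel) (copy Inl (S_space, Ra_rel \<Gamma> t') :: point space_rel) \<Longrightarrow> t \<in> A_patterns \<Longrightarrow> t' \<in> A_patterns \<Longrightarrow> t = t'"
  "leq_c (copy Inl (cantor_space, Id_on (CC \<Gamma>)) :: point space_rel) (copy Inr (D_space, R_rel \<Gamma> t) :: point space_rel) \<Longrightarrow> t \<notin> P_patterns"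
  "leq_c (copy Inl (cantor_space, Id_on (CC \<Gamma>)) :: point space_rel) (copy Inl (S_space, Ra_rel \<Gamma> t) :: point space_rel) \<Longrightarrow> t \<notin> A_patterns"
  "leq_c (copy Inr (D_space, R_rel \<Gamma> t) :: point space_rel) (copy Inl (cantor_space, Id_on (CC \<Gamma>)) :: point space_rel) \<Longrightarrow> t \<notin> P_patterns"
  "leq_c (copy Inl (S_space, Ra_rel \<Gamma> t) :: point space_rel) (copy Inl (cantor_space, Id_on (CC \<Gamma>)) :: point space_rel) \<Longrightarrow> t \<notin> A_patterns"
  "leq_c (copy Inr (D_space, R_rel \<Gamma> t) :: point space_rel) (copy Inl (S_space, Ra_rel \<Gamma> t') :: point space_rel) \<Longrightarrow> t \<in> P_patterns \<Longrightarrow> t' \<notin> A_patterns"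
  "leq_c (copy Inl (S_space, Ra_rel \<Gamma> t) :: point space_rel) (copy Inr (D_space, R_rel \<Gamma> t') :: point space_rel) \<Longrightarrow> t \<notin> A_patterns"
proof -
  note D = leq_c_copyD[OF inj_Inl inj_Inl] leq_c_copyD[OF inj_Inl inj_Inr] leq_c_copyD[OF inj_Inr inj_Inl] leq_c_copyD[OF inj_Inr inj_Inr]
  note rel = relation_on_examples
  show "t = t'" if "leq_c (copy Inr (D_space, R_rel \<Gamma> t) :: point space_rel) (copy Inr (D_space, R_rel \<Gamma> t') :: point space_rel)" "t \<in> P_patterns" "t' \<in> P_patterns"
    using D(4)[OF rel(2) that(1)] R_R_eq[OF that(2,3)] by (elim exE)
  show "t = t'" if "leq_c (copy Inl (S_space, Ra_rel \<Gamma> t) :: point space_rel) (copy Inl (S_space, Ra_rel \<Gamma> t') :: point space_rel)" "t \<in> A_patterns" "t' \<in> A_patterns"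
    using D(1)[OF rel(3) that(1)] Ra_Ra_eq[OF that(2,3)] by (elim exE)
  show "t \<notin> P_patterns" if "leq_c (copy Inl (cantor_space, Id_on (CC \<Gamma>)) :: point space_rel) (copy Inr (D_space, R_rel \<Gamma> t) :: point space_rel)"
    using D(2)[OF rel(1) that] diagonal_not_R[of t \<Gamma>] by (elim exE) (rule notI)
  show "t \<notin> A_patterns" if "leq_c (copy Inl (cantor_space, Id_on (CC \<Gamma>)) :: point space_rel) (copy Inl (S_space, Ra_rel \<Gamma> t) :: point space_rel)"
    using D(1)[OF rel(1) that] diagonal_not_Ra[of t \<Gamma>] by (elim exE) (rule notI)
  show "t \<notin> P_patterns" if "leq_c (copy Inr (D_space, R_rel \<Gamma> t) :: point space_rel) (copy Inl (cantor_space, Id_on (CC \<Gamma>)) :: point space_rel)"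
    using D(3)[OF rel(2) that] R_not_diagonal[of t \<Gamma>] by (elim exE) (rule notI)
  show "t \<notin> A_patterns" if "leq_c (copy Inl (S_space, Ra_rel \<Gamma> t) :: point space_rel) (copy Inl (cantor_space, Id_on (CC \<Gamma>)) :: point space_rel)"
    using D(1)[OF rel(3) that] Ra_not_diagonal[of t \<Gamma>] by (elim exE) (rule notI)
  show "t' \<notin> A_patterns" if "leq_c (copy Inr (D_space, R_rel \<Gamma> t) :: point space_rel) (copy Inl (S_space, Ra_rel \<Gamma> t') :: point space_rel)" "t \<in> P_patterns"
    using D(3)[OF rel(2) that(1)] R_not_Ra[OF that(2), of t' \<Gamma>] by (elim exE) (rule notI)
  show "t \<notin> A_patterns" if "leq_c (copy Inl (S_space, Ra_rel \<Gamma> t) :: point space_rel) (copy Inr (D_space, R_rel \<Gamma> t') :: point space_rel)"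
    using D(2)[OF rel(3) that] Ra_not_R[of t \<Gamma> t'] by (elim exE) (rule notI)
qed

lemma leq_c_family_eq:
  assumes p: "p \<in> A_family \<Gamma> \<union> B_family \<Gamma>" and q: "q \<in> A_family \<Gamma> \<union> B_family \<Gamma>" and le: "leq_c p q"
  shows "p = q"
  using p
proof (cases rule: family_cases)
  case 1
  note p = this
  show ?thesis
    using q
  proof (cases rule: family_cases)
    case 1
    then show ?thesis
      using p by simp
  qed (use le leq_c_examples(3,4) p in auto)
next
  case (2 t)
  note p = this
  show ?thesis
    using q
  proof (cases rule: family_cases)
    case (2 t')
    then show ?thesis
      using le leq_c_examples(1)[of \<Gamma> t t'] p by simp
  qed (use le leq_c_examples(5,7) p in auto)
next
  case (3 t)
  note p = this
  show ?thesis
    using q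
  proof (cases rule: family_cases)
    case (3 t')
    then show ?thesis
      using le leq_c_examples(2)[of \<Gamma> t t'] p by simp
  qed (use le leq_c_examples(6,8) p in auto)
qed

lemma leq_c_copy_refl:
  assumes "inj e" "relation_on X R"
  shows "leq_c (copy e (X, R)) (copy e (X, R))"
proof -
  obtain Y T where YT: "copy e (X, R) = (Y, T)"
    by (cases "copy e (X, R)")
  show ?thesis
    unfolding YT by (rule leq_c_refl[OF copy_isomorphic(2)[OF assms YT]])
qed

definition pattern_code :: "pattern \<Rightarrow> nat \<times> nat \<times> nat \<times> nat" where
  "pattern_code t = (t (False, False), t (False, True), t (True, False), t (True, True))"

lemma inj_pattern_code: "inj pattern_code"
proof (rule injI)
  fix s t assume "pattern_code s = pattern_code t"
  then have "s (i, j) = t (i, j)" for i j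
    by (cases i; cases j) (simp_all add: pattern_code_def)
  then show "s = t"
    by (simp add: fun_eq_iff)
qed

lemma pattern_code_surj: "\<exists>t. pattern_code t = (a, b, c, d)"
  by (rule exI[of _ "\<lambda>(i, j). if i then (if j then d else c) else (if j then b else a)"]) (simp add: pattern_code_def)

text \<open>
  Patterns are functions; counting them means filtering the list of all quadruples of values.
\<close>
lemma card_patterns:
  assumes "\<And>t. t \<in> A \<longleftrightarrow> range t \<subseteq> {0, 1, 2, 3} \<and> Q (pattern_code t)"
  shows "finite A" "card A = length (filter Q (List.product [0,1,2,3] (List.product [0,1,2,3] (List.product [0,1,2,3] [0,1,2,3]))))"
proof -
  let ?L = "filter Q (List.product [0,1,2,3] (List.product [0,1,2,3] (List.product [0,1,2,3] [0,1,2,3])))"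
  have rng: "range t \<subseteq> {0, 1, 2, 3} \<longleftrightarrow> pattern_code t \<in> {0, 1, 2, 3} \<times> {0, 1, 2, 3} \<times> {0, 1, 2, 3} \<times> {0, 1, 2, 3}"
    for t :: pattern
  proof -
    have "range t \<subseteq> {0, 1, 2, 3} \<longleftrightarrow> (\<forall>i j. t (i, j) \<in> {0, 1, 2, 3})"
      by (simp only: image_subset_iff ball_UNIV split_paired_All)
    then show ?thesis
      by (simp only: pattern_code_def mem_Times_iff all_bool_eq fst_conv snd_conv) blast
  qed
  have img: "pattern_code ` A = set ?L"
  proof (rule set_eqI)
    fix x :: "nat \<times> nat \<times> nat \<times> nat"
    obtain a b c d where x: "x = (a, b, c, d)"
      by (cases x) auto
    obtain t where t: "pattern_code t = x"
      using pattern_code_surj x by blast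
    have "x \<in> pattern_code ` A \<longleftrightarrow> t \<in> A"
      unfolding t[symmetric] by (rule inj_image_mem_iff[OF inj_pattern_code])
    also have "\<dots> \<longleftrightarrow> x \<in> {0, 1, 2, 3} \<times> {0, 1, 2, 3} \<times> {0, 1, 2, 3} \<times> {0, 1, 2, 3} \<and> Q x"
      unfolding assms rng t ..
    finally show "x \<in> pattern_code ` A \<longleftrightarrow> x \<in> set ?L"
      unfolding set_filter set_product by (simp add: x)
  qed
  have inj: "inj_on pattern_code A"
    using inj_pattern_code by (rule inj_on_subset) simp
  show "finite A"
    using finite_imageD[OF _ inj] unfolding img by simp
  have "distinct ?L"
    by (intro distinct_filter distinct_product) simp_all
  then show "card A = length ?L"
    using card_image[OF inj] distinct_card unfolding img by metis
qed

lemma card_P_patterns: "finite P_patterns" "card P_patterns = 33"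
proof -
  note c = card_patterns[of P_patterns "\<lambda>(a, b, c, d). a \<noteq> 0 \<and> d \<noteq> 0 \<and> b = 0 \<and> (c = 0 \<longrightarrow> a \<le> d)"]
  have iff: "t \<in> P_patterns \<longleftrightarrow> range t \<subseteq> {0, 1, 2, 3} \<and>
      (case pattern_code t of (a, b, c, d) \<Rightarrow> a \<noteq> 0 \<and> d \<noteq> 0 \<and> b = 0 \<and> (c = 0 \<longrightarrow> a \<le> d))" for t
    by (simp add: P_patterns_def pattern_code_def)
  show "finite P_patterns"
    by (rule c(1)[OF iff])
  show "card P_patterns = 33"
    unfolding c(2)[OF iff] by simp
qed

lemma card_A_patterns: "finite A_patterns" "card A_patterns = 42"
proof -
  note c = card_patterns[of A_patterns "\<lambda>(a, b, c, d). (a = 0 \<or> a = 1) \<and> (b = 0 \<or> c = 0) \<and> d \<noteq> 0"]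
  have iff: "t \<in> A_patterns \<longleftrightarrow> range t \<subseteq> {0, 1, 2, 3} \<and>
      (case pattern_code t of (a, b, c, d) \<Rightarrow> (a = 0 \<or> a = 1) \<and> (b = 0 \<or> c = 0) \<and> d \<noteq> 0)" for t
    by (simp add: A_patterns_def pattern_code_def)
  show "finite A_patterns"
    by (rule c(1)[OF iff])
  show "card A_patterns = 42"
    unfolding c(2)[OF iff] by simp
qed

text \<open>
  33 patterns on \<open>D_space\<close>, 42 patterns on \<open>S_space\<close>, and the diagonal; different data give different examples because they are incomparable.
\<close>
lemma card_families: "card (A_family \<Gamma> \<union> B_family \<Gamma>) = 76"
proof -
  let ?d = "copy Inl (cantor_space, Id_on (CC \<Gamma>)) :: point space_rel"
  let ?r = "\<lambda>t. copy Inr (D_space, R_rel \<Gamma> t) :: point space_rel"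
  let ?a = "\<lambda>t. copy Inl (S_space, Ra_rel \<Gamma> t) :: point space_rel"
  have refl: "leq_c ?d ?d" "leq_c (?r t) (?r t)" "leq_c (?a t) (?a t)" for t
    by (rule leq_c_copy_refl, simp, rule relation_on_examples)+
  have ir: "inj_on ?r P_patterns"
  proof (rule inj_onI)
    fix s t assume "s \<in> P_patterns" "t \<in> P_patterns" and e: "?r s = ?r t"
    moreover have "leq_c (?r s) (?r t)"
      unfolding e by (rule refl(2))
    ultimately show "s = t"
      using leq_c_examples(1) by blast
  qed
  have ia: "inj_on ?a A_patterns"
  proof (rule inj_onI)
    fix s t assume "s \<in> A_patterns" "t \<in> A_patterns" and e: "?a s = ?a t"
    moreover have "leq_c (?a s) (?a t)"
      unfolding e by (rule refl(3))
    ultimately show "s = t"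
      using leq_c_examples(2) by blast
  qed
  have d1: "?d \<notin> ?r ` P_patterns"
  proof
    assume "?d \<in> ?r ` P_patterns"
    then obtain t where t: "t \<in> P_patterns" "?d = ?r t"
      by (rule imageE)
    have "leq_c ?d (?r t)"
      unfolding t(2)[symmetric] by (rule refl(1))
    then show False
      using leq_c_examples(3) t(1) by blast
  qed
  have d2: "?d \<notin> ?a ` A_patterns"
  proof
    assume "?d \<in> ?a ` A_patterns"
    then obtain t where t: "t \<in> A_patterns" "?d = ?a t"
      by (rule imageE)
    have "leq_c ?d (?a t)"
      unfolding t(2)[symmetric] by (rule refl(1))
    then show False
      using leq_c_examples(4) t(1) by blast
  qed
  have d3: "?r ` P_patterns \<inter> ?a ` A_patterns = {}"
  proof -
    have ne: "?r s \<noteq> ?a t" if st: "s \<in> P_patterns" "t \<in> A_patterns" for s t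
    proof
      assume e: "?r s = ?a t"
      have "leq_c (?r s) (?a t)"
        unfolding e[symmetric] by (rule refl(2))
      from leq_c_examples(7)[OF this st(1)] st(2) show False ..
    qed
    show ?thesis
    proof (rule equals0I)
      fix p assume "p \<in> ?r ` P_patterns \<inter> ?a ` A_patterns"
      then obtain s t where "s \<in> P_patterns" "p = ?r s" "t \<in> A_patterns" "p = ?a t"
        by (elim IntE imageE)
      then show False
        using ne[of s t] by simp
    qed
  qed
  have "A_family \<Gamma> \<union> B_family \<Gamma> = insert ?d (?r ` P_patterns \<union> ?a ` A_patterns)"
    unfolding A_family_def B_family_def Setcompr_eq_image by simp
  moreover have "card (?r ` P_patterns \<union> ?a ` A_patterns) = 33 + 42"
    using card_Un_disjoint[OF _ _ d3] card_image[OF ir] card_image[OF ia] card_P_patterns card_A_patterns by simp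
  ultimately show ?thesis
    using d1 d2 card_P_patterns(1) card_A_patterns(1) by simp
qed

lemma family_subset: "A_family \<Gamma> \<union> B_family \<Gamma> \<subseteq> s_acyclic_borel_relations \<Gamma>"
proof
  fix p assume "p \<in> A_family \<Gamma> \<union> B_family \<Gamma>"
  then show "p \<in> s_acyclic_borel_relations \<Gamma>"
    by (cases rule: family_cases) (simp_all add: diagonal_member R_rel_member Ra_rel_member)
qed

section \<open>Graphs\<close>

definition graph_pattern :: "pattern" where
  "graph_pattern p = (if fst p = snd p then 1 else 0)"

definition centre_pattern :: "pattern" where
  "centre_pattern p = (if p = (True, True) then 1 else 0)"

lemma graph_pattern: "graph_pattern \<in> P_patterns" "R_rel \<Gamma> graph_pattern = Gm \<Gamma>"
proof -
  show "graph_pattern \<in> P_patterns"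
    by (auto simp: P_patterns_def graph_pattern_def)
  have "((i, x), (j, y)) \<in> R_rel \<Gamma> graph_pattern \<longleftrightarrow> ((i, x), (j, y)) \<in> Gm \<Gamma>" for i j x y
    unfolding R_rel_iff by (auto simp: Gm_def graph_pattern_def)
  then show "R_rel \<Gamma> graph_pattern = Gm \<Gamma>"
    by (auto simp: split_paired_all)
qed

lemma centre_pattern: "centre_pattern \<in> A_patterns" "Ra_rel \<Gamma> centre_pattern = Gma \<Gamma>"
  by (auto simp: A_patterns_def centre_pattern_def Ra_rel_def Gma_def symm_def)

lemma graph_family_alt:
  "graph_family \<Gamma> = {copy Inr (D_space, R_rel \<Gamma> graph_pattern), copy Inl (S_space, Ra_rel \<Gamma> centre_pattern)}"
  by (simp add: graph_family_def graph_pattern centre_pattern)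

lemma graph_family_subset: "graph_family \<Gamma> \<subseteq> A_family \<Gamma> \<union> B_family \<Gamma>"
  using graph_pattern(1) centre_pattern(1) unfolding graph_family_alt A_family_def B_family_def by blast

lemma symm_sym: "sym R \<Longrightarrow> symm R = R"
  by (auto simp: symm_def dest: symD)

lemma acyclic_borel_graphs_iff:
  "(X, R) \<in> acyclic_borel_graphs \<Gamma> \<longleftrightarrow> (X, R) \<in> s_acyclic_borel_relations \<Gamma> \<and> graph_rel R"
  by (auto simp: acyclic_borel_graphs_def s_acyclic_borel_relations_def s_acyclic_rel_def graph_rel_def symm_sym)

lemma graph_family_members: "graph_family \<Gamma> \<subseteq> acyclic_borel_graphs \<Gamma>"
proof
  fix p assume p: "p \<in> graph_family \<Gamma>"
  have gr: "graph_rel (map_prod e e ` R)" if "inj e" "graph_rel R" for e :: "'b \<Rightarrow> point" and R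
    unfolding graph_rel_def
  proof (intro conjI symI irreflI notI)
    fix a b assume "(a, b) \<in> map_prod e e ` R"
    then obtain x y where xy: "(x, y) \<in> R" "a = e x" "b = e y"
      by auto
    then have "(y, x) \<in> R"
      using that(2) by (auto simp: graph_rel_def dest: symD)
    then show "(b, a) \<in> map_prod e e ` R"
      using xy by (intro image_eqI[of _ _ "(y, x)"]) simp_all
  next
    fix a assume "(a, a) \<in> map_prod e e ` R"
    then obtain x y where "(x, y) \<in> R" "e x = e y"
      by auto
    then show False
      using that by (auto simp: graph_rel_def irrefl_def inj_eq)
  qed
  have "graph_rel (Gm \<Gamma>)" "graph_rel (Gma \<Gamma>)"
    by (auto simp: graph_rel_def sym_def irrefl_def Gm_def Gma_def symm_def)
  then have "graph_rel (snd p)"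
    using p gr[of Inl "Gma \<Gamma>"] gr[of Inr "Gm \<Gamma>"] by (auto simp: graph_family_def copy_def)
  moreover have "p \<in> s_acyclic_borel_relations \<Gamma>"
    using p graph_family_subset family_subset by blast
  ultimately show "p \<in> acyclic_borel_graphs \<Gamma>"
    using acyclic_borel_graphs_iff[of "fst p" "snd p" \<Gamma>] by simp
qed

lemma leq_c_graph_rel:
  assumes le: "leq_c (copy e (Y, S)) (X, R)" and e: "inj e" and S: "relation_on Y S" and R: "graph_rel R"
  shows "graph_rel S"
proof -
  obtain Z T where ZT: "copy e (Y, S) = (Z, T)"
    by (cases "copy e (Y, S)")
  note iso = copy_isomorphic[OF e S ZT]
  obtain f where f: "T = {(x, y) \<in> topspace Z \<times> topspace Z. (f x, f y) \<in> R}"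
    using le unfolding ZT leq_c_def by auto
  have "graph_rel T"
    using R unfolding graph_rel_def sym_def irrefl_def f by auto
  then show ?thesis
    unfolding graph_rel_def sym_def irrefl_def iso(3) by auto
qed

text \<open>
  A minorant of a graph is a graph. This excludes the diagonal, and forces the pattern to be symmetric with empty diagonal.
\<close>
lemma graph_minorant:
  assumes XR: "(X, R) \<in> acyclic_borel_graphs \<Gamma>"
  shows "\<exists>p\<in>graph_family \<Gamma>. inj_leq_c p (X, R)"
proof -
  have R: "(X, R) \<in> s_acyclic_borel_relations \<Gamma>" "graph_rel R"
    using XR by (auto simp: acyclic_borel_graphs_iff)
  obtain p where p: "p \<in> A_family \<Gamma> \<union> B_family \<Gamma>" "inj_leq_c p (X, R)"
    using minorant_exists[OF R(1)] by blast
  note le = inj_leq_c_imp_leq_c[OF p(2)]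
  obtain z where z: "z \<in> CC \<Gamma>"
    using CC_nontrivial by blast
  from p(1) have "p \<in> graph_family \<Gamma>"
  proof (cases rule: family_cases)
    case 1
    have "graph_rel (Id_on (CC \<Gamma>))"
      by (rule leq_c_graph_rel[OF le[unfolded 1] inj_Inl relation_on_examples(1) R(2)])
    then show ?thesis
      using z by (auto simp: graph_rel_def irrefl_def)
  next
    case (2 t)
    have g: "graph_rel (R_rel \<Gamma> t)"
      by (rule leq_c_graph_rel[OF le[unfolded 2(2)] inj_Inr relation_on_examples(2) R(2)])
    have rng: "t p \<in> {0, 1, 2, 3}" for p
      using 2(1) unfolding P_patterns_def by blast
    have t01: "t (False, True) = 0"
      using 2(1) by (simp add: P_patterns_def)
    have "((i, x), (i, x)) \<notin> R_rel \<Gamma> t" for i x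
      using g by (simp add: graph_rel_def irrefl_def)
    then have Sii: "SS \<Gamma> (t (i, i)) = SS \<Gamma> 1" for i
      unfolding R_rel_iff by auto
    have tii: "t (i, i) = 1" for i
      by (rule SS_inj[OF rng _ Sii]) simp
    have "((True, x), (False, x)) \<in> R_rel \<Gamma> t \<longleftrightarrow> ((False, x), (True, x)) \<in> R_rel \<Gamma> t" for x
      using g symD[of "R_rel \<Gamma> t"] unfolding graph_rel_def by metis
    then have "SS \<Gamma> (t (True, False)) = SS \<Gamma> (t (False, True))"
      unfolding R_rel_iff by auto
    then have "t (True, False) = t (False, True)"
      by (rule SS_inj[OF rng rng])
    then have "t (i, j) = graph_pattern (i, j)" for i j
      using tii t01 by (cases i; cases j) (simp_all add: graph_pattern_def)
    then have "t = graph_pattern"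
      by (simp add: fun_eq_iff)
    then show ?thesis
      using 2(2) by (simp add: graph_family_alt)
  next
    case (3 t)
    have g: "graph_rel (Ra_rel \<Gamma> t)"
      by (rule leq_c_graph_rel[OF le[unfolded 3(2)] inj_Inl relation_on_examples(3) R(2)])
    have rng: "t p \<in> {0, 1, 2, 3}" for p
      using 3(1) unfolding A_patterns_def by blast
    have irr: "(x, x) \<notin> Ra_rel \<Gamma> t" for x
      using g by (simp add: graph_rel_def irrefl_def)
    have t00: "t (False, False) = 0"
      using irr[of zeros] 3(1) by (auto simp: Ra_rel_cases A_patterns_def)
    have "SS \<Gamma> (t (True, True)) = SS \<Gamma> 1"
      using irr[of "one_cons _"] by (auto simp: Ra_rel_cases)
    then have t11: "t (True, True) = 1"
      using SS_inj[OF rng] by simp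
    have "(zeros, one_cons x) \<in> Ra_rel \<Gamma> t \<longleftrightarrow> (one_cons x, zeros) \<in> Ra_rel \<Gamma> t" for x
      using g symD[of "Ra_rel \<Gamma> t"] unfolding graph_rel_def by metis
    then have "SS \<Gamma> (t (False, True)) = SS \<Gamma> (t (True, False))"
      unfolding Ra_rel_cases by auto
    then have "t (False, True) = t (True, False)"
      by (rule SS_inj[OF rng rng])
    then have "t (False, True) = 0" "t (True, False) = 0"
      using 3(1) by (auto simp: A_patterns_def)
    then have "t (i, j) = centre_pattern (i, j)" for i j
      using t00 t11 by (cases i; cases j) (simp_all add: centre_pattern_def)
    then have "t = centre_pattern"
      by (simp add: fun_eq_iff)
    then show ?thesis
      using 3(2) by (simp add: graph_family_alt)
  qed
  then show ?thesis
    using p(2) by blast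
qed

theorem theorem1p8:
  fixes \<Gamma> :: rank_two_class
  shows
    "card (A_family \<Gamma> \<union> B_family \<Gamma>) = 76 \<and>
     antichain_basis inj_leq_c inj_leq_c
       (s_acyclic_borel_relations \<Gamma>) (s_acyclic_borel_relations \<Gamma> :: 'a space_rel set)
       (A_family \<Gamma> \<union> B_family \<Gamma>) \<and>
     antichain_basis leq_c leq_c
       (s_acyclic_borel_relations \<Gamma>) (s_acyclic_borel_relations \<Gamma> :: 'a space_rel set)
       (A_family \<Gamma> \<union> B_family \<Gamma>) \<and>
     antichain_basis inj_leq_c inj_leq_c
       (acyclic_borel_graphs \<Gamma>) (acyclic_borel_graphs \<Gamma> :: 'a space_rel set)
       (graph_family \<Gamma>) \<and>
     antichain_basis leq_c leq_c
       (acyclic_borel_graphs \<Gamma>) (acyclic_borel_graphs \<Gamma> :: 'a space_rel set)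
       (graph_family \<Gamma>)"
proof -
  let ?F = "A_family \<Gamma> \<union> B_family \<Gamma>"
  have anti: "antichain leq_c ?F" "antichain inj_leq_c ?F"
    unfolding antichain_def using leq_c_family_eq inj_leq_c_imp_leq_c by metis+
  then have anti_graph: "antichain leq_c (graph_family \<Gamma>)" "antichain inj_leq_c (graph_family \<Gamma>)"
    unfolding antichain_def using subsetD[OF graph_family_subset] by metis+
  have basis: "\<forall>q\<in>(s_acyclic_borel_relations \<Gamma> :: 'a space_rel set). \<exists>p\<in>?F. inj_leq_c p q"
    using minorant_exists by (metis surj_pair)
  then have basis': "\<forall>q\<in>(s_acyclic_borel_relations \<Gamma> :: 'a space_rel set). \<exists>p\<in>?F. leq_c p q"
    using inj_leq_c_imp_leq_c by metis
  have graphs: "\<forall>q\<in>(acyclic_borel_graphs \<Gamma> :: 'a space_rel set). \<exists>p\<in>graph_family \<Gamma>. inj_leq_c p q"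
    using graph_minorant by (metis surj_pair)
  then have graphs': "\<forall>q\<in>(acyclic_borel_graphs \<Gamma> :: 'a space_rel set). \<exists>p\<in>graph_family \<Gamma>. leq_c p q"
    using inj_leq_c_imp_leq_c by metis
  show ?thesis
    unfolding antichain_basis_def
    using card_families family_subset graph_family_members anti anti_graph basis basis' graphs graphs' by simp
qed

end
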